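(* Let $n\ge 3$, $q=\frac{2n}{n-2}$, $\kappa=\frac{n-1}{n}$. Identify $S^1$ with $[-\pi,\pi]$ with endpoints identified, and let $\lambda=-1$ on $(-\pi,0)$, $\lambda=1$ on $(0,\pi)$. For $t\in\mathbb{R}$ let $\tau_t=t+\lambda$. Let $N$ be a smooth positive function on $S^1$, let $\gamma_N=-\frac{\int_{S^1}\lambda N}{\int_{S^1}N}$, and let $\eta,\mu\in\mathbb{R}$. Consider the system $$-2\kappa q\,\phi''-2\eta^2\phi^{-q-1}-\kappa\Big(\mu+\tfrac{1}{2N}w'\Big)^2\phi^{-q-1}+\kappa\tau_t^2\phi^{q-1}=0,\qquad \Big(\tfrac{1}{2N}w'\Big)'-\phi^q\tau_t'=0$$ on $S^1$. If $|t-\gamma_N|>2$, then a solution $(\phi,w)$ exists if and only if $\eta\neq0$ or $\mu\neq0$. If moreover $\mu=0$, the solution is unique.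
   Context: Here $\tau_t'=2(\delta_0-\delta_\pi)$ is the distributional derivative ($\delta_x$ the Dirac mass at $x$), and the second equation is understood in the sense of distributions. A solution is a pair $(\phi,w)\in W^{2,p}_+(S^1)\times W^{1,p}(S^1)$ for some $p>1$, where the subscript $+$ denotes positive functions. If $(\phi,w)$ is a solution, so is $(\phi,w+c)$ for any constant $c$; "the solution is unique" means every other solution is of the form $(\phi,w+c)$. *)

theory Defs
  imports "HOL-Analysis.Analysis"
begin

text \<open>Functions on S^1 are represented as 2 pi-periodic functions on the real line;
  S^1 is identified with [-pi, pi] with endpoints identified.\<close>

definition periodic2pi :: "(real \<Rightarrow> real) \<Rightarrow> bool" where
  "periodic2pi f \<longleftrightarrow> (\<forall>x. f (x + 2 * pi) = f x)"

definition smooth_fun :: "(real \<Rightarrow> real) \<Rightarrow> bool" where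
  "smooth_fun f \<longleftrightarrow> (\<forall>k x. ((deriv ^^ k) f) differentiable (at x))"

definition Lp_circ :: "real \<Rightarrow> (real \<Rightarrow> real) \<Rightarrow> bool" where
  "Lp_circ p g \<longleftrightarrow> g absolutely_integrable_on {-pi..pi}
      \<and> (\<lambda>x. \<bar>g x\<bar> powr p) integrable_on {-pi..pi}"

definition weak_deriv_circ :: "(real \<Rightarrow> real) \<Rightarrow> (real \<Rightarrow> real) \<Rightarrow> bool" where
  "weak_deriv_circ f g \<longleftrightarrow> g absolutely_integrable_on {-pi..pi}
      \<and> (\<forall>x\<in>{-pi..pi}. f x = f (-pi) + integral {-pi..x} g)"

definition W1p_circ :: "real \<Rightarrow> (real \<Rightarrow> real) \<Rightarrow> (real \<Rightarrow> real) \<Rightarrow> bool" where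
  "W1p_circ p f f1 \<longleftrightarrow> periodic2pi f \<and> Lp_circ p f \<and> Lp_circ p f1 \<and> weak_deriv_circ f f1"

definition W2p_circ :: "real \<Rightarrow> (real \<Rightarrow> real) \<Rightarrow> (real \<Rightarrow> real) \<Rightarrow> (real \<Rightarrow> real) \<Rightarrow> bool" where
  "W2p_circ p f f1 f2 \<longleftrightarrow> W1p_circ p f f1 \<and> W1p_circ p f1 f2"

text \<open>lambda = -1 on (-pi,0), 1 on (0,pi) (extended periodically).\<close>
definition lam :: "real \<Rightarrow> real" where
  "lam x = (if sin x < 0 then -1 else if sin x > 0 then 1 else 0)"

definition tau :: "real \<Rightarrow> real \<Rightarrow> real" where
  "tau t x = t + lam x"

definition gammaN :: "(real \<Rightarrow> real) \<Rightarrow> real" where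
  "gammaN N = - (integral {-pi..pi} (\<lambda>x. lam x * N x)) / integral {-pi..pi} N"

definition q_exp :: "nat \<Rightarrow> real" where
  "q_exp n = 2 * real n / (real n - 2)"

definition kappa :: "nat \<Rightarrow> real" where
  "kappa n = (real n - 1) / real n"

text \<open>A solution (phi, w) \<in> W^{2,p}_+ \<times> W^{1,p} for some p > 1. The first equation holds
  a.e.; the second in the sense of distributions, with tau_t' = 2(delta_0 - delta_pi).\<close>
definition is_solution ::
  "nat \<Rightarrow> (real \<Rightarrow> real) \<Rightarrow> real \<Rightarrow> real \<Rightarrow> real \<Rightarrow> (real \<Rightarrow> real) \<Rightarrow> (real \<Rightarrow> real) \<Rightarrow> bool" where
  "is_solution n N t \<eta> \<mu> \<phi> w \<longleftrightarrow>
    (\<exists>p>1. \<exists>\<phi>1 \<phi>2 w1.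
       (\<forall>x. \<phi> x > 0) \<and> W2p_circ p \<phi> \<phi>1 \<phi>2 \<and> W1p_circ p w w1 \<and>
       (AE x in lborel. x \<in> {-pi..pi} \<longrightarrow>
          - 2 * kappa n * q_exp n * \<phi>2 x
          - 2 * \<eta>\<^sup>2 * \<phi> x powr (- q_exp n - 1)
          - kappa n * (\<mu> + w1 x / (2 * N x))\<^sup>2 * \<phi> x powr (- q_exp n - 1)
          + kappa n * (tau t x)\<^sup>2 * \<phi> x powr (q_exp n - 1) = 0) \<and>
       (\<forall>\<psi>. smooth_fun \<psi> \<and> periodic2pi \<psi> \<longrightarrow>
          - integral {-pi..pi} (\<lambda>x. w1 x / (2 * N x) * deriv \<psi> x)
            = 2 * \<phi> 0 powr q_exp n * \<psi> 0 - 2 * \<phi> pi powr q_exp n * \<psi> pi))"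

end

theory Submission
  imports Defs
begin

text \<open>The second equation can be integrated. Testing it with 1 gives
  \<open>\<phi> 0 = \<phi> pi\<close>; with \<open>b = \<phi> 0 powr q\<close> it then says that
  w'/(2N) - b \<lambda> is constant, and periodicity of \<open>w\<close> makes the constant b
  \<gamma>, where \<gamma> is \<open>gammaN N\<close>. Hence \<phi> solves an autonomous equation
  u'' = \<open>nl q B A u\<close> on each half circle: on (0, pi) with B = (t+1)^2 and A = e +
  (\<mu> + b(1+\<gamma>))^2, on (-pi, 0) with B = (t-1)^2 and A = e + (\<mu> - b(1-\<gamma>))^2,
  where e = 2 \<eta>^2 / \<kappa>. Since \<open>nl\<close> is nondecreasing in u, the maximum
  principle makes each half symmetric about its midpoint and determines it from \<open>b\<close>: it
  comes from a quarter circle with Dirichlet data at the junction and Neumann data at the midpoint.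
  What remains is continuity of \<phi>' at the junctions, so solutions correspond, up to constants
  in \<open>w\<close>, to the positive zeros of the scalar function \<open>net_slope\<close>
  (\<open>solution_net_slope\<close>, \<open>solution_unique_of_value\<close>,
  \<open>solution_of_data\<close>). The reflection of the circle reduces t < \<gamma> - 2 to t >
  \<gamma> + 2.

  Existence is the intermediate value theorem (\<open>zero_exists\<close>). If e + \<mu>^2 > 0, both
  halves rise from the junction for small \<open>b\<close>, so the net slope is positive. For large
  \<open>b\<close> the right half dips so steeply that it outweighs the left one; here t > \<gamma>
  + 2 gives the limiting squared slopes (t-\<gamma>)^2 against at most max(0, 2-\<gamma>-t)^2, up to
  a common factor.

  Let now \<mu> = 0. At a zero the right half dips and the left half rises. Let x > 1 be
  \<open>b\<close> divided by the q-th power of \<phi> at the right midpoint, y > 1 the q-th power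
  at the left midpoint divided by \<open>b\<close>, and h = e / b^2. Conservation of energy turns
  the matching of slopes into an algebraic equation between x, y and h. Separation of variables
  gives two integrals, one in (x, h) and one in (y, h), both equal to (pi/2) b^\<nu> with \<nu> =
  1/n (\<open>time_min\<close>, \<open>time_max\<close>). If e = 0, the algebraic equation forces x
  \<le> y, and then the integrand of the rising half dominates that of the dipping half on a larger
  interval, so the integrals cannot agree (\<open>kmin_exclusion\<close>,
  \<open>net_nonzero\<close>). If e > 0, every zero is a strict crossing from positive to negative
  values (\<open>crossing\<close>): power curves through the zero serve as barriers for x and y, and
  along them the difference of the squared slopes has a definite derivative
  (\<open>growth_balance\<close>, \<open>exponents_exist\<close>). A continuous function with only
  downward crossings has at most one zero (\<open>zero_unique\<close>).\<close>

section \<open>Maximum principle and the Dirichlet-Neumann problem with a Lipschitz right-hand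
  side\<close>

text \<open>Between the last point where \<open>z\<close> is nonpositive and a point where it is
  positive, some point has both \<open>z > 0\<close> and \<open>z1 > 0\<close>. From there on
  convexity keeps the slope up as long as \<open>z\<close> is positive, and the slope keeps
  \<open>z\<close> positive, up to \<open>l\<close>; this contradicts either end condition.\<close>

lemma max_principle:
  fixes z z1 z2 :: "real \<Rightarrow> real"
  assumes d1: "\<And>x. x \<in> {0..l} \<Longrightarrow> (z has_real_derivative z1 x) (at x within {0..l})"
    and d2: "\<And>x. x \<in> {0..l} \<Longrightarrow> (z1 has_real_derivative z2 x) (at x within {0..l})"
    and z0: "z 0 \<le> 0" and zl: "z l \<le> 0 \<or> z1 l \<le> 0"
    and conv: "\<And>x. x \<in> {0..l} \<Longrightarrow> z x > 0 \<Longrightarrow> z2 x \<ge> 0"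
    and x0: "x0 \<in> {0..l}"
  shows "z x0 \<le> 0"
proof (rule ccontr)
  assume "\<not> z x0 \<le> 0"
  then have pos: "z x0 > 0" by simp
  have cz: "continuous_on {0..l} z"
    using d1 by (meson DERIV_continuous continuous_on_eq_continuous_within)
  have cz1: "continuous_on {0..l} z1"
    using d2 by (meson DERIV_continuous continuous_on_eq_continuous_within)
  have at1: "(z has_real_derivative z1 y) (at y)" if "0 < y" "y < l" for y
    using d1[of y] that at_within_interior[of y "{0..l}"] by (simp add: interior_atLeastAtMost_real)
  have at2: "(z1 has_real_derivative z2 y) (at y)" if "0 < y" "y < l" for y
    using d2[of y] that at_within_interior[of y "{0..l}"] by (simp add: interior_atLeastAtMost_real)
  define S where "S = {y \<in> {0..x0}. z y \<le> 0}"
  have "S = {0..x0} \<inter> z -` {..0}" unfolding S_def by auto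
  moreover have "closed ({0..x0} \<inter> z -` {..0})"
    using cz x0 by (intro continuous_closed_preimage) (auto intro: continuous_on_subset)
  ultimately have "closed S" by simp
  moreover have "bounded S" unfolding S_def by (rule bounded_subset[of "{0..x0}"]) auto
  ultimately have "compact S" by (simp add: compact_eq_bounded_closed)
  moreover have "0 \<in> S" using z0 x0 unfolding S_def by auto
  ultimately obtain c where c: "c \<in> S" "\<forall>y\<in>S. y \<le> c"
    using compact_attains_sup[of S] by blast
  have cx: "0 \<le> c" "c < x0" "z c \<le> 0"
    using c(1) pos unfolding S_def by (auto simp: less_le)
  have pc: "z y > 0" if "c < y" "y \<le> x0" for y
  proof (rule ccontr)
    assume "\<not> z y > 0"
    then have "y \<in> S" using that cx unfolding S_def by auto
    then show False using c(2) that by force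
  qed
  obtain \<xi> where \<xi>: "c < \<xi>" "\<xi> < x0" "z x0 - z c = (x0 - c) * z1 \<xi>"
    using MVT2[of c x0 z z1] mvt[of c x0 z "\<lambda>x h. z1 x * h"] cx x0 cz at1
    by (smt (verit, best) atLeastAtMost_iff continuous_on_subset has_field_derivative_def subset_eq mult.commute)
  have z1\<xi>: "z1 \<xi> > 0"
    using \<xi> cx pos by (smt (verit, best) mult_le_0_iff)
  have zx: "z \<xi> > 0" using pc \<xi> by simp
  have mono: "z1 y \<ge> z1 \<xi>" if y: "\<xi> \<le> y" "y \<le> l" and p: "\<And>w. \<xi> \<le> w \<Longrightarrow> w < y \<Longrightarrow> z w > 0" for y
  proof -
    have "z1 \<xi> \<le> z1 y"
    proof (rule DERIV_nonneg_imp_increasing_open[OF y(1)])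
      show "\<exists>d. (z1 has_real_derivative d) (at w) \<and> 0 \<le> d" if "\<xi> < w" "w < y" for w
        using at2[of w] conv[of w] p[of w] that y \<xi> cx by (intro exI[of _ "z2 w"]) auto
      show "continuous_on {\<xi>..y} z1"
        using cz1 by (rule continuous_on_subset) (use y \<xi> cx in auto)
    qed
    then show ?thesis .
  qed
  have incr: "z \<xi> \<le> z y" if y: "\<xi> \<le> y" "y \<le> l" and p: "\<And>w. \<xi> \<le> w \<Longrightarrow> w < y \<Longrightarrow> z w > 0" for y
  proof (rule DERIV_nonneg_imp_increasing_open[OF y(1)])
    show "\<exists>d. (z has_real_derivative d) (at w) \<and> 0 \<le> d" if "\<xi> < w" "w < y" for w
      using at1[of w] mono[of w] p that y \<xi> cx z1\<xi> by (intro exI[of _ "z1 w"]) force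
    show "continuous_on {\<xi>..y} z"
      using cz by (rule continuous_on_subset) (use y \<xi> cx in auto)
  qed
  have all: "z y > 0" if "\<xi> \<le> y" "y \<le> l" for y
  proof (rule ccontr)
    assume "\<not> z y > 0"
    define R where "R = {w \<in> {\<xi>..y}. z w \<le> 0}"
    have "R = {\<xi>..y} \<inter> z -` {..0}" unfolding R_def by auto
    moreover have "closed ({\<xi>..y} \<inter> z -` {..0})"
      using cz that \<xi> cx by (intro continuous_closed_preimage) (auto intro: continuous_on_subset)
    ultimately have "closed R" by simp
    moreover have "bounded R" unfolding R_def by (rule bounded_subset[of "{\<xi>..y}"]) auto
    ultimately have "compact R" by (simp add: compact_eq_bounded_closed)
    moreover have "y \<in> R" using \<open>\<not> z y > 0\<close> that unfolding R_def by auto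
    ultimately obtain d where d: "d \<in> R" "\<forall>w\<in>R. d \<le> w"
      using compact_attains_inf[of R] by blast
    have "z w > 0" if "\<xi> \<le> w" "w < d" for w
    proof (rule ccontr)
      assume "\<not> z w > 0"
      then have "w \<in> R" using that d(1) unfolding R_def by auto
      then show False using d(2) that by force
    qed
    then have "z \<xi> \<le> z d" using incr[of d] d(1) that unfolding R_def by auto
    then show False using d(1) zx unfolding R_def by auto
  qed
  have "z1 l > 0" "z l > 0"
    using mono[of l] all z1\<xi> \<xi> x0 by (force, simp)
  then show False using zl by auto
qed

text \<open>With k^2 = K the equation reads u'' - k^2 u = -(K u - F(u)), and \<open>T\<close> is the
  Green operator of the left side. As \<open>F\<close> is nondecreasing and K-Lipschitz, K u - F(u)
  is again K-Lipschitz. The Green kernel times k^2 integrates to 1 - cosh(k(l-x)) / cosh(kl), so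
  \<open>T\<close> contracts the sup norm for every \<open>K\<close> and \<open>l\<close>.\<close>

lemma DN_exists_lipschitz:
  fixes F :: "real \<Rightarrow> real"
  assumes l: "l > 0" and mono: "mono F" and K: "K > 0"
    and lip: "\<And>x y. \<bar>F x - F y\<bar> \<le> K * \<bar>x - y\<bar>"
  obtains u u1 where
    "\<And>x. x \<in> {0..l} \<Longrightarrow> (u has_real_derivative u1 x) (at x within {0..l})"
    "\<And>x. x \<in> {0..l} \<Longrightarrow> (u1 has_real_derivative F (u x)) (at x within {0..l})"
    "u 0 = a" "u1 l = 0"
proof -
  define k where "k = sqrt K"
  have k: "k > 0" "k\<^sup>2 = K" using K by (auto simp: k_def)
  define ch where "ch = cosh (k * l)"
  have ch: "ch > 1" using k l cosh_real_strict_mono[of 0 "k * l"] by (simp add: ch_def)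
  define g where "g u y = k\<^sup>2 * u y - F (u y)" for u :: "real \<Rightarrow> real" and y
  define Sn where "Sn u x = integral {0..x} (\<lambda>y. sinh (k * y) * g u y)" for u x
  define Cn where "Cn u x = integral {0..l} (\<lambda>y. cosh (k * (l - y)) * g u y)
      - integral {0..x} (\<lambda>y. cosh (k * (l - y)) * g u y)" for u x
  define T where "T u x = (a * cosh (k * (l - x)) + (cosh (k * (l - x)) * Sn u x + sinh (k * x) * Cn u x) / k) / ch" for u x
  define T1 where "T1 u x = (- k * a * sinh (k * (l - x)) - sinh (k * (l - x)) * Sn u x + cosh (k * x) * Cn u x) / ch" for u x
  have cF: "continuous_on UNIV F"
    unfolding continuous_on_iff
  proof (intro ballI allI impI)
    fix x and e :: real assume "e > 0"
    then show "\<exists>d>0. \<forall>x'\<in>UNIV. dist x' x < d \<longrightarrow> dist (F x') (F x) < e"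
      using lip K by (intro exI[of _ "e / K"])
        (auto simp: dist_real_def field_simps intro: le_less_trans[OF lip])
  qed
  have cg: "continuous_on S (g u)" if "continuous_on S u" for u S
    unfolding g_def using that cF by (intro continuous_intros continuous_on_compose2[OF cF]) auto
  have chadd: "cosh (k * (l - x)) * cosh (k * x) + sinh (k * (l - x)) * sinh (k * x) = ch" for x
    unfolding ch_def cosh_add[symmetric] by (simp add: algebra_simps)
  have dS: "(Sn u has_real_derivative sinh (k * x) * g u x) (at x within {0..l})"
    if "continuous_on {0..l} u" "x \<in> {0..l}" for u x
    unfolding Sn_def by (rule integral_has_real_derivative) (use that in \<open>auto intro!: continuous_intros cg\<close>)
  have dC: "(Cn u has_real_derivative - cosh (k * (l - x)) * g u x) (at x within {0..l})"
    if "continuous_on {0..l} u" "x \<in> {0..l}" for u x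
  proof -
    have "((\<lambda>x. integral {0..x} (\<lambda>y. cosh (k * (l - y)) * g u y)) has_real_derivative cosh (k * (l - x)) * g u x) (at x within {0..l})"
      by (rule integral_has_real_derivative) (use that in \<open>auto intro!: continuous_intros cg\<close>)
    from DERIV_diff[OF DERIV_const this] show ?thesis unfolding Cn_def by simp
  qed
  have dT: "(T u has_real_derivative T1 u x) (at x within {0..l})"
    if "continuous_on {0..l} u" "x \<in> {0..l}" for u x
    unfolding T_def T1_def using k ch
    by (auto intro!: derivative_eq_intros dS[OF that] dC[OF that] simp: field_simps)
  have dT1: "(T1 u has_real_derivative k\<^sup>2 * T u x - g u x) (at x within {0..l})"
    if "continuous_on {0..l} u" "x \<in> {0..l}" for u x
  proof -
    have "(T1 u has_real_derivative (k\<^sup>2 * a * cosh (k * (l - x)) + k * cosh (k * (l - x)) * Sn u x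
        + k * sinh (k * x) * Cn u x
        - (cosh (k * (l - x)) * cosh (k * x) + sinh (k * (l - x)) * sinh (k * x)) * g u x) / ch) (at x within {0..l})"
      unfolding T1_def using k(1) ch
      by (auto intro!: derivative_eq_intros dS[OF that] dC[OF that] simp: field_simps power2_eq_square)
    then show ?thesis unfolding chadd T_def
      by (rule back_subst[where P="\<lambda>D. (T1 u has_real_derivative D) (at x within {0..l})"])
        (use k(1) ch in \<open>simp add: field_simps power2_eq_square\<close>)
  qed
  have glip: "\<bar>g u y - g v y\<bar> \<le> k\<^sup>2 * \<bar>u y - v y\<bar>" for u v y
  proof -
    have "\<bar>g u y - g v y\<bar> = \<bar>K * (u y - v y) - (F (u y) - F (v y))\<bar>"
      unfolding g_def k(2) by (simp add: algebra_simps)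
    also have "\<dots> \<le> K * \<bar>u y - v y\<bar>"
    proof -
      have *: "\<bar>K * (p - r) - (F p - F r)\<bar> \<le> K * \<bar>p - r\<bar>" if "p \<le> r" for p r
      proof -
        have "F p \<le> F r" by (rule monoD[OF mono that])
        moreover have "K * p \<le> K * r" using that K by simp
        moreover have "F r - F p \<le> K * r - K * p"
          using lip[of r p] that by (simp add: right_diff_distrib)
        moreover have "K * \<bar>p - r\<bar> = K * r - K * p" using that by (simp add: algebra_simps)
        ultimately show ?thesis by (simp add: right_diff_distrib)
      qed
      show ?thesis
        using *[of "u y" "v y"] *[of "v y" "u y"]
        by (cases "u y \<le> v y") (simp_all add: abs_minus_commute right_diff_distrib abs_if split: if_splits)
    qed
    finally show ?thesis by (simp add: k)
  qed
  have contr: "\<bar>T u x - T v x\<bar> \<le> (1 - 1 / ch) * M"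
    if u: "continuous_on {0..l} u" and v: "continuous_on {0..l} v" and x: "x \<in> {0..l}"
      and M: "\<And>y. \<bar>u y - v y\<bar> \<le> M" for u v x M
  proof -
    have M0: "M \<ge> 0" using M[of 0] by linarith
    have gM: "\<bar>g u y - g v y\<bar> \<le> k\<^sup>2 * M" for y
      using glip[of u y v] M[of y] by (smt (verit) mult_left_mono zero_le_power2)
    have iS: "(\<lambda>y. sinh (k * y) * g w y) integrable_on {0..x}" if "continuous_on {0..l} w" for w
      using that x by (intro integrable_continuous_real continuous_intros cg) (auto intro: continuous_on_subset)
    have iC: "(\<lambda>y. cosh (k * (l - y)) * g w y) integrable_on {p..r}" if "continuous_on {0..l} w" "{p..r} \<subseteq> {0..l}" for w p r
      using that by (intro integrable_continuous_real continuous_intros cg) (auto intro: continuous_on_subset)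
    have hS: "((\<lambda>y. sinh (k * y) * (k\<^sup>2 * M)) has_integral (cosh (k * x) - 1) * (k * M)) {0..x}"
    proof -
      have "((\<lambda>y. sinh (k * y) * (k\<^sup>2 * M)) has_integral
          cosh (k * x) * (k * M) - cosh (k * 0) * (k * M)) {0..x}"
        by (rule fundamental_theorem_of_calculus)
          (use x in \<open>auto simp: has_real_derivative_iff_has_vector_derivative[symmetric] power2_eq_square algebra_simps
          intro!: derivative_eq_intros\<close>)
      then show ?thesis by (simp add: algebra_simps)
    qed
    have "\<bar>Sn u x - Sn v x\<bar> = \<bar>integral {0..x} (\<lambda>y. sinh (k * y) * g u y - sinh (k * y) * g v y)\<bar>"
      unfolding Sn_def using iS u v by (simp add: Henstock_Kurzweil_Integration.integral_diff)
    also have "\<dots> \<le> integral {0..x} (\<lambda>y. sinh (k * y) * (k\<^sup>2 * M))"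
      unfolding real_norm_def[symmetric]
    proof (rule integral_norm_bound_integral)
      show "(\<lambda>y. sinh (k * y) * g u y - sinh (k * y) * g v y) integrable_on {0..x}"
        using iS u v by (intro integrable_diff)
      show "(\<lambda>y. sinh (k * y) * (k\<^sup>2 * M)) integrable_on {0..x}" using hS by blast
      show "norm (sinh (k * y) * g u y - sinh (k * y) * g v y) \<le> sinh (k * y) * (k\<^sup>2 * M)" if "y \<in> {0..x}" for y
        unfolding right_diff_distrib[symmetric] real_norm_def abs_mult
        using that k gM by (intro mult_mono) auto
    qed
    also have "\<dots> = (cosh (k * x) - 1) * (k * M)" using hS by (rule integral_unique)
    finally have bS: "\<bar>Sn u x - Sn v x\<bar> \<le> (cosh (k * x) - 1) * (k * M)" .
    have hC: "((\<lambda>y. cosh (k * (l - y)) * (k\<^sup>2 * M)) has_integral sinh (k * (l - x)) * (k * M)) {x..l}"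
    proof -
      have "((\<lambda>y. cosh (k * (l - y)) * (k\<^sup>2 * M)) has_integral
          - sinh (k * (l - l)) * (k * M) - (- sinh (k * (l - x)) * (k * M))) {x..l}"
        by (rule fundamental_theorem_of_calculus)
          (use x in \<open>auto simp: has_real_derivative_iff_has_vector_derivative[symmetric] power2_eq_square algebra_simps
          intro!: derivative_eq_intros\<close>)
      then show ?thesis by (simp add: algebra_simps)
    qed
    have Ceq: "Cn w x = integral {x..l} (\<lambda>y. cosh (k * (l - y)) * g w y)" if "continuous_on {0..l} w" for w
      using Henstock_Kurzweil_Integration.integral_combine[of 0 x l "\<lambda>y. cosh (k * (l - y)) * g w y"] x iC[OF that, of 0 l]
      unfolding Cn_def by auto
    have "\<bar>Cn u x - Cn v x\<bar> = \<bar>integral {x..l} (\<lambda>y. cosh (k * (l - y)) * g u y - cosh (k * (l - y)) * g v y)\<bar>"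
      using iC u v x Ceq by (simp add: Henstock_Kurzweil_Integration.integral_diff)
    also have "\<dots> \<le> integral {x..l} (\<lambda>y. cosh (k * (l - y)) * (k\<^sup>2 * M))"
      unfolding real_norm_def[symmetric]
    proof (rule integral_norm_bound_integral)
      show "(\<lambda>y. cosh (k * (l - y)) * g u y - cosh (k * (l - y)) * g v y) integrable_on {x..l}"
        using iC u v x by (intro integrable_diff) auto
      show "(\<lambda>y. cosh (k * (l - y)) * (k\<^sup>2 * M)) integrable_on {x..l}" using hC by blast
      show "norm (cosh (k * (l - y)) * g u y - cosh (k * (l - y)) * g v y) \<le> cosh (k * (l - y)) * (k\<^sup>2 * M)" if "y \<in> {x..l}" for y
        unfolding right_diff_distrib[symmetric] real_norm_def abs_mult
        using that k gM by (intro mult_mono) auto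
    qed
    also have "\<dots> = sinh (k * (l - x)) * (k * M)" using hC by (rule integral_unique)
    finally have bC: "\<bar>Cn u x - Cn v x\<bar> \<le> sinh (k * (l - x)) * (k * M)" .
    have sx: "sinh (k * x) \<ge> 0" using k x by simp
    have "\<bar>T u x - T v x\<bar> = \<bar>cosh (k * (l - x)) * (Sn u x - Sn v x) + sinh (k * x) * (Cn u x - Cn v x)\<bar> / (k * ch)"
    proof -
      have "T u x - T v x = (cosh (k * (l - x)) * (Sn u x - Sn v x) + sinh (k * x) * (Cn u x - Cn v x)) / (k * ch)"
        unfolding T_def using k(1) ch by (simp add: field_simps)
      then show ?thesis using k(1) ch by (simp add: abs_mult)
    qed
    also have "\<dots> \<le> (cosh (k * (l - x)) * ((cosh (k * x) - 1) * (k * M)) + sinh (k * x) * (sinh (k * (l - x)) * (k * M))) / (k * ch)"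
    proof (rule divide_right_mono)
      have "\<bar>cosh (k * (l - x)) * (Sn u x - Sn v x) + sinh (k * x) * (Cn u x - Cn v x)\<bar>
          \<le> cosh (k * (l - x)) * \<bar>Sn u x - Sn v x\<bar> + sinh (k * x) * \<bar>Cn u x - Cn v x\<bar>"
        using sx abs_triangle_ineq[of "cosh (k * (l - x)) * (Sn u x - Sn v x)" "sinh (k * x) * (Cn u x - Cn v x)"]
        by (simp add: abs_mult)
      also have "\<dots> \<le> cosh (k * (l - x)) * ((cosh (k * x) - 1) * (k * M)) + sinh (k * x) * (sinh (k * (l - x)) * (k * M))"
        using sx bS bC by (intro add_mono mult_left_mono) auto
      finally show "\<bar>cosh (k * (l - x)) * (Sn u x - Sn v x) + sinh (k * x) * (Cn u x - Cn v x)\<bar>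
          \<le> cosh (k * (l - x)) * ((cosh (k * x) - 1) * (k * M)) + sinh (k * x) * (sinh (k * (l - x)) * (k * M))" .
    qed (use k ch in auto)
    also have "\<dots> = ((cosh (k * (l - x)) * cosh (k * x) + sinh (k * (l - x)) * sinh (k * x)) - cosh (k * (l - x))) * M / ch"
      using k ch by (simp add: field_simps)
    also have "\<dots> \<le> (ch - 1) * M / ch"
      unfolding chadd using M0 ch cosh_real_ge_1[of "k * (l - x)"] by (intro divide_right_mono mult_right_mono) auto
    also have "\<dots> = (1 - 1 / ch) * M" using ch by (simp add: field_simps)
    finally show ?thesis .
  qed
  \<comment> \<open>Clamping to \<open>{0..l}\<close> turns functions on the interval into bounded
    continuous functions on the line, the complete space in which the fixed point is found.\<close>
  define cl where "cl x = max 0 (min l x)" for x :: real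
  have clin: "cl x \<in> {0..l}" for x using l by (auto simp: cl_def)
  have ccl: "continuous_on S cl" for S unfolding cl_def by (intro continuous_intros)
  have cT: "continuous_on {0..l} (T u)" if "continuous_on {0..l} u" for u
    using dT[OF that] by (meson DERIV_continuous continuous_on_eq_continuous_within)
  have inb: "(\<lambda>x. T u (cl x)) \<in> bcontfun" if "continuous_on {0..l} u" for u
  proof -
    have "continuous_on UNIV (\<lambda>x. T u (cl x))"
      using cT[OF that] ccl clin by (intro continuous_on_compose2[OF cT[OF that]]) auto
    moreover have "bounded (T u ` {0..l})"
      using cT[OF that] by (intro compact_imp_bounded compact_continuous_image) auto
    then have "bounded (range (\<lambda>x. T u (cl x)))"
      by (rule bounded_subset) (use clin in auto)
    ultimately show ?thesis by (simp add: bcontfun_def)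
  qed
  define \<T> where "\<T> f = Bcontfun (\<lambda>x. T (apply_bcontfun f) (cl x))" for f :: "real \<Rightarrow>\<^sub>C real"
  have cu: "continuous_on S (apply_bcontfun f)" for S and f :: "real \<Rightarrow>\<^sub>C real"
    by simp
  have ap: "apply_bcontfun (\<T> f) x = T (apply_bcontfun f) (cl x)" for f x
    unfolding \<T>_def using inb[OF cu] by (simp add: Bcontfun_inverse)
  have "\<exists>!f. \<T> f = f"
  proof (rule banach_fix_type)
    show "0 \<le> 1 - 1 / ch" "1 - 1 / ch < 1" using ch by auto
    show "\<forall>f h. dist (\<T> f) (\<T> h) \<le> (1 - 1 / ch) * dist f h"
    proof (intro allI)
      fix f h :: "real \<Rightarrow>\<^sub>C real"
      show "dist (\<T> f) (\<T> h) \<le> (1 - 1 / ch) * dist f h"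
      proof (rule dist_bound)
        fix x
        have "\<bar>T (apply_bcontfun f) (cl x) - T (apply_bcontfun h) (cl x)\<bar> \<le> (1 - 1 / ch) * dist f h"
          by (rule contr[OF cu cu clin]) (use dist_bounded[of f _ h] in \<open>auto simp: dist_real_def\<close>)
        then show "dist (apply_bcontfun (\<T> f) x) (apply_bcontfun (\<T> h) x) \<le> (1 - 1 / ch) * dist f h"
          by (simp add: ap dist_real_def)
      qed
    qed
  qed
  then obtain f where f: "\<T> f = f" by blast
  define u where "u = apply_bcontfun f"
  have uT: "u x = T u x" if "x \<in> {0..l}" for x
  proof -
    have "u x = apply_bcontfun (\<T> f) x" by (simp add: f u_def)
    also have "\<dots> = T u (cl x)" by (simp add: ap u_def)
    also have "cl x = x" using that by (auto simp: cl_def)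
    finally show ?thesis .
  qed
  have cuu: "continuous_on {0..l} u" unfolding u_def by (rule cu)
  show thesis
  proof (rule that[of u "T1 u"])
    show "(u has_real_derivative T1 u x) (at x within {0..l})" if "x \<in> {0..l}" for x
      by (rule has_field_derivative_transform_within[OF dT[OF cuu that], of 1]) (use uT that in auto)
    show "(T1 u has_real_derivative F (u x)) (at x within {0..l})" if "x \<in> {0..l}" for x
      using dT1[OF cuu that] uT[OF that] by (simp add: g_def)
    show "u 0 = a" using uT[of 0] l ch by (simp add: T_def Sn_def ch_def)
    show "T1 u l = 0" by (simp add: T1_def Cn_def)
  qed
qed

section \<open>The equation on a quarter circle: comparison, existence, energy, monotonicity\<close>

text \<open>The equation of one half circle solved for the second derivative: \<open>B\<close> is
  the square of \<open>tau\<close>, and \<open>A\<close> collects both terms with the negative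
  power.\<close>

definition nl :: "real \<Rightarrow> real \<Rightarrow> real \<Rightarrow> real \<Rightarrow> real" where
  "nl q B A w = (B * w powr (q - 1) - A * w powr (- q - 1)) / (2 * q)"

text \<open>A quarter circle: 0 is the junction, where the Dirichlet value is left open, and
  \<open>l\<close> is the midpoint of the half circle, where a symmetric solution has zero
  derivative.\<close>

definition DN :: "real \<Rightarrow> real \<Rightarrow> real \<Rightarrow> real \<Rightarrow> (real \<Rightarrow> real) \<Rightarrow> (real \<Rightarrow> real) \<Rightarrow> bool" where
  "DN q l B A u u1 \<longleftrightarrow> u1 l = 0 \<and> (\<forall>x\<in>{0..l}. u x > 0
     \<and> (u has_real_derivative u1 x) (at x within {0..l})
     \<and> (u1 has_real_derivative nl q B A (u x)) (at x within {0..l}))"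

lemma nl_mono:
  assumes "q > 1" "B \<ge> 0" "A \<ge> 0" "0 < v" "v \<le> w"
  shows "nl q B A v \<le> nl q B A w"
proof -
  have "v powr (q - 1) \<le> w powr (q - 1)" using assms by (intro powr_mono2) auto
  moreover have "w powr (- q - 1) \<le> v powr (- q - 1)" using assms by (intro powr_mono2') auto
  ultimately show ?thesis unfolding nl_def using assms
    by (intro divide_right_mono diff_mono mult_left_mono) auto
qed

lemma nl_eq:
  assumes "w > 0"
  shows "nl q B A w = w powr (- q - 1) * (B * (w powr q)\<^sup>2 - A) / (2 * q)"
proof -
  have "(w powr q)\<^sup>2 = w powr (2 * q)" using assms by (simp add: powr_powr powr_numeral [symmetric] mult.commute)
  moreover have "w powr (- q - 1) * w powr (2 * q) = w powr (q - 1)"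
    by (simp add: powr_add[symmetric])
  ultimately show ?thesis unfolding nl_def by (simp add: algebra_simps)
qed

text \<open>By monotonicity of \<open>nl\<close> the difference \<open>u - V\<close> is convex
  wherever it is positive, so the maximum principle applies; this is why the inequality for
  \<open>V\<close> is demanded only where \<open>u\<close> exceeds it.\<close>

lemma DN_le_super:
  assumes q: "q > 1" "B \<ge> 0" "A \<ge> 0" and u: "DN q l B A u u1"
    and V: "\<And>x. x \<in> {0..l} \<Longrightarrow> V x > 0"
      "\<And>x. x \<in> {0..l} \<Longrightarrow> (V has_real_derivative Vd x) (at x within {0..l})"
      "\<And>x. x \<in> {0..l} \<Longrightarrow> (Vd has_real_derivative Vdd x) (at x within {0..l})"
      "\<And>x. x \<in> {0..l} \<Longrightarrow> u x > V x \<Longrightarrow> Vdd x \<le> nl q B A (V x)"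
      "u 0 \<le> V 0" "Vd l \<ge> 0" and x: "x \<in> {0..l}"
  shows "u x \<le> V x"
proof -
  have "u x - V x \<le> 0"
  proof (rule max_principle[of l "\<lambda>x. u x - V x" "\<lambda>x. u1 x - Vd x" "\<lambda>x. nl q B A (u x) - Vdd x"])
    fix y assume y: "y \<in> {0..l}"
    show "((\<lambda>x. u x - V x) has_real_derivative u1 y - Vd y) (at y within {0..l})"
      "((\<lambda>x. u1 x - Vd x) has_real_derivative nl q B A (u y) - Vdd y) (at y within {0..l})"
      using u V y unfolding DN_def by (auto intro!: derivative_intros)
    show "0 \<le> nl q B A (u y) - Vdd y" if "0 < u y - V y"
      using nl_mono[of q B A "V y" "u y"] q V(1)[OF y] V(4)[OF y] that by auto
  qed (use u V x in \<open>auto simp: DN_def\<close>)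
  then show ?thesis by simp
qed

lemma DN_ge_sub:
  assumes q: "q > 1" "B \<ge> 0" "A \<ge> 0" and u: "DN q l B A u u1"
    and V: "\<And>x. x \<in> {0..l} \<Longrightarrow> V x > 0"
      "\<And>x. x \<in> {0..l} \<Longrightarrow> (V has_real_derivative Vd x) (at x within {0..l})"
      "\<And>x. x \<in> {0..l} \<Longrightarrow> (Vd has_real_derivative Vdd x) (at x within {0..l})"
      "\<And>x. x \<in> {0..l} \<Longrightarrow> u x < V x \<Longrightarrow> Vdd x \<ge> nl q B A (V x)"
      "u 0 \<ge> V 0" "Vd l \<le> 0" and x: "x \<in> {0..l}"
  shows "u x \<ge> V x"
proof -
  have "V x - u x \<le> 0"
  proof (rule max_principle[of l "\<lambda>x. V x - u x" "\<lambda>x. Vd x - u1 x" "\<lambda>x. Vdd x - nl q B A (u x)"])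
    fix y assume y: "y \<in> {0..l}"
    show "((\<lambda>x. V x - u x) has_real_derivative Vd y - u1 y) (at y within {0..l})"
      "((\<lambda>x. Vd x - u1 x) has_real_derivative Vdd y - nl q B A (u y)) (at y within {0..l})"
      using u V y unfolding DN_def by (auto intro!: derivative_intros)
    show "0 \<le> Vdd y - nl q B A (u y)" if "0 < V y - u y"
      using nl_mono[of q B A "u y" "V y"] q V(4)[OF y] that u y by (auto simp: DN_def)
  qed (use u V x in \<open>auto simp: DN_def\<close>)
  then show ?thesis by simp
qed

lemma DN_unique:
  assumes q: "q > 1" "B \<ge> 0" "A \<ge> 0" and u: "DN q l B A u u1" and v: "DN q l B A v v1"
    and "u 0 = v 0" and x: "x \<in> {0..l}"
  shows "u x = v x"
proof (rule antisym)
  show "u x \<le> v x"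
    by (rule DN_le_super[OF q u, where Vd=v1 and Vdd="\<lambda>x. nl q B A (v x)"]) (use v assms in \<open>auto simp: DN_def\<close>)
  show "v x \<le> u x"
    by (rule DN_le_super[OF q v, where Vd=u1 and Vdd="\<lambda>x. nl q B A (u x)"]) (use u assms in \<open>auto simp: DN_def\<close>)
qed

lemma nl_lipschitz:
  assumes q: "q > 2" "B \<ge> 0" "A \<ge> 0" and m: "0 < m" 
    and v: "v \<in> {m..M}" "w \<in> {m..M}"
  shows "\<bar>nl q B A v - nl q B A w\<bar> \<le> (B * (q - 1) * M powr (q - 2) + A * (q + 1) * m powr (- q - 2)) / (2 * q) * \<bar>v - w\<bar>"
proof -
  let ?K = "(B * (q - 1) * M powr (q - 2) + A * (q + 1) * m powr (- q - 2)) / (2 * q)"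
  have main: "\<bar>nl q B A v - nl q B A w\<bar> \<le> ?K * \<bar>v - w\<bar>" if "v < w" "v \<in> {m..M}" "w \<in> {m..M}" for v w
  proof -
    have D: "(nl q B A has_real_derivative (B * (q - 1) * y powr (q - 2) + A * (q + 1) * y powr (- q - 2)) / (2 * q)) (at y)"
      if "v \<le> y" "y \<le> w" for y
    proof -
      have "y > 0" using that \<open>v \<in> _\<close> m by auto
      then show ?thesis unfolding nl_def[abs_def] using q
        by (auto intro!: derivative_eq_intros simp: field_simps)
    qed
    obtain z where z: "v < z" "z < w" "nl q B A w - nl q B A v = (w - v) * ((B * (q - 1) * z powr (q - 2) + A * (q + 1) * z powr (- q - 2)) / (2 * q))"
      using MVT2[OF \<open>v < w\<close> D] by blast
    have "z powr (q - 2) \<le> M powr (q - 2)" using z that m q by (intro powr_mono2) auto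
    moreover have "z powr (- q - 2) \<le> m powr (- q - 2)" using z that m q by (intro powr_mono2') auto
    ultimately have le: "(B * (q - 1) * z powr (q - 2) + A * (q + 1) * z powr (- q - 2)) / (2 * q) \<le> ?K"
      using q by (intro divide_right_mono add_mono mult_left_mono) auto
    have "nl q B A w - nl q B A v \<le> (w - v) * ?K"
      unfolding z(3) by (rule mult_left_mono[OF le]) (use \<open>v < w\<close> in simp)
    moreover have "nl q B A v \<le> nl q B A w" using nl_mono[of q B A v w] q that m by auto
    ultimately show ?thesis using \<open>v < w\<close> by (simp add: mult.commute)
  qed
  show ?thesis
  proof (cases v w rule: linorder_cases)
    case equal
    then show ?thesis by simp
  next
    case less
    then show ?thesis using main[of v w] v by blast
  next
    case greater
    then show ?thesis using main[of w v] v by (simp add: abs_minus_commute)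
  qed
qed

text \<open>Clamping the argument of \<open>nl\<close> to \<open>{m..M}\<close> gives a globally
  Lipschitz right-hand side, and barriers show that the clamp never acts. The upper barrier
  \<open>M\<close> dominates the boundary value and the equilibrium; the lower one is the cosh
  profile \<open>V\<close>, which is bounded below by \<open>m\<close>.\<close>

lemma DN_exists:
  assumes q: "q > 2" "B > 0" "A \<ge> 0" and l: "l > 0" and a: "a > 0"
  obtains u u1 where "DN q l B A u u1" "u 0 = a"
proof -
  \<comment> \<open>Chosen so that B V^(q-1) / (2q) \<le> k^2 V whenever V \<le> a; hence the
    solution \<open>V\<close> of V'' = k^2 V is a subsolution.\<close>
  define k where "k = sqrt (B * a powr (q - 2) / (2 * q))"
  have k: "k > 0" "k\<^sup>2 = B * a powr (q - 2) / (2 * q)" using q a by (auto simp: k_def)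
  define V where "V x = a / cosh (k * l) * cosh (k * (l - x))" for x
  define m where "m = a / cosh (k * l)"
  have m: "0 < m" "m \<le> a"
    using a cosh_real_ge_1[of "k * l"] by (auto simp: m_def divide_simps)
  define M where "M = max a ((A / B) powr (1 / (2 * q)))"
  have M: "a \<le> M" "M > 0" using a by (auto simp: M_def)
  have MA: "nl q B A M \<ge> 0"
  proof -
    have "A \<le> B * (M powr q)\<^sup>2"
    proof (cases "A = 0")
      case False
      have "A / B = (((A / B) powr (1 / (2 * q))) powr q)\<^sup>2"
        using False q by (simp add: powr_powr power2_eq_square powr_add[symmetric])
      also have "\<dots> \<le> (M powr q)\<^sup>2"
        using q by (intro power_mono powr_mono2) (auto simp: M_def)
      finally show ?thesis using q by (simp add: field_simps)
    qed (use q in simp)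
    then show ?thesis using nl_eq[OF M(2)] q by simp
  qed
  define F where "F w = nl q B A (max m (min M w))" for w
  have mM: "m \<le> M" using m M by linarith
  define K where "K = (B * (q - 1) * M powr (q - 2) + A * (q + 1) * m powr (- q - 2)) / (2 * q)"
  have "B * (q - 1) * M powr (q - 2) > 0" using q M by auto
  moreover have "A * (q + 1) * m powr (- q - 2) \<ge> 0" using q by auto
  ultimately have K: "K > 0" unfolding K_def using q by (intro divide_pos_pos add_pos_nonneg) auto
  have clr: "max m (min M w) \<in> {m..M}" for w using mM by auto
  obtain u u1 where u: "\<And>x. x \<in> {0..l} \<Longrightarrow> (u has_real_derivative u1 x) (at x within {0..l})"
    "\<And>x. x \<in> {0..l} \<Longrightarrow> (u1 has_real_derivative F (u x)) (at x within {0..l})" "u 0 = a" "u1 l = 0"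
  proof (rule DN_exists_lipschitz[OF l _ K, of F a])
    show "mono F" unfolding F_def by (intro monoI nl_mono) (use q m in auto)
    fix x y
    have "\<bar>F x - F y\<bar> \<le> K * \<bar>max m (min M x) - max m (min M y)\<bar>"
      unfolding F_def K_def using nl_lipschitz[OF q(1) _ q(3) m(1) clr clr] q by auto
    also have "\<dots> \<le> K * \<bar>x - y\<bar>" using K by (intro mult_left_mono) auto
    finally show "\<bar>F x - F y\<bar> \<le> K * \<bar>x - y\<bar>" .
  qed blast
  have up: "u x \<le> M" if x: "x \<in> {0..l}" for x
  proof -
    have "u x - M \<le> 0"
    proof (rule max_principle[of l "\<lambda>x. u x - M" u1 "\<lambda>x. F (u x)"])
      fix y assume y: "y \<in> {0..l}"
      show "((\<lambda>x. u x - M) has_real_derivative u1 y) (at y within {0..l})"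
        using u(1)[OF y] by (auto intro!: derivative_eq_intros)
      show "0 \<le> F (u y)" if "0 < u y - M" using that MA mM by (simp add: F_def)
    qed (use u x M in auto)
    then show ?thesis by simp
  qed
  have Va: "V x \<le> a" "m \<le> V x" if x: "x \<in> {0..l}" for x
  proof -
    have "cosh (k * (l - x)) \<le> cosh (k * l)"
      using k x l by (subst cosh_real_nonneg_le_iff) auto
    then show "V x \<le> a" unfolding V_def using a by (simp add: field_simps)
    show "m \<le> V x" unfolding V_def m_def using a cosh_real_ge_1[of "k * (l - x)"]
      by (simp add: field_simps)
  qed
  have lo: "V x \<le> u x" if x: "x \<in> {0..l}" for x
  proof -
    have "V x - u x \<le> 0"
    proof (rule max_principle[of l "\<lambda>x. V x - u x" "\<lambda>x. - k * (a / cosh (k * l)) * sinh (k * (l - x)) - u1 x" "\<lambda>x. k\<^sup>2 * V x - F (u x)"])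
      fix y assume y: "y \<in> {0..l}"
      show "((\<lambda>x. V x - u x) has_real_derivative - k * (a / cosh (k * l)) * sinh (k * (l - y)) - u1 y) (at y within {0..l})"
        unfolding V_def using u(1)[OF y] by (auto intro!: derivative_eq_intros)
      show "((\<lambda>x. - k * (a / cosh (k * l)) * sinh (k * (l - x)) - u1 x) has_real_derivative k\<^sup>2 * V y - F (u y)) (at y within {0..l})"
        unfolding V_def using u(2)[OF y] by (auto intro!: derivative_eq_intros simp: power2_eq_square)
      show "0 \<le> k\<^sup>2 * V y - F (u y)" if "0 < V y - u y"
      proof -
        have V0: "V y > 0" using Va[OF y] m by linarith
        have "F (u y) \<le> nl q B A (V y)"
          unfolding F_def by (rule nl_mono) (use q m that Va[OF y] M in auto)
        also have "\<dots> \<le> B * V y powr (q - 1) / (2 * q)"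
          unfolding nl_def using q by (intro divide_right_mono) auto
        also have "V y powr (q - 1) = V y powr (q - 2) * V y"
          using V0 powr_add[of "V y" "q - 2" 1] by simp
        also have "B * (V y powr (q - 2) * V y) / (2 * q) \<le> B * (a powr (q - 2) * V y) / (2 * q)"
          using q V0 Va[OF y] by (intro divide_right_mono mult_left_mono mult_right_mono powr_mono2) auto
        also have "\<dots> = k\<^sup>2 * V y" by (simp add: k)
        finally show ?thesis by simp
      qed
    qed (use u x in \<open>auto simp: V_def\<close>)
    then show ?thesis by simp
  qed
  show thesis
  proof (rule that[of u u1])
    show "DN q l B A u u1"
      unfolding DN_def
    proof (intro conjI ballI)
      fix x assume x: "x \<in> {0..l}"
      show "0 < u x" using lo[OF x] Va[OF x] m by linarith
      have "F (u x) = nl q B A (u x)"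
        unfolding F_def using up[OF x] lo[OF x] Va[OF x] by (simp add: max_def min_def)
      then show "(u1 has_real_derivative nl q B A (u x)) (at x within {0..l})"
        using u(2)[OF x] by simp
    qed (use u in auto)
  qed (rule u)
qed

lemma DN_pos: "DN q l B A u u1 \<Longrightarrow> x \<in> {0..l} \<Longrightarrow> u x > 0"
  and DN_d1: "DN q l B A u u1 \<Longrightarrow> x \<in> {0..l} \<Longrightarrow> (u has_real_derivative u1 x) (at x within {0..l})"
  and DN_d2: "DN q l B A u u1 \<Longrightarrow> x \<in> {0..l} \<Longrightarrow> (u1 has_real_derivative nl q B A (u x)) (at x within {0..l})"
  and DN_end: "DN q l B A u u1 \<Longrightarrow> u1 l = 0"
  by (auto simp: DN_def)

lemma DN_cont: "DN q l B A u u1 \<Longrightarrow> continuous_on {0..l} u"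
  by (meson DN_d1 DERIV_continuous continuous_on_eq_continuous_within)

lemma DN_cont1: "DN q l B A u u1 \<Longrightarrow> continuous_on {0..l} u1"
  by (meson DN_d2 DERIV_continuous continuous_on_eq_continuous_within)

lemma DN_at:
  assumes "DN q l B A u u1" "0 < x" "x < l"
  shows "(u has_real_derivative u1 x) (at x)" "(u1 has_real_derivative nl q B A (u x)) (at x)"
  using DN_d1[OF assms(1), of x] DN_d2[OF assms(1), of x] at_within_interior[of x "{0..l}"] assms(2,3)
  by (auto simp: interior_atLeastAtMost_real)

text \<open>Multiplication by u' gives the first integral q^2 u'^2 - (B W + A / W) with W = u^q. Its
  kinetic term vanishes at \<open>l\<close>, and the difference of B W + A / W at two arguments
  factors.\<close>

lemma DN_energy:
  assumes q: "q > 0" and u: "DN q l B A u u1" and x: "x \<in> {0..l}"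
  shows "q\<^sup>2 * (u1 x)\<^sup>2 = (u x powr q - u l powr q) * (B - A / (u x powr q * u l powr q))"
proof -
  define E where "E y = q\<^sup>2 * (u1 y)\<^sup>2 - (B * u y powr q + A * u y powr (- q))" for y
  have "(E has_real_derivative 0) (at y within {0..l})" if y: "y \<in> {0..l}" for y
    unfolding E_def
    using DN_pos[OF u y] DN_d1[OF u y] DN_d2[OF u y] q
    by (auto intro!: derivative_eq_intros simp: nl_def field_simps power2_eq_square)
  then obtain c where c: "\<forall>y\<in>{0..l}. E y = c"
    using has_field_derivative_zero_constant[of "{0..l}" E] by auto
  have l: "l \<in> {0..l}" using x by auto
  have "E x = E l" using c x l by auto
  then have "q\<^sup>2 * (u1 x)\<^sup>2 = B * u x powr q + A * u x powr (- q) - (B * u l powr q + A * u l powr (- q))"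
    using DN_end[OF u] by (simp add: E_def)
  then show ?thesis using DN_pos[OF u x] DN_pos[OF u l]
    by (simp add: powr_minus field_simps)
qed

lemma nl_sign:
  assumes "w > 0" "q > 0"
  shows "nl q B A w > 0 \<longleftrightarrow> A < B * (w powr q)\<^sup>2" "nl q B A w < 0 \<longleftrightarrow> B * (w powr q)\<^sup>2 < A"
    "nl q B A w = 0 \<longleftrightarrow> B * (w powr q)\<^sup>2 = A"
  using assms by (auto simp: nl_eq zero_less_mult_iff zero_less_divide_iff divide_less_0_iff mult_less_0_iff)

lemma equilibrium:
  fixes q A B :: real
  assumes "q > 0" "A > 0" "B > 0"
  obtains s where "s > 0" "B * (s powr q)\<^sup>2 = A" "nl q B A s = 0"
proof -
  define s where "s = (sqrt (A / B)) powr (1 / q)"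
  have "s > 0" "B * (s powr q)\<^sup>2 = A"
    using assms by (auto simp: s_def powr_powr)
  then show thesis using that nl_sign(3)[of s q B A] assms by auto
qed

text \<open>A solution starting above the equilibrium \<open>s\<close> never reaches it: with k^2 a
  Lipschitz constant of \<open>nl\<close> on the range, \<open>s + d * cosh (k * (l - y))\<close> is
  a subsolution with the same initial value. So the solution is strictly convex and dips towards its
  midpoint. \<open>DN_max_nl\<close> is the mirror image, where the midpoint is a maximum.\<close>

lemma DN_min_nl:
  assumes q: "q > 2" "B > 0" "A \<ge> 0" and l: "l > 0" and u: "DN q l B A u u1"
    and A: "A < B * (u 0 powr q)\<^sup>2" and x: "x \<in> {0..l}"
  shows "nl q B A (u x) > 0"
proof (cases "A = 0")
  case True
  then show ?thesis using nl_sign(1)[of "u x" q B A] DN_pos[OF u x] q by simp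
next
  case False
  then obtain s where s: "s > 0" "B * (s powr q)\<^sup>2 = A" "nl q B A s = 0"
    using equilibrium[of q A B] q by auto
  define a where "a = u 0"
  have a: "a > 0" using DN_pos[OF u, of 0] l by (simp add: a_def)
  have sa: "s < a"
  proof (rule ccontr)
    assume "\<not> s < a"
    then have "nl q B A a \<le> nl q B A s" using a q by (intro nl_mono) auto
    then show False using nl_sign(1)[of a q B A] a A s q by (simp add: a_def)
  qed
  define k where "k = sqrt ((B * (q - 1) * a powr (q - 2) + A * (q + 1) * s powr (- q - 2)) / (2 * q))"
  have k2: "k\<^sup>2 = (B * (q - 1) * a powr (q - 2) + A * (q + 1) * s powr (- q - 2)) / (2 * q)"
    unfolding k_def using q by (intro real_sqrt_pow2 divide_nonneg_pos add_nonneg_nonneg mult_nonneg_nonneg) auto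
  have k: "k \<ge> 0" unfolding k_def using q by (intro real_sqrt_ge_zero divide_nonneg_pos add_nonneg_nonneg mult_nonneg_nonneg) auto
  define d where "d = (a - s) / cosh (k * l)"
  have d: "d > 0" using sa by (simp add: d_def)
  define V where "V y = s + d * cosh (k * (l - y))" for y
  have Vb: "s < V y" "V y \<le> a" if "y \<in> {0..l}" for y
  proof -
    show "s < V y" using d by (simp add: V_def)
    have "cosh (k * (l - y)) \<le> cosh (k * l)" using k that by (subst cosh_real_nonneg_le_iff) (auto intro: mult_left_mono)
    then have "d * cosh (k * (l - y)) \<le> d * cosh (k * l)" using d by simp
    then show "V y \<le> a" by (simp add: V_def d_def)
  qed
  have "u x \<ge> V x"
  proof (rule DN_ge_sub[OF _ _ q(3) u, where V=V and Vd="\<lambda>y. - d * k * sinh (k * (l - y))" and Vdd="\<lambda>y. k\<^sup>2 * (V y - s)"])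
    fix y assume y: "y \<in> {0..l}"
    show "(V has_real_derivative - d * k * sinh (k * (l - y))) (at y within {0..l})"
      unfolding V_def by (auto intro!: derivative_eq_intros)
    show "((\<lambda>y. - d * k * sinh (k * (l - y))) has_real_derivative k\<^sup>2 * (V y - s)) (at y within {0..l})"
      unfolding V_def by (auto intro!: derivative_eq_intros simp: power2_eq_square)
    have "\<bar>nl q B A (V y) - nl q B A s\<bar> \<le> k\<^sup>2 * \<bar>V y - s\<bar>"
      unfolding k2 by (rule nl_lipschitz) (use q s sa Vb[OF y] in auto)
    then show "nl q B A (V y) \<le> k\<^sup>2 * (V y - s)" using Vb[OF y] s by auto
    show "0 < V y" using Vb[OF y] s by linarith
  qed (use q x in \<open>auto simp: V_def d_def a_def[symmetric]\<close>)
  then have "u x > s" using Vb[OF x] by linarith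
  then have "s powr q < u x powr q" using s q by (intro powr_less_mono2) auto
  then have "(s powr q)\<^sup>2 < (u x powr q)\<^sup>2" by (intro power_strict_mono) auto
  then have "A < B * (u x powr q)\<^sup>2" using s(2) q by (metis mult_less_cancel_left_pos)
  then show ?thesis using nl_sign(1)[of "u x" q B A] DN_pos[OF u x] q by simp
qed

lemma DN_max_nl:
  assumes q: "q > 2" "B > 0" "A \<ge> 0" and l: "l > 0" and u: "DN q l B A u u1"
    and A: "B * (u 0 powr q)\<^sup>2 < A" and x: "x \<in> {0..l}"
  shows "nl q B A (u x) < 0"
proof -
  have "A > 0" using A q by (smt (verit) mult_nonneg_nonneg zero_le_power2)
  then obtain s where s: "s > 0" "B * (s powr q)\<^sup>2 = A" "nl q B A s = 0"
    using equilibrium[of q A B] q by auto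
  define a where "a = u 0"
  have a: "a > 0" using DN_pos[OF u, of 0] l by (simp add: a_def)
  have sa: "a < s"
  proof (rule ccontr)
    assume "\<not> a < s"
    then have "nl q B A a \<ge> nl q B A s" using s q by (intro nl_mono) auto
    then show False using nl_sign(2)[of a q B A] a A s q by (simp add: a_def)
  qed
  define k where "k = sqrt ((B * (q - 1) * s powr (q - 2) + A * (q + 1) * a powr (- q - 2)) / (2 * q))"
  have k2: "k\<^sup>2 = (B * (q - 1) * s powr (q - 2) + A * (q + 1) * a powr (- q - 2)) / (2 * q)"
    unfolding k_def using q by (intro real_sqrt_pow2 divide_nonneg_pos add_nonneg_nonneg mult_nonneg_nonneg) auto
  have k: "k \<ge> 0" unfolding k_def using q by (intro real_sqrt_ge_zero divide_nonneg_pos add_nonneg_nonneg mult_nonneg_nonneg) auto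
  define d where "d = (s - a) / cosh (k * l)"
  have d: "d > 0" using sa by (simp add: d_def)
  define V where "V y = s - d * cosh (k * (l - y))" for y
  have Vb: "V y < s" "a \<le> V y" if "y \<in> {0..l}" for y
  proof -
    show "V y < s" using d by (simp add: V_def)
    have "cosh (k * (l - y)) \<le> cosh (k * l)" using k that by (subst cosh_real_nonneg_le_iff) (auto intro: mult_left_mono)
    then have "d * cosh (k * (l - y)) \<le> d * cosh (k * l)" using d by simp
    then show "a \<le> V y" by (simp add: V_def d_def)
  qed
  have "u x \<le> V x"
  proof (rule DN_le_super[OF _ _ q(3) u, where V=V and Vd="\<lambda>y. d * k * sinh (k * (l - y))" and Vdd="\<lambda>y. - (k\<^sup>2 * (s - V y))"])
    fix y assume y: "y \<in> {0..l}"
    show "(V has_real_derivative d * k * sinh (k * (l - y))) (at y within {0..l})"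
      unfolding V_def by (auto intro!: derivative_eq_intros)
    show "((\<lambda>y. d * k * sinh (k * (l - y))) has_real_derivative - (k\<^sup>2 * (s - V y))) (at y within {0..l})"
      unfolding V_def by (auto intro!: derivative_eq_intros simp: power2_eq_square)
    have "\<bar>nl q B A (V y) - nl q B A s\<bar> \<le> k\<^sup>2 * \<bar>V y - s\<bar>"
      unfolding k2 by (rule nl_lipschitz) (use q a sa Vb[OF y] in auto)
    then show "- (k\<^sup>2 * (s - V y)) \<le> nl q B A (V y)" using Vb[OF y] s by auto
    show "0 < V y" using Vb[OF y] a by linarith
  qed (use q x in \<open>auto simp: V_def d_def a_def[symmetric]\<close>)
  then have "u x < s" using Vb[OF x] by linarith
  then have "u x powr q < s powr q" using DN_pos[OF u x] q by (intro powr_less_mono2) auto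
  then have "(u x powr q)\<^sup>2 < (s powr q)\<^sup>2" by (intro power_strict_mono) auto
  then have "B * (u x powr q)\<^sup>2 < A" using s(2) q by (metis mult_less_cancel_left_pos)
  then show ?thesis using nl_sign(2)[of "u x" q B A] DN_pos[OF u x] q by simp
qed

lemma DN_eq_type:
  assumes q: "q > 1" "B > 0" "A \<ge> 0" and l: "l > 0" and u: "DN q l B A u u1"
    and A: "A = B * (u 0 powr q)\<^sup>2" and x: "x \<in> {0..l}"
  shows "u x = u 0"
proof (rule DN_unique[OF q(1) _ q(3) u _ _ x, where ?v1.0="\<lambda>_. 0"])
  have "u 0 > 0" using DN_pos[OF u] l by simp
  moreover have "nl q B A (u 0) = 0" using nl_sign(3)[of "u 0" q B A] A q \<open>u 0 > 0\<close> by simp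
  ultimately show "DN q l B A (\<lambda>_. u 0) (\<lambda>_. 0)" by (simp add: DN_def)
qed (use q in auto)

lemma DN_min_mono:
  assumes q: "q > 2" "B > 0" "A \<ge> 0" and l: "l > 0" and u: "DN q l B A u u1"
    and A: "A < B * (u 0 powr q)\<^sup>2" and x: "x \<in> {0..<l}"
  shows "u1 x < 0" "u l < u x"
proof -
  have neg: "u1 y < 0" if y: "y \<in> {0..<l}" for y
  proof -
    have "u1 y < u1 l"
    proof (rule DERIV_pos_imp_increasing_open[of y l u1])
      show "\<exists>d. (u1 has_real_derivative d) (at w) \<and> 0 < d" if "y < w" "w < l" for w
        using DN_at[OF u, of w] DN_min_nl[OF q l u A, of w] that y by auto
      show "continuous_on {y..l} u1" using DN_cont1[OF u] y by (auto intro: continuous_on_subset)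
    qed (use y in auto)
    then show ?thesis using DN_end[OF u] by simp
  qed
  then show "u1 x < 0" using x .
  show "u l < u x"
  proof (rule DERIV_neg_imp_decreasing_open[of x l u])
    show "\<exists>d. (u has_real_derivative d) (at w) \<and> d < 0" if "x < w" "w < l" for w
      using DN_at[OF u, of w] neg[of w] that x by auto
    show "continuous_on {x..l} u" using DN_cont[OF u] x by (auto intro: continuous_on_subset)
  qed (use x in auto)
qed

lemma DN_max_mono:
  assumes q: "q > 2" "B > 0" "A \<ge> 0" and l: "l > 0" and u: "DN q l B A u u1"
    and A: "B * (u 0 powr q)\<^sup>2 < A" and x: "x \<in> {0..<l}"
  shows "u1 x > 0" "u x < u l"
proof -
  have neg: "u1 y > 0" if y: "y \<in> {0..<l}" for y
  proof -
    have "u1 l < u1 y"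
    proof (rule DERIV_neg_imp_decreasing_open[of y l u1])
      show "\<exists>d. (u1 has_real_derivative d) (at w) \<and> d < 0" if "y < w" "w < l" for w
        using DN_at[OF u, of w] DN_max_nl[OF q l u A, of w] that y by auto
      show "continuous_on {y..l} u1" using DN_cont1[OF u] y by (auto intro: continuous_on_subset)
    qed (use y in auto)
    then show ?thesis using DN_end[OF u] by simp
  qed
  then show "u1 x > 0" using x .
  show "u x < u l"
  proof (rule DERIV_pos_imp_increasing_open[of x l u])
    show "\<exists>d. (u has_real_derivative d) (at w) \<and> 0 < d" if "x < w" "w < l" for w
      using DN_at[OF u, of w] neg[of w] that x by auto
    show "continuous_on {x..l} u" using DN_cont[OF u] x by (auto intro: continuous_on_subset)
  qed (use x in auto)
qed

text \<open>One formula covers dipping, constant and rising solutions, because \<open>sqrt\<close>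
  is the odd real root: when b < c its argument is negative and the slope positive. The factors
  \<open>b - c\<close> and \<open>B - A / (b * c)\<close> always have the same sign, so the energy
  identity gives the modulus. This keeps the slope a continuous expression in \<open>b\<close> and
  \<open>c\<close> across a change of type.\<close>

lemma DN_slope:
  assumes q: "q > 2" "B > 0" "A \<ge> 0" and l: "l > 0" and u: "DN q l B A u u1"
    and b: "b = u 0 powr q" and c: "c = u l powr q"
  shows "q * u1 0 = - sqrt ((b - c) * \<bar>B - A / (b * c)\<bar>)"
proof -
  have l0: "0 \<in> {0..l}" "l \<in> {0..l}" "0 \<in> {0..<l}" using l by auto
  have pos: "b > 0" "c > 0" using DN_pos[OF u l0(1)] DN_pos[OF u l0(2)] b c by auto
  have en: "(q * u1 0)\<^sup>2 = (b - c) * (B - A / (b * c))"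
    using DN_energy[OF _ u l0(1)] q b c by (simp add: power_mult_distrib)
  consider "A < B * b\<^sup>2" | "A = B * b\<^sup>2" | "B * b\<^sup>2 < A" by linarith
  then show ?thesis
  proof cases
    case 1
    have "u l < u 0" "u1 0 < 0" using DN_min_mono[OF q l u _ l0(3)] 1 b by auto
    then have "c < b" using b c DN_pos[OF u l0(2)] q by (auto intro: powr_less_mono2)
    moreover have "A < B * c\<^sup>2" using DN_min_nl[OF q l u _ l0(2)] 1 b c nl_sign(1)[of "u l" q B A] q DN_pos[OF u l0(2)] by auto
    then have "A < B * (b * c)"
      using \<open>c < b\<close> pos q by (smt (verit) mult_left_mono mult_right_mono power2_eq_square)
    then have "B - A / (b * c) > 0" using pos by (simp add: field_simps)
    ultimately have "sqrt ((b - c) * \<bar>B - A / (b * c)\<bar>) = sqrt ((q * u1 0)\<^sup>2)" using en by simp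
    then show ?thesis using \<open>u1 0 < 0\<close> q by (simp add: abs_mult)
  next
    case 2
    have "u l = u 0" using DN_eq_type[OF _ q(2,3) l u _ l0(2)] 2 b q by auto
    then have "b = c" using b c by simp
    then have "(q * u1 0)\<^sup>2 = 0" using en by simp
    then show ?thesis using \<open>b = c\<close> by simp
  next
    case 3
    have "u 0 < u l" "u1 0 > 0" using DN_max_mono[OF q l u _ l0(3)] 3 b by auto
    then have "b < c" using b c DN_pos[OF u l0(1)] q by (auto intro: powr_less_mono2)
    have "B * c\<^sup>2 < A" using DN_max_nl[OF q l u _ l0(2)] 3 b c nl_sign(2)[of "u l" q B A] q DN_pos[OF u l0(2)] by auto
    then have "B * (b * c) < A"
      using \<open>b < c\<close> pos q by (smt (verit) mult_left_mono mult_right_mono power2_eq_square)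
    then have "B - A / (b * c) < 0" using pos by (simp add: field_simps)
    then have "(b - c) * \<bar>B - A / (b * c)\<bar> = - ((b - c) * (B - A / (b * c)))"
      by (simp only: abs_of_neg mult_minus_right)
    also have "\<dots> = - ((q * u1 0)\<^sup>2)" using en by simp
    finally have "sqrt ((b - c) * \<bar>B - A / (b * c)\<bar>) = - sqrt ((q * u1 0)\<^sup>2)"
      by (simp only: real_sqrt_minus)
    then show ?thesis using \<open>u1 0 > 0\<close> q by (simp add: abs_mult)
  qed
qed

section \<open>Continuous dependence of the midpoint value and of the initial slope\<close>

lemma powr_superadd:
  fixes a b p :: real
  assumes "a \<ge> 0" "b \<ge> 0" "p \<ge> 1"
  shows "a powr p + b powr p \<le> (a + b) powr p"
proof -
  have *: "x powr p = x * x powr (p - 1)" if "x \<ge> 0" for x :: real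
    using that powr_add[of x 1 "p - 1"] by (cases "x = 0") auto
  have "a powr p + b powr p = a * a powr (p - 1) + b * b powr (p - 1)"
    using * assms by simp
  also have "\<dots> \<le> a * (a + b) powr (p - 1) + b * (a + b) powr (p - 1)"
    using assms by (intro add_mono mult_left_mono powr_mono2) auto
  also have "\<dots> = (a + b) powr p" using *[of "a + b"] assms by (simp add: distrib_right)
  finally show ?thesis .
qed

text \<open>By superadditivity of the power, raising the argument by d raises the first term of
  \<open>nl\<close> by at least B d^(q-1) / (2q), which absorbs a small change of \<open>A\<close>.
  A solution shifted by a constant therefore becomes a barrier for the problem with a neighbouring
  \<open>A\<close>.\<close>

lemma nl_shift:
  assumes q: "q > 2" "B > 0" "A \<ge> 0" "A' \<ge> 0" and vw: "0 < v" "v < w" "0 < m" "m \<le> w"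
    and d: "\<bar>A' - A\<bar> * m powr (- q - 1) \<le> B * (w - v) powr (q - 1)"
  shows "nl q B A' v \<le> nl q B A w"
proof -
  have 1: "B * (v powr (q - 1) + (w - v) powr (q - 1)) \<le> B * w powr (q - 1)"
    using powr_superadd[of v "w - v" "q - 1"] q vw by (intro mult_left_mono) auto
  have "w powr (- q - 1) \<le> v powr (- q - 1)" using q vw by (intro powr_mono2') auto
  then have 2: "A' * w powr (- q - 1) \<le> A' * v powr (- q - 1)" using q by (intro mult_left_mono) auto
  have "w powr (- q - 1) \<le> m powr (- q - 1)" using q vw by (intro powr_mono2') auto
  then have "\<bar>A' - A\<bar> * w powr (- q - 1) \<le> \<bar>A' - A\<bar> * m powr (- q - 1)"
    by (intro mult_left_mono) auto
  then have "(A - A') * w powr (- q - 1) \<le> B * (w - v) powr (q - 1)"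
    using d mult_right_mono[of "A - A'" "\<bar>A' - A\<bar>" "w powr (- q - 1)"] by force
  then have "A * w powr (- q - 1) \<le> B * (w - v) powr (q - 1) + A' * w powr (- q - 1)"
    by (simp add: left_diff_distrib)
  then show ?thesis unfolding nl_def using 1 2 q
    by (intro divide_right_mono) (auto simp: distrib_left)
qed

text \<open>\<open>v + e\<close> is a supersolution and \<open>v - e\<close> a subsolution of the
  problem with parameter \<open>A\<close>.\<close>

lemma DN_close:
  assumes q: "q > 2" "B > 0" "A \<ge> 0" "A' \<ge> 0"
    and u: "DN q l B A u u1" and v: "DN q l B A' v v1"
    and m: "\<And>x. x \<in> {0..l} \<Longrightarrow> m \<le> v x" and e: "0 < e" "e < m"
    and d0: "\<bar>u 0 - v 0\<bar> \<le> e" and d: "\<bar>A' - A\<bar> * m powr (- q - 1) \<le> B * e powr (q - 1)"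
    and x: "x \<in> {0..l}"
  shows "\<bar>u x - v x\<bar> \<le> e"
proof -
  have dv: "(v has_real_derivative v1 y) (at y within {0..l})"
    "(v1 has_real_derivative nl q B A' (v y)) (at y within {0..l})" if "y \<in> {0..l}" for y
    using DN_d1[OF v that] DN_d2[OF v that] by auto
  have "u x \<le> v x + e"
  proof (rule DN_le_super[OF _ _ q(3) u, where Vd=v1 and Vdd="\<lambda>y. nl q B A' (v y)"])
    fix y assume y: "y \<in> {0..l}"
    show "((\<lambda>y. v y + e) has_real_derivative v1 y) (at y within {0..l})"
      using dv(1)[OF y] by (auto intro!: derivative_eq_intros)
    show "nl q B A' (v y) \<le> nl q B A (v y + e)"
      by (rule nl_shift[OF q, where m=m]) (use m[OF y] e d in auto)
    show "0 < v y + e" using m[OF y] e by auto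
  qed (use q dv d0 x DN_end[OF v] in auto)
  moreover have "u x \<ge> v x - e"
  proof (rule DN_ge_sub[OF _ _ q(3) u, where Vd=v1 and Vdd="\<lambda>y. nl q B A' (v y)"])
    fix y assume y: "y \<in> {0..l}"
    show "((\<lambda>y. v y - e) has_real_derivative v1 y) (at y within {0..l})"
      using dv(1)[OF y] by (auto intro!: derivative_eq_intros)
    show "nl q B A (v y - e) \<le> nl q B A' (v y)"
      by (rule nl_shift[OF q(1,2,4,3), where m=m]) (use m[OF y] e d in \<open>auto simp: abs_minus_commute\<close>)
    show "0 < v y - e" using m[OF y] e by auto
  qed (use q dv d0 x DN_end[OF v] in auto)
  ultimately show ?thesis by linarith
qed

text \<open>The choice has exactly one candidate, by existence and uniqueness for the quarter circle
  (\<open>cmid_ex\<close>, \<open>cmid_eq\<close>). End values are measured by their q-th powers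
  because the energy is rational in these.\<close>

definition cmid :: "real \<Rightarrow> real \<Rightarrow> real \<Rightarrow> real \<Rightarrow> real \<Rightarrow> real" where
  "cmid q l B A b = (SOME c. \<exists>u u1. DN q l B A u u1 \<and> u 0 powr q = b \<and> c = u l powr q)"

text \<open>The derivative at the junction, expressed through the midpoint by
  \<open>DN_slope\<close>, so that its continuity in \<open>b\<close> follows from that of
  \<open>cmid\<close>.\<close>

definition slope :: "real \<Rightarrow> real \<Rightarrow> real \<Rightarrow> real \<Rightarrow> real \<Rightarrow> real" where
  "slope q l B A b = - sqrt ((b - cmid q l B A b) * \<bar>B - A / (b * cmid q l B A b)\<bar>) / q"

lemma cmid_eq:
  assumes q: "q > 2" "B > 0" "A \<ge> 0" and l: "l > 0" and u: "DN q l B A u u1"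
  shows "cmid q l B A (u 0 powr q) = u l powr q"
  unfolding cmid_def
proof (rule some_equality)
  show "\<exists>v v1. DN q l B A v v1 \<and> v 0 powr q = u 0 powr q \<and> u l powr q = v l powr q"
    using u by blast
  fix c assume "\<exists>v v1. DN q l B A v v1 \<and> v 0 powr q = u 0 powr q \<and> c = v l powr q"
  then obtain v v1 where v: "DN q l B A v v1" "v 0 powr q = u 0 powr q" "c = v l powr q" by blast
  have "(v 0 powr q) powr (1 / q) = (u 0 powr q) powr (1 / q)" by (simp only: v(2))
  moreover have "v 0 > 0" "u 0 > 0" using DN_pos[OF v(1)] DN_pos[OF u] l by auto
  ultimately have "v 0 = u 0" using q by (simp add: powr_powr)
  then have "v l = u l" using DN_unique[OF _ _ q(3) v(1) u] q l by simp
  then show "c = u l powr q" by (simp add: v)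
qed

lemma cmid_ex:
  assumes q: "q > 2" "B > 0" "A \<ge> 0" and l: "l > 0" and b: "b > 0"
  obtains u u1 where "DN q l B A u u1" "u 0 = b powr (1 / q)" "u 0 powr q = b" "cmid q l B A b = u l powr q" 
    "slope q l B A b = u1 0"
proof -
  obtain u u1 where u: "DN q l B A u u1" "u 0 = b powr (1 / q)"
    using DN_exists[OF q l, of "b powr (1 / q)"] b by auto
  have ub: "u 0 powr q = b" using u(2) b q by (simp add: powr_powr)
  have c: "cmid q l B A b = u l powr q" using cmid_eq[OF q l u(1)] ub by simp
  have "q * u1 0 = q * slope q l B A b"
    using DN_slope[OF q l u(1) ub[symmetric] c] q by (simp add: slope_def)
  then show thesis using that u ub c q by auto
qed

lemma slope_eq:
  assumes q: "q > 2" "B > 0" "A \<ge> 0" and l: "l > 0" and u: "DN q l B A u u1"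
  shows "slope q l B A (u 0 powr q) = u1 0"
  using DN_slope[OF q l u refl refl] cmid_eq[OF q l u] q unfolding slope_def
  by (metis less_trans nonzero_mult_div_cancel_left order_less_irrefl zero_less_numeral)

text \<open>Here \<open>A\<close> moves with \<open>b\<close>, as it does when the flux is
  proportional to \<open>b\<close>. Continuity is proved for the midpoint value itself by
  \<open>DN_close\<close>, with the limit solution bounded below by its minimum \<open>m\<close>,
  and then carried over to the q-th power.\<close>

lemma cmid_isCont:
  assumes q: "q > 2" "B > 0" and l: "l > 0" and A: "\<And>b. b > 0 \<Longrightarrow> A b \<ge> 0" and cA: "isCont A b1" and b1: "b1 > 0"
  shows "isCont (\<lambda>b. cmid q l B (A b) b) b1"
proof -
  obtain v v1 where v: "DN q l B (A b1) v v1" "v 0 = b1 powr (1 / q)" "cmid q l B (A b1) b1 = v l powr q"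
    using cmid_ex[OF q A[OF b1] l b1] by metis
  have "\<exists>x\<in>{0..l}. \<forall>y\<in>{0..l}. v x \<le> v y"
    by (rule continuous_attains_inf) (use DN_cont[OF v(1)] l in auto)
  then obtain x0 where x0: "x0 \<in> {0..l}" "\<forall>y\<in>{0..l}. v x0 \<le> v y" by blast
  define m where "m = v x0"
  have m: "m > 0" "\<And>y. y \<in> {0..l} \<Longrightarrow> m \<le> v y" using x0 DN_pos[OF v(1)] by (auto simp: m_def)
  define g where "g b = cmid q l B (A b) b powr (1 / q)" for b
  have lim: "(g \<longlongrightarrow> g b1) (at b1)"
  proof (rule tendstoI)
    fix e0 :: real assume e0: "e0 > 0"
    define e where "e = min (e0 / 2) (m / 2)"
    have e: "e > 0" "e < m" "e < e0" using e0 m by (auto simp: e_def)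
    define d where "d = B * e powr (q - 1) / m powr (- q - 1)"
    have d: "d > 0" using q e m by (simp add: d_def)
    have "((\<lambda>b. b powr (1 / q)) \<longlongrightarrow> b1 powr (1 / q)) (at b1)"
      using b1 by (intro tendsto_intros) auto
    then have 1: "\<forall>\<^sub>F b in at b1. dist (b powr (1 / q)) (b1 powr (1 / q)) < e" using e by (auto dest: tendstoD)
    have 2: "\<forall>\<^sub>F b in at b1. dist (A b) (A b1) < d" using cA d by (auto simp: isCont_def dest: tendstoD)
    have 3: "\<forall>\<^sub>F b in at b1. b > 0" using b1 order_tendstoD(1)[OF tendsto_ident_at, of 0 b1 UNIV] by simp
    show "\<forall>\<^sub>F b in at b1. dist (g b) (g b1) < e0"
      using 1 2 3
    proof eventually_elim
      case (elim b)
      obtain u u1 where u: "DN q l B (A b) u u1" "u 0 = b powr (1 / q)" "cmid q l B (A b) b = u l powr q"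
        using cmid_ex[OF q A[OF elim(3)] l elim(3)] by metis
      have "\<bar>u l - v l\<bar> \<le> e"
      proof (rule DN_close[OF q A[OF elim(3)] A[OF b1] u(1) v(1) m(2) e(1,2)])
        show "\<bar>u 0 - v 0\<bar> \<le> e" using elim(1) by (simp add: u v dist_real_def)
        have "\<bar>A b1 - A b\<bar> * m powr (- q - 1) \<le> d * m powr (- q - 1)"
          using elim(2) by (intro mult_right_mono) (auto simp: dist_real_def)
        also have "\<dots> = B * e powr (q - 1)" using m by (simp add: d_def)
        finally show "\<bar>A b1 - A b\<bar> * m powr (- q - 1) \<le> B * e powr (q - 1)" .
      qed (use l in auto)
      moreover have "g b = u l" "g b1 = v l"
        using DN_pos[OF u(1), of l] DN_pos[OF v(1), of l] l q by (auto simp: g_def u v powr_powr)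
      ultimately show ?case using e by (simp add: dist_real_def)
    qed
  qed
  have gpos: "g b > 0" "cmid q l B (A b) b = g b powr q" if "b > 0" for b
  proof -
    obtain u u1 where u: "DN q l B (A b) u u1" "cmid q l B (A b) b = u l powr q"
      using cmid_ex[OF q A[OF \<open>b > 0\<close>] l \<open>b > 0\<close>] by metis
    have "u l > 0" using DN_pos[OF u(1)] l by simp
    then show "g b > 0" "cmid q l B (A b) b = g b powr q" using u(2) q by (auto simp: g_def powr_powr)
  qed
  have "((\<lambda>b. g b powr q) \<longlongrightarrow> g b1 powr q) (at b1)"
    using lim gpos(1)[OF b1] by (intro tendsto_intros) auto
  moreover have "\<forall>\<^sub>F b in at b1. b > 0" using b1 order_tendstoD(1)[OF tendsto_ident_at, of 0 b1 UNIV] by simp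
  then have "\<forall>\<^sub>F b in at b1. g b powr q = cmid q l B (A b) b" by eventually_elim (simp add: gpos)
  ultimately show ?thesis unfolding isCont_def using gpos(2)[OF b1] tendsto_cong by force
qed

lemma cmid_pos:
  assumes q: "q > 2" "B > 0" "A \<ge> 0" and l: "l > 0" and b: "b > 0"
  shows "cmid q l B A b > 0"
proof -
  obtain u u1 where u: "DN q l B A u u1" "cmid q l B A b = u l powr q"
    using cmid_ex[OF q l b] by metis
  then show ?thesis using DN_pos[OF u(1), of l] l by simp
qed

lemma slope_isCont:
  assumes q: "q > 2" "B > 0" and l: "l > 0" and A: "\<And>b. b > 0 \<Longrightarrow> A b \<ge> 0" and cA: "isCont A b1" and b1: "b1 > 0"
  shows "isCont (\<lambda>b. slope q l B (A b) b) b1"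
  unfolding slope_def
  using cmid_isCont[OF assms] cA cmid_pos[OF q A[OF b1] l b1] b1 q
  by (intro continuous_intros) auto

lemma slope_min:
  assumes q: "q > 2" "B > 0" "A \<ge> 0" and l: "l > 0" and b: "b > 0" and A: "A < B * b\<^sup>2"
  shows "cmid q l B A b < b" "A < B * (cmid q l B A b)\<^sup>2" "slope q l B A b < 0"
    "(q * slope q l B A b)\<^sup>2 = (b - cmid q l B A b) * (B - A / (b * cmid q l B A b))"
proof -
  obtain u u1 where u: "DN q l B A u u1" "u 0 powr q = b" "cmid q l B A b = u l powr q" "slope q l B A b = u1 0"
    using cmid_ex[OF q l b] by metis
  have A': "A < B * (u 0 powr q)\<^sup>2" using A u by simp
  have l0: "0 \<in> {0..l}" "l \<in> {0..l}" "0 \<in> {0..<l}" using l by auto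
  have "u l < u 0" "u1 0 < 0" using DN_min_mono[OF q l u(1) A' l0(3)] by auto
  then show "slope q l B A b < 0" using u by simp
  have "u l powr q < u 0 powr q"
    using \<open>u l < u 0\<close> DN_pos[OF u(1) l0(2)] q by (auto intro: powr_less_mono2)
  then show "cmid q l B A b < b" using u by simp
  show "A < B * (cmid q l B A b)\<^sup>2" using DN_min_nl[OF q l u(1) A' l0(2)] nl_sign(1)[of "u l" q B A] q DN_pos[OF u(1) l0(2)] u by auto
  show "(q * slope q l B A b)\<^sup>2 = (b - cmid q l B A b) * (B - A / (b * cmid q l B A b))"
    using DN_energy[OF _ u(1) l0(1)] q u by (simp add: power_mult_distrib)
qed

lemma slope_max:
  assumes q: "q > 2" "B > 0" "A \<ge> 0" and l: "l > 0" and b: "b > 0" and A: "B * b\<^sup>2 < A"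
  shows "b < cmid q l B A b" "B * (cmid q l B A b)\<^sup>2 < A" "slope q l B A b > 0"
    "(q * slope q l B A b)\<^sup>2 = (cmid q l B A b - b) * (A / (b * cmid q l B A b) - B)"
proof -
  obtain u u1 where u: "DN q l B A u u1" "u 0 powr q = b" "cmid q l B A b = u l powr q" "slope q l B A b = u1 0"
    using cmid_ex[OF q l b] by metis
  have A': "B * (u 0 powr q)\<^sup>2 < A" using A u by simp
  have l0: "0 \<in> {0..l}" "l \<in> {0..l}" "0 \<in> {0..<l}" using l by auto
  have "u 0 < u l" "u1 0 > 0" using DN_max_mono[OF q l u(1) A' l0(3)] by auto
  then show "slope q l B A b > 0" using u by simp
  have "u 0 powr q < u l powr q"
    using \<open>u 0 < u l\<close> DN_pos[OF u(1) l0(1)] q by (auto intro: powr_less_mono2)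
  then show "b < cmid q l B A b" using u by simp
  show "B * (cmid q l B A b)\<^sup>2 < A" using DN_max_nl[OF q l u(1) A' l0(2)] nl_sign(2)[of "u l" q B A] q DN_pos[OF u(1) l0(2)] u by auto
  have "(q * slope q l B A b)\<^sup>2 = (b - cmid q l B A b) * (B - A / (b * cmid q l B A b))"
    using DN_energy[OF _ u(1) l0(1)] q u by (simp add: power_mult_distrib)
  also have "\<dots> = (cmid q l B A b - b) * (A / (b * cmid q l B A b) - B)"
    by (simp only: left_diff_distrib right_diff_distrib)
  finally show "(q * slope q l B A b)\<^sup>2 = (cmid q l B A b - b) * (A / (b * cmid q l B A b) - B)" .
qed

lemma slope_eq_0:
  assumes q: "q > 2" "B > 0" "A \<ge> 0" and l: "l > 0" and b: "b > 0" and A: "B * b\<^sup>2 = A"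
  shows "slope q l B A b = 0"
proof -
  obtain u u1 where u: "DN q l B A u u1" "u 0 powr q = b" "cmid q l B A b = u l powr q" "slope q l B A b = u1 0"
    using cmid_ex[OF q l b] by metis
  have "u l = u 0" by (rule DN_eq_type[OF _ q(2,3) l u(1)]) (use A u q l in auto)
  then show ?thesis using u by (simp add: slope_def)
qed

text \<open>The bound is uniform in the midpoint value c: the energy contains -(A / c + B c), which
  is at most -2 sqrt(A B) by the arithmetic-geometric mean inequality.\<close>

lemma slope_sq_le:
  assumes q: "q > 2" "B > 0" "A \<ge> 0" and l: "l > 0" and b: "b > 0" and A: "B * b\<^sup>2 < A"
  shows "(q * slope q l B A b)\<^sup>2 \<le> (sqrt A / b - sqrt B)\<^sup>2 * b"
proof -
  define c where "c = cmid q l B A b"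
  note s = slope_max[OF assms, folded c_def]
  have c: "c > 0" using s b by simp
  have "(sqrt A - sqrt B * c)\<^sup>2 \<ge> 0" by simp
  then have "2 * (sqrt A * sqrt B) * c \<le> A + B * c\<^sup>2"
    using q by (simp add: power2_diff power_mult_distrib algebra_simps)
  then have "2 * (sqrt A * sqrt B) \<le> A / c + B * c" using c by (simp add: field_simps power2_eq_square)
  moreover have "(q * slope q l B A b)\<^sup>2 = A / b + B * b - (A / c + B * c)"
    unfolding s(4) using b c by (simp add: field_simps)
  moreover have "(sqrt A / b - sqrt B)\<^sup>2 * b = A / b + B * b - 2 * (sqrt A * sqrt B)"
    using b q by (simp add: power2_eq_square field_simps)
  ultimately show ?thesis by linarith
qed

text \<open>If the midpoint stayed at or above X b, then u'' would be at least the constant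
  \<open>k\<close> on the whole quarter circle, and the parabola a - k(l x - x^2/2) would push u to
  0 by the time it reaches \<open>l\<close>.\<close>

lemma cmid_small:
  assumes q: "q > 2" "B > 0" "A \<ge> 0" and l: "l > 0" and b: "b > 0" and X: "0 < X" "X < 1"
    and big: "(B * (X * b)\<^sup>2 - A) * l\<^sup>2 \<ge> 4 * q * b powr (1 + 2 / q)"
  shows "cmid q l B A b < X * b"
proof (rule ccontr)
  assume nc: "\<not> cmid q l B A b < X * b"
  have Apos: "B * (X * b)\<^sup>2 - A > 0"
  proof (rule ccontr)
    assume "\<not> B * (X * b)\<^sup>2 - A > 0"
    then have "(B * (X * b)\<^sup>2 - A) * l\<^sup>2 \<le> 0" by (simp add: mult_nonpos_nonneg)
    moreover have "4 * q * b powr (1 + 2 / q) > 0" using q b by simp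
    ultimately show False using big by linarith
  qed
  have "(X * b)\<^sup>2 \<le> b\<^sup>2" using X b by (intro power_mono) auto
  then have "B * (X * b)\<^sup>2 \<le> B * b\<^sup>2" using q by simp
  then have A: "A < B * b\<^sup>2" using Apos by linarith
  obtain u u1 where u: "DN q l B A u u1" "u 0 powr q = b" "cmid q l B A b = u l powr q"
      "u 0 = b powr (1 / q)"
    using cmid_ex[OF q l b] by metis
  define a where "a = u 0"
  have a: "a > 0" using DN_pos[OF u(1), of 0] l by (simp add: a_def)
  have ub: "u x \<le> a" "X * b \<le> u x powr q" if x: "x \<in> {0..l}" for x
  proof -
    show "u x \<le> a" unfolding a_def
    proof (rule DN_le_super[OF _ _ q(3) u(1), where Vd="\<lambda>_. 0" and Vdd="\<lambda>_. 0"])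
      show "0 \<le> nl q B A (u 0)" using nl_sign(1)[of "u 0" q B A] A u a q by (simp add: a_def)
    qed (use q x a a_def in auto)
    have "u l \<le> u x" using DN_min_mono(2)[OF q l u(1), of x] A u x by (cases "x = l") auto
    then have "u l powr q \<le> u x powr q" using q DN_pos[OF u(1), of l] l by (intro powr_mono2) auto
    then show "X * b \<le> u x powr q" using nc u by simp
  qed
  define k where "k = a powr (- q - 1) * (B * (X * b)\<^sup>2 - A) / (2 * q)"
  have knl: "k \<le> nl q B A (u x)" if x: "x \<in> {0..l}" for x
  proof -
    have p: "u x > 0" using DN_pos[OF u(1) x] .
    have "(X * b)\<^sup>2 \<le> (u x powr q)\<^sup>2" using ub[OF x] X b by (intro power_mono) auto
    then have "B * (X * b)\<^sup>2 - A \<le> B * (u x powr q)\<^sup>2 - A" using q by simp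
    moreover have "a powr (- q - 1) \<le> u x powr (- q - 1)" using ub[OF x] p q by (intro powr_mono2') auto
    ultimately show ?thesis unfolding nl_eq[OF p] k_def using Apos q
      by (intro divide_right_mono mult_mono) auto
  qed
  have "u l - (a - k * (l * l - l\<^sup>2 / 2)) \<le> 0"
  proof (rule max_principle[of l "\<lambda>x. u x - (a - k * (l * x - x\<^sup>2 / 2))" "\<lambda>x. u1 x + k * (l - x)" "\<lambda>x. nl q B A (u x) - k"])
    fix x assume x: "x \<in> {0..l}"
    show "((\<lambda>x. u x - (a - k * (l * x - x\<^sup>2 / 2))) has_real_derivative u1 x + k * (l - x)) (at x within {0..l})"
      using DN_d1[OF u(1) x] by (auto intro!: derivative_eq_intros)
    show "((\<lambda>x. u1 x + k * (l - x)) has_real_derivative nl q B A (u x) - k) (at x within {0..l})"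
      using DN_d2[OF u(1) x] by (auto intro!: derivative_eq_intros)
    show "0 \<le> nl q B A (u x) - k" using knl[OF x] by simp
  qed (use l DN_end[OF u(1)] a_def in auto)
  then have "u l \<le> a - k * (l\<^sup>2 / 2)" by (simp add: power2_eq_square algebra_simps)
  moreover have "k * (l\<^sup>2 / 2) \<ge> a"
  proof -
    have e: "b powr (1 + 2 / q) = a powr (q + 2)"
    proof -
      have "a powr (q + 2) = b powr (1 / q * (q + 2))" using u(4) by (simp add: a_def powr_powr)
      also have "1 / q * (q + 2) = 1 + 2 / q" using q by (simp add: field_simps)
      finally show ?thesis by simp
    qed
    have "a powr (- q - 1) * (4 * q * a powr (q + 2)) \<le> a powr (- q - 1) * ((B * (X * b)\<^sup>2 - A) * l\<^sup>2)"
      using big e by (intro mult_left_mono) auto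
    moreover have "a powr (- q - 1) * (4 * q * a powr (q + 2)) = 4 * q * a"
      using a powr_add[of a "- q - 1" "q + 2"] by simp
    ultimately show ?thesis unfolding k_def using q by (simp add: field_simps)
  qed
  ultimately have "u l \<le> 0" by linarith
  then show False using DN_pos[OF u(1), of l] l by simp
qed

section \<open>The quarter length as an integral, by separation of variables\<close>

text \<open>Along g' = -1/K(g) the primitive of K decreases at unit speed.\<close>

lemma time_identity:
  fixes g K :: "real \<Rightarrow> real"
  assumes l: "l > 0" and cg: "continuous_on {0..l} g" and gl: "g l = 0"
    and rg: "\<And>x. x \<in> {0..l} \<Longrightarrow> g x \<in> {0..g 0}"
    and dg: "\<And>x. 0 < x \<Longrightarrow> x < l \<Longrightarrow> (g has_real_derivative - 1 / K (g x)) (at x)"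
    and cK: "continuous_on {0..g 0} K" and Kpos: "\<And>y. y \<in> {0..g 0} \<Longrightarrow> K y > 0"
  shows "integral {0..g 0} K = l"
proof -
  define G where "G y = integral {0..y} K" for y
  have dG: "(G has_real_derivative K y) (at y within {0..g 0})" if "y \<in> {0..g 0}" for y
    unfolding G_def by (rule integral_has_real_derivative[OF cK that])
  have cG: "continuous_on {0..g 0} G"
    using dG by (meson DERIV_continuous continuous_on_eq_continuous_within)
  have "G (g l) + l = G (g 0) + 0"
  proof (rule DERIV_isconst_end[of 0 l "\<lambda>x. G (g x) + x"])
    show "continuous_on {0..l} (\<lambda>x. G (g x) + x)"
      using rg by (intro continuous_intros continuous_on_compose2[OF cG cg]) auto
    fix x assume x: "0 < x" "x < l"
    have gx: "g x \<in> {0..g 0}" using rg x by simp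
    have "(G has_real_derivative K (g x)) (at (g x) within g ` {0..l})"
      by (rule DERIV_subset[OF dG[OF gx]]) (use rg in auto)
    from DERIV_image_chain[OF this DERIV_subset[OF dg[OF x]]]
    have "((G \<circ> g) has_real_derivative K (g x) * (- 1 / K (g x))) (at x within {0..l})" by simp
    then have "((\<lambda>x. G (g x)) has_real_derivative - 1) (at x)"
      using Kpos[OF gx] at_within_interior[of x "{0..l}"] x by (simp add: o_def interior_atLeastAtMost_real)
    then show "((\<lambda>x. G (g x) + x) has_real_derivative 0) (at x)"
      by (auto intro!: derivative_eq_intros)
  qed (rule l)
  then show ?thesis by (simp add: G_def gl)
qed

lemma powr_pred_exponent:
  fixes u q \<nu> :: real
  assumes "u > 0" "q > 0" "1 / q = 1 / 2 - \<nu>"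
  shows "u powr (q - 1) = (u powr q) powr (1 / 2 + \<nu>)"
proof -
  have "\<nu> = 1 / 2 - 1 / q" using assms(3) by linarith
  then have "q * (1 / 2 + \<nu>) = q - 1" using assms(2) by (simp add: field_simps)
  then show ?thesis by (simp add: powr_powr)
qed

lemma sqrt_diff_frac:
  fixes W c :: real
  assumes "0 < c" "c < W"
  shows "0 < sqrt (1 - c / W)" "sqrt (1 - c / W) = sqrt (W - c) / sqrt W" "(sqrt (1 - c / W))\<^sup>2 = 1 - c / W"
proof -
  have "1 - c / W = (W - c) / W" using assms by (simp add: field_simps)
  then show "sqrt (1 - c / W) = sqrt (W - c) / sqrt W" by (simp add: real_sqrt_divide)
  show "0 < sqrt (1 - c / W)" "(sqrt (1 - c / W))\<^sup>2 = 1 - c / W" using assms by auto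
qed

text \<open>This coordinate regularises the turning point. The squared speed of W = u^q vanishes to
  first order in W - c, and the square root cancels that zero, so the speed of the coordinate is a
  nonvanishing function of the coordinate up to the midpoint. \<open>DN_max_coordinate\<close> does
  the same for rising solutions with the ratio inverted.\<close>

lemma DN_min_coordinate:
  assumes q: "q > 2" "B > 0" "A \<ge> 0" and l: "l > 0" and u: "DN q l B A u u1"
    and A: "A < B * (u 0 powr q)\<^sup>2" and \<nu>: "1 / q = 1 / 2 - \<nu>" and x: "0 < x" "x < l"
    and c: "c = u l powr q"
  shows "((\<lambda>x. sqrt (1 - c / u x powr q)) has_real_derivative
     - (1 / 2 * c powr \<nu> * (c / u x powr q) powr (1 - \<nu>) * sqrt (B - A / c\<^sup>2 * (c / u x powr q)))) (at x)"
proof -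
  have xi: "x \<in> {0..l}" "x \<in> {0..<l}" "l \<in> {0..l}" using x by auto
  have up: "u x > 0" using DN_pos[OF u xi(1)] .
  define W where "W = u x powr q"
  have cpos: "c > 0" using DN_pos[OF u xi(3)] c by simp
  have mono: "u1 x < 0" "u l < u x" using DN_min_mono[OF q l u A xi(2)] by auto
  have cW: "c < W" unfolding W_def c using mono DN_pos[OF u xi(3)] q by (intro powr_less_mono2) auto
  have W: "W > 0" using cW cpos by simp
  define R where "R = B - A / (W * c)"
  have en: "(q * u1 x)\<^sup>2 = (W - c) * R"
    using DN_energy[OF _ u xi(1)] q by (simp add: W_def c R_def power_mult_distrib)
  have "(q * u1 x)\<^sup>2 > 0" using mono q by simp
  then have R: "R > 0" using en cW by (simp add: zero_less_mult_iff)
  have "sqrt ((q * u1 x)\<^sup>2) = sqrt (W - c) * sqrt R" unfolding en by (simp add: real_sqrt_mult)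
  then have qu: "q * u1 x = - (sqrt (W - c) * sqrt R)" using mono q by (simp add: abs_mult)
  note sq = sqrt_diff_frac[OF cpos cW]
  have dW: "((\<lambda>x. u x powr q) has_real_derivative q * u1 x * u x powr (q - 1)) (at x)"
    using DN_at(1)[OF u x] up by (auto intro!: derivative_eq_intros)
  have "((\<lambda>x. sqrt (1 - c / u x powr q)) has_real_derivative
      (c * (q * u1 x * u x powr (q - 1)) / (W * W)) * (inverse (sqrt (1 - c / W)) / 2)) (at x)"
    using W sq(1) up dW cpos
    by (auto intro!: derivative_eq_intros DN_at(1)[OF u x] simp: W_def[symmetric] field_simps)
  moreover have "(c * (q * u1 x * u x powr (q - 1)) / (W * W)) * (inverse (sqrt (1 - c / W)) / 2)
      = - (1 / 2 * c powr \<nu> * (c / W) powr (1 - \<nu>) * sqrt (B - A / c\<^sup>2 * (c / W)))"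
  proof -
    have "u x powr (q - 1) = W powr (1 / 2 + \<nu>)"
      unfolding W_def by (rule powr_pred_exponent) (use up q \<nu> in auto)
    also have "\<dots> = sqrt W * W powr \<nu>" using W by (simp add: powr_add powr_half_sqrt)
    finally have e1: "u x powr (q - 1) = sqrt W * W powr \<nu>" .
    have e2: "(c / W) powr (1 - \<nu>) = c powr (1 - \<nu>) * W powr \<nu> / W"
      using cpos W by (simp add: powr_divide powr_diff)
    have e2': "c powr \<nu> * c powr (1 - \<nu>) = c" using cpos by (simp add: powr_add[symmetric])
    have e3: "B - A / c\<^sup>2 * (c / W) = R" using cpos W by (simp add: R_def power2_eq_square field_simps)
    have "(c * (q * u1 x * u x powr (q - 1)) / (W * W)) * (inverse (sqrt (1 - c / W)) / 2)
        = - (c * (sqrt (W - c) * sqrt R * (sqrt W * W powr \<nu>)) / (W * W)) * (sqrt W / sqrt (W - c)) / 2"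
      unfolding e1 qu sq(2) by simp
    also have "\<dots> = - (c * sqrt R * (sqrt W * sqrt W) * W powr \<nu> / (W * W) / 2)"
      using cW by (simp add: field_simps)
    also have "\<dots> = - (c * sqrt R * W powr \<nu> / W / 2)" using W by simp
    also have "\<dots> = - (1 / 2 * c powr \<nu> * (c / W) powr (1 - \<nu>) * sqrt (B - A / c\<^sup>2 * (c / W)))"
      unfolding e2 e3 using e2' by (simp add: field_simps)
    finally show ?thesis .
  qed
  ultimately show ?thesis by (simp only: W_def[symmetric])
qed

lemma DN_max_coordinate:
  assumes q: "q > 2" "B > 0" "A \<ge> 0" and l: "l > 0" and u: "DN q l B A u u1"
    and A: "B * (u 0 powr q)\<^sup>2 < A" and \<nu>: "1 / q = 1 / 2 - \<nu>" and x: "0 < x" "x < l"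
    and c: "c = u l powr q"
  shows "((\<lambda>x. sqrt (1 - u x powr q / c)) has_real_derivative
     - (1 / 2 * (u x powr q) powr \<nu> * sqrt (A / c\<^sup>2 - B * (u x powr q / c)))) (at x)"
proof -
  have xi: "x \<in> {0..l}" "x \<in> {0..<l}" "l \<in> {0..l}" using x by auto
  have up: "u x > 0" using DN_pos[OF u xi(1)] .
  define W where "W = u x powr q"
  have W: "W > 0" using up by (simp add: W_def)
  have mono: "u1 x > 0" "u x < u l" using DN_max_mono[OF q l u A xi(2)] by auto
  have cW: "W < c" unfolding W_def c using mono up q by (intro powr_less_mono2) auto
  have cpos: "c > 0" using W cW by simp
  define R where "R = A / (W * c) - B"
  have "(q * u1 x)\<^sup>2 = (W - c) * (B - A / (W * c))"
    using DN_energy[OF _ u xi(1)] q by (simp add: W_def c power_mult_distrib)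
  also have "\<dots> = (c - W) * R" unfolding R_def by (simp only: left_diff_distrib right_diff_distrib)
  finally have en: "(q * u1 x)\<^sup>2 = (c - W) * R" .
  have "(q * u1 x)\<^sup>2 > 0" using mono q by simp
  then have R: "R > 0" using en cW by (simp add: zero_less_mult_iff)
  have "sqrt ((q * u1 x)\<^sup>2) = sqrt (c - W) * sqrt R" unfolding en by (simp add: real_sqrt_mult)
  then have qu: "q * u1 x = sqrt (c - W) * sqrt R" using mono q by (simp add: abs_mult)
  note sq = sqrt_diff_frac[OF W cW]
  have dW: "((\<lambda>x. u x powr q) has_real_derivative q * u1 x * u x powr (q - 1)) (at x)"
    using DN_at(1)[OF u x] up by (auto intro!: derivative_eq_intros)
  have "((\<lambda>x. sqrt (1 - u x powr q / c)) has_real_derivative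
      (- (q * u1 x * u x powr (q - 1)) / c) * (inverse (sqrt (1 - W / c)) / 2)) (at x)"
    using W sq(1) up dW cpos
    by (auto intro!: derivative_eq_intros DN_at(1)[OF u x] simp: W_def[symmetric] field_simps)
  moreover have "(- (q * u1 x * u x powr (q - 1)) / c) * (inverse (sqrt (1 - W / c)) / 2)
      = - (1 / 2 * W powr \<nu> * sqrt (A / c\<^sup>2 - B * (W / c)))"
  proof -
    have "u x powr (q - 1) = W powr (1 / 2 + \<nu>)"
      unfolding W_def by (rule powr_pred_exponent) (use up q \<nu> in auto)
    also have "\<dots> = sqrt W * W powr \<nu>" using W by (simp add: powr_add powr_half_sqrt)
    finally have e1: "u x powr (q - 1) = sqrt W * W powr \<nu>" .
    have e3: "A / c\<^sup>2 - B * (W / c) = W * R / c" using cpos W by (simp add: R_def power2_eq_square field_simps)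
    have "(- (q * u1 x * u x powr (q - 1)) / c) * (inverse (sqrt (1 - W / c)) / 2)
        = - ((sqrt (c - W) * sqrt R * (sqrt W * W powr \<nu>)) / c) * (sqrt c / sqrt (c - W)) / 2"
      unfolding e1 qu sq(2) by simp
    also have "\<dots> = - (1 / 2 * W powr \<nu> * (sqrt W * sqrt R * sqrt c / c))"
      using cW by (simp add: field_simps)
    also have "sqrt W * sqrt R * sqrt c / c = sqrt W * sqrt R / sqrt c"
      using cpos by (simp add: field_simps)
    also have "\<dots> = sqrt (A / c\<^sup>2 - B * (W / c))"
      unfolding e3 by (simp add: real_sqrt_mult real_sqrt_divide)
    finally show ?thesis .
  qed
  ultimately show ?thesis by (simp only: W_def[symmetric])
qed

lemma DN_min_le:
  assumes q: "q > 2" "B > 0" "A \<ge> 0" and l: "l > 0" and u: "DN q l B A u u1"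
    and A: "A < B * (u 0 powr q)\<^sup>2" and x: "x \<in> {0..l}"
  shows "u l \<le> u x" "u x \<le> u 0"
proof -
  have u0: "u 0 > 0" using DN_pos[OF u, of 0] l by simp
  show "u x \<le> u 0"
  proof (rule DN_le_super[OF _ _ q(3) u, where Vd="\<lambda>_. 0" and Vdd="\<lambda>_. 0"])
    show "0 \<le> nl q B A (u 0)" using nl_sign(1)[of "u 0" q B A] A u0 q by simp
  qed (use q x u0 in auto)
  show "u l \<le> u x" using DN_min_mono(2)[OF q l u A, of x] x by (cases "x = l") auto
qed

lemma DN_max_ge:
  assumes q: "q > 2" "B > 0" "A \<ge> 0" and l: "l > 0" and u: "DN q l B A u u1"
    and A: "B * (u 0 powr q)\<^sup>2 < A" and x: "x \<in> {0..l}"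
  shows "u x \<le> u l" "u 0 \<le> u x"
proof -
  have u0: "u 0 > 0" using DN_pos[OF u, of 0] l by simp
  show "u 0 \<le> u x"
  proof (rule DN_ge_sub[OF _ _ q(3) u, where Vd="\<lambda>_. 0" and Vdd="\<lambda>_. 0"])
    show "nl q B A (u 0) \<le> 0" using nl_sign(2)[of "u 0" q B A] A u0 q by simp
  qed (use q x u0 in auto)
  show "u x \<le> u l" using DN_max_mono(2)[OF q l u A, of x] x by (cases "x = l") auto
qed

text \<open>The time density in the coordinate s, multiplied by b^\<nu>. Here 1 - s^2 is the
  quotient, at most 1, of the q-th powers of the current and midpoint values. Exchanging \<nu> with
  1 - \<nu> and \<open>B\<close> with \<open>H\<close> gives the density for rising
  solutions.\<close>

definition kmin :: "real \<Rightarrow> real \<Rightarrow> real \<Rightarrow> real \<Rightarrow> real \<Rightarrow> real" where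
  "kmin \<nu> B H x s = 2 * (x * (1 - s\<^sup>2)) powr \<nu> / ((1 - s\<^sup>2) * sqrt (B - H * x\<^sup>2 * (1 - s\<^sup>2)))"

text \<open>The hyperbolic angle whose squared cosh is \<open>x\<close>.\<close>

definition Theta :: "real \<Rightarrow> real" where
  "Theta x = artanh (sqrt (1 - 1 / x))"

text \<open>The density \<open>kmin\<close> after the substitution s = tanh(Theta x * \<theta>),
  which fixes the interval of integration to \<open>{0..1}\<close> and absorbs the factor 1 / (1 -
  s^2).\<close>

definition kminh :: "real \<Rightarrow> real \<Rightarrow> real \<Rightarrow> real \<Rightarrow> real \<Rightarrow> real" where
  "kminh \<nu> B H x \<theta> = 2 * Theta x * (x / (cosh (Theta x * \<theta>))\<^sup>2) powr \<nu>
     / sqrt (B - H * (x / cosh (Theta x * \<theta>))\<^sup>2)"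

lemma sqrt_frac_range:
  fixes x :: real
  assumes "x > 1" "s \<in> {0..sqrt (1 - 1 / x)}"
  shows "1 / x \<le> 1 - s\<^sup>2" "1 - s\<^sup>2 \<le> 1" "0 \<le> s" "s < 1"
proof -
  have "s\<^sup>2 \<le> (sqrt (1 - 1 / x))\<^sup>2" using assms by (intro power_mono) auto
  also have "\<dots> = 1 - 1 / x" using assms by simp
  finally show 1: "1 / x \<le> 1 - s\<^sup>2" by simp
  show "1 - s\<^sup>2 \<le> 1" "0 \<le> s" using assms by auto
  have "s\<^sup>2 < 1" using 1 assms by (smt (verit) divide_pos_pos)
  then show "s < 1" by (simp add: abs_square_less_1)
qed

lemma kmin_cont:
  assumes "x > 1" "H \<ge> 0" "H * x\<^sup>2 < B"
  shows "continuous_on {0..sqrt (1 - 1 / x)} (kmin \<nu> B H x)"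
    and "\<And>s. s \<in> {0..sqrt (1 - 1 / x)} \<Longrightarrow> kmin \<nu> B H x s > 0"
proof -
  have *: "1 - s\<^sup>2 > 0" "B - H * x\<^sup>2 * (1 - s\<^sup>2) > 0" if "s \<in> {0..sqrt (1 - 1 / x)}" for s
  proof -
    note r = sqrt_frac_range[OF assms(1) that]
    show 1: "1 - s\<^sup>2 > 0" using r(1) assms(1) by (smt (verit) divide_pos_pos)
    have "H * x\<^sup>2 * (1 - s\<^sup>2) \<le> H * x\<^sup>2 * 1" using r assms by (intro mult_left_mono) auto
    then show "B - H * x\<^sup>2 * (1 - s\<^sup>2) > 0" using assms by linarith
  qed
  show "continuous_on {0..sqrt (1 - 1 / x)} (kmin \<nu> B H x)"
    unfolding kmin_def[abs_def] using * assms by (intro continuous_intros ballI) (fastforce)+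
  show "kmin \<nu> B H x s > 0" if "s \<in> {0..sqrt (1 - 1 / x)}" for s
    unfolding kmin_def using *[OF that] assms by simp
qed

lemma tanh_artanh:
  fixes s :: real
  assumes "-1 < s" "s < 1"
  shows "tanh (artanh s) = s"
proof -
  have z: "(1 + s) / (1 - s) > 0" using assms by simp
  have "artanh s = ln (sqrt ((1 + s) / (1 - s)))"
    using z by (simp add: artanh_def ln_sqrt)
  then have "tanh (artanh s) = ((1 + s) / (1 - s) - 1) / ((1 + s) / (1 - s) + 1)"
    using z by (simp add: tanh_ln_real)
  also have "\<dots> = s" using assms by (simp add: field_simps)
  finally show ?thesis .
qed

lemma cosh_artanh_sq:
  fixes s :: real
  assumes "-1 < s" "s < 1"
  shows "1 / (cosh (artanh s))\<^sup>2 = 1 - s\<^sup>2"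
proof -
  have "(tanh (artanh s))\<^sup>2 = 1 - 1 / (cosh (artanh s))\<^sup>2"
  proof -
    have "(sinh (artanh s))\<^sup>2 = (cosh (artanh s))\<^sup>2 - 1" using cosh_square_eq[of "artanh s"] by simp
    then show ?thesis unfolding tanh_def power_divide
      using cosh_real_pos[of "artanh s"] by (simp add: diff_divide_distrib)
  qed
  then show ?thesis using tanh_artanh[OF assms] by simp
qed

lemma Theta_props:
  assumes "x > 1"
  shows "Theta x > 0" "(cosh (Theta x))\<^sup>2 = x"
proof -
  have s: "0 < sqrt (1 - 1 / x)" "sqrt (1 - 1 / x) < 1" using assms by auto
  have "1 / (cosh (Theta x))\<^sup>2 = 1 - (sqrt (1 - 1 / x))\<^sup>2"
    unfolding Theta_def by (rule cosh_artanh_sq) (use s in linarith)+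
  also have "\<dots> = 1 / x" using assms by simp
  finally show "(cosh (Theta x))\<^sup>2 = x" by (metis div_by_1 divide_divide_eq_right mult_1)
  have "-1 < sqrt (1 - 1 / x)" using s by linarith
  from tanh_artanh[OF this s(2)] have "tanh (Theta x) > 0" unfolding Theta_def using s by simp
  then show "Theta x > 0" by simp
qed

text \<open>The scaling of the equation leaves only x, H and the factor b^\<nu>. The form over the
  moving interval is used to compare a dipping with a rising solution pointwise, the form over the
  fixed interval to compare two dipping solutions with different x.\<close>

lemma time_min:
  assumes q: "q > 2" "B > 0" "A \<ge> 0" and l: "l > 0" and b: "b > 0" and A: "A < B * b\<^sup>2"
    and \<nu>: "1 / q = 1 / 2 - \<nu>" and x: "x = b / cmid q l B A b" and H: "H = A / b\<^sup>2"
  shows "integral {0..sqrt (1 - 1 / x)} (kmin \<nu> B H x) = l * b powr \<nu>"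
    and "integral {0..1} (kminh \<nu> B H x) = l * b powr \<nu>"
proof -
  obtain u u1 where u: "DN q l B A u u1" "u 0 powr q = b" "cmid q l B A b = u l powr q"
    using cmid_ex[OF q l b] by metis
  have A': "A < B * (u 0 powr q)\<^sup>2" using A u by simp
  define c where "c = u l powr q"
  have xc: "x = b / c" using x u c_def by simp
  have c: "0 < c" "c < b" "A < B * c\<^sup>2"
    using cmid_pos[OF q l b] slope_min[OF q l b A] u c_def by auto
  have x1: "x > 1" using c xc by simp
  have H0: "H \<ge> 0" "H * x\<^sup>2 = A / c\<^sup>2" using q b c by (auto simp: H xc power_divide)
  have HB: "H * x\<^sup>2 < B" unfolding H0(2) using c by (simp add: pos_divide_less_eq)
  define g where "g y = sqrt (1 - c / u y powr q)" for y
  have bW: "c \<le> u y powr q" "u y powr q \<le> b" if "y \<in> {0..l}" for y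
  proof -
    show "c \<le> u y powr q" unfolding c_def using DN_min_le(1)[OF q l u(1) A' that] DN_pos[OF u(1), of l] l q
      by (intro powr_mono2) auto
    show "u y powr q \<le> b" unfolding u(2)[symmetric] using DN_min_le(2)[OF q l u(1) A' that] DN_pos[OF u(1) that] q
      by (intro powr_mono2) auto
  qed
  have g0: "g 0 = sqrt (1 - 1 / x)" using c by (simp add: g_def u(2) xc)
  have rg: "g y \<in> {0..g 0}" if "y \<in> {0..l}" for y
  proof -
    have "c / b \<le> c / u y powr q"
      using bW[OF that] c by (intro frac_le) auto
    moreover have "c / u y powr q \<le> 1"
      using bW[OF that] c by (simp add: divide_le_eq)
    ultimately have "c / b \<le> c / u y powr q" "c / u y powr q \<le> 1" by auto
    then show ?thesis by (simp add: g_def u(2))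
  qed
  have cg: "continuous_on {0..l} g"
    unfolding g_def using DN_cont[OF u(1)] DN_pos[OF u(1)] by (intro continuous_intros) force+
  have gl: "g l = 0" using c by (simp add: g_def c_def)
  have g2: "1 - (g y)\<^sup>2 = c / u y powr q" if "y \<in> {0..l}" for y
  proof -
    have "c / u y powr q \<le> 1" using bW[OF that] c by (simp add: divide_le_eq)
    then show ?thesis by (simp add: g_def)
  qed
  have dg: "(g has_real_derivative - 1 / (kmin \<nu> B H x (g y) / b powr \<nu>)) (at y)" if y: "0 < y" "y < l" for y
  proof -
    have yi: "y \<in> {0..l}" using y by auto
    define W where "W = u y powr q"
    have W: "W > 0" using DN_pos[OF u(1) yi] by (simp add: W_def)
    have r: "x * (c / W) = b / W" using c by (simp add: xc)
    have g2W: "1 - (g y)\<^sup>2 = c / W" using g2[OF yi] by (simp add: W_def)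
    then have k: "kmin \<nu> B H x (g y) = 2 * (b / W) powr \<nu> / (c / W * sqrt (B - A / c\<^sup>2 * (c / W)))"
      unfolding kmin_def g2W H0(2) r by simp
    have e: "(c / W) powr (1 - \<nu>) = c powr (1 - \<nu>) * W powr \<nu> / W"
      using c W by (simp add: powr_divide powr_diff)
    have e': "c powr \<nu> * c powr (1 - \<nu>) = c" using c by (simp add: powr_add[symmetric])
    have "1 / (kmin \<nu> B H x (g y) / b powr \<nu>) = 1 / 2 * c powr \<nu> * (c / W) powr (1 - \<nu>) * sqrt (B - A / c\<^sup>2 * (c / W))"
      unfolding k e using e' b W c by (simp add: powr_divide field_simps)
    then have "- 1 / (kmin \<nu> B H x (g y) / b powr \<nu>) = - (1 / 2 * c powr \<nu> * (c / W) powr (1 - \<nu>) * sqrt (B - A / c\<^sup>2 * (c / W)))"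
      by (simp only: minus_divide_left[symmetric])
    then show ?thesis
      using DN_min_coordinate[OF q l u(1) A' \<nu> y c_def] unfolding g_def[symmetric] W_def by (simp only:)
  qed
  have g1: "g y < 1" "0 \<le> g y" if "y \<in> {0..l}" for y
    using sqrt_frac_range[OF x1, of "g y"] rg[OF that] g0 by auto
  note kc = kmin_cont[OF x1 H0(1) HB, where \<nu>=\<nu>]
  have "integral {0..g 0} (\<lambda>s. kmin \<nu> B H x s / b powr \<nu>) = l"
  proof (rule time_identity[OF l cg gl rg dg])
    show "continuous_on {0..g 0} (\<lambda>s. kmin \<nu> B H x s / b powr \<nu>)"
      using kc(1) b by (intro continuous_intros) (auto simp: g0)
    show "kmin \<nu> B H x y / b powr \<nu> > 0" if "y \<in> {0..g 0}" for y
      unfolding g0[symmetric] using kc(2) that b by (simp add: g0)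
  qed
  then show "integral {0..sqrt (1 - 1 / x)} (kmin \<nu> B H x) = l * b powr \<nu>"
    using b by (simp add: g0 field_simps)
  define h where "h y = artanh (g y) / Theta x" for y
  have T: "Theta x > 0" "(cosh (Theta x))\<^sup>2 = x" using Theta_props[OF x1] by auto
  have h0: "h 0 = 1" using T by (simp add: h_def Theta_def g0)
  have coshT: "1 / (cosh (Theta x * h y))\<^sup>2 = 1 - (g y)\<^sup>2" if "y \<in> {0..l}" for y
    using cosh_artanh_sq[of "g y"] g1[OF that] T by (simp add: h_def)
  have artmono: "artanh r \<le> artanh s" if "0 \<le> r" "r \<le> s" "s < 1" for r s :: real
  proof -
    have "tanh (artanh r) \<le> tanh (artanh s)" using that by (simp add: tanh_artanh)
    then show ?thesis by simp
  qed
  have "integral {0..h 0} (\<lambda>\<theta>. kminh \<nu> B H x \<theta> / b powr \<nu>) = l"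
  proof (rule time_identity[OF l])
    show "continuous_on {0..l} h" unfolding h_def using cg g1 T
      by (intro continuous_intros) (force simp: less_eq_real_def)+
    show "h l = 0" by (simp add: h_def gl)
    show "h y \<in> {0..h 0}" if "y \<in> {0..l}" for y
      using artmono[of "g y" "g 0"] artmono[of 0 "g y"] rg[OF that] g1[OF that] g1[of 0] l T
      by (auto simp: h_def intro: divide_right_mono)
    show "(h has_real_derivative - 1 / (kminh \<nu> B H x (h y) / b powr \<nu>)) (at y)" if y: "0 < y" "y < l" for y
    proof -
      have yi: "y \<in> {0..l}" using y by auto
      have "(artanh has_real_derivative 1 / (1 - (g y)\<^sup>2)) (at (g y))"
        by (rule artanh_real_has_field_derivative) (use g1[OF yi] in auto)
      from DERIV_cdivide[OF DERIV_chain2[OF this dg[OF y]], of "Theta x"]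
      have "(h has_real_derivative (1 / (1 - (g y)\<^sup>2)) * (- 1 / (kmin \<nu> B H x (g y) / b powr \<nu>)) / Theta x) (at y)"
        unfolding h_def[abs_def] .
      moreover have k: "kminh \<nu> B H x (h y) = Theta x * (1 - (g y)\<^sup>2) * kmin \<nu> B H x (g y)"
      proof -
        have "kminh \<nu> B H x (h y) = 2 * Theta x * (x * (1 / (cosh (Theta x * h y))\<^sup>2)) powr \<nu>
           / sqrt (B - H * x\<^sup>2 * (1 / (cosh (Theta x * h y))\<^sup>2))"
          by (simp add: kminh_def power_divide)
        also have "\<dots> = Theta x * (1 - (g y)\<^sup>2) * kmin \<nu> B H x (g y)"
          unfolding coshT[OF yi] kmin_def using g2[OF yi] bW[OF yi] c by simp
        finally show ?thesis .
      qed
      moreover have "(1 / (1 - (g y)\<^sup>2)) * (- 1 / (kmin \<nu> B H x (g y) / b powr \<nu>)) / Theta x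
          = - 1 / (kminh \<nu> B H x (h y) / b powr \<nu>)"
        unfolding k by (simp add: mult_ac)
      ultimately show ?thesis by (simp only:)
    qed
    have cp: "H * (x / cosh (Theta x * \<theta>))\<^sup>2 < B" for \<theta>
    proof -
      have "1 \<le> (cosh (Theta x * \<theta>))\<^sup>2" using cosh_real_ge_1[of "Theta x * \<theta>"] by simp
      then have "H * (x / cosh (Theta x * \<theta>))\<^sup>2 \<le> H * (x\<^sup>2 / 1)"
        unfolding power_divide using H0 by (intro mult_left_mono frac_le) auto
      then show ?thesis using HB by simp
    qed
    then have cp': "sqrt (B - H * (x / cosh (Theta x * \<theta>))\<^sup>2) > 0" for \<theta> by simp
    show "continuous_on {0..h 0} (\<lambda>\<theta>. kminh \<nu> B H x \<theta> / b powr \<nu>)"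
      unfolding kminh_def using b x1
      by (intro continuous_intros ballI) (auto, metis cp less_irrefl)
    show "kminh \<nu> B H x \<theta> / b powr \<nu> > 0" for \<theta>
      unfolding kminh_def using cp'[of \<theta>] T b x1 by (simp del: real_sqrt_gt_0_iff)
  qed
  then show "integral {0..1} (kminh \<nu> B H x) = l * b powr \<nu>"
    using b by (simp add: h0 field_simps)
qed

text \<open>For rising solutions a linear rescaling of s is enough to fix the interval.\<close>

lemma time_max:
  assumes q: "q > 2" "B > 0" "A \<ge> 0" and l: "l > 0" and b: "b > 0" and A: "B * b\<^sup>2 < A"
    and \<nu>: "1 / q = 1 / 2 - \<nu>" and y: "y = cmid q l B A b / b" and H: "H = A / b\<^sup>2"
  shows "integral {0..sqrt (1 - 1 / y)} (kmin (1 - \<nu>) H B y) = l * b powr \<nu>"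
    and "integral {0..1} (\<lambda>s. sqrt (1 - 1 / y) * kmin (1 - \<nu>) H B y (sqrt (1 - 1 / y) * s)) = l * b powr \<nu>"
proof -
  obtain u u1 where u: "DN q l B A u u1" "u 0 powr q = b" "cmid q l B A b = u l powr q"
    using cmid_ex[OF q l b] by metis
  have A': "B * (u 0 powr q)\<^sup>2 < A" using A u by simp
  define c where "c = u l powr q"
  have yc: "y = c / b" using y u c_def by simp
  have c: "b < c" "B * c\<^sup>2 < A"
    using slope_max[OF q l b A] u c_def by auto
  then have c0: "c > 0" using b by simp
  have y1: "y > 1" using c b yc by simp
  have HB: "B * y\<^sup>2 < H" using c b by (simp add: H yc power_divide field_simps)
  have B0: "B \<ge> 0" using q by simp
  define g where "g z = sqrt (1 - u z powr q / c)" for z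
  have bW: "b \<le> u z powr q" "u z powr q \<le> c" if "z \<in> {0..l}" for z
  proof -
    show "u z powr q \<le> c" unfolding c_def using DN_max_ge(1)[OF q l u(1) A' that] DN_pos[OF u(1) that] q
      by (intro powr_mono2) auto
    show "b \<le> u z powr q" unfolding u(2)[symmetric] using DN_max_ge(2)[OF q l u(1) A' that] DN_pos[OF u(1), of 0] q l
      by (intro powr_mono2) auto
  qed
  have g0: "g 0 = sqrt (1 - 1 / y)" using c by (simp add: g_def u(2) yc)
  have rg: "g z \<in> {0..g 0}" if "z \<in> {0..l}" for z
    unfolding g_def using bW[OF that] c c0 u(2) by (auto simp: divide_right_mono)
  have cg: "continuous_on {0..l} g"
    unfolding g_def using DN_cont[OF u(1)] DN_pos[OF u(1)] c0
    by (intro continuous_intros) (auto dest: DN_pos[OF u(1)])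
  have gl: "g l = 0" using c0 by (simp add: g_def c_def)
  have g2: "1 - (g z)\<^sup>2 = u z powr q / c" if "z \<in> {0..l}" for z
    using bW[OF that] b c0 by (simp add: g_def)
  define K where "K s = kmin (1 - \<nu>) H B y s / b powr \<nu>" for s
  have dg: "(g has_real_derivative - 1 / K (g z)) (at z)" if z: "0 < z" "z < l" for z
  proof -
    have zi: "z \<in> {0..l}" using z by auto
    define W where "W = u z powr q"
    have W: "W > 0" using DN_pos[OF u(1) zi] by (simp add: W_def)
    have "y * (W / c) = W / b" using c0 by (simp add: yc)
    then have k: "kmin (1 - \<nu>) H B y (g z) = 2 * (W / b) powr (1 - \<nu>) / (W / c * sqrt (H - B * y\<^sup>2 * (W / c)))"
      unfolding kmin_def g2[OF zi] by (simp add: W_def)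
    have "H - B * y\<^sup>2 * (W / c) = (A / c\<^sup>2 - B * (W / c)) * (c / b)\<^sup>2"
      using b c0 by (simp add: H yc power_divide field_simps)
    then have sq: "sqrt (H - B * y\<^sup>2 * (W / c)) = sqrt (A / c\<^sup>2 - B * (W / c)) * (c / b)"
      using b c0 by (simp add: real_sqrt_mult)
    have e: "(W / b) powr (1 - \<nu>) = W / W powr \<nu> * b powr \<nu> / b"
      using b W by (simp add: powr_divide powr_diff)
    have "1 / K (g z) = 1 / 2 * W powr \<nu> * sqrt (A / c\<^sup>2 - B * (W / c))"
      unfolding k K_def e sq using b W c0 by (simp add: field_simps)
    then have "- 1 / K (g z) = - (1 / 2 * W powr \<nu> * sqrt (A / c\<^sup>2 - B * (W / c)))"
      by (simp only: minus_divide_left[symmetric])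
    then show ?thesis
      using DN_max_coordinate[OF q l u(1) A' \<nu> z c_def] unfolding g_def[symmetric] W_def by (simp only:)
  qed
  note kc = kmin_cont[OF y1 B0 HB, where \<nu>="1 - \<nu>"]
  have cK: "continuous_on {0..g 0} K" unfolding K_def
    using kc(1) b by (intro continuous_intros) (auto simp: g0)
  have pK: "K s > 0" if "s \<in> {0..g 0}" for s
    using kc(2) that b by (simp add: g0 K_def)
  have "integral {0..g 0} K = l" by (rule time_identity[OF l cg gl rg dg cK pK])
  then show "integral {0..sqrt (1 - 1 / y)} (kmin (1 - \<nu>) H B y) = l * b powr \<nu>"
    using b by (simp add: g0 K_def[abs_def] field_simps)
  have s0: "g 0 > 0" using y1 by (simp add: g0)
  define h where "h z = g z / g 0" for z
  have h0: "h 0 = 1" using s0 by (simp add: h_def)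
  have "integral {0..h 0} (\<lambda>s. g 0 * K (g 0 * s)) = l"
  proof (rule time_identity[OF l])
    show "continuous_on {0..l} h" unfolding h_def using cg s0 by (intro continuous_intros) auto
    show "h l = 0" by (simp add: h_def gl)
    show "h z \<in> {0..h 0}" if "z \<in> {0..l}" for z
      using rg[OF that] s0 by (auto simp: h_def field_simps)
    show "(h has_real_derivative - 1 / (g 0 * K (g 0 * h z))) (at z)" if "0 < z" "z < l" for z
      using DERIV_cdivide[OF dg[OF that], of "g 0"] s0 by (simp add: h_def[abs_def] field_simps)
    have m: "g 0 * s \<in> {0..g 0}" if "s \<in> {0..h 0}" for s
      using that s0 h0 by auto
    show "continuous_on {0..h 0} (\<lambda>s. g 0 * K (g 0 * s))"
      using m by (intro continuous_intros continuous_on_compose2[OF cK]) auto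
    show "0 < g 0 * K (g 0 * s)" if "s \<in> {0..h 0}" for s
      using s0 pK[OF m[OF that]] by simp
  qed
  then show "integral {0..1} (\<lambda>s. sqrt (1 - 1 / y) * kmin (1 - \<nu>) H B y (sqrt (1 - 1 / y) * s)) = l * b powr \<nu>"
    using b by (simp add: g0 h0[unfolded h_def] h0 K_def field_simps)
qed

section \<open>Algebra of the slope matching\<close>

text \<open>The expression (1 - 1/x)(B - H x) is the squared slope of a dipping solution up to the
  factor b / q^2; for a rising one it is (y - 1)(H / y - B). The factored differences here and in
  \<open>flux_max_diff\<close> exhibit the monotonicity of both fluxes on their admissible ranges,
  and \<open>flux_gap\<close> compares the two fluxes at one argument.\<close>

lemma flux_min_diff:
  fixes x w B H :: real
  assumes "x > 0" "w > 0"
  shows "(1 - 1 / x) * (B - H * x) - (1 - 1 / w) * (B - H * w) = (x - w) * (B / (x * w) - H)"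
  using assms by (simp add: field_simps)

lemma flux_max_diff:
  fixes y w B H :: real
  assumes "y > 0" "w > 0"
  shows "(y - 1) * (H / y - B) - (w - 1) * (H / w - B) = (y - w) * (H / (y * w) - B)"
  using assms by (simp add: field_simps)

lemma flux_gap:
  fixes w :: real
  assumes "w > 0"
  shows "(1 - 1 / w) * (Bp - Hp * w) - (w - 1) * (Hm / w - Bm) = (1 - 1 / w) * ((Bp - Hm) - (Hp - Bm) * w)"
  using assms by (simp add: field_simps)

text \<open>The rising flux is monotone, so replacing y by the smaller x turns the equality into an
  inequality at the common argument x, where \<open>flux_gap\<close> applies. In
  \<open>flux_eq_gt\<close> the dipping flux is moved down to y instead.\<close>

lemma flux_eq_le:
  fixes x y :: real
  assumes x: "x > 1" and xy: "x \<le> y" and Hm: "Bm * y\<^sup>2 < Hm" "Bm \<ge> 0"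
    and D: "(1 - 1 / x) * (Bp - Hp * x) = (y - 1) * (Hm / y - Bm)"
  shows "(Hp - Bm) * x \<le> Bp - Hm"
proof -
  have "Bm * (y * x) \<le> Bm * y\<^sup>2"
    unfolding power2_eq_square using xy x Hm by (intro mult_left_mono) auto
  then have "Hm / (y * x) - Bm \<ge> 0" using x xy Hm by (simp add: field_simps)
  then have "(y - 1) * (Hm / y - Bm) - (x - 1) * (Hm / x - Bm) \<ge> 0"
    using flux_max_diff[of y x Hm Bm] x xy by simp
  then have "(1 - 1 / x) * ((Bp - Hm) - (Hp - Bm) * x) \<ge> 0"
    using flux_gap[of x Bp Hp Hm Bm] x D by simp
  then show ?thesis using x by (simp add: zero_le_mult_iff)
qed

lemma flux_eq_gt:
  fixes x y :: real
  assumes y: "y > 1" and xy: "y < x" and Hp: "Hp * x\<^sup>2 < Bp" "Hp \<ge> 0"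
    and D: "(1 - 1 / x) * (Bp - Hp * x) = (y - 1) * (Hm / y - Bm)"
  shows "Bp - Hm < (Hp - Bm) * y"
proof -
  have "Hp * (x * y) \<le> Hp * x\<^sup>2"
    unfolding power2_eq_square using xy y Hp by (intro mult_left_mono) auto
  then have "Bp / (x * y) - Hp > 0" using y xy Hp by (simp add: field_simps)
  then have "(1 - 1 / x) * (Bp - Hp * x) - (1 - 1 / y) * (Bp - Hp * y) > 0"
    using flux_min_diff[of x y Bp Hp] y xy by simp
  then have "(1 - 1 / y) * ((Bp - Hm) - (Hp - Bm) * y) < 0"
    using flux_gap[of y Bp Hp Hm Bm] y D by simp
  then show ?thesis using y by (simp add: mult_less_0_iff)
qed

lemma flux_min_square:
  fixes x :: real
  assumes "x > 0"
  shows "(1 - 1 / x) * (s\<^sup>2 - r\<^sup>2 * x) = (s - r)\<^sup>2 - (s - r * x)\<^sup>2 / x"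
  using assms by (simp add: field_simps power2_eq_square)

lemma flux_max_le:
  fixes y :: real
  assumes "y > 0"
  shows "(y - 1) * (s\<^sup>2 / y - r\<^sup>2) \<le> (s - r)\<^sup>2"
proof -
  have "(s - r)\<^sup>2 - (y - 1) * (s\<^sup>2 / y - r\<^sup>2) = (s - r * y)\<^sup>2 / y"
    using assms by (simp add: field_simps power2_eq_square)
  moreover have "(s - r * y)\<^sup>2 / y \<ge> 0" using assms by simp
  ultimately show ?thesis by linarith
qed

text \<open>The parameters stand for T = t - 1 and g = 1 + \<gamma>. When y < x, the flux gap
  together with the range bounds u x < T + 2 and T y < v forces u + v > 2(T + 1), and squaring this
  gives a lower bound for h.\<close>

lemma large_h:
  fixes T g h x y :: real
  assumes g: "0 < g" "g < T" "T < 2 - g" and h: "h \<ge> 0" and y: "y > 1" and xy: "y < x"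
    and Hp: "(g\<^sup>2 + h) * x\<^sup>2 < (T + 2)\<^sup>2" and Hm: "T\<^sup>2 * y\<^sup>2 < (2 - g)\<^sup>2 + h"
    and D: "(1 - 1 / x) * ((T + 2)\<^sup>2 - (g\<^sup>2 + h) * x) = (y - 1) * (((2 - g)\<^sup>2 + h) / y - T\<^sup>2)"
  shows "16 / 9 * T\<^sup>2 < h"
proof -
  define u where "u = sqrt (g\<^sup>2 + h)"
  define v where "v = sqrt ((2 - g)\<^sup>2 + h)"
  have u2: "u\<^sup>2 = g\<^sup>2 + h" and v2: "v\<^sup>2 = (2 - g)\<^sup>2 + h" using h by (auto simp: u_def v_def)
  have u: "u > 0" and v: "v > 0" using g h by (auto simp: u_def v_def intro!: add_pos_nonneg)
  have PQ: "(T + 2)\<^sup>2 - v\<^sup>2 < (u\<^sup>2 - T\<^sup>2) * y"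
    unfolding u2 v2 by (rule flux_eq_gt[OF y xy Hp _ D]) (use h in simp)
  have "(u * x)\<^sup>2 < (T + 2)\<^sup>2" using Hp u2 by (simp add: power_mult_distrib)
  then have ux: "u * x < T + 2" by (rule power2_less_imp_less) (use g in simp)
  have "(T * y)\<^sup>2 < v\<^sup>2" using Hm v2 by (simp add: power_mult_distrib)
  then have Ty: "T * y < v" by (rule power2_less_imp_less) (use v in simp)
  have "u * y < u * x" using u xy by simp
  then have uy: "u * y < T + 2" using ux by linarith
  \<comment> \<open>Otherwise \<open>u - T\<close> is positive and at most \<open>T + 2 - v\<close>.
    Dividing the gap inequality by \<open>u - T\<close> then gives T + 2 + v < (u + T) y, against u
    y < T + 2 and T y < v.\<close>
  have sum: "2 * (T + 1) < u + v"
  proof (rule ccontr)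
    assume n: "\<not> 2 * (T + 1) < u + v"
    have AB: "u - T \<le> T + 2 - v" using n by (simp add: algebra_simps)
    have "(T + 2)\<^sup>2 - v\<^sup>2 + (u\<^sup>2 - T\<^sup>2) = 4 * (T + g)" unfolding u2 v2 by (simp add: power2_eq_square algebra_simps)
    moreover have "(u\<^sup>2 - T\<^sup>2) * y \<le> 0" if "u\<^sup>2 - T\<^sup>2 \<le> 0"
      using that y by (intro mult_nonpos_nonneg) auto
    ultimately have "u\<^sup>2 - T\<^sup>2 > 0" using PQ g by argo
    then have B: "u - T > 0" using u g by (simp add: power2_eq_square square_diff_square_factored zero_less_mult_iff)
    have "(T + 2 - v) * (T + 2 + v) < (u - T) * ((u + T) * y)"
      using PQ by (simp add: power2_eq_square algebra_simps)
    moreover have "(u - T) * (T + 2 + v) \<le> (T + 2 - v) * (T + 2 + v)"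
      using AB v g by (intro mult_right_mono) auto
    ultimately have "(u - T) * (T + 2 + v) < (u - T) * ((u + T) * y)" by linarith
    then have "T + 2 + v < (u + T) * y" using B by simp
    then show False using uy Ty by (simp add: algebra_simps)
  qed
  \<comment> \<open>These are the t and \<gamma> of the system. In terms of s = u + v one has 4(1 +
    c^2 + h) = s^2 + 16 c^2 / s^2, which for s > 2t exceeds its value at s = 2t.\<close>
  define t where "t = T + 1"
  define c where "c = g - 1"
  have t: "t > 1" using g by (simp add: t_def)
  have cc: "c\<^sup>2 < 1" using g by (simp add: c_def abs_square_less_1)
  define s where "s = u + v"
  have s: "2 * t < s" using sum by (simp add: s_def t_def)
  have s0: "s > 0" using s t by linarith
  have "(v - u) * s = - 4 * c" using u2 v2 by (simp add: s_def c_def power2_eq_square algebra_simps)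
  then have vu: "v - u = - 4 * c / s" using s0 by (simp add: field_simps)
  have "2 * (u\<^sup>2 + v\<^sup>2) = s\<^sup>2 + (v - u)\<^sup>2" by (simp add: s_def power2_eq_square algebra_simps)
  then have e: "4 * (1 + c\<^sup>2 + h) = s\<^sup>2 + 16 * c\<^sup>2 / s\<^sup>2"
    unfolding vu u2 v2 by (simp add: c_def power_divide power2_eq_square algebra_simps)
  have st: "4 * t\<^sup>2 < s\<^sup>2"
    using power_strict_mono[OF s, of 2] t by (simp add: power_mult_distrib)
  have t2: "t\<^sup>2 > 1" using t by (simp add: one_less_power)
  have "s\<^sup>2 + 16 * c\<^sup>2 / s\<^sup>2 - (4 * t\<^sup>2 + 4 * c\<^sup>2 / t\<^sup>2) = (s\<^sup>2 - 4 * t\<^sup>2) * (1 - 4 * c\<^sup>2 / (s\<^sup>2 * t\<^sup>2))"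
    using s0 t by (simp add: field_simps)
  moreover have "4 * c\<^sup>2 / (s\<^sup>2 * t\<^sup>2) < 1"
  proof -
    have "4 * 1 < s\<^sup>2" using st t2 by linarith
    then have "4 * 1 * 1 < s\<^sup>2 * t\<^sup>2" using t2 by (intro mult_strict_mono) auto
    then show ?thesis using cc s0 t by (simp add: divide_less_eq)
  qed
  ultimately have "s\<^sup>2 + 16 * c\<^sup>2 / s\<^sup>2 > 4 * t\<^sup>2 + 4 * c\<^sup>2 / t\<^sup>2"
    using st mult_pos_pos[of "s\<^sup>2 - 4 * t\<^sup>2" "1 - 4 * c\<^sup>2 / (s\<^sup>2 * t\<^sup>2)"] by linarith
  then have "4 * (t\<^sup>2 + c\<^sup>2 / t\<^sup>2) < 4 * (1 + c\<^sup>2 + h)" unfolding e by simp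
  then have "h > t\<^sup>2 + c\<^sup>2 / t\<^sup>2 - 1 - c\<^sup>2" by (simp only: mult_less_cancel_left) argo
  also have "t\<^sup>2 + c\<^sup>2 / t\<^sup>2 - 1 - c\<^sup>2 = (t\<^sup>2 - 1) * (t\<^sup>2 - c\<^sup>2) / t\<^sup>2"
    using t by (simp add: field_simps)
  finally have h1: "(t\<^sup>2 - 1) * (t\<^sup>2 - c\<^sup>2) / t\<^sup>2 < h" .
  have 1: "t\<^sup>2 - 1 = T * (T + 2)" by (simp add: t_def power2_eq_square algebra_simps)
  have "t\<^sup>2 - c\<^sup>2 = T * (T + 2) + g * (2 - g)" by (simp add: t_def c_def power2_eq_square algebra_simps)
  moreover have "g * (2 - g) > 0" using g by (intro mult_pos_pos) auto
  ultimately have 2: "t\<^sup>2 - c\<^sup>2 \<ge> T * (T + 2)" by linarith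
  have "16 / 9 * T\<^sup>2 * t\<^sup>2 \<le> (T * (T + 2))\<^sup>2"
  proof -
    have "(4 / 3 * t)\<^sup>2 \<le> (T + 2)\<^sup>2" using g t by (intro power_mono) (auto simp: t_def)
    then have "T\<^sup>2 * (4 / 3 * t)\<^sup>2 \<le> T\<^sup>2 * (T + 2)\<^sup>2" by (intro mult_left_mono) auto
    then show ?thesis by (simp add: power_mult_distrib power_divide)
  qed
  also have "\<dots> \<le> (t\<^sup>2 - 1) * (t\<^sup>2 - c\<^sup>2)"
    unfolding 1 power2_eq_square[of "T * (T + 2)"] using 2 g by (intro mult_left_mono) auto
  finally have "16 / 9 * T\<^sup>2 \<le> (t\<^sup>2 - 1) * (t\<^sup>2 - c\<^sup>2) / t\<^sup>2" using t by (simp add: field_simps)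
  then show ?thesis using h1 by linarith
qed

text \<open>The expression is three times the derivative, in log b, of the dipping minus the rising
  flux along the barrier curves of \<open>crossing\<close>, taken at the extremal exponents for
  \<nu> = 1/3. Multiplying the coefficients by x - 1 and y - 1 brings in the common flux
  \<open>E\<close>, so that only the difference of the two \<open>E\<close> terms and a loss of size
  H(x-1)/4 have to be paid for by h(x - 1/y).\<close>

lemma growth_balance:
  fixes T g h x y :: real
  assumes g: "0 < g" "g < T" "T < 2 - g" and h: "h > 0" "g\<^sup>2 \<le> h" and x: "x > 1" and y: "y > 1"
    and Hp: "(g\<^sup>2 + h) * x\<^sup>2 < (T + 2)\<^sup>2" and Hm: "T\<^sup>2 * y\<^sup>2 < (2 - g)\<^sup>2 + h"
    and D: "(1 - 1 / x) * ((T + 2)\<^sup>2 - (g\<^sup>2 + h) * x) = (y - 1) * (((2 - g)\<^sup>2 + h) / y - T\<^sup>2)"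
  shows "0 < ((T + 2)\<^sup>2 / x - (g\<^sup>2 + h) * x) * (6 * (x - 1) / (4 * x - 1)) + 6 * h * (x - 1 / y)
     - (((2 - g)\<^sup>2 + h) / y - T\<^sup>2 * y) * (6 * (y - 1) / (4 * y - 1))"
proof -
  define B where "B = (T + 2)\<^sup>2"
  define H where "H = g\<^sup>2 + h"
  define M where "M = (2 - g)\<^sup>2 + h"
  define E where "E = (1 - 1 / x) * (B - H * x)"
  have H2: "H \<le> 2 * h" using h by (simp add: H_def)
  have E2: "E = (y - 1) * (M / y - T\<^sup>2)" using D by (simp add: E_def B_def H_def M_def)
  have Epos: "E > 0"
  proof -
    have "x \<le> x\<^sup>2" using x by (simp add: power2_eq_square)
    then have "H * x \<le> H * x\<^sup>2" using h by (intro mult_left_mono) (auto simp: H_def)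
    then show ?thesis unfolding E_def using Hp x by (intro mult_pos_pos) (auto simp: B_def H_def)
  qed
  have e1: "(B / x - H * x) * (x - 1) = E - H * (x - 1)\<^sup>2"
    using x by (simp add: E_def power2_eq_square field_simps)
  have e2: "(M / y - T\<^sup>2 * y) * (y - 1) = E - T\<^sup>2 * (y - 1)\<^sup>2"
    using y by (simp add: E2 power2_eq_square field_simps)
  have xp: "4 * x - 1 > 0" "4 * y - 1 > 0" using x y by auto
  have "(B / x - H * x) * (6 * (x - 1) / (4 * x - 1)) + 6 * h * (x - 1 / y) - (M / y - T\<^sup>2 * y) * (6 * (y - 1) / (4 * y - 1))
     = 6 * ((E - H * (x - 1)\<^sup>2) / (4 * x - 1) + h * (x - 1 / y) - (E - T\<^sup>2 * (y - 1)\<^sup>2) / (4 * y - 1))"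
    unfolding e1[symmetric] e2[symmetric] by (simp add: field_simps)
  moreover have "(E - H * (x - 1)\<^sup>2) / (4 * x - 1) + h * (x - 1 / y) - (E - T\<^sup>2 * (y - 1)\<^sup>2) / (4 * y - 1) > 0"
  proof -
    have r: "(x - 1)\<^sup>2 / (4 * x - 1) \<le> (x - 1) / 4"
    proof -
      have "(x - 1)\<^sup>2 * 4 \<le> (x - 1) * (4 * x - 1)" using x by (simp add: power2_eq_square algebra_simps)
      then show ?thesis using xp by (simp add: divide_simps)
    qed
    have Hpos: "H > 0" using h g by (simp add: H_def add_nonneg_pos)
    have b1: "H * (x - 1)\<^sup>2 / (4 * x - 1) \<le> H * (x - 1) / 4"
      using mult_left_mono[OF r, of H] Hpos by simp
    have b2: "T\<^sup>2 * (y - 1)\<^sup>2 / (4 * y - 1) \<ge> 0" using xp by simp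
    have hx: "h * (x - 1) < h * (x - 1 / y)" using h y by simp
    show ?thesis
    proof (cases "x \<le> y")
      case True
      have "E / (4 * y - 1) \<le> E / (4 * x - 1)" using True Epos xp by (intro divide_left_mono) auto
      moreover have "H * (x - 1) / 4 \<le> 2 * h * (x - 1) / 4" using H2 x by (intro divide_right_mono mult_right_mono) auto
      moreover have "h * (x - 1) > 0" using h x by simp
      then have "2 * h * (x - 1) / 4 < h * (x - 1 / y)" using hx by argo
      ultimately show ?thesis using b1 b2 by (simp add: diff_divide_distrib)
    next
      \<comment> \<open>Here the \<open>E\<close> terms have the unfavourable order. By
        \<open>large_h\<close>, T^2 < (9/16) h and so H \<le> (25/16) h; the two losses are then at
        most 25/48 and 25/64 of h(x - 1/y), together less than the whole.\<close>
      case False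
      then have xy: "y < x" by simp
      have hT: "16 / 9 * T\<^sup>2 < h" by (rule large_h[OF g _ y xy Hp Hm D]) (use h in simp)
      have "g\<^sup>2 \<le> T\<^sup>2" using g by (intro power_mono) auto
      then have H3: "H \<le> 25 / 16 * h" using hT by (simp add: H_def)
      have id: "B * (x - y) / (x * y) = h * (x - 1 / y) + T\<^sup>2 * (x - y) - (T\<^sup>2 - g\<^sup>2) * (x - 1) - (B - (2 - g)\<^sup>2) * (1 - 1 / y)"
      proof -
        have "B * (x - y) / (x * y) = B * (1 / y - 1 / x)" using x y by (simp add: field_simps)
        moreover have "B * (1 - 1 / x) - H * (x - 1) = M * (1 - 1 / y) - T\<^sup>2 * (y - 1)"
          using E2 x y unfolding E_def by (simp add: field_simps)
        ultimately show ?thesis unfolding H_def M_def by (simp add: algebra_simps)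
      qed
      have "(2 - g)\<^sup>2 \<le> B" unfolding B_def using g by (intro power_mono) auto
      then have "(B - (2 - g)\<^sup>2) * (1 - 1 / y) \<ge> 0" using y by (intro mult_nonneg_nonneg) auto
      moreover have "(T\<^sup>2 - g\<^sup>2) * (x - 1) \<ge> 0" using \<open>g\<^sup>2 \<le> T\<^sup>2\<close> x by simp
      ultimately have bB1: "B * (x - y) / (x * y) \<le> h * (x - 1 / y) + T\<^sup>2 * (x - y)" using id by linarith
      have "1 / y \<le> 1" using y by simp
      then have "1 / y \<le> y" using y by linarith
      then have "T\<^sup>2 * (x - y) \<le> 9 / 16 * h * (x - 1 / y)"
        using hT xy h by (intro mult_mono) auto
      then have "T\<^sup>2 * (x - y) \<le> 9 / 16 * (h * (x - 1 / y))" by (simp only: mult.assoc)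
      then have bB: "B * (x - y) / (x * y) \<le> 25 / 16 * (h * (x - 1 / y))" using bB1 by argo
      have "E \<le> B * (x - 1) / x" unfolding E_def using x Hpos by (simp add: field_simps)
      define c where "c = 4 * (x - 1) * y / ((4 * x - 1) * (4 * y - 1))"
      have c: "0 \<le> c" "c \<le> 1 / 3"
      proof -
        show "0 \<le> c" unfolding c_def using x y xp by simp
        have "3 * (4 * (x - 1) * y) \<le> (4 * x - 1) * (4 * y - 1)"
        proof -
          have "(4 * x - 1) * (4 * y - 1) - 3 * (4 * (x - 1) * y) = 4 * x * (y - 1) + 8 * y + 1" by (simp add: algebra_simps)
          moreover have "4 * x * (y - 1) \<ge> 0" using x y by simp
          ultimately show ?thesis using y by linarith
        qed
        then show "c \<le> 1 / 3" unfolding c_def using xp by (simp add: divide_simps)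
      qed
      have "E / (4 * y - 1) - E / (4 * x - 1) = E * (4 * (x - y)) / ((4 * x - 1) * (4 * y - 1))"
        using xp by (simp add: field_simps)
      also have "\<dots> \<le> B * (x - 1) / x * (4 * (x - y)) / ((4 * x - 1) * (4 * y - 1))"
        using \<open>E \<le> B * (x - 1) / x\<close> xy xp by (intro divide_right_mono mult_right_mono) auto
      also have "\<dots> = c * (B * (x - y) / (x * y))"
      proof -
        have "B * (x - 1) / x * (4 * (x - y)) / p = 4 * (x - 1) * y / p * (B * (x - y) / (x * y))" if "p \<noteq> 0" for p
          using x y that by (simp add: field_simps)
        then show ?thesis unfolding c_def using xp by simp
      qed
      also have "\<dots> \<le> 1 / 3 * (25 / 16 * (h * (x - 1 / y)))"
        by (intro mult_mono bB c) (use h x y hx in \<open>auto simp: B_def xy less_imp_le\<close>)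
      finally have 1: "E / (4 * y - 1) - E / (4 * x - 1) \<le> 25 / 48 * (h * (x - 1 / y))" by simp
      have "H * (x - 1) / 4 \<le> 25 / 16 * h * (x - 1) / 4" using H3 x by (intro divide_right_mono mult_right_mono) auto
      also have "\<dots> = 25 / 64 * (h * (x - 1))" by simp
      finally have 2: "H * (x - 1)\<^sup>2 / (4 * x - 1) \<le> 25 / 64 * (h * (x - 1))" using b1 by linarith
      have "h * (x - 1) > 0" using h x by simp
      then show ?thesis using 1 2 b2 hx by (simp add: diff_divide_distrib)
    qed
  qed
  ultimately show ?thesis unfolding B_def H_def M_def
    by (simp only: zero_less_mult_iff) simp
qed

text \<open>As a function of v^3, the quantity v^2 is concave and lies above its chord.\<close>

lemma cube_chord:
  fixes v y :: real
  assumes "1 \<le> v" "v \<le> y" "1 < y"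
  shows "(v ^ 3 - 1) / (y ^ 3 - 1) * (y\<^sup>2 - 1) \<le> v\<^sup>2 - 1"
proof -
  have y3: "y ^ 3 - 1 > 0" using assms by (simp add: one_less_power)
  have "(v\<^sup>2 - 1) * (y ^ 3 - 1) - (v ^ 3 - 1) * (y\<^sup>2 - 1)
      = (v - 1) * (y - 1) * ((y - v) * (v * y + y + v))"
    by (simp add: power2_eq_square power3_eq_cube algebra_simps)
  moreover have "(v - 1) * (y - 1) * ((y - v) * (v * y + y + v)) \<ge> 0"
    using assms by (intro mult_nonneg_nonneg add_nonneg_nonneg) auto
  ultimately show ?thesis using y3 by (simp add: field_simps)
qed

text \<open>This supplies the pointwise hypotheses of \<open>kmin_exclusion\<close> when h is small.
  In the variable v^3 the term P - Q x v^3 is affine and is nonnegative at v = 1 by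
  \<open>flux_eq_le\<close>, while v^2 - 1 lies above its chord; so the claim reduces to the strict
  inequality at the endpoint v = r.\<close>

lemma small_h_kernel:
  fixes T g h x y :: real
  assumes g: "0 < g" "g < T" "T < 2 - g" and h: "0 \<le> h" "h \<le> g\<^sup>2" and x: "x > 1" and xy: "x \<le> y"
    and Hp: "(g\<^sup>2 + h) * x\<^sup>2 < (T + 2)\<^sup>2" and Hm: "T\<^sup>2 * y\<^sup>2 < (2 - g)\<^sup>2 + h"
    and D: "(1 - 1 / x) * ((T + 2)\<^sup>2 - (g\<^sup>2 + h) * x) = (y - 1) * (((2 - g)\<^sup>2 + h) / y - T\<^sup>2)"
    and r: "1 \<le> v" "v \<le> r" "r ^ 3 = x"
  shows "(2 - g)\<^sup>2 + h - T\<^sup>2 * x * v ^ 3 \<le> v\<^sup>2 * ((T + 2)\<^sup>2 - (g\<^sup>2 + h) * x * v ^ 3)"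
    and "(2 - g)\<^sup>2 + h - T\<^sup>2 * x * r ^ 3 < r\<^sup>2 * ((T + 2)\<^sup>2 - (g\<^sup>2 + h) * x * r ^ 3)"
proof -
  define H where "H = sqrt (g\<^sup>2 + h)"
  define M where "M = sqrt ((2 - g)\<^sup>2 + h)"
  have H2: "H\<^sup>2 = g\<^sup>2 + h" and M2: "M\<^sup>2 = (2 - g)\<^sup>2 + h" using h by (auto simp: H_def M_def)
  have Hpos: "H > 0" using g h by (auto simp: H_def intro!: add_pos_nonneg)
  define P where "P = (T + 2)\<^sup>2 - M\<^sup>2"
  define Q where "Q = H\<^sup>2 - T\<^sup>2"
  have PQ: "Q * x \<le> P"
    unfolding P_def Q_def H2 M2 by (rule flux_eq_le[OF x xy Hm _ D]) simp
  have PQs: "P + Q = 4 * (T + g)" unfolding P_def Q_def H2 M2 by (simp add: power2_eq_square algebra_simps)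
  have r1: "r > 1"
  proof (rule ccontr)
    assume "\<not> r > 1"
    then have "r = 1" using r by linarith
    then show False using r x by simp
  qed
  define z where "z = H * x"
  have z2: "z\<^sup>2 = (g\<^sup>2 + h) * x\<^sup>2" by (simp add: z_def power_mult_distrib H2)
  have zpos: "z > 0" using Hpos x by (simp add: z_def)
  have zT: "z < T + 2" using Hp z2 g power2_less_imp_less[of z "T + 2"] by simp
  have z4: "z \<le> 4" using zT g by linarith
  have B: "(T + 2)\<^sup>2 - z\<^sup>2 = (T + 2 - z) * (T + 2 + z)" by (simp add: power2_eq_square algebra_simps)
  have hg: "h \<le> T\<^sup>2" using h g power_strict_mono[of g T 2] by simp
  have Qg: "Q \<le> g\<^sup>2" using h g power_strict_mono[of g T 2] by (simp add: Q_def H2)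
  have g21: "g\<^sup>2 \<le> g" using g by (simp add: power2_eq_square mult_left_le)
  have Ppos: "P > 0" using PQs Qg g21 g by argo
  \<comment> \<open>Only P < Q x^2 needs work. Then Q > 0, x^2 \<ge> 7 and r^2 \<ge> 3/2, while
    equality of the fluxes keeps z = H x below two thirds of T + 2 or equal to it; so (r^2 -
    1)((T+2)^2 - z^2) is at least z^2 / 2, which covers Q x^2.\<close>
  have main: "(r\<^sup>2 - 1) * ((T + 2)\<^sup>2 - z\<^sup>2) + (P - Q * x\<^sup>2) > 0"
  proof (cases "Q * x\<^sup>2 \<le> P")
    case True
    have "(r\<^sup>2 - 1) * ((T + 2)\<^sup>2 - z\<^sup>2) > 0" unfolding B using r1 zT zpos g
      by (intro mult_pos_pos) (auto simp: one_less_power)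
    then show ?thesis using True by linarith
  next
    case False
    have Qpos: "Q > 0"
    proof (rule ccontr)
      assume "\<not> Q > 0"
      then have "Q * x\<^sup>2 \<le> 0" by (simp add: mult_nonpos_nonneg)
      then show False using False Ppos by linarith
    qed
    then have HT: "T < H" using Hpos power2_less_imp_less[of T H] by (simp add: Q_def)
    have Qh: "Q \<le> H\<^sup>2 / 2"
    proof -
      have "g\<^sup>2 \<le> T\<^sup>2" using g by (intro power_mono) auto
      then have "H\<^sup>2 \<le> 2 * T\<^sup>2" unfolding H2 using hg by simp
      then show ?thesis by (simp add: Q_def)
    qed
    have Qz: "Q * x\<^sup>2 \<le> z\<^sup>2 / 2"
      using mult_right_mono[OF Qh, of "x\<^sup>2"] by (simp add: z_def power_mult_distrib)
    have x7: "7 \<le> x\<^sup>2"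
    proof -
      have "z\<^sup>2 \<le> 2 * g\<^sup>2 * x\<^sup>2" unfolding z2 using h by (intro mult_right_mono) auto
      then have "z\<^sup>2 \<le> 2 * (g\<^sup>2 * x\<^sup>2)" by (simp only: mult.assoc)
      moreover have "4 * (T + g) < z\<^sup>2 / 2 + g\<^sup>2" using False Qz Qg PQs by argo
      ultimately have "8 * g < g\<^sup>2 * x\<^sup>2 + g\<^sup>2" using g by argo
      then have "g * 8 < g * (g * (x\<^sup>2 + 1))" by (simp add: power2_eq_square algebra_simps)
      then have "8 < g * (x\<^sup>2 + 1)" using g by simp
      moreover have "g * (x\<^sup>2 + 1) \<le> 1 * (x\<^sup>2 + 1)" using g by (intro mult_right_mono) auto
      ultimately show ?thesis by simp
    qed
    have r2: "3 / 2 \<le> r\<^sup>2"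
    proof (rule ccontr)
      assume n: "\<not> 3 / 2 \<le> r\<^sup>2"
      have "(r\<^sup>2) ^ 3 \<le> (3 / 2) ^ 3" using n by (intro power_mono) auto
      moreover have "(r\<^sup>2) ^ 3 = x\<^sup>2" by (simp add: r(3)[symmetric] power_mult[symmetric] mult.commute)
      ultimately show False using x7 by (simp add: power3_eq_cube)
    qed
    have Tz: "z / 2 \<le> T + 2 - z"
    proof -
      have D1: "(T + 2 - H)\<^sup>2 - (T + 2 - H * x)\<^sup>2 / x \<le> (M - T)\<^sup>2"
      proof -
        have "(T + 2 - H)\<^sup>2 - (T + 2 - H * x)\<^sup>2 / x = (1 - 1 / x) * ((T + 2)\<^sup>2 - H\<^sup>2 * x)"
          by (rule flux_min_square[symmetric]) (use x in linarith)
        also have "\<dots> = (y - 1) * (M\<^sup>2 / y - T\<^sup>2)" unfolding H2 M2 by (rule D)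
        also have "\<dots> \<le> (M - T)\<^sup>2" by (rule flux_max_le) (use x xy in linarith)
        finally show ?thesis .
      qed
      have "(T + 2 - H)\<^sup>2 - (M - T)\<^sup>2 = 4 * (T + g) - 2 * (T + 2) * H + 2 * T * M"
      proof -
        have "(T + 2 - H)\<^sup>2 - (M - T)\<^sup>2 = (T + 2)\<^sup>2 - T\<^sup>2 + H\<^sup>2 - M\<^sup>2 - 2 * (T + 2) * H + 2 * T * M"
          by (simp add: power2_eq_square algebra_simps)
        also have "(T + 2)\<^sup>2 - T\<^sup>2 + H\<^sup>2 - M\<^sup>2 = 4 * (T + g)"
          unfolding H2 M2 by (simp add: power2_eq_square algebra_simps)
        finally show ?thesis .
      qed
      moreover have "H \<le> 4 * (T + g) - 2 * (T + 2) * H + 2 * T * M"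
      proof -
        have "2 - g \<le> M" unfolding M_def by (rule real_le_rsqrt) (use h in simp)
        then have a1: "2 * T * (2 - g) \<le> 2 * T * M" using g by (intro mult_left_mono) auto
        have "H\<^sup>2 \<le> 2 * g\<^sup>2" unfolding H2 using h by linarith
        \<comment> \<open>283/200 is a rational number just above the square root of 2.\<close>
        also have "\<dots> \<le> (283 / 200)\<^sup>2 * g\<^sup>2" by (intro mult_right_mono) (simp_all add: power2_eq_square)
        also have "\<dots> = (283 / 200 * g)\<^sup>2" by (simp only: power_mult_distrib)
        finally have Hg: "H \<le> 283 / 200 * g" by (rule power2_le_imp_le) (use g in simp)
        have a2: "2 * T * H \<le> 2 * T * (283 / 200 * g)" using Hg g by (intro mult_left_mono) auto
        have a3: "T * g \<le> T * 1" using g by (intro mult_left_mono) auto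
        have a4: "8 * T + 4 * g - 283 / 100 * (T * g) - 283 / 40 * g - 2 * (T * g) \<ge> 0"
          using a3 g by linarith
        have "2 * (T + 2) * H = 2 * T * H + 4 * H" "2 * T * (2 - g) = 4 * T - 2 * (T * g)"
          "2 * T * (283 / 200 * g) = 283 / 100 * (T * g)" by (simp_all add: algebra_simps)
        then show ?thesis using a1 a2 a4 Hg by simp
      qed
      ultimately have "H \<le> (T + 2 - z)\<^sup>2 / x" using D1 by (simp add: z_def)
      then have "z \<le> (T + 2 - z)\<^sup>2" using x by (simp add: z_def field_simps)
      moreover have "(z / 2)\<^sup>2 \<le> z" using z4 zpos by (simp add: power2_eq_square)
      ultimately have "(z / 2)\<^sup>2 \<le> (T + 2 - z)\<^sup>2" by linarith
      then show ?thesis by (rule power2_le_imp_le) (use zT in simp)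
    qed
    have "z\<^sup>2 \<le> (T + 2)\<^sup>2 - z\<^sup>2"
    proof -
      have "z / 2 * (2 * z) \<le> (T + 2 - z) * (T + 2 + z)"
        using Tz zT zpos by (intro mult_mono) auto
      then show ?thesis unfolding B by (simp add: power2_eq_square)
    qed
    then have "1 / 2 * z\<^sup>2 \<le> (r\<^sup>2 - 1) * ((T + 2)\<^sup>2 - z\<^sup>2)"
      using r2 by (intro mult_mono) auto
    then show ?thesis using Qz Ppos by linarith
  qed
  have strict: "M\<^sup>2 - T\<^sup>2 * x * x < r\<^sup>2 * ((T + 2)\<^sup>2 - H\<^sup>2 * x * x)"
    using main z2 unfolding P_def Q_def H2[symmetric] by (simp add: power2_eq_square algebra_simps)
  then show "(2 - g)\<^sup>2 + h - T\<^sup>2 * x * r ^ 3 < r\<^sup>2 * ((T + 2)\<^sup>2 - (g\<^sup>2 + h) * x * r ^ 3)"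
    by (simp add: H2 M2 r(3))
  define \<theta> where "\<theta> = (v ^ 3 - 1) / (x - 1)"
  have v3: "1 \<le> v ^ 3" "v ^ 3 \<le> x" using r power_mono[of v r 3] by auto
  have \<theta>: "0 \<le> \<theta>" "\<theta> \<le> 1" "\<theta> * (x - 1) = v ^ 3 - 1" using v3 x by (auto simp: \<theta>_def)
  have ch: "\<theta> * (r\<^sup>2 - 1) \<le> v\<^sup>2 - 1"
    using cube_chord[OF r(1,2) r1] r(3) by (simp add: \<theta>_def)
  have le: "H\<^sup>2 * x * v ^ 3 \<le> z\<^sup>2"
  proof -
    have "H\<^sup>2 * x * v ^ 3 \<le> H\<^sup>2 * x * x" using v3 x by (intro mult_left_mono) auto
    then show ?thesis unfolding z2 H2 by (simp add: power2_eq_square)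
  qed
  have Bz: "(T + 2)\<^sup>2 - z\<^sup>2 \<ge> 0" using Hp z2 by simp
  have v21: "v\<^sup>2 - 1 \<ge> 0" using r by (simp add: one_le_power)
  have "\<theta> * (r\<^sup>2 - 1) * ((T + 2)\<^sup>2 - z\<^sup>2) \<le> (v\<^sup>2 - 1) * ((T + 2)\<^sup>2 - H\<^sup>2 * x * v ^ 3)"
    by (rule mult_mono[OF ch]) (use le Bz v21 in auto)
  moreover have "P - Q * x * v ^ 3 = (1 - \<theta>) * (P - Q * x) + \<theta> * (P - Q * x\<^sup>2)"
  proof -
    have "v ^ 3 = 1 + \<theta> * (x - 1)" using \<theta>(3) by simp
    then show ?thesis by (simp only:) (simp add: power2_eq_square algebra_simps)
  qed
  moreover have "(1 - \<theta>) * (P - Q * x) \<ge> 0" using \<theta> PQ by simp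
  moreover have "\<theta> * ((r\<^sup>2 - 1) * ((T + 2)\<^sup>2 - z\<^sup>2) + (P - Q * x\<^sup>2)) \<ge> 0"
    using \<theta> main by simp
  ultimately have "0 \<le> (v\<^sup>2 - 1) * ((T + 2)\<^sup>2 - H\<^sup>2 * x * v ^ 3) + (P - Q * x * v ^ 3)"
    by (simp add: algebra_simps)
  then show "(2 - g)\<^sup>2 + h - T\<^sup>2 * x * v ^ 3 \<le> v\<^sup>2 * ((T + 2)\<^sup>2 - (g\<^sup>2 + h) * x * v ^ 3)"
    unfolding P_def Q_def H2 M2 by (simp add: algebra_simps)
qed

section \<open>Comparison of the length integrals of a dipping and a rising half\<close>

text \<open>Put w = x(1 - s^2) = v^3, so w \<ge> 1. The hypotheses compare the square roots in the
  two densities at the cost of a factor v, and w^\<nu> v \<le> w^(1-\<nu>) because \<nu> \<le> 1/3;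
  this is where the condition n \<ge> 3 enters. The rising density is then at least the dipping one,
  strictly at s = 0, and is integrated over an interval at least as long.\<close>

lemma kmin_exclusion:
  fixes x y \<nu> :: real
  assumes \<nu>: "\<nu> \<le> 1 / 3" and x: "x > 1" and xy: "x \<le> y"
    and p: "0 \<le> Hp" "Hp * x\<^sup>2 < Bp" and m: "0 \<le> Bm" "Bm * y\<^sup>2 < Hm"
    and eq: "integral {0..sqrt (1 - 1 / x)} (kmin \<nu> Bp Hp x) = integral {0..sqrt (1 - 1 / y)} (kmin (1 - \<nu>) Hm Bm y)"
    and le: "\<And>v. 1 \<le> v \<Longrightarrow> v ^ 3 \<le> x \<Longrightarrow> Hm - Bm * x * v ^ 3 \<le> v\<^sup>2 * (Bp - Hp * x * v ^ 3)"
    and less: "\<And>v. 1 \<le> v \<Longrightarrow> v ^ 3 = x \<Longrightarrow> Hm - Bm * x * v ^ 3 < v\<^sup>2 * (Bp - Hp * x * v ^ 3)"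
  shows False
proof -
  define S where "S = sqrt (1 - 1 / x)"
  define S' where "S' = sqrt (1 - 1 / y)"
  have y: "y > 1" using x xy by simp
  have SS: "0 < S" "S \<le> S'" using x xy by (auto simp: S_def S'_def frac_le)
  note c1 = kmin_cont(1)[OF x p, where \<nu>=\<nu>, folded S_def]
  note c2 = kmin_cont(1)[OF y m, where \<nu>="1 - \<nu>", folded S'_def] 
  note p2 = kmin_cont(2)[OF y m, where \<nu>="1 - \<nu>", folded S'_def]
  have pt: "kmin \<nu> Bp Hp x s \<le> kmin (1 - \<nu>) Hm Bm y s"
    "s = 0 \<Longrightarrow> kmin \<nu> Bp Hp x s < kmin (1 - \<nu>) Hm Bm y s" if s: "s \<in> {0..S}" for s
  proof -
    note r = sqrt_frac_range[OF x s[unfolded S_def]]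
    have s': "s \<in> {0..S'}" using s SS by auto
    note r' = sqrt_frac_range[OF y s'[unfolded S'_def]]
    define m1 where "m1 = 1 - s\<^sup>2"
    have m1: "m1 > 0" "m1 \<le> 1" "1 \<le> x * m1"
    proof -
      have "1 / x \<le> m1" using r by (simp add: m1_def)
      moreover have "0 < 1 / x" using x by simp
      ultimately show "m1 > 0" by linarith
      show "m1 \<le> 1" using r by (simp add: m1_def)
      show "1 \<le> x * m1" using \<open>1 / x \<le> m1\<close> x by (simp add: divide_le_eq mult.commute)
    qed
    define w where "w = x * m1"
    have w: "1 \<le> w" "w \<le> x" using m1 x by (auto simp: w_def mult_left_le)
    define v where "v = w powr (1 / 3)"
    have v3: "v ^ 3 = w" using w by (simp add: v_def powr_power)
    have v1: "1 \<le> v" using w by (simp add: v_def ge_one_powr_ge_zero)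
    have d1: "Bp - Hp * x * w > 0"
    proof -
      have "Hp * x * w \<le> Hp * x * x" using w p x by (intro mult_left_mono) auto
      then show ?thesis using p by (simp add: power2_eq_square)
    qed
    have d2: "Hm - Bm * y\<^sup>2 * m1 > 0"
    proof -
      have "Bm * y\<^sup>2 * m1 \<le> Bm * y\<^sup>2 * 1" using m1 m by (intro mult_left_mono) auto
      then show ?thesis using m by simp
    qed
    have xy2: "Bm * x * w \<le> Bm * y\<^sup>2 * m1"
    proof -
      have "x * x \<le> y * y" using x xy by (intro mult_mono) auto
      then have "Bm * (x * x) * m1 \<le> Bm * (y * y) * m1" using m m1 by (intro mult_right_mono mult_left_mono) auto
      then show ?thesis by (simp add: w_def power2_eq_square mult_ac)
    qed
    have vw: "w powr \<nu> * v \<le> (y * m1) powr (1 - \<nu>)"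
    proof -
      have "w powr \<nu> * v = w powr (\<nu> + 1 / 3)" by (simp add: v_def powr_add)
      also have "\<dots> \<le> w powr (1 - \<nu>)" using w \<nu> by (intro powr_mono) auto
      also have "\<dots> \<le> (y * m1) powr (1 - \<nu>)"
        using w \<nu> xy m1 by (intro powr_mono2) (auto simp: w_def)
      finally show ?thesis .
    qed
    define a where "a = sqrt (Bp - Hp * x * w)"
    define b where "b = sqrt (Hm - Bm * y\<^sup>2 * m1)"
    have ab: "a > 0" "b > 0" using d1 d2 by (auto simp: a_def b_def)
    have va: "v * a = sqrt (v\<^sup>2 * (Bp - Hp * x * w))" using v1 by (simp add: a_def real_sqrt_mult)
    have k1: "kmin \<nu> Bp Hp x s = 2 * w powr \<nu> / (m1 * a)"
      by (simp add: kmin_def a_def w_def m1_def power2_eq_square mult_ac)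
    have k2: "kmin (1 - \<nu>) Hm Bm y s = 2 * (y * m1) powr (1 - \<nu>) / (m1 * b)"
      by (simp add: kmin_def b_def m1_def)
    have wp: "w powr \<nu> > 0" using w by simp
    have "b \<le> v * a" unfolding va b_def
      using le[OF v1] xy2 w v3 by (intro real_sqrt_le_mono) auto
    then have "w powr \<nu> * b \<le> w powr \<nu> * (v * a)" using wp by simp
    also have "\<dots> = w powr \<nu> * v * a" by simp
    also have "\<dots> \<le> (y * m1) powr (1 - \<nu>) * a" using vw ab by (intro mult_right_mono) auto
    finally show "kmin \<nu> Bp Hp x s \<le> kmin (1 - \<nu>) Hm Bm y s"
      unfolding k1 k2 using m1 ab by (simp add: field_simps)
    show "kmin \<nu> Bp Hp x s < kmin (1 - \<nu>) Hm Bm y s" if "s = 0"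
    proof -
      have "w = x" using that by (simp add: w_def m1_def)
      have "b < v * a" unfolding va b_def
        using less[OF v1] xy2 v3 \<open>w = x\<close> by (intro real_sqrt_less_mono) auto
      then have "w powr \<nu> * b < w powr \<nu> * (v * a)" using wp by simp
      also have "\<dots> = w powr \<nu> * v * a" by simp
      also have "\<dots> \<le> (y * m1) powr (1 - \<nu>) * a" using vw ab by (intro mult_right_mono) auto
      finally show ?thesis unfolding k1 k2 using m1 ab by (simp add: field_simps)
    qed
  qed
  have c2': "continuous_on {0..S} (kmin (1 - \<nu>) Hm Bm y)" using c2 SS by (auto intro: continuous_on_subset)
  define f where "f s = kmin (1 - \<nu>) Hm Bm y s - kmin \<nu> Bp Hp x s" for s
  have i1: "kmin \<nu> Bp Hp x integrable_on {0..S}" "kmin (1 - \<nu>) Hm Bm y integrable_on {0..S}"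
    "kmin (1 - \<nu>) Hm Bm y integrable_on {0..S'}"
    using c1 c2 c2' by (auto intro: integrable_continuous_real)
  have cf: "continuous_on {0..S} f" unfolding f_def using c1 c2' by (intro continuous_intros)
  have "integral {0..S} f \<noteq> 0"
    using integral_eq_0_iff[OF cf SS(1)] pt SS by (force simp: f_def)
  moreover have "integral {0..S} f \<ge> 0"
    using pt cf by (intro Henstock_Kurzweil_Integration.integral_nonneg integrable_continuous_real) (auto simp: f_def)
  moreover have "integral {0..S} f = integral {0..S} (kmin (1 - \<nu>) Hm Bm y) - integral {0..S} (kmin \<nu> Bp Hp x)"
    unfolding f_def using i1 by (intro Henstock_Kurzweil_Integration.integral_diff)
  moreover have "integral {0..S} (kmin (1 - \<nu>) Hm Bm y) \<le> integral {0..S'} (kmin (1 - \<nu>) Hm Bm y)"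
    using SS i1 p2 by (intro integral_subset_le) (auto intro: less_imp_le)
  ultimately show False using eq unfolding S_def S'_def by linarith
qed

section \<open>Growth rates of the length integrals\<close>

text \<open>After cross-multiplication the product-to-sum formulas reduce the claim to monotonicity
  of cosh. It makes the quotient x / cosh^2 inside \<open>kminh\<close> nondecreasing in x.\<close>

lemma cosh_ratio_mono:
  fixes a b r :: real
  assumes "0 \<le> a" "a \<le> b" "0 \<le> r" "r \<le> 1"
  shows "cosh a / cosh (a * r) \<le> cosh b / cosh (b * r)"
proof -
  have prod: "2 * (cosh p * cosh s) = cosh (p + s) + cosh (p - s)" for p s :: real
    by (simp add: cosh_add cosh_diff)
  have le: "cosh p \<le> cosh s" if "\<bar>p\<bar> \<le> s" for p s :: real
    using that cosh_real_nonneg_le_iff[of "\<bar>p\<bar>" s] by simp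
  have "a * r \<le> a * 1" "b * r \<le> b * 1" using assms by (auto intro: mult_left_le)
  have "(b - a) * r \<le> (b - a) * 1" using assms by (intro mult_left_mono) auto
  then have 1: "a + b * r \<le> b + a * r" by (simp add: algebra_simps)
  have "a * (1 + r) \<le> b * (1 + r)" using assms by (intro mult_right_mono) auto
  then have 2: "\<bar>a - b * r\<bar> \<le> b - a * r" using 1 by (simp add: algebra_simps abs_le_iff)
     (use \<open>a * r \<le> a * 1\<close> \<open>b * r \<le> b * 1\<close> assms in linarith)
  have "0 \<le> a + b * r" using assms by simp
  then have "cosh (a + b * r) + cosh (a - b * r) \<le> cosh (b + a * r) + cosh (b - a * r)"
    using 1 2 by (intro add_mono le) auto
  then have "cosh a * cosh (b * r) \<le> cosh b * cosh (a * r)" using prod[of a "b * r"] prod[of b "a * r"] by linarith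
  then show ?thesis using cosh_real_pos[of "a * r"] cosh_real_pos[of "b * r"] by (simp add: field_simps)
qed

lemma Theta_mono:
  assumes "1 < x" "x \<le> y"
  shows "Theta x \<le> Theta y"
proof -
  have "(cosh (Theta x))\<^sup>2 \<le> (cosh (Theta y))\<^sup>2" using Theta_props(2)[of x] Theta_props(2)[of y] assms by simp
  then have "cosh (Theta x) \<le> cosh (Theta y)" by (rule power2_le_imp_le) simp
  then show ?thesis using cosh_real_nonneg_le_iff[of "Theta x" "Theta y"] Theta_props(1)[of x] Theta_props(1)[of y] assms by simp
qed

lemma kminh_cont:
  assumes x: "x > 1" and H: "0 \<le> H" "H * x\<^sup>2 < B"
  shows "continuous_on {0..1} (kminh \<nu> B H x)" "\<And>\<theta>. kminh \<nu> B H x \<theta> > 0"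
    "\<And>\<theta>. H * (x / cosh (Theta x * \<theta>))\<^sup>2 < B"
proof -
  show cp: "H * (x / cosh (Theta x * \<theta>))\<^sup>2 < B" for \<theta>
  proof -
    have "1 \<le> (cosh (Theta x * \<theta>))\<^sup>2" using cosh_real_ge_1[of "Theta x * \<theta>"] by simp
    then have "H * (x / cosh (Theta x * \<theta>))\<^sup>2 \<le> H * (x\<^sup>2 / 1)"
      unfolding power_divide using H by (intro mult_left_mono frac_le) auto
    then show ?thesis using H by simp
  qed
  show "continuous_on {0..1} (kminh \<nu> B H x)"
    unfolding kminh_def[abs_def] using x
    by (intro continuous_intros ballI) (auto, metis cp less_irrefl)
  show "kminh \<nu> B H x \<theta> > 0" for \<theta>
    unfolding kminh_def using cp[of \<theta>] Theta_props(1)[OF x] x by simp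
qed

text \<open>A larger x has a larger \<open>Theta\<close>, which lowers the factors 1 / cosh. As long
  as H x^2 does not increase, the integrand therefore grows at most like its prefactor Theta(x)
  x^\<nu>.\<close>

lemma kminh_ratio:
  assumes x: "1 < x" "x \<le> x'" and H: "0 \<le> H'" "H' * x'\<^sup>2 \<le> H * x\<^sup>2" "H * x\<^sup>2 < B" and \<nu>: "\<nu> > 0"
  shows "integral {0..1} (kminh \<nu> B H' x') \<le> Theta x' * x' powr \<nu> / (Theta x * x powr \<nu>) * integral {0..1} (kminh \<nu> B H x)"
proof -
  have x': "1 < x'" using x by simp
  have H0: "0 \<le> H" 
  proof -
    have "0 \<le> H' * x'\<^sup>2" using H by simp
    then have "0 \<le> H * x\<^sup>2" using H by linarith
    then show ?thesis using x by (simp add: zero_le_mult_iff)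
  qed
  define T where "T = Theta x"
  define T' where "T' = Theta x'"
  have T: "0 < T" "T \<le> T'" using Theta_props(1)[OF x(1)] Theta_mono[OF x] by (auto simp: T_def T'_def)
  have v: "H' * x'\<^sup>2 < B" using H by simp
  define c where "c = T' * x' powr \<nu> / (T * x powr \<nu>)"
  have c: "c > 0" using T x x' by (simp add: c_def)
  have "kminh \<nu> B H' x' r \<le> c * kminh \<nu> B H x r" if r: "r \<in> {0..1}" for r
  proof -
    have "T * r \<le> T' * r" using T r by (intro mult_right_mono) auto
    then have ch: "cosh (T * r) \<le> cosh (T' * r)" using T r by (subst cosh_real_nonneg_le_iff) auto
    have ch1: "1 \<le> cosh (T * r)" by (rule cosh_real_ge_1)
    have ch2: "(cosh (T * r))\<^sup>2 \<le> (cosh (T' * r))\<^sup>2" using ch ch1 by (intro power_mono) auto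
    have a: "x' / (cosh (T' * r))\<^sup>2 \<le> x' / (cosh (T * r))\<^sup>2"
      using ch2 ch1 x' by (intro divide_left_mono mult_pos_pos) (auto intro: less_le_trans[OF zero_less_one])
    have "H' * (x' / cosh (T' * r))\<^sup>2 \<le> H' * (x'\<^sup>2 / (cosh (T * r))\<^sup>2)"
      unfolding power_divide using ch2 ch1 x' H by (intro mult_left_mono divide_left_mono mult_pos_pos) (auto intro: less_le_trans[OF zero_less_one])
    also have "\<dots> = (H' * x'\<^sup>2) / (cosh (T * r))\<^sup>2" by simp
    also have "\<dots> \<le> (H * x\<^sup>2) / (cosh (T * r))\<^sup>2" using H by (intro divide_right_mono) auto
    finally have b: "H' * (x' / cosh (T' * r))\<^sup>2 \<le> H * (x / cosh (T * r))\<^sup>2" by (simp add: power_divide)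
    have bv: "H * (x / cosh (T * r))\<^sup>2 < B" using kminh_cont(3)[OF x(1) H0 H(3)] by (simp add: T_def)
    have "kminh \<nu> B H' x' r \<le> 2 * T' * (x' / (cosh (T * r))\<^sup>2) powr \<nu> / sqrt (B - H * (x / cosh (T * r))\<^sup>2)"
          proof -
      have n: "2 * T' * (x' / (cosh (T' * r))\<^sup>2) powr \<nu> \<le> 2 * T' * (x' / (cosh (T * r))\<^sup>2) powr \<nu>"
        by (intro mult_left_mono powr_mono2 a) (use T x' \<nu> in auto)
      have d: "sqrt (B - H * (x / cosh (T * r))\<^sup>2) \<le> sqrt (B - H' * (x' / cosh (T' * r))\<^sup>2)"
        using b by simp
      show ?thesis unfolding kminh_def T'_def[symmetric]
        by (rule frac_le[OF _ n _ d]) (use bv T x' in auto)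
    qed
    also have "\<dots> = c * kminh \<nu> B H x r"
      unfolding kminh_def T_def[symmetric] c_def using T x x' ch1 by (simp add: powr_divide field_simps)
    finally show ?thesis .
  qed
  then have "integral {0..1} (kminh \<nu> B H' x') \<le> integral {0..1} (\<lambda>r. c * kminh \<nu> B H x r)"
    using kminh_cont(1)[OF x' H(1) v] kminh_cont(1)[OF x(1) H0 H(3)]
    by (intro integral_le integrable_continuous_real continuous_intros) auto
  then show ?thesis by (simp add: c_def T_def T'_def)
qed

lemma kminh_mono:
  assumes x: "1 < x" "x \<le> x'" and H: "0 \<le> H" "H \<le> H'" "H' * x'\<^sup>2 < B" and \<nu>: "\<nu> > 0"
  shows "integral {0..1} (kminh \<nu> B H x) \<le> integral {0..1} (kminh \<nu> B H' x')"
proof -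
  have x': "1 < x'" using x by simp
  define T where "T = Theta x"
  define T' where "T' = Theta x'"
  have T: "0 < T" "T \<le> T'" using Theta_props(1)[OF x(1)] Theta_mono[OF x] by (auto simp: T_def T'_def)
  have Tx: "(cosh T)\<^sup>2 = x" "(cosh T')\<^sup>2 = x'" using Theta_props(2)[OF x(1)] Theta_props(2)[OF x'] by (auto simp: T_def T'_def)
  have "x\<^sup>2 \<le> x'\<^sup>2" using x by (intro power_mono) auto
  then have "H * x\<^sup>2 \<le> H' * x'\<^sup>2" using H by (intro mult_mono) auto
  then have v: "H * x\<^sup>2 < B" using H by simp
  have "kminh \<nu> B H x r \<le> kminh \<nu> B H' x' r" if r: "r \<in> {0..1}" for r
  proof -
    have ch: "cosh T / cosh (T * r) \<le> cosh T' / cosh (T' * r)"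
      by (rule cosh_ratio_mono) (use T r in auto)
    then have "(cosh T / cosh (T * r))\<^sup>2 \<le> (cosh T' / cosh (T' * r))\<^sup>2" by (intro power_mono) auto
    then have a: "x / (cosh (T * r))\<^sup>2 \<le> x' / (cosh (T' * r))\<^sup>2" by (simp add: power_divide Tx)
    then have "x * (x / (cosh (T * r))\<^sup>2) \<le> x' * (x' / (cosh (T' * r))\<^sup>2)" using x by (intro mult_mono) auto
    then have "(x / cosh (T * r))\<^sup>2 \<le> (x' / cosh (T' * r))\<^sup>2" by (simp add: power_divide power2_eq_square)
    then have b: "H * (x / cosh (T * r))\<^sup>2 \<le> H' * (x' / cosh (T' * r))\<^sup>2" using H by (intro mult_mono) auto
    have bv: "H' * (x' / cosh (T' * r))\<^sup>2 < B" using kminh_cont(3)[OF x' _ H(3)] H by (simp add: T'_def)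
    show ?thesis
    proof -
      have "(x / (cosh (T * r))\<^sup>2) powr \<nu> \<le> (x' / (cosh (T' * r))\<^sup>2) powr \<nu>"
        by (rule powr_mono2) (use a x \<nu> in auto)
      then have n: "2 * T * (x / (cosh (T * r))\<^sup>2) powr \<nu> \<le> 2 * T' * (x' / (cosh (T' * r))\<^sup>2) powr \<nu>"
        using T by (intro mult_mono) auto
      have d: "sqrt (B - H' * (x' / cosh (T' * r))\<^sup>2) \<le> sqrt (B - H * (x / cosh (T * r))\<^sup>2)"
        using b by simp
      show ?thesis unfolding kminh_def T_def[symmetric] T'_def[symmetric]
        by (rule frac_le[OF _ n _ d]) (use bv T x in auto)
    qed
  qed
  then show ?thesis
    using kminh_cont(1)[OF x(1) H(1) v] kminh_cont(1)[OF x' _ H(3)] H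
    by (intro integral_le integrable_continuous_real) auto
qed

text \<open>Once the prefactor y^(1-\<nu>) sqrt(1 - 1/y) is split off, both remaining factors sit in
  the denominator, and neither increases: 1 - s^2 shrinks, and y^2 (1 - s^2) grows under the
  root.\<close>

lemma kmax_ratio:
  assumes y: "1 < y" "y \<le> y'" and H: "0 \<le> B" "B * y'\<^sup>2 < H'" "H' \<le> H" and \<nu>: "0 < \<nu>" "\<nu> < 1"
  shows "y' powr (1 - \<nu>) * sqrt (1 - 1 / y') / (y powr (1 - \<nu>) * sqrt (1 - 1 / y))
      * integral {0..1} (\<lambda>s. sqrt (1 - 1 / y) * kmin (1 - \<nu>) H B y (sqrt (1 - 1 / y) * s))
    \<le> integral {0..1} (\<lambda>s. sqrt (1 - 1 / y') * kmin (1 - \<nu>) H' B y' (sqrt (1 - 1 / y') * s))"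
proof -
  have y': "1 < y'" using y by simp
  define b where "b = sqrt (1 - 1 / y)"
  define b' where "b' = sqrt (1 - 1 / y')"
  have b: "0 < b" "b \<le> b'" "b < 1" "b' < 1" using y by (auto simp: b_def b'_def frac_le)
  have b2: "b\<^sup>2 = 1 - 1 / y" "b'\<^sup>2 = 1 - 1 / y'" using y by (auto simp: b_def b'_def)
  define c where "c = y' powr (1 - \<nu>) * b' / (y powr (1 - \<nu>) * b)"
  have "y\<^sup>2 \<le> y'\<^sup>2" using y by (intro power_mono) auto
  then have "B * y\<^sup>2 \<le> B * y'\<^sup>2" using H by (intro mult_left_mono) auto
  then have v: "B * y\<^sup>2 < H" using H by simp
  have cont: "continuous_on {0..1} (\<lambda>s. p * kmin (1 - \<nu>) h B z (p * s))" if "1 < z" "B * z\<^sup>2 < h" "p = sqrt (1 - 1 / z)" for z h p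
  proof (intro continuous_intros continuous_on_compose2[OF kmin_cont(1)[OF that(1) H(1) that(2)]])
    have "p \<ge> 0" using that by simp
    then have "p * s \<le> p" if "s \<le> 1" for s using that by (intro mult_left_le)
    then show "(*) p ` {0..1} \<subseteq> {0..sqrt (1 - 1 / z)}" using that(3) \<open>p \<ge> 0\<close> by auto
  qed
  have "c * (b * kmin (1 - \<nu>) H B y (b * s)) \<le> b' * kmin (1 - \<nu>) H' B y' (b' * s)" if s: "s \<in> {0..1}" for s
  proof -
    define m where "m = 1 - (b * s)\<^sup>2"
    define m' where "m' = 1 - (b' * s)\<^sup>2"
    have "(b * s)\<^sup>2 \<le> (b' * s)\<^sup>2" using b s by (intro power_mono mult_right_mono) auto
    then have mm: "m' \<le> m" by (simp add: m_def m'_def)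
    have "(b' * s)\<^sup>2 \<le> b'\<^sup>2 * 1" unfolding power_mult_distrib using s by (intro mult_left_mono) (auto simp: abs_square_le_1)
    then have m0: "m' \<ge> 1 / y'" by (simp add: m'_def b2)
    moreover have "1 / y' > 0" using y' by simp
    ultimately have m'pos: "m' > 0" by linarith
    have m1: "m' \<le> 1" by (simp add: m'_def)
    have ym: "z\<^sup>2 * (1 - ((1 - 1 / z) * s\<^sup>2)) = z * (z * (1 - s\<^sup>2) + s\<^sup>2)" if "z > 1" for z
      using that by (simp add: field_simps power2_eq_square)
    have s2: "s\<^sup>2 \<le> 1" using s by (simp add: abs_square_le_1)
    have "y\<^sup>2 * m = y * (y * (1 - s\<^sup>2) + s\<^sup>2)" using ym[OF y(1)] by (simp add: m_def power_mult_distrib b2)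
    also have "\<dots> \<le> y' * (y' * (1 - s\<^sup>2) + s\<^sup>2)" using y s2 by (intro mult_mono add_mono) auto
    also have "\<dots> = y'\<^sup>2 * m'" using ym[OF y'] by (simp add: m'_def power_mult_distrib b2)
    finally have "B * (y\<^sup>2 * m) \<le> B * (y'\<^sup>2 * m')" using H by (intro mult_left_mono)
    then have den: "H' - B * y'\<^sup>2 * m' \<le> H - B * y\<^sup>2 * m" using H by (simp add: mult.assoc)
    have dpos: "H' - B * y'\<^sup>2 * m' > 0"
    proof -
      have "B * y'\<^sup>2 * m' \<le> B * y'\<^sup>2 * 1" using m1 H by (intro mult_left_mono) auto
      then show ?thesis using H by simp
    qed
    have form: "p * kmin (1 - \<nu>) h B z (p * s) = 2 * p * z powr (1 - \<nu>) / (k powr \<nu> * sqrt (h - B * z\<^sup>2 * k))"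
      if "k = 1 - (p * s)\<^sup>2" "k > 0" "z > 0" for p h z k
    proof -
      have "(z * k) powr (1 - \<nu>) = z powr (1 - \<nu>) * (k / k powr \<nu>)"
        using that by (simp add: powr_mult powr_diff)
      then show ?thesis unfolding kmin_def that(1)[symmetric] using that(2) by simp
    qed
    have "c * (b * kmin (1 - \<nu>) H B y (b * s)) = 2 * b' * y' powr (1 - \<nu>) / (m powr \<nu> * sqrt (H - B * y\<^sup>2 * m))"
      using form[OF m_def] mm m'pos y b unfolding c_def by simp
    also have "\<dots> \<le> 2 * b' * y' powr (1 - \<nu>) / (m' powr \<nu> * sqrt (H' - B * y'\<^sup>2 * m'))"
      using mm m'pos den dpos b \<nu> by (intro divide_left_mono mult_mono mult_pos_pos powr_mono2) auto
    also have "\<dots> = b' * kmin (1 - \<nu>) H' B y' (b' * s)" using form[OF m'_def] m'pos y' by simp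
    finally show ?thesis .
  qed
  then have "integral {0..1} (\<lambda>s. c * (b * kmin (1 - \<nu>) H B y (b * s))) \<le> integral {0..1} (\<lambda>s. b' * kmin (1 - \<nu>) H' B y' (b' * s))"
    using continuous_on_mult_left[OF cont[OF y(1) v b_def], of c] cont[OF y' H(2) b'_def]
    by (intro integral_le integrable_continuous_real) auto
  then show ?thesis
    by (simp only: Henstock_Kurzweil_Integration.integral_mult_right c_def b_def b'_def)
qed

text \<open>This is 3 sinh w \<le> w (2 + cosh w) at w = 2x, obtained by integrating three times
  from w sinh w \<ge> 0.\<close>

lemma sinh_cosh_le:
  fixes x :: real
  assumes "x \<ge> 0"
  shows "sinh x * cosh x \<le> x * (1 + 2 / 3 * (sinh x)\<^sup>2)"
proof -
  have mono: "f 0 \<le> f z" if "z \<ge> 0" "\<And>w. w \<ge> 0 \<Longrightarrow> (f has_real_derivative f' w) (at w)" "\<And>w. w \<ge> 0 \<Longrightarrow> 0 \<le> f' w"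
    for f f' :: "real \<Rightarrow> real" and z
    using that DERIV_nonneg_imp_nondecreasing[of 0 z f] by blast
  have 1: "0 \<le> w * cosh w - sinh w" if "w \<ge> 0" for w :: real
  proof -
    have "0 * cosh 0 - sinh (0 :: real) \<le> w * cosh w - sinh w"
      by (rule mono[where f="\<lambda>w. w * cosh w - sinh w" and f'="\<lambda>w. w * sinh w"])
        (use that in \<open>auto intro!: derivative_eq_intros\<close>)
    then show ?thesis by simp
  qed
  have 2: "0 \<le> 2 - 2 * cosh w + w * sinh w" if "w \<ge> 0" for w :: real
  proof -
    have "2 - 2 * cosh 0 + 0 * sinh (0 :: real) \<le> 2 - 2 * cosh w + w * sinh w"
      by (rule mono[where f="\<lambda>w. 2 - 2 * cosh w + w * sinh w" and f'="\<lambda>w. w * cosh w - sinh w"])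
        (rule that, (auto intro!: derivative_eq_intros simp: algebra_simps)[1], rule 1)
    then show ?thesis by simp
  qed
  have 3: "0 \<le> w * (2 + cosh w) - 3 * sinh w" if "w \<ge> 0" for w :: real
  proof -
    have "0 * (2 + cosh 0) - 3 * sinh (0 :: real) \<le> w * (2 + cosh w) - 3 * sinh w"
      by (rule mono[where f="\<lambda>w. w * (2 + cosh w) - 3 * sinh w" and f'="\<lambda>w. 2 - 2 * cosh w + w * sinh w"])
        (rule that, (auto intro!: derivative_eq_intros simp: algebra_simps)[1], rule 2)
    then show ?thesis by simp
  qed
  have "cosh (2 * x) = 1 + 2 * (sinh x)\<^sup>2"
    using cosh_double[of x] cosh_square_eq[of x] by linarith
  then have "3 * (2 * sinh x * cosh x) \<le> 2 * x * (2 + (1 + 2 * (sinh x)\<^sup>2))"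
    using 3[of "2 * x"] assms sinh_double[of x] by simp
  also have "\<dots> = 6 * (x * (1 + 2 / 3 * (sinh x)\<^sup>2))" by (simp add: algebra_simps)
  finally show ?thesis by simp
qed

lemma Theta_deriv:
  assumes "x > 1"
  shows "(Theta has_real_derivative 1 / (2 * x * sqrt (1 - 1 / x))) (at x)"
proof -
  have s: "sqrt (1 - 1 / x) < 1" "-1 < sqrt (1 - 1 / x)" "0 < sqrt (1 - 1 / x)"
  proof -
    show "sqrt (1 - 1 / x) < 1" "0 < sqrt (1 - 1 / x)" using assms by auto
    then show "-1 < sqrt (1 - 1 / x)" by linarith
  qed
  have ds: "((\<lambda>x. sqrt (1 - 1 / x)) has_real_derivative (1 / x\<^sup>2) * (inverse (sqrt (1 - 1 / x)) / 2)) (at x)"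
    using assms by (auto intro!: derivative_eq_intros simp: power2_eq_square field_simps)
  have da: "(artanh has_real_derivative 1 / (1 - (sqrt (1 - 1 / x))\<^sup>2)) (at (sqrt (1 - 1 / x)))"
    by (rule artanh_real_has_field_derivative) (use s in auto)
  have "((\<lambda>x. artanh (sqrt (1 - 1 / x))) has_real_derivative
      1 / (1 - (sqrt (1 - 1 / x))\<^sup>2) * ((1 / x\<^sup>2) * (inverse (sqrt (1 - 1 / x)) / 2))) (at x)"
    by (rule DERIV_chain2[OF da ds])
  moreover have "1 / (1 - (sqrt (1 - 1 / x))\<^sup>2) * ((1 / x\<^sup>2) * (inverse (sqrt (1 - 1 / x)) / 2)) = 1 / (2 * x * sqrt (1 - 1 / x))"
    using assms s(3) by (simp add: power2_eq_square field_simps)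
  ultimately show ?thesis unfolding Theta_def[abs_def] by simp
qed

text \<open>The left side is x Theta'(x) / Theta(x). At the angle T = Theta(x) it equals sinh T cosh
  T / (2 T sinh^2 T), with sinh^2 T = x - 1.\<close>

lemma Theta_log_deriv_le:
  assumes "x > 1"
  shows "1 / (2 * sqrt (1 - 1 / x) * Theta x) \<le> 1 / 2 * (1 / (x - 1) + 2 / 3)"
proof -
  define T where "T = Theta x"
  have T: "T > 0" "(cosh T)\<^sup>2 = x" using Theta_props[OF assms] by (auto simp: T_def)
  have sh: "(sinh T)\<^sup>2 = x - 1" using T(2) by (simp add: cosh_square_eq)
  have shp: "sinh T > 0" using T by simp
  have "sqrt (1 - 1 / x) = tanh T"
  proof -
    have s: "sqrt (1 - 1 / x) < 1" "0 \<le> sqrt (1 - 1 / x)" using assms by auto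
    then have "-1 < sqrt (1 - 1 / x)" by linarith
    then show ?thesis unfolding T_def Theta_def using s by (intro tanh_artanh[symmetric])
  qed
  then have "1 / (2 * sqrt (1 - 1 / x) * T) = 1 / (2 * tanh T * T)" by (simp only:)
  also have "\<dots> = sinh T * cosh T / (2 * (sinh T)\<^sup>2 * T)"
    using shp by (simp add: tanh_def power2_eq_square field_simps)
  also have "\<dots> \<le> T * (1 + 2 / 3 * (sinh T)\<^sup>2) / (2 * (sinh T)\<^sup>2 * T)"
    using sinh_cosh_le[of T] T shp by (intro divide_right_mono) auto
  also have "\<dots> = (1 + 2 / 3 * (x - 1)) / (2 * (x - 1))" using T sh by simp
  also have "\<dots> = 1 / 2 * (1 / (x - 1) + 2 / 3)" using assms by (simp add: field_simps)
  finally show ?thesis by (simp add: T_def)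
qed

lemma deriv_pos_local:
  fixes f :: "real \<Rightarrow> real"
  assumes "(f has_real_derivative d) (at a)" "d > 0"
  shows "\<forall>\<^sub>F z in nhds a. (a < z \<longrightarrow> f a < f z) \<and> (z < a \<longrightarrow> f z < f a)"
proof -
  obtain d1 where d1: "d1 > 0" "\<And>h. 0 < h \<Longrightarrow> h < d1 \<Longrightarrow> f a < f (a + h)"
    using DERIV_pos_inc_right[OF assms] by blast
  obtain d2 where d2: "d2 > 0" "\<And>h. 0 < h \<Longrightarrow> h < d2 \<Longrightarrow> f (a - h) < f a"
    using DERIV_pos_inc_left[OF assms] by blast
  show ?thesis unfolding eventually_nhds_metric
  proof (intro exI[of _ "min d1 d2"] conjI allI impI)
    show "min d1 d2 > 0" using d1 d2 by simp
    fix z assume z: "dist z a < min d1 d2"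
    show "f a < f z" if "a < z" using d1(2)[of "z - a"] z that by (simp add: dist_real_def)
    show "f z < f a" if "z < a" using d2(2)[of "a - z"] z that by (simp add: dist_real_def)
  qed
qed

text \<open>The exponents define the barrier curves x \<beta>^\<rho> and y \<beta>^\<sigma> used in
  \<open>crossing\<close>. To first order, \<rho> must make the bound for the dipping integral grow
  more slowly than \<beta>^\<nu>, \<sigma> must make the bound for the rising integral grow faster,
  (Gp + h) x^2 must decrease, and the flux difference must still increase. The rational
  \<open>mx\<close> and \<open>my\<close> are the reciprocals of \<open>ku\<close> and
  \<open>kv\<close> at \<nu> = 1/3, the worst case.\<close>

lemma exponents_exist:
  fixes x y h Bp Gp Bm Gm \<nu> :: real
  assumes \<nu>: "0 < \<nu>" "\<nu> \<le> 1 / 3" and x: "x > 1" and y: "y > 1" and h: "h > 0" and G: "Gp \<ge> 0"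
    and Hp: "(Gp + h) * x\<^sup>2 < Bp" and Hm: "Bm * y\<^sup>2 < Gm + h" and Bm: "Bm \<ge> 0"
    and alt: "Gm \<le> Bm \<or> (Gp \<le> h \<and> 0 < (Bp / x - (Gp + h) * x) * (6 * (x - 1) / (4 * x - 1)) + 6 * h * (x - 1 / y)
     - ((Gm + h) / y - Bm * y) * (6 * (y - 1) / (4 * y - 1)))"
  obtains \<rho> \<sigma> where "\<rho> \<ge> 0" "\<sigma> \<ge> 0" "\<rho> * (1 / (2 * sqrt (1 - 1 / x) * Theta x) + \<nu>) < \<nu>" "\<rho> * (Gp + h) < h"
    "\<nu> < \<sigma> * (1 / (2 * (y - 1)) + (1 - \<nu>))"
    "0 < (Bp / x - (Gp + h) * x) * \<rho> + 2 * h * (x - 1 / y) - ((Gm + h) / y - Bm * y) * \<sigma>"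
proof -
  define ku where "ku = 1 / 2 * (1 / (x - 1) + 2 / 3) + \<nu>"
  define kv where "kv = 1 / (2 * (y - 1)) + (1 - \<nu>)"
  define a where "a = Bp / x - (Gp + h) * x"
  define d where "d = (Gm + h) / y - Bm * y"
  define mx where "mx = 6 * (x - 1) / (4 * x - 1)"
  define my where "my = 6 * (y - 1) / (4 * y - 1)"
  have a: "a > 0" using Hp x by (simp add: a_def power2_eq_square field_simps)
  have d: "d > 0" using Hm y by (simp add: d_def power2_eq_square field_simps)
  have ku: "ku > 1 / 3 + \<nu>" using x by (simp add: ku_def)
  have ku0: "ku > 0" using ku \<nu> by linarith
  have kv0: "kv > 0" using y \<nu> by (simp add: kv_def add_pos_pos)
  have Lu: "1 / (2 * sqrt (1 - 1 / x) * Theta x) + \<nu> \<le> ku"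
    using Theta_log_deriv_le[OF x] by (simp add: ku_def)
  have m: "mx > 0" "my > 0" using x y by (auto simp: mx_def my_def)
  have "ku \<le> 1 / mx"
  proof -
    have e: "1 / mx = 1 / 2 * (1 / (x - 1) + 4 / 3)" unfolding mx_def using x by (simp add: field_simps)
    show ?thesis unfolding e ku_def using \<nu> by argo
  qed
  then have r0: "\<nu> * mx \<le> \<nu> / ku" using m ku0 \<nu> by (simp add: field_simps)
  have "1 / my \<le> kv"
  proof -
    have e: "1 / my = 1 / (2 * (y - 1)) + 2 / 3" unfolding my_def using y by (simp add: field_simps)
    show ?thesis unfolding e kv_def using \<nu> by argo
  qed
  then have s0: "\<nu> / kv \<le> \<nu> * my" using m kv0 \<nu> by (simp add: field_simps)
  have y1: "1 / y < 1" using y by simp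
  have xy: "x - 1 / y > 0" using x y1 by linarith
  \<comment> \<open>In the first alternative r = 0 works, because the explicit \<beta>-dependence of
    h alone outweighs the loss from \<sigma>. In the second the extremal value \<nu> / ku is
    needed.\<close>
  obtain r where r: "r \<ge> 0" "r \<le> \<nu> / ku" "r * (Gp + h) < h" "0 < a * r + 2 * h * (x - 1 / y) - d * (\<nu> / kv)"
  proof -
    from alt show thesis
    proof (elim disjE conjE)
      assume GB: "Gm \<le> Bm"
      have "d \<le> h / y"
      proof -
        have "Bm * 1 \<le> Bm * (y * y)" using y Bm by (intro mult_left_mono) (auto simp: less_1_mult less_imp_le)
        then have "(Gm + h) - Bm * (y * y) \<le> h" using GB by simp
        then have "((Gm + h) - Bm * (y * y)) / y \<le> h / y" using y by (intro divide_right_mono) auto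
        then show ?thesis using y by (simp add: d_def diff_divide_distrib)
      qed
      then have "d * (\<nu> / kv) \<le> h / y * (1 / 3 * my)"
        using s0 \<nu> kv0 m h y d by (intro mult_mono order_trans[OF s0] mult_right_mono) auto
      also have "1 / 3 * my < 2 * (y - 1)"
      proof -
        have "2 * (y - 1) * 1 < 2 * (y - 1) * (4 * y - 1)" using y by (intro mult_strict_left_mono) auto
        then have "2 * (y - 1) * 1 / (4 * y - 1) < 2 * (y - 1) * (4 * y - 1) / (4 * y - 1)"
          using y by (intro divide_strict_right_mono) auto
        moreover have "1 / 3 * my = 2 * (y - 1) * 1 / (4 * y - 1)" using y by (simp add: my_def field_simps)
        moreover have "2 * (y - 1) * (4 * y - 1) / (4 * y - 1) = 2 * (y - 1)" using y by simp
        ultimately show ?thesis by argo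
      qed
      then have "h / y * (1 / 3 * my) < h / y * (2 * (y - 1))" using h y by (intro mult_strict_left_mono) auto
      also have "\<dots> = 2 * h * (1 - 1 / y)" using y by (simp add: field_simps)
      also have "\<dots> \<le> 2 * h * (x - 1 / y)" using h x by (intro mult_left_mono) auto
      finally have "0 < a * 0 + 2 * h * (x - 1 / y) - d * (\<nu> / kv)" by simp
      then show thesis using that[of 0] \<nu> ku0 h by simp
    next
      assume gh: "Gp \<le> h" and S: "0 < (Bp / x - (Gp + h) * x) * (6 * (x - 1) / (4 * x - 1)) + 6 * h * (x - 1 / y)
     - ((Gm + h) / y - Bm * y) * (6 * (y - 1) / (4 * y - 1))"
      have "\<nu> * 2 < ku" using ku \<nu> by linarith
      then have "\<nu> / ku < 1 / 2" using ku0 by (simp add: field_simps)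
      moreover have "Gp + h > 0" using G h by simp
      ultimately have "\<nu> / ku * (Gp + h) < 1 / 2 * (Gp + h)" by (intro mult_strict_right_mono)
      also have "\<dots> \<le> h" using gh by simp
      finally have 1: "\<nu> / ku * (Gp + h) < h" .
      have "0 < \<nu> * (a * mx + 6 * h * (x - 1 / y) - d * my)" using S \<nu> by (simp add: a_def d_def mx_def my_def)
      also have "\<dots> = a * (\<nu> * mx) + (6 * \<nu>) * (h * (x - 1 / y)) - d * (\<nu> * my)" by (simp add: algebra_simps)
      also have "\<dots> \<le> a * (\<nu> / ku) + 2 * (h * (x - 1 / y)) - d * (\<nu> / kv)"
        using r0 s0 a d h xy \<nu> by (intro diff_mono add_mono mult_left_mono mult_right_mono) auto
      finally show thesis using that[of "\<nu> / ku"] 1 \<nu> ku0 by (simp add: mult.assoc)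
    qed
  qed
  define S where "S = a * r + 2 * h * (x - 1 / y) - d * (\<nu> / kv)"
  \<comment> \<open>Half of the surplus \<open>S\<close> is spent on moving both exponents off their
    extremal values, which makes all inequalities strict.\<close>
  define \<epsilon> where "\<epsilon> = S / (2 * (a + d))"
  have \<epsilon>: "\<epsilon> > 0" using r(4) a d by (simp add: \<epsilon>_def S_def)
  have "a + d \<noteq> 0" using a d by linarith
  then have \<epsilon>2: "\<epsilon> * (a + d) = S / 2" by (simp add: \<epsilon>_def field_simps)
  define \<rho> where "\<rho> = max 0 (r - \<epsilon>)"
  define \<sigma> where "\<sigma> = \<nu> / kv + \<epsilon>"
  have \<rho>r: "r - \<epsilon> \<le> \<rho>" "\<rho> \<le> r" "0 \<le> \<rho>" "r > 0 \<Longrightarrow> \<rho> < r" using \<epsilon> r by (auto simp: \<rho>_def)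
  show thesis
  proof (rule that[of \<rho> \<sigma>])
    show "\<rho> \<ge> 0" by fact
    show "\<sigma> \<ge> 0" using \<nu> kv0 \<epsilon> by (simp add: \<sigma>_def)
    have "\<rho> * ku < \<nu>"
    proof (cases "r = 0")
      case True
      then have "\<rho> = 0" using \<rho>r by linarith
      then show ?thesis using \<nu> by simp
    next
      case False
      then have "\<rho> < \<nu> / ku" using \<rho>r r by auto
      then show ?thesis using ku0 by (simp add: field_simps)
    qed
    moreover have "\<rho> * (1 / (2 * sqrt (1 - 1 / x) * Theta x) + \<nu>) \<le> \<rho> * ku" using Lu \<rho>r by (intro mult_left_mono) auto
    ultimately show "\<rho> * (1 / (2 * sqrt (1 - 1 / x) * Theta x) + \<nu>) < \<nu>" by linarith
    have "\<rho> * (Gp + h) \<le> r * (Gp + h)" using \<rho>r G h by (intro mult_right_mono) auto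
    then show "\<rho> * (Gp + h) < h" using r by linarith
    show "\<nu> < \<sigma> * (1 / (2 * (y - 1)) + (1 - \<nu>))"
      using kv0 \<epsilon> unfolding kv_def[symmetric] \<sigma>_def by (simp add: distrib_right)
    have "a * (r - \<epsilon>) \<le> a * \<rho>" using \<rho>r a by (intro mult_left_mono) auto
    then have "S - \<epsilon> * (a + d) \<le> a * \<rho> + 2 * h * (x - 1 / y) - d * \<sigma>"
      unfolding S_def \<sigma>_def by (simp add: algebra_simps)
    then show "0 < (Bp / x - (Gp + h) * x) * \<rho> + 2 * h * (x - 1 / y) - ((Gm + h) / y - Bm * y) * \<sigma>"
      unfolding a_def[symmetric] d_def[symmetric] using \<epsilon>2 r(4)[folded S_def] by linarith
  qed
qed

lemma less_iff_square_less:
  fixes x y :: real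
  assumes "0 \<le> x" "0 \<le> y"
  shows "x < y \<longleftrightarrow> x\<^sup>2 < y\<^sup>2"
  using power_mono_iff[of y x 2] assms by (simp add: not_le[symmetric])

section \<open>The matching function for \<mu> = 0 and t > 2 + \<gamma>\<close>

text \<open>Here \<nu> stands for 1/n, so that q = 2n/(n-2), and \<open>e\<close> for 2 \<eta>^2 /
  \<kappa>. With \<mu> = 0 the flux contributions to the coefficients \<open>A\<close> scale like
  b^2, so after division by b^2 only the term \<open>hr b\<close> still depends on
  \<open>b\<close>.\<close>

locale circle_flux =
  fixes q l \<nu> t \<gamma> e :: real
  assumes q: "q > 2" and l: "l > 0" and \<nu>: "1 / q = 1 / 2 - \<nu>" "0 < \<nu>" "\<nu> \<le> 1 / 3"
    and t: "t > 2 + \<gamma>" and \<gamma>: "-1 < \<gamma>" "\<gamma> < 1" and e: "e \<ge> 0"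
begin

definition "Bp = (t + 1)\<^sup>2"
definition "Bm = (t - 1)\<^sup>2"
definition "Gp = (1 + \<gamma>)\<^sup>2"
definition "Gm = (1 - \<gamma>)\<^sup>2"
definition "sp b = slope q l Bp (e + b\<^sup>2 * Gp) b"
definition "sm b = slope q l Bm (e + b\<^sup>2 * Gm) b"
definition "net b = sp b + sm b"
definition "xr b = b / cmid q l Bp (e + b\<^sup>2 * Gp) b"
definition "yr b = cmid q l Bm (e + b\<^sup>2 * Gm) b / b"
definition "hr b = e / b\<^sup>2"
definition "minside b \<longleftrightarrow> Gp + hr b < Bp"
definition "maxside b \<longleftrightarrow> Bm < Gm + hr b"

lemma pos: "Bp > 0" "Bm > 0" "Gp > 0" "Gm > 0" "t > 1"
  using t \<gamma> by (auto simp: Bp_def Bm_def Gp_def Gm_def)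

lemma A_nonneg: "e + b\<^sup>2 * Gp \<ge> 0" "e + b\<^sup>2 * Gm \<ge> 0"
  using e by (auto simp: Gp_def Gm_def)

lemma A_eq:
  assumes "b > 0"
  shows "(e + b\<^sup>2 * Gp) / b\<^sup>2 = Gp + hr b" "(e + b\<^sup>2 * Gm) / b\<^sup>2 = Gm + hr b"
    "e + b\<^sup>2 * Gp = b\<^sup>2 * (Gp + hr b)" "e + b\<^sup>2 * Gm = b\<^sup>2 * (Gm + hr b)"
  using assms by (auto simp: hr_def field_simps)

lemma side_iff:
  assumes "b > 0"
  shows "minside b \<longleftrightarrow> e + b\<^sup>2 * Gp < Bp * b\<^sup>2" "maxside b \<longleftrightarrow> Bm * b\<^sup>2 < e + b\<^sup>2 * Gm"
  unfolding minside_def maxside_def A_eq[OF assms] using assms by (auto simp: mult.commute)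

lemma min_facts:
  assumes b: "b > 0" and m: "minside b"
  shows "1 < xr b" "(Gp + hr b) * (xr b)\<^sup>2 < Bp" "sp b < 0"
    "(q * sp b)\<^sup>2 = b * ((1 - 1 / xr b) * (Bp - (Gp + hr b) * xr b))"
    "integral {0..sqrt (1 - 1 / xr b)} (kmin \<nu> Bp (Gp + hr b) (xr b)) = l * b powr \<nu>"
    "integral {0..1} (kminh \<nu> Bp (Gp + hr b) (xr b)) = l * b powr \<nu>"
proof -
  have A: "e + b\<^sup>2 * Gp < Bp * b\<^sup>2" using m side_iff[OF b] by simp
  note s = slope_min[OF q pos(1) A_nonneg(1) l b A]
  define c where "c = cmid q l Bp (e + b\<^sup>2 * Gp) b"
  have c: "0 < c" "c < b" using cmid_pos[OF q pos(1) A_nonneg(1) l b] s(1) by (auto simp: c_def)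
  show "1 < xr b" using c by (simp add: xr_def c_def[symmetric])
  show "sp b < 0" using s(3) by (simp add: sp_def)
  have x: "xr b = b / c" by (simp add: xr_def c_def)
  have "b\<^sup>2 * (Gp + hr b) < Bp * c\<^sup>2" using s(2) A_eq(3)[OF b] by (simp add: c_def)
  then show "(Gp + hr b) * (xr b)\<^sup>2 < Bp" using c b by (simp add: x power_divide field_simps)
  have "(e + b\<^sup>2 * Gp) / (b * c) = (Gp + hr b) * xr b"
    unfolding A_eq(3)[OF b] x using b c by (simp add: power2_eq_square field_simps)
  moreover have "b * (1 - 1 / xr b) = b - c" using b c by (simp add: x right_diff_distrib)
  ultimately show "(q * sp b)\<^sup>2 = b * ((1 - 1 / xr b) * (Bp - (Gp + hr b) * xr b))"
    using s(4) by (simp add: sp_def c_def[symmetric] mult.assoc[symmetric])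
  show "integral {0..sqrt (1 - 1 / xr b)} (kmin \<nu> Bp (Gp + hr b) (xr b)) = l * b powr \<nu>"
    "integral {0..1} (kminh \<nu> Bp (Gp + hr b) (xr b)) = l * b powr \<nu>"
    using time_min[OF q pos(1) A_nonneg(1) l b A \<nu>(1) xr_def A_eq(1)[OF b, symmetric]] by auto
qed

lemma max_facts:
  assumes b: "b > 0" and m: "maxside b"
  shows "1 < yr b" "Bm * (yr b)\<^sup>2 < Gm + hr b" "sm b > 0"
    "(q * sm b)\<^sup>2 = b * ((yr b - 1) * ((Gm + hr b) / yr b - Bm))"
    "integral {0..sqrt (1 - 1 / yr b)} (kmin (1 - \<nu>) (Gm + hr b) Bm (yr b)) = l * b powr \<nu>"
    "integral {0..1} (\<lambda>s. sqrt (1 - 1 / yr b) * kmin (1 - \<nu>) (Gm + hr b) Bm (yr b) (sqrt (1 - 1 / yr b) * s)) = l * b powr \<nu>"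
proof -
  have A: "Bm * b\<^sup>2 < e + b\<^sup>2 * Gm" using m side_iff[OF b] by simp
  note s = slope_max[OF q pos(2) A_nonneg(2) l b A]
  define c where "c = cmid q l Bm (e + b\<^sup>2 * Gm) b"
  have c: "0 < c" "b < c" using cmid_pos[OF q pos(2) A_nonneg(2) l b] s(1) by (auto simp: c_def)
  show "1 < yr b" using c b by (simp add: yr_def c_def[symmetric])
  show "sm b > 0" using s(3) by (simp add: sm_def)
  have y: "yr b = c / b" by (simp add: yr_def c_def)
  have "Bm * c\<^sup>2 < b\<^sup>2 * (Gm + hr b)" using s(2) A_eq(4)[OF b] by (simp add: c_def)
  then show "Bm * (yr b)\<^sup>2 < Gm + hr b" using c b by (simp add: y power_divide field_simps)
  have "(e + b\<^sup>2 * Gm) / (b * c) = (Gm + hr b) / yr b"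
    unfolding A_eq(4)[OF b] y using b c by (simp add: power2_eq_square field_simps)
  moreover have "b * (yr b - 1) = c - b" using b c by (simp add: y right_diff_distrib)
  ultimately show "(q * sm b)\<^sup>2 = b * ((yr b - 1) * ((Gm + hr b) / yr b - Bm))"
    using s(4) by (simp add: sm_def c_def[symmetric] mult.assoc[symmetric])
  show "integral {0..sqrt (1 - 1 / yr b)} (kmin (1 - \<nu>) (Gm + hr b) Bm (yr b)) = l * b powr \<nu>"
    "integral {0..1} (\<lambda>s. sqrt (1 - 1 / yr b) * kmin (1 - \<nu>) (Gm + hr b) Bm (yr b) (sqrt (1 - 1 / yr b) * s)) = l * b powr \<nu>"
    using time_max[OF q pos(2) A_nonneg(2) l b A \<nu>(1) yr_def A_eq(2)[OF b, symmetric]] by auto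
qed

lemma sp_nonneg:
  assumes b: "b > 0" and n: "\<not> minside b"
  shows "sp b \<ge> 0"
proof (cases "Bp * b\<^sup>2 = e + b\<^sup>2 * Gp")
  case True
  then show ?thesis unfolding sp_def using slope_eq_0[OF q pos(1) A_nonneg(1) l b] by simp
next
  case False
  then have "Bp * b\<^sup>2 < e + b\<^sup>2 * Gp" using n side_iff(1)[OF b] by simp
  then show ?thesis unfolding sp_def using slope_max(3)[OF q pos(1) A_nonneg(1) l b] by (simp add: less_imp_le)
qed

lemma sm_nonpos:
  assumes b: "b > 0" and n: "\<not> maxside b"
  shows "sm b \<le> 0"
proof (cases "Bm * b\<^sup>2 = e + b\<^sup>2 * Gm")
  case True
  then show ?thesis unfolding sm_def using slope_eq_0[OF q pos(2) A_nonneg(2) l b] by simp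
next
  case False
  then have "e + b\<^sup>2 * Gm < Bm * b\<^sup>2" using n side_iff(2)[OF b] by simp
  then show ?thesis unfolding sm_def using slope_min(3)[OF q pos(2) A_nonneg(2) l b] by (simp add: less_imp_le)
qed

lemma Bp_Bm: "Bp - Bm = 4 * t" "Gp - Gm = 4 * \<gamma>"
  by (simp_all add: Bp_def Bm_def Gp_def Gm_def power2_eq_square algebra_simps)

text \<open>If the right half did not dip, then the left half could not rise; the two type
  conditions would give Bp - Bm \<le> Gp - Gm, that is t \<le> \<gamma>. So the right half dips, and
  the left half has to rise to compensate.\<close>

lemma zero_types:
  assumes b: "b > 0" and z: "net b = 0"
  shows "minside b" "maxside b"
proof -
  show "minside b"
  proof (rule ccontr)
    assume n: "\<not> minside b"
    then have "sm b \<le> 0" using sp_nonneg[OF b n] z by (simp add: net_def)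
    then have "\<not> maxside b" using max_facts(3)[OF b] by force
    then show False using n Bp_Bm t by (simp add: minside_def maxside_def)
  qed
  then have "sm b > 0" using min_facts(3)[OF b] z by (simp add: net_def)
  then show "maxside b" using sm_nonpos[OF b] by force
qed

lemma net_zero_iff_flux:
  assumes b: "b > 0" and "minside b" "maxside b"
  shows "net b = 0 \<longleftrightarrow> (1 - 1 / xr b) * (Bp - (Gp + hr b) * xr b) = (yr b - 1) * ((Gm + hr b) / yr b - Bm)"
    "net b < 0 \<longleftrightarrow> (1 - 1 / xr b) * (Bp - (Gp + hr b) * xr b) > (yr b - 1) * ((Gm + hr b) / yr b - Bm)"
proof -
  define D1 where "D1 = (1 - 1 / xr b) * (Bp - (Gp + hr b) * xr b)"
  define D2 where "D2 = (yr b - 1) * ((Gm + hr b) / yr b - Bm)"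
  have n: "sp b < 0" "sm b > 0" "(q * - sp b)\<^sup>2 = b * D1" "(q * sm b)\<^sup>2 = b * D2"
    using min_facts(3,4)[OF assms(1,2)] max_facts(3,4)[OF assms(1,3)] by (auto simp: D1_def D2_def)
  have q0: "q > 0" using q by simp
  have "- sp b < sm b \<longleftrightarrow> q * - sp b < q * sm b"
    by (rule mult_less_cancel_left_pos[OF q0, symmetric])
  also have "\<dots> \<longleftrightarrow> (q * - sp b)\<^sup>2 < (q * sm b)\<^sup>2"
    using n q by (intro less_iff_square_less) (auto simp: mult_le_0_iff)
  also have "\<dots> \<longleftrightarrow> D1 < D2" unfolding n using b by simp
  finally have 1: "- sp b < sm b \<longleftrightarrow> D1 < D2" .
  have "sm b < - sp b \<longleftrightarrow> q * sm b < q * - sp b"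
    by (rule mult_less_cancel_left_pos[OF q0, symmetric])
  also have "\<dots> \<longleftrightarrow> (q * sm b)\<^sup>2 < (q * - sp b)\<^sup>2"
    using n q by (intro less_iff_square_less) (auto simp: mult_le_0_iff)
  also have "\<dots> \<longleftrightarrow> D2 < D1" unfolding n using b by simp
  finally have 2: "sm b < - sp b \<longleftrightarrow> D2 < D1" .
  show "net b = 0 \<longleftrightarrow> (1 - 1 / xr b) * (Bp - (Gp + hr b) * xr b) = (yr b - 1) * ((Gm + hr b) / yr b - Bm)"
    "net b < 0 \<longleftrightarrow> (1 - 1 / xr b) * (Bp - (Gp + hr b) * xr b) > (yr b - 1) * ((Gm + hr b) / yr b - Bm)"
    unfolding D1_def[symmetric] D2_def[symmetric] net_def using 1 2 by linarith+
qed

lemma Gm_lt_Bp: "Gm < Bp"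
  unfolding Gm_def Bp_def using t \<gamma> by (intro power_strict_mono) auto

lemma Gp_lt_Bm: "Gp < Bm"
  unfolding Gp_def Bm_def using t \<gamma> by (intro power_strict_mono) auto

lemma kernel_no_zero:
  assumes b: "b > 0" and z: "net b = 0" and xy: "xr b \<le> yr b"
    and le: "\<And>v. 1 \<le> v \<Longrightarrow> v ^ 3 \<le> xr b \<Longrightarrow> Gm + hr b - Bm * xr b * v ^ 3 \<le> v\<^sup>2 * (Bp - (Gp + hr b) * xr b * v ^ 3)"
    and less: "\<And>v. 1 \<le> v \<Longrightarrow> v ^ 3 = xr b \<Longrightarrow> Gm + hr b - Bm * xr b * v ^ 3 < v\<^sup>2 * (Bp - (Gp + hr b) * xr b * v ^ 3)"
  shows False
proof -
  note types = zero_types[OF b z]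
  note mn = min_facts[OF b types(1)]
  note mx = max_facts[OF b types(2)]
  have "Gp + hr b \<ge> 0" using pos e by (simp add: hr_def)
  then show False
    by (intro kmin_exclusion[OF \<nu>(3) mn(1) xy _ mn(2) _ mx(2) _ le less]) (use mn(5) mx(5) pos in auto)
qed

text \<open>Without \<open>e\<close> the coefficients of the flux gap have fixed signs, Gm < Bp and
  Gp < Bm. By \<open>flux_eq_gt\<close> this excludes y < x, and for x \<le> y it gives the kernel
  inequality at once.\<close>

lemma net_nonzero:
  assumes b: "b > 0" and e0: "e = 0"
  shows "net b \<noteq> 0"
proof
  assume z: "net b = 0"
  note types = zero_types[OF b z]
  note mn = min_facts[OF b types(1)]
  note mx = max_facts[OF b types(2)]
  note D = net_zero_iff_flux(1)[OF b types, THEN iffD1, OF z]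
  have h0: "hr b = 0" unfolding hr_def using e0 by simp
  have P: "Bp - Gm > 0" and Q: "Gp - Bm < 0" using Gm_lt_Bp Gp_lt_Bm by auto
  have xy: "xr b \<le> yr b"
  proof (rule ccontr)
    assume "\<not> xr b \<le> yr b"
    then have "Bp - Gm < (Gp - Bm) * yr b"
      using flux_eq_gt[OF mx(1) _ mn(2) _ D] pos h0 by simp
    moreover have "(Gp - Bm) * yr b \<le> 0" using Q mx(1) by (intro mult_nonpos_nonneg) auto
    ultimately show False using P by linarith
  qed
  have key: "Gm - Bm * xr b * v ^ 3 < v\<^sup>2 * (Bp - Gp * xr b * v ^ 3)" if v: "1 \<le> v" "v ^ 3 \<le> xr b" for v
  proof -
    have "Gp * xr b * v ^ 3 \<le> Gp * xr b * xr b" using v mn(1) pos by (intro mult_left_mono) auto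
    then have "Bp - Gp * xr b * v ^ 3 > 0" using mn(2) h0 by (simp add: power2_eq_square)
    then have "1 * (Bp - Gp * xr b * v ^ 3) \<le> v\<^sup>2 * (Bp - Gp * xr b * v ^ 3)"
      using v by (intro mult_right_mono) (auto simp: one_le_power)
    moreover have "Gp * (xr b * v ^ 3) \<le> Bm * (xr b * v ^ 3)" using Q mn(1) v by (intro mult_right_mono) auto
    ultimately show ?thesis using P by (simp add: mult.assoc)
  qed
  show False
  proof (rule kernel_no_zero[OF b z xy])
    fix v :: real assume v: "1 \<le> v" "v ^ 3 \<le> xr b"
    show "Gm + hr b - Bm * xr b * v ^ 3 \<le> v\<^sup>2 * (Bp - (Gp + hr b) * xr b * v ^ 3)"
      using key[OF v] unfolding h0 by simp
  next
    fix v :: real assume v: "1 \<le> v" "v ^ 3 = xr b"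
    then have "v ^ 3 \<le> xr b" by simp
    from key[OF v(1) this] show "Gm + hr b - Bm * xr b * v ^ 3 < v\<^sup>2 * (Bp - (Gp + hr b) * xr b * v ^ 3)"
      unfolding h0 by simp
  qed
qed

text \<open>When Bm < Gm, no zero has \<open>hr b < Gp\<close>: for x \<le> y the kernel comparison
  forbids it, and for y < x \<open>large_h\<close> makes \<open>hr b\<close> larger than T^2 > g^2 =
  Gp. So \<open>growth_balance\<close> is available.\<close>

lemma zero_balance:
  assumes b: "b > 0" and z: "net b = 0" and e0: "e > 0"
  shows "Gm \<le> Bm \<or> (Gp \<le> hr b \<and> 0 < (Bp / xr b - (Gp + hr b) * xr b) * (6 * (xr b - 1) / (4 * xr b - 1)) + 6 * hr b * (xr b - 1 / yr b)
     - ((Gm + hr b) / yr b - Bm * yr b) * (6 * (yr b - 1) / (4 * yr b - 1)))"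
proof (cases "Gm \<le> Bm")
  case False
  note types = zero_types[OF b z]
  note mn = min_facts[OF b types(1)]
  note mx = max_facts[OF b types(2)]
  note D = net_zero_iff_flux(1)[OF b types, THEN iffD1, OF z]
  define T where "T = t - 1"
  define g where "g = 1 + \<gamma>"
  have gT: "0 < g" "g < T" using t \<gamma> by (auto simp: T_def g_def)
  have "T < 2 - g"
  proof -
    have "Bm < Gm" using False by simp
    then have "t - 1 < 1 - \<gamma>" unfolding Bm_def Gm_def by (rule power2_less_imp_less) (use \<gamma> in simp)
    then show ?thesis by (simp add: T_def g_def)
  qed
  note g = gT this
  have eqs: "Bp = (T + 2)\<^sup>2" "Bm = T\<^sup>2" "Gp = g\<^sup>2" "Gm = (2 - g)\<^sup>2"
    by (simp_all add: Bp_def Bm_def Gp_def Gm_def T_def g_def algebra_simps)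
  have h: "hr b > 0" using e0 b by (simp add: hr_def)
  have "Gp \<le> hr b"
  proof (rule ccontr)
    assume n: "\<not> Gp \<le> hr b"
    show False
    proof (cases "xr b \<le> yr b")
      case True
      have k: "(2 - g)\<^sup>2 + hr b - T\<^sup>2 * xr b * v ^ 3 \<le> v\<^sup>2 * ((T + 2)\<^sup>2 - (g\<^sup>2 + hr b) * xr b * v ^ 3)"
        "(2 - g)\<^sup>2 + hr b - T\<^sup>2 * xr b * r ^ 3 < r\<^sup>2 * ((T + 2)\<^sup>2 - (g\<^sup>2 + hr b) * xr b * r ^ 3)"
        if "1 \<le> v" "v \<le> r" "r ^ 3 = xr b" for v r
        using small_h_kernel[OF g _ _ mn(1) True mn(2)[unfolded eqs] mx(2)[unfolded eqs] D[unfolded eqs] that] h n eqs by auto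
      show False
      proof (rule kernel_no_zero[OF b z True])
        define r where "r = xr b powr (1 / 3)"
        have r3: "r ^ 3 = xr b" "r \<ge> 0" using mn(1) by (auto simp: r_def powr_power)
        fix v :: real assume v: "1 \<le> v" "v ^ 3 \<le> xr b"
        then have "v \<le> r" using r3 by (metis power_le_imp_le_base numeral_3_eq_3)
        then show "Gm + hr b - Bm * xr b * v ^ 3 \<le> v\<^sup>2 * (Bp - (Gp + hr b) * xr b * v ^ 3)"
          using k(1)[OF v(1) _ r3(1)] unfolding eqs by simp
      next
        fix v :: real assume v: "1 \<le> v" "v ^ 3 = xr b"
        then show "Gm + hr b - Bm * xr b * v ^ 3 < v\<^sup>2 * (Bp - (Gp + hr b) * xr b * v ^ 3)"
          using k(2)[OF v(1) order.refl v(2)] unfolding eqs by simp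
      qed
    next
      case False
      then have "16 / 9 * T\<^sup>2 < hr b"
        using large_h[OF g _ mx(1) _ mn(2)[unfolded eqs] mx(2)[unfolded eqs] D[unfolded eqs]] h by simp
      moreover have "g\<^sup>2 < T\<^sup>2" using g by (intro power_strict_mono) auto
      moreover have "T\<^sup>2 \<le> 16 / 9 * T\<^sup>2" by simp
      ultimately show False using n eqs by linarith
    qed
  qed
  then show ?thesis
    using growth_balance[OF g h _ mn(1) mx(1) mn(2)[unfolded eqs] mx(2)[unfolded eqs] D[unfolded eqs]] unfolding eqs by simp
qed simp

end

section \<open>Every zero is a downward crossing, hence uniqueness\<close>

lemma cont_pos_local:
  fixes f :: "real \<Rightarrow> real"
  assumes "isCont f a" "f a > 0"
  shows "\<forall>\<^sub>F z in nhds a. f z > 0"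
proof -
  have "(f \<longlongrightarrow> f a) (nhds a)" using assms(1) by (simp add: isCont_def tendsto_at_iff_tendsto_nhds)
  then show ?thesis using assms(2) by (rule order_tendstoD)
qed

lemma deriv_neg_local:
  fixes f :: "real \<Rightarrow> real"
  assumes "(f has_real_derivative d) (at a)" "d < 0"
  shows "\<forall>\<^sub>F z in nhds a. (a < z \<longrightarrow> f z < f a) \<and> (z < a \<longrightarrow> f a < f z)"
  using deriv_pos_local[OF DERIV_minus[OF assms(1)]] assms(2) by simp

lemma flux_min_mono:
  fixes x w B H :: real
  assumes "0 < w" "w \<le> x" "H \<ge> 0" "H * x\<^sup>2 < B"
  shows "(1 - 1 / w) * (B - H * w) \<le> (1 - 1 / x) * (B - H * x)"
proof -
  have "H * (x * w) \<le> H * (x * x)" using assms by (intro mult_left_mono) auto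
  then have "B / (x * w) - H \<ge> 0" using assms by (simp add: power2_eq_square field_simps)
  then have "(x - w) * (B / (x * w) - H) \<ge> 0" using assms by simp
  then show ?thesis using flux_min_diff[of x w B H] assms by simp
qed

lemma flux_max_mono:
  fixes y w B H :: real
  assumes "0 < w" "w \<le> y" "B \<ge> 0" "B * y\<^sup>2 < H"
  shows "(w - 1) * (H / w - B) \<le> (y - 1) * (H / y - B)"
proof -
  have "B * (y * w) \<le> B * (y * y)" using assms by (intro mult_left_mono) auto
  then have "H / (y * w) - B \<ge> 0" using assms by (simp add: power2_eq_square field_simps)
  then have "(y - w) * (H / (y * w) - B) \<ge> 0" using assms by simp
  then show ?thesis using flux_max_diff[of y w H B] assms by simp
qed

lemma Theta_powr_mono:
  assumes "1 < x" "x \<le> y" "\<nu> > 0"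
  shows "Theta x * x powr \<nu> \<le> Theta y * y powr \<nu>"
  using Theta_mono[OF assms(1,2)] Theta_props(1)[OF assms(1)] assms
  by (intro mult_mono powr_mono2) auto

lemma sqrt_powr_mono:
  fixes x y \<nu> :: real
  assumes "1 < x" "x \<le> y" "\<nu> < 1"
  shows "x powr (1 - \<nu>) * sqrt (1 - 1 / x) \<le> y powr (1 - \<nu>) * sqrt (1 - 1 / y)"
  using assms by (intro mult_mono powr_mono2) (auto simp: frac_le)

context circle_flux
begin

text \<open>Implicit differentiation of the length integrals is replaced by barriers. With \<beta> =
  b / b1 > 1 the integrals must grow exactly by \<beta>^\<nu>, which puts the true x above
  X(\<beta>) and the true y below Y(\<beta>). Monotonicity of the two fluxes then transfers the sign
  of \<open>f4\<close> from the barriers to the true values. For \<beta> < 1 all comparisons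
  reverse.\<close>

lemma crossing:
  assumes b1: "b1 > 0" and z: "net b1 = 0" and e0: "e > 0"
  shows "\<forall>\<^sub>F b in nhds b1. (b1 < b \<longrightarrow> net b < 0) \<and> (b < b1 \<longrightarrow> net b > 0)"
proof -
  define x1 where "x1 = xr b1"
  define y1 where "y1 = yr b1"
  define h1 where "h1 = hr b1"
  note types = zero_types[OF b1 z]
  note mn = min_facts[OF b1 types(1), folded x1_def h1_def]
  note mx = max_facts[OF b1 types(2), folded y1_def h1_def]
  note D = net_zero_iff_flux(1)[OF b1 types, THEN iffD1, OF z, folded x1_def y1_def h1_def]
  have h1: "h1 > 0" using e0 b1 by (simp add: h1_def hr_def)
  obtain \<rho> \<sigma> where rs: "\<rho> \<ge> 0" "\<sigma> \<ge> 0" "\<rho> * (1 / (2 * sqrt (1 - 1 / x1) * Theta x1) + \<nu>) < \<nu>" "\<rho> * (Gp + h1) < h1"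
    "\<nu> < \<sigma> * (1 / (2 * (y1 - 1)) + (1 - \<nu>))"
    "0 < (Bp / x1 - (Gp + h1) * x1) * \<rho> + 2 * h1 * (x1 - 1 / y1) - ((Gm + h1) / y1 - Bm * y1) * \<sigma>"
    using exponents_exist[OF \<nu>(2,3) mn(1) mx(1) h1 _ mn(2) mx(2) _ zero_balance[OF b1 z e0, folded x1_def y1_def h1_def]] pos
    by (metis less_imp_le)
  define H where "H \<beta> = h1 / \<beta>\<^sup>2" for \<beta> :: real
  define X where "X \<beta> = x1 * \<beta> powr \<rho>" for \<beta> :: real
  define Y where "Y \<beta> = y1 * \<beta> powr \<sigma>" for \<beta> :: real
  have at1: "H 1 = h1" "X 1 = x1" "Y 1 = y1" by (auto simp: H_def X_def Y_def)
  have x1: "x1 > 1" and y1: "y1 > 1" using mn mx by auto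
  have dH: "(H has_real_derivative - 2 * h1) (at 1)"
    unfolding H_def by (auto intro!: derivative_eq_intros)
  have dX: "(X has_real_derivative \<rho> * x1) (at 1)"
    unfolding X_def by (auto intro!: derivative_eq_intros)
  have dY: "(Y has_real_derivative \<sigma> * y1) (at 1)"
    unfolding Y_def by (auto intro!: derivative_eq_intros)
  have T1: "Theta x1 > 0" using Theta_props(1)[OF x1] .
  have dTh: "((\<lambda>\<beta>. Theta (X \<beta>)) has_real_derivative 1 / (2 * x1 * sqrt (1 - 1 / x1)) * (\<rho> * x1)) (at 1)"
    by (rule DERIV_chain2[OF _ dX]) (use Theta_deriv[OF x1] at1 in simp)
  \<comment> \<open>\<open>f1\<close> and \<open>f2\<close> are the logarithms of the prefactors in
    \<open>kminh_ratio\<close> and \<open>kmax_ratio\<close> relative to \<beta>^\<nu>,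
    \<open>f3\<close> is the product that \<open>kminh_ratio\<close> requires not to increase, and
    \<open>f4\<close> is the difference of the fluxes. The choice of \<rho> and \<sigma> fixes the
    signs of their derivatives at \<beta> = 1.\<close>
  define f1 where "f1 \<beta> = ln (Theta (X \<beta>)) + \<nu> * ln (X \<beta>) - \<nu> * ln \<beta>" for \<beta>
  have df1: "(f1 has_real_derivative \<rho> * (1 / (2 * sqrt (1 - 1 / x1) * Theta x1) + \<nu>) - \<nu>) (at 1)"
    unfolding f1_def using T1 x1 at1
    by (auto intro!: derivative_eq_intros dTh dX simp: field_simps)
  define f2 where "f2 \<beta> = (1 - \<nu>) * ln (Y \<beta>) + 1 / 2 * ln (1 - 1 / Y \<beta>) - \<nu> * ln \<beta>" for \<beta>
  have df2: "(f2 has_real_derivative \<sigma> * (1 / (2 * (y1 - 1)) + (1 - \<nu>)) - \<nu>) (at 1)"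
    unfolding f2_def using y1 at1
    by (auto intro!: derivative_eq_intros dY simp: field_simps)
  define f3 where "f3 \<beta> = (Gp + H \<beta>) * (X \<beta>)\<^sup>2" for \<beta>
  have df3: "(f3 has_real_derivative 2 * x1\<^sup>2 * (\<rho> * (Gp + h1) - h1)) (at 1)"
    unfolding f3_def using at1
    by (auto intro!: derivative_eq_intros dX dH simp: power2_eq_square algebra_simps)
  define f4 where "f4 \<beta> = Bp + Gp + H \<beta> - Bp / X \<beta> - (Gp + H \<beta>) * X \<beta>
      - (Gm + H \<beta> + Bm - Bm * Y \<beta> - (Gm + H \<beta>) / Y \<beta>)" for \<beta>
  have f4_eq: "f4 \<beta> = (1 - 1 / X \<beta>) * (Bp - (Gp + H \<beta>) * X \<beta>) - (Y \<beta> - 1) * ((Gm + H \<beta>) / Y \<beta> - Bm)"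
    if "X \<beta> > 0" "Y \<beta> > 0" for \<beta>
    using that by (simp add: f4_def field_simps)
  have df4: "(f4 has_real_derivative (Bp / x1 - (Gp + h1) * x1) * \<rho> + 2 * h1 * (x1 - 1 / y1) - ((Gm + h1) / y1 - Bm * y1) * \<sigma>) (at 1)"
  proof -
    have "(f4 has_real_derivative - 2 * h1 + Bp * (\<rho> * x1) / x1\<^sup>2 - (- 2 * h1 * x1 + (Gp + h1) * (\<rho> * x1))
        - (- 2 * h1 - Bm * (\<sigma> * y1) - (- 2 * h1 * y1 - (Gm + h1) * (\<sigma> * y1)) / y1\<^sup>2)) (at 1)"
      unfolding f4_def using at1 x1 y1
      by (auto intro!: derivative_eq_intros dX dH dY simp: power2_eq_square)
    moreover have "- 2 * h1 + Bp * (\<rho> * x1) / x1\<^sup>2 - (- 2 * h1 * x1 + (Gp + h1) * (\<rho> * x1))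
        - (- 2 * h1 - Bm * (\<sigma> * y1) - (- 2 * h1 * y1 - (Gm + h1) * (\<sigma> * y1)) / y1\<^sup>2)
      = (Bp / x1 - (Gp + h1) * x1) * \<rho> + 2 * h1 * (x1 - 1 / y1) - ((Gm + h1) / y1 - Bm * y1) * \<sigma>"
      using x1 y1 by (simp add: power2_eq_square field_simps)
    ultimately show ?thesis by (simp only:)
  qed
  have f41: "f4 1 = 0" using D x1 y1 by (simp add: f4_eq at1)
  note cX = DERIV_isCont[OF dX] and cY = DERIV_isCont[OF dY] and cH = DERIV_isCont[OF dH]
  have "\<forall>\<^sub>F \<beta> in nhds 1. ((1 < \<beta> \<longrightarrow> f1 \<beta> < f1 1) \<and> (\<beta> < 1 \<longrightarrow> f1 1 < f1 \<beta>))
      \<and> ((1 < \<beta> \<longrightarrow> f2 1 < f2 \<beta>) \<and> (\<beta> < 1 \<longrightarrow> f2 \<beta> < f2 1))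
      \<and> ((1 < \<beta> \<longrightarrow> f3 \<beta> < f3 1) \<and> (\<beta> < 1 \<longrightarrow> f3 1 < f3 \<beta>))
      \<and> ((1 < \<beta> \<longrightarrow> f4 1 < f4 \<beta>) \<and> (\<beta> < 1 \<longrightarrow> f4 \<beta> < f4 1))
      \<and> 0 < \<beta> \<and> 0 < X \<beta> - 1 \<and> 0 < Y \<beta> - 1 \<and> 0 < Bp - (Gp + H \<beta>) \<and> 0 < Gm + H \<beta> - Bm
      \<and> 0 < Bp - (Gp + H \<beta>) * (X \<beta>)\<^sup>2 \<and> 0 < Gm + H \<beta> - Bm * (Y \<beta>)\<^sup>2"
  proof -
    have a1: "\<forall>\<^sub>F \<beta> in nhds 1. (1 < \<beta> \<longrightarrow> f1 \<beta> < f1 1) \<and> (\<beta> < 1 \<longrightarrow> f1 1 < f1 \<beta>)"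
      by (rule deriv_neg_local[OF df1]) (use rs in simp)
    have a2: "\<forall>\<^sub>F \<beta> in nhds 1. (1 < \<beta> \<longrightarrow> f2 1 < f2 \<beta>) \<and> (\<beta> < 1 \<longrightarrow> f2 \<beta> < f2 1)"
      by (rule deriv_pos_local[OF df2]) (use rs in simp)
    have a3: "\<forall>\<^sub>F \<beta> in nhds 1. (1 < \<beta> \<longrightarrow> f3 \<beta> < f3 1) \<and> (\<beta> < 1 \<longrightarrow> f3 1 < f3 \<beta>)"
      by (rule deriv_neg_local[OF df3]) (use rs x1 in \<open>auto intro!: mult_pos_neg\<close>)
    have a4: "\<forall>\<^sub>F \<beta> in nhds 1. (1 < \<beta> \<longrightarrow> f4 1 < f4 \<beta>) \<and> (\<beta> < 1 \<longrightarrow> f4 \<beta> < f4 1)"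
      by (rule deriv_pos_local[OF df4]) (use rs in simp)
    have a5: "\<forall>\<^sub>F \<beta> in nhds 1. 0 < (\<beta> :: real)" by (rule cont_pos_local) auto
    have a6: "\<forall>\<^sub>F \<beta> in nhds 1. 0 < X \<beta> - 1"
      by (rule cont_pos_local) (use cX x1 at1 in \<open>auto intro!: continuous_intros\<close>)
    have a7: "\<forall>\<^sub>F \<beta> in nhds 1. 0 < Y \<beta> - 1"
      by (rule cont_pos_local) (use cY y1 at1 in \<open>auto intro!: continuous_intros\<close>)
    have a8: "\<forall>\<^sub>F \<beta> in nhds 1. 0 < Bp - (Gp + H \<beta>)"
      by (rule cont_pos_local) (use cH at1 types(1) h1_def minside_def in \<open>auto intro!: continuous_intros\<close>)
    have a9: "\<forall>\<^sub>F \<beta> in nhds 1. 0 < Gm + H \<beta> - Bm"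
      by (rule cont_pos_local) (use cH at1 types(2) h1_def maxside_def in \<open>auto intro!: continuous_intros\<close>)
    have a10: "\<forall>\<^sub>F \<beta> in nhds 1. 0 < Bp - (Gp + H \<beta>) * (X \<beta>)\<^sup>2"
      by (rule cont_pos_local) (use cH cX at1 mn(2) in \<open>auto intro!: continuous_intros\<close>)
    have a11: "\<forall>\<^sub>F \<beta> in nhds 1. 0 < Gm + H \<beta> - Bm * (Y \<beta>)\<^sup>2"
      by (rule cont_pos_local) (use cH cY at1 mx(2) in \<open>auto intro!: continuous_intros\<close>)
    show ?thesis using a1 a2 a3 a4 a5 a6 a7 a8 a9 a10 a11
      by eventually_elim (intro conjI; (elim conjE)?; assumption)
  qed
  moreover have "filterlim (\<lambda>b. b / b1) (nhds 1) (nhds b1)"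
  proof -
    have "((\<lambda>b. b / b1) \<longlongrightarrow> b1 / b1) (nhds b1)"
      using b1 by (intro tendsto_divide tendsto_const filterlim_ident) auto
    then show ?thesis using b1 by simp
  qed
  ultimately have "\<forall>\<^sub>F b in nhds b1. (\<lambda>\<beta>. ((1 < \<beta> \<longrightarrow> f1 \<beta> < f1 1) \<and> (\<beta> < 1 \<longrightarrow> f1 1 < f1 \<beta>))
      \<and> ((1 < \<beta> \<longrightarrow> f2 1 < f2 \<beta>) \<and> (\<beta> < 1 \<longrightarrow> f2 \<beta> < f2 1))
      \<and> ((1 < \<beta> \<longrightarrow> f3 \<beta> < f3 1) \<and> (\<beta> < 1 \<longrightarrow> f3 1 < f3 \<beta>))
      \<and> ((1 < \<beta> \<longrightarrow> f4 1 < f4 \<beta>) \<and> (\<beta> < 1 \<longrightarrow> f4 \<beta> < f4 1))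
      \<and> 0 < \<beta> \<and> 0 < X \<beta> - 1 \<and> 0 < Y \<beta> - 1 \<and> 0 < Bp - (Gp + H \<beta>) \<and> 0 < Gm + H \<beta> - Bm
      \<and> 0 < Bp - (Gp + H \<beta>) * (X \<beta>)\<^sup>2 \<and> 0 < Gm + H \<beta> - Bm * (Y \<beta>)\<^sup>2) (b / b1)"
    by (rule eventually_compose_filterlim)
  then show ?thesis
  proof eventually_elim
    case (elim b)
    define \<beta> where "\<beta> = b / b1"
    note E = elim[folded \<beta>_def]
    have \<beta>: "\<beta> > 0" "b = b1 * \<beta>" using E b1 by (auto simp: \<beta>_def)
    have b: "b > 0" using \<beta> b1 by simp
    have hb: "hr b = H \<beta>" using b1 \<beta> by (simp add: hr_def H_def h1_def power_mult_distrib)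
    have ts: "minside b" "maxside b" using E by (auto simp: minside_def maxside_def hb)
    define xb where "xb = xr b"
    define yb where "yb = yr b"
    define \<eta> where "\<eta> = \<beta> powr \<nu>"
    have \<eta>: "\<eta> > 0" using \<beta> by (simp add: \<eta>_def)
    note mb = min_facts[OF b ts(1), folded xb_def, unfolded hb]
    note xbb = max_facts[OF b ts(2), folded yb_def, unfolded hb]
    define I where "I = l * b1 powr \<nu>"
    have I: "I > 0" using l b1 by (simp add: I_def)
    have Ib: "l * b powr \<nu> = \<eta> * I" using b1 \<beta> by (simp add: I_def \<eta>_def powr_mult)
    note i1 = mn(6)[folded I_def] and i2 = mx(6)[folded I_def]
    note j1 = mb(6)[unfolded Ib] and j2 = xbb(6)[unfolded Ib]
    have Hpos: "Gp + H \<beta> \<ge> 0" "Gp + h1 \<ge> 0" using pos h1 by (auto simp: H_def)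
    have Xp: "X \<beta> > 1" "Y \<beta> > 1" using E by auto
    have TX: "Theta (X \<beta>) > 0" using Theta_props(1)[OF Xp(1)] .
    define sx where "sx x = Theta x * x powr \<nu>" for x
    define sy where "sy y = y powr (1 - \<nu>) * sqrt (1 - 1 / y)" for y
    have sxp: "sx x > 0" if "x > 1" for x using Theta_props(1)[OF that] that by (simp add: sx_def)
    have syp: "sy y > 0" if "y > 1" for y using that by (simp add: sy_def)
    have sxm: "sx x \<le> sx x'" if "1 < x" "x \<le> x'" for x x' unfolding sx_def by (rule Theta_powr_mono) (use that \<nu> in auto)
    have sym: "sy y \<le> sy y'" if "1 < y" "y \<le> y'" for y y' unfolding sy_def by (rule sqrt_powr_mono) (use that \<nu> in auto)
    have l1: "ln (sx (X \<beta>)) - ln (\<eta> * sx x1) = f1 \<beta> - f1 1"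
      using TX Xp T1 x1 \<beta> by (simp add: sx_def f1_def \<eta>_def ln_mult ln_powr at1)
    have l2: "ln (sy (Y \<beta>)) - ln (\<eta> * sy y1) = f2 \<beta> - f2 1"
      using Xp y1 \<beta> by (simp add: sy_def f2_def \<eta>_def ln_mult ln_powr ln_sqrt at1)
    have s1: "\<eta> * sx x1 > 0" "sx (X \<beta>) > 0" using \<eta> sxp x1 Xp by auto
    have s2: "\<eta> * sy y1 > 0" "sy (Y \<beta>) > 0" using \<eta> syp y1 Xp by auto
    have up1: "integral {0..1} (kminh \<nu> Bp H' x') \<le> sx x' / sx x * integral {0..1} (kminh \<nu> Bp K x)"
      if "1 < x" "x \<le> x'" "0 \<le> H'" "H' * x'\<^sup>2 \<le> K * x\<^sup>2" "K * x\<^sup>2 < Bp" for x x' H' K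
      using kminh_ratio[OF that \<nu>(2)] by (simp add: sx_def)
    have up2: "sy y' / sy y * integral {0..1} (\<lambda>s. sqrt (1 - 1 / y) * kmin (1 - \<nu>) K Bm y (sqrt (1 - 1 / y) * s))
        \<le> integral {0..1} (\<lambda>s. sqrt (1 - 1 / y') * kmin (1 - \<nu>) K' Bm y' (sqrt (1 - 1 / y') * s))"
      if "1 < y" "y \<le> y'" "Bm * y'\<^sup>2 < K'" "K' \<le> K" for y y' K K'
      unfolding sy_def using kmax_ratio[OF that(1,2) _ that(3,4) \<nu>(2)] \<nu> pos by simp
    have f31: "f3 1 = (Gp + h1) * x1\<^sup>2" by (simp add: f3_def at1)
    show ?case
    proof (intro conjI impI)
      assume "b1 < b"
      then have g1: "1 < \<beta>" using b1 by (simp add: \<beta>_def)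
      then have \<eta>1: "1 < \<eta>" using \<nu> by (simp add: \<eta>_def)
      have HH: "H \<beta> \<le> h1" using g1 h1 by (simp add: H_def divide_le_eq one_le_power)
      have YY: "y1 \<le> Y \<beta>" using g1 rs y1 by (simp add: Y_def ge_one_powr_ge_zero)
      have sX: "sx (X \<beta>) < \<eta> * sx x1"
      proof -
        have "f1 \<beta> < f1 1" using E g1 by blast
        then have "ln (sx (X \<beta>)) < ln (\<eta> * sx x1)" using l1 by linarith
        then show ?thesis using ln_less_cancel_iff s1 by blast
      qed
      have sY: "\<eta> * sy y1 < sy (Y \<beta>)"
      proof -
        have "f2 1 < f2 \<beta>" using E g1 by blast
        then have "ln (\<eta> * sy y1) < ln (sy (Y \<beta>))" using l2 by linarith
        then show ?thesis using ln_less_cancel_iff s2 by blast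
      qed
      \<comment> \<open>Suppose x is at most X(\<beta>). If x \<ge> x1, then
        \<open>kminh_ratio\<close> bounds the growth of the integral below \<beta>^\<nu>; if x < x1,
        then by \<open>kminh_mono\<close> the integral does not grow at all.\<close>
      have c1: "X \<beta> < xb"
      proof (rule ccontr)
        assume "\<not> X \<beta> < xb"
        then have le: "xb \<le> X \<beta>" by simp
        show False
        proof (cases "x1 \<le> xb")
          case True
          have "(Gp + H \<beta>) * xb\<^sup>2 \<le> f3 \<beta>" unfolding f3_def using le mb(1) Hpos by (intro mult_left_mono power_mono) auto
          then have "(Gp + H \<beta>) * xb\<^sup>2 \<le> (Gp + h1) * x1\<^sup>2" using E g1 f31 by simp
          from up1[OF x1 True Hpos(1) this mn(2)] have "\<eta> * I \<le> sx xb / sx x1 * I" unfolding i1 j1 .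
          then have "\<eta> * sx x1 \<le> sx xb" using I sxp[OF x1] by (simp add: field_simps)
          then show False using sX sxm[OF mb(1) le] by linarith
        next
          case False
          then have "integral {0..1} (kminh \<nu> Bp (Gp + H \<beta>) xb) \<le> integral {0..1} (kminh \<nu> Bp (Gp + h1) x1)"
            by (intro kminh_mono) (use mb(1) Hpos HH mn(2) \<nu> in auto)
          then show False unfolding i1 j1 using \<eta>1 I by simp
        qed
      qed
      have c2: "yb < Y \<beta>"
      proof (rule ccontr)
        assume "\<not> yb < Y \<beta>"
        then have le: "Y \<beta> \<le> yb" by simp
        from up2[OF y1 order_trans[OF YY le] xbb(2), of "Gm + h1"] HH
        have "sy yb / sy y1 * I \<le> \<eta> * I" unfolding i2 j2 by simp
        then have "sy yb \<le> \<eta> * sy y1" using I syp[OF y1] by (simp add: field_simps)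
        then show False using sY sym[OF Xp(2) le] by linarith
      qed
      have "(yb - 1) * ((Gm + H \<beta>) / yb - Bm) \<le> (Y \<beta> - 1) * ((Gm + H \<beta>) / Y \<beta> - Bm)"
        by (rule flux_max_mono) (use c2 xbb(1) pos E in auto)
      also have "\<dots> < (1 - 1 / X \<beta>) * (Bp - (Gp + H \<beta>) * X \<beta>)" using E g1 f41 Xp by (simp add: f4_eq)
      also have "\<dots> \<le> (1 - 1 / xb) * (Bp - (Gp + H \<beta>) * xb)"
        by (rule flux_min_mono) (use c1 Xp Hpos mb in auto)
      finally show "net b < 0" unfolding net_zero_iff_flux(2)[OF b ts] xb_def[symmetric] yb_def[symmetric] hb .
    next
      assume "b < b1"
      then have g1: "\<beta> < 1" using b1 by (simp add: \<beta>_def)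
      then have \<eta>1: "\<eta> < 1" using \<nu> \<beta> powr_less_mono2[of \<nu> \<beta> 1] by (simp add: \<eta>_def)
      have "\<beta>\<^sup>2 \<le> 1" using g1 \<beta> by (simp add: power_le_one)
      then have HH: "h1 \<le> H \<beta>" using \<beta> h1 by (simp add: H_def le_divide_eq mult_left_le)
      have "\<beta> powr \<sigma> \<le> 1 powr \<sigma>" using g1 \<beta> rs by (intro powr_mono2) auto
      then have YY: "Y \<beta> \<le> y1" using y1 by (simp add: Y_def)
      have sX: "\<eta> * sx x1 < sx (X \<beta>)"
      proof -
        have "f1 1 < f1 \<beta>" using E g1 by blast
        then have "ln (\<eta> * sx x1) < ln (sx (X \<beta>))" using l1 by linarith
        then show ?thesis using ln_less_cancel_iff s1 by blast
      qed
      have sY: "sy (Y \<beta>) < \<eta> * sy y1"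
      proof -
        have "f2 \<beta> < f2 1" using E g1 by blast
        then have "ln (sy (Y \<beta>)) < ln (\<eta> * sy y1)" using l2 by linarith
        then show ?thesis using ln_less_cancel_iff s2 by blast
      qed
      have c1: "xb \<le> X \<beta>"
      proof (rule ccontr)
        assume "\<not> xb \<le> X \<beta>"
        then have le: "X \<beta> \<le> xb" by simp
        show False
        proof (cases "xb \<le> x1")
          case True
          have "f3 \<beta> \<le> (Gp + H \<beta>) * xb\<^sup>2" unfolding f3_def using le Xp Hpos by (intro mult_left_mono power_mono) auto
          then have "(Gp + h1) * x1\<^sup>2 \<le> (Gp + H \<beta>) * xb\<^sup>2" using E g1 f31 by simp
          from up1[OF mb(1) True Hpos(2) this mb(2)] have "I \<le> sx x1 / sx xb * (\<eta> * I)" unfolding i1 j1 .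
          then have "sx xb \<le> \<eta> * sx x1" using I sxp[OF mb(1)] by (simp add: field_simps)
          then show False using sX sxm[OF Xp(1) le] by linarith
        next
          case False
          then have "integral {0..1} (kminh \<nu> Bp (Gp + h1) x1) \<le> integral {0..1} (kminh \<nu> Bp (Gp + H \<beta>) xb)"
            by (intro kminh_mono) (use mb mn(1) Hpos HH \<nu> in auto)
          then show False unfolding i1 j1 using \<eta>1 I by simp
        qed
      qed
      have c2: "Y \<beta> \<le> yb"
      proof (rule ccontr)
        assume "\<not> Y \<beta> \<le> yb"
        then have le: "yb \<le> Y \<beta>" by simp
        from up2[OF xbb(1) order_trans[OF le YY] mx(2), of "Gm + H \<beta>"] HH
        have "sy y1 / sy yb * (\<eta> * I) \<le> I" unfolding i2 j2 by simp
        then have "\<eta> * sy y1 \<le> sy yb" using I syp[OF xbb(1)] by (simp add: field_simps)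
        then show False using sY sym[OF xbb(1) le] by linarith
      qed
      have "(1 - 1 / xb) * (Bp - (Gp + H \<beta>) * xb) \<le> (1 - 1 / X \<beta>) * (Bp - (Gp + H \<beta>) * X \<beta>)"
        by (rule flux_min_mono) (use c1 mb Hpos E in auto)
      also have "\<dots> < (Y \<beta> - 1) * ((Gm + H \<beta>) / Y \<beta> - Bm)" using E g1 f41 Xp by (simp add: f4_eq)
      also have "\<dots> \<le> (yb - 1) * ((Gm + H \<beta>) / yb - Bm)"
        by (rule flux_max_mono) (use c2 Xp pos xbb in auto)
      finally have "\<not> net b < 0" "net b \<noteq> 0"
        unfolding net_zero_iff_flux[OF b ts] xb_def[symmetric] yb_def[symmetric] hb by auto
      then show "net b > 0" by linarith
    qed
  qed
qed

lemma net_isCont: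
  assumes "b > 0"
  shows "isCont net b"
  unfolding net_def[abs_def] sp_def[abs_def] sm_def[abs_def]
  using assms A_nonneg pos q l by (intro continuous_intros slope_isCont) auto

text \<open>To the right of a zero the function is negative. At the first point where it becomes
  nonnegative again it vanishes by continuity, with negative values just before, whereas
  \<open>crossing\<close> puts positive values to the left of every zero.\<close>

lemma zero_unique:
  assumes e0: "e > 0" and b1: "b1 > 0" "net b1 = 0" and b2: "b2 > 0" "net b2 = 0"
  shows "b1 = b2"
proof -
  have False if b: "0 < b1" "b1 < b2" "net b1 = 0" "net b2 = 0" for b1 b2
  proof -
    obtain d where d: "d > 0" "\<And>b. dist b b1 < d \<Longrightarrow> b1 < b \<Longrightarrow> net b < 0"
      using crossing[OF b(1,3) e0] unfolding eventually_nhds_metric by blast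
    define b' where "b' = min (b1 + d / 2) ((b1 + b2) / 2)"
    have b': "b1 < b'" "b' < b2" "net b' < 0"
    proof -
      show "b1 < b'" "b' < b2" using b d by (auto simp: b'_def min_less_iff_disj)
      then show "net b' < 0" using d by (auto simp: b'_def dist_real_def)
    qed
    have cont: "continuous_on {b'..b2} net"
      using net_isCont b b' by (intro continuous_at_imp_continuous_on) auto
    define S where "S = {b'..b2} \<inter> net -` {0..}"
    have "closed S" unfolding S_def by (intro continuous_closed_preimage cont) auto
    moreover have "bounded S" by (rule bounded_subset[of "{b'..b2}"]) (auto simp: S_def)
    ultimately have "compact S" by (simp add: compact_eq_bounded_closed)
    moreover have "b2 \<in> S" using b b' by (auto simp: S_def)
    ultimately obtain b0 where b0: "b0 \<in> S" "\<forall>s\<in>S. b0 \<le> s" using compact_attains_inf[of S] by blast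
    have b0': "b' < b0" "b0 \<le> b2" "net b0 \<ge> 0" using b0(1) b' by (auto simp: S_def less_le)
    have neg: "net s < 0" if "b' \<le> s" "s < b0" for s
    proof (rule ccontr)
      assume "\<not> net s < 0"
      then have "s \<in> S" using that b0' by (auto simp: S_def)
      then show False using b0(2) that by force
    qed
    have pos0: "b0 > 0" using b0' b' b by linarith
    have "net b0 = 0"
    proof (rule ccontr)
      assume "net b0 \<noteq> 0"
      then have "net b0 > 0" using b0' by simp
      from cont_pos_local[OF net_isCont[OF pos0] this]
      obtain d2 where d2: "d2 > 0" "\<And>b. dist b b0 < d2 \<Longrightarrow> net b > 0" unfolding eventually_nhds_metric by blast
      define s where "s = max b' (b0 - d2 / 2)"
      have "b' \<le> s" "s < b0" "dist s b0 < d2" using d2 b0' by (auto simp: s_def dist_real_def)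
      then show False using neg d2(2) by force
    qed
    from crossing[OF pos0 this e0]
    obtain d2 where d2: "d2 > 0" "\<And>b. dist b b0 < d2 \<Longrightarrow> b < b0 \<Longrightarrow> net b > 0" unfolding eventually_nhds_metric by blast
    define s where "s = max b' (b0 - d2 / 2)"
    have "b' \<le> s" "s < b0" "dist s b0 < d2" using d2 b0' by (auto simp: s_def dist_real_def)
    then show False using neg d2(2) by force
  qed
  then show ?thesis using b1 b2 by (metis linorder_neqE_linordered_idom)
qed

end

section \<open>Existence of a zero of the matching function\<close>

lemma slope_nonpos:
  assumes q: "q > 2" "B > 0" "A \<ge> 0" and l: "l > 0" and b: "b > 0" and A: "A \<le> B * b\<^sup>2"
  shows "slope q l B A b \<le> 0"
  using slope_min(3)[OF q l b] slope_eq_0[OF q l b] A by (cases "B * b\<^sup>2 = A") (auto simp: less_le)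

text \<open>As b tends to 0, both \<open>A\<close> tend to e + \<mu>^2 > 0 while B b^2 tends to 0,
  so both halves rise. As b tends to infinity, A / b^2 tends to \<open>Gp\<close> and
  \<open>Gm\<close>, so \<mu> and \<open>e\<close> drop out; \<open>cmid_small\<close> forces the
  right midpoint below X b, which makes the dipping slope large, while \<open>slope_sq_le\<close>
  bounds the other slope.\<close>

lemma zero_exists:
  fixes q l t \<gamma> e \<mu> :: real
  assumes q: "q > 2" and l: "l > 0" and t: "t > 2 + \<gamma>" and \<gamma>: "-1 < \<gamma>" "\<gamma> < 1"
    and e: "e \<ge> 0" and pos: "e + \<mu>\<^sup>2 > 0"
  shows "\<exists>b>0. slope q l ((t + 1)\<^sup>2) (e + (\<mu> + b * (1 + \<gamma>))\<^sup>2) b + slope q l ((t - 1)\<^sup>2) (e + (\<mu> - b * (1 - \<gamma>))\<^sup>2) b = 0"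
proof -
  define Bp where "Bp = (t + 1)\<^sup>2"
  define Bm where "Bm = (t - 1)\<^sup>2"
  define Ap where "Ap b = e + (\<mu> + b * (1 + \<gamma>))\<^sup>2" for b
  define Am where "Am b = e + (\<mu> - b * (1 - \<gamma>))\<^sup>2" for b
  define F where "F b = slope q l Bp (Ap b) b + slope q l Bm (Am b) b" for b
  have t1: "t > 1" using t \<gamma> by simp
  have B: "Bp > 0" "Bm > 0" using t1 by (auto simp: Bp_def Bm_def)
  have A: "Ap b \<ge> 0" "Am b \<ge> 0" for b using e by (auto simp: Ap_def Am_def)
  have cA: "isCont Ap b" "isCont Am b" for b unfolding Ap_def Am_def by (intro continuous_intros)+
  have cF: "isCont F b" if "b > 0" for b
    unfolding F_def using that q l B A cA by (intro continuous_intros slope_isCont) auto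
  have "\<forall>\<^sub>F b in nhds 0. 0 < Ap b - Bp * b\<^sup>2"
    by (rule cont_pos_local) (use cA pos in \<open>auto intro!: continuous_intros simp: Ap_def\<close>)
  moreover have "\<forall>\<^sub>F b in nhds 0. 0 < Am b - Bm * b\<^sup>2"
    by (rule cont_pos_local) (use cA pos in \<open>auto intro!: continuous_intros simp: Am_def\<close>)
  ultimately have "\<forall>\<^sub>F b in nhds 0. 0 < Ap b - Bp * b\<^sup>2 \<and> 0 < Am b - Bm * b\<^sup>2" by (rule eventually_conj)
  then obtain d where d: "d > 0" "\<And>b. dist b 0 < d \<Longrightarrow> 0 < Ap b - Bp * b\<^sup>2 \<and> 0 < Am b - Bm * b\<^sup>2"
    unfolding eventually_nhds_metric by blast
  define b0 where "b0 = d / 2"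
  have b0: "b0 > 0" "Bp * b0\<^sup>2 < Ap b0" "Bm * b0\<^sup>2 < Am b0" using d(1) d(2)[of b0] by (auto simp: b0_def dist_real_def)
  have F0: "F b0 > 0"
    unfolding F_def using slope_max(3)[OF q B(1) A(1) l b0(1,2)] slope_max(3)[OF q B(2) A(2) l b0(1,3)] by simp
  define Gp where "Gp = (1 + \<gamma>)\<^sup>2"
  define Gm where "Gm = (1 - \<gamma>)\<^sup>2"
  define mi where "mi = max 0 ((1 - \<gamma>) - (t - 1))"
  \<comment> \<open>The limiting equilibrium ratio, Bp X0^2 = Gp, at which the dipping flux is (t -
    \<gamma>)^2.\<close>
  define X0 where "X0 = (1 + \<gamma>) / (t + 1)"
  have X0: "0 < X0" "X0 < 1" using t \<gamma> t1 by (auto simp: X0_def)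
  define Df where "Df X = (1 - X) * (Bp - Gp / X) - mi\<^sup>2" for X
  have "Df X0 > 0"
  proof -
    have "(1 - X0) * (Bp - Gp / X0) = (t - \<gamma>)\<^sup>2"
    proof -
      define s where "s = t + 1"
      define r where "r = 1 + \<gamma>"
      have s: "s > 0" "r > 0" using t1 \<gamma> by (auto simp: s_def r_def)
      have "(1 - r / s) * (s\<^sup>2 - r\<^sup>2 / (r / s)) = (s - r)\<^sup>2"
        using s by (simp add: power2_eq_square field_simps)
      then show ?thesis by (simp add: X0_def Bp_def Gp_def s_def r_def)
    qed
    moreover have "mi\<^sup>2 < (t - \<gamma>)\<^sup>2" using t t1 \<gamma> by (intro power_strict_mono) (auto simp: mi_def)
    ultimately show ?thesis by (simp add: Df_def)
  qed
  moreover have "isCont Df X0" unfolding Df_def using X0 by (intro continuous_intros) auto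
  ultimately have "\<forall>\<^sub>F X in nhds X0. Df X > 0" by (intro cont_pos_local)
  then obtain d1 where d1: "d1 > 0" "\<And>X. dist X X0 < d1 \<Longrightarrow> Df X > 0" unfolding eventually_nhds_metric by blast
  \<comment> \<open>Slightly above the equilibrium ratio: this gives Gp < Bp X^2 strictly, as
    \<open>cmid_small\<close> requires for large \<open>b\<close>, while by continuity the flux
    still beats that of the left half.\<close>
  define X where "X = min (X0 + d1 / 2) ((X0 + 1) / 2)"
  have X: "X0 < X" "X < 1" using d1 X0 by (auto simp: X_def min_less_iff_disj)
  have DX: "(1 - X) * (Bp - Gp / X) > mi\<^sup>2" using d1(2)[of X] X d1(1) by (auto simp: Df_def X_def dist_real_def)
  have X0': "0 < X" using X X0 by simp
  have GX: "Gp < Bp * X\<^sup>2"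
  proof -
    have "X0\<^sup>2 < X\<^sup>2" using X X0 by (intro power_strict_mono) auto
    then have "Bp * X0\<^sup>2 < Bp * X\<^sup>2" using B by simp
    moreover have "Bp * X0\<^sup>2 = Gp" using t1 by (simp add: Bp_def X0_def Gp_def power_divide)
    ultimately show ?thesis by simp
  qed
  have inv: "((\<lambda>b. c / b) \<longlongrightarrow> 0) at_top" for c :: real
    by (rule tendsto_divide_0[OF tendsto_const filterlim_at_top_imp_at_infinity[OF filterlim_ident]])
  have Hp: "((\<lambda>b. Ap b / b\<^sup>2) \<longlongrightarrow> Gp) at_top"
  proof (rule Lim_transform_eventually)
    have "((\<lambda>b. e / b * (1 / b) + (\<mu> / b + (1 + \<gamma>))\<^sup>2) \<longlongrightarrow> 0 * 0 + (0 + (1 + \<gamma>))\<^sup>2) at_top"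
      by (intro tendsto_intros inv)
    then show "((\<lambda>b. e / b * (1 / b) + (\<mu> / b + (1 + \<gamma>))\<^sup>2) \<longlongrightarrow> Gp) at_top" by (simp add: Gp_def)
    show "\<forall>\<^sub>F b in at_top. e / b * (1 / b) + (\<mu> / b + (1 + \<gamma>))\<^sup>2 = Ap b / b\<^sup>2"
      using eventually_gt_at_top[of "0::real"] by eventually_elim (simp add: Ap_def field_simps power2_eq_square)
  qed
  have Hm: "((\<lambda>b. Am b / b\<^sup>2) \<longlongrightarrow> Gm) at_top"
  proof (rule Lim_transform_eventually)
    have "((\<lambda>b. e / b * (1 / b) + (\<mu> / b - (1 - \<gamma>))\<^sup>2) \<longlongrightarrow> 0 * 0 + (0 - (1 - \<gamma>))\<^sup>2) at_top"
      by (intro tendsto_intros inv)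
    then show "((\<lambda>b. e / b * (1 / b) + (\<mu> / b - (1 - \<gamma>))\<^sup>2) \<longlongrightarrow> Gm) at_top"
      by (simp add: Gm_def power2_commute)
    show "\<forall>\<^sub>F b in at_top. e / b * (1 / b) + (\<mu> / b - (1 - \<gamma>))\<^sup>2 = Am b / b\<^sup>2"
      using eventually_gt_at_top[of "0::real"] by eventually_elim (simp add: Am_def field_simps power2_eq_square)
  qed
  have "((\<lambda>b. (Bp * X\<^sup>2 - Ap b / b\<^sup>2) * l\<^sup>2 - 4 * q * b powr (2 / q - 1)) \<longlongrightarrow> (Bp * X\<^sup>2 - Gp) * l\<^sup>2 - 4 * q * 0) at_top"
    using q by (intro tendsto_intros Hp tendsto_neg_powr filterlim_ident) (auto simp: field_simps)
  then have ev1: "\<forall>\<^sub>F b in at_top. 0 < (Bp * X\<^sup>2 - Ap b / b\<^sup>2) * l\<^sup>2 - 4 * q * b powr (2 / q - 1)"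
    by (rule order_tendstoD) (use GX l in simp)
  have "((\<lambda>b. (1 - X) * (Bp - Ap b / b\<^sup>2 / X) - (max 0 (sqrt (Am b / b\<^sup>2) - sqrt Bm))\<^sup>2)
      \<longlongrightarrow> (1 - X) * (Bp - Gp / X) - (max 0 (sqrt Gm - sqrt Bm))\<^sup>2) at_top"
    using X0' by (intro tendsto_intros Hp Hm) auto
  then have ev2: "\<forall>\<^sub>F b in at_top. 0 < (1 - X) * (Bp - Ap b / b\<^sup>2 / X) - (max 0 (sqrt (Am b / b\<^sup>2) - sqrt Bm))\<^sup>2"
  proof (rule order_tendstoD)
    have "sqrt Gm = 1 - \<gamma>" "sqrt Bm = t - 1" using t1 \<gamma> by (auto simp: Gm_def Bm_def)
    then show "0 < (1 - X) * (Bp - Gp / X) - (max 0 (sqrt Gm - sqrt Bm))\<^sup>2" using DX by (simp add: mi_def)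
  qed
  have "\<forall>\<^sub>F b in at_top. b > b0 \<and> F b < 0"
    using ev1 ev2 eventually_gt_at_top[of b0]
  proof eventually_elim
    case (elim b)
    have b: "b > 0" using elim b0 by simp
    define h where "h = Ap b / b\<^sup>2"
    have h: "h \<ge> 0" "Ap b = h * b\<^sup>2" using A b by (auto simp: h_def)
    have pw: "b powr (1 + 2 / q) = b\<^sup>2 * b powr (2 / q - 1)"
      using b powr_add[of b 2 "2 / q - 1"] by simp
    have "4 * q * b powr (2 / q - 1) \<le> (Bp * X\<^sup>2 - h) * l\<^sup>2" using elim by (simp add: h_def)
    then have "b\<^sup>2 * (4 * q * b powr (2 / q - 1)) \<le> b\<^sup>2 * ((Bp * X\<^sup>2 - h) * l\<^sup>2)" by (intro mult_left_mono) auto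
    then have "(Bp * (X * b)\<^sup>2 - Ap b) * l\<^sup>2 \<ge> 4 * q * b powr (1 + 2 / q)"
      unfolding h(2) pw by (simp add: power_mult_distrib algebra_simps)
    from cmid_small[OF q B(1) A(1) l b X0' X(2) this]
    have cX: "cmid q l Bp (Ap b) b < X * b" .
    have hX: "h < Bp * X\<^sup>2"
    proof (rule ccontr)
      assume "\<not> h < Bp * X\<^sup>2"
      then have "(Bp * X\<^sup>2 - h) * l\<^sup>2 \<le> 0" by (intro mult_nonpos_nonneg) auto
      moreover have "4 * q * b powr (2 / q - 1) > 0" using q b by simp
      ultimately show False using elim by (simp add: h_def)
    qed
    have "Bp * X\<^sup>2 \<le> Bp * 1" using X X0' B by (intro mult_left_mono) (auto simp: power_le_one)
    then have "h < Bp" using hX by simp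
    then have Ab: "Ap b < Bp * b\<^sup>2" unfolding h(2) using b by simp
    note s = slope_min[OF q B(1) A(1) l b Ab]
    define c where "c = cmid q l Bp (Ap b) b"
    define sp where "sp = slope q l Bp (Ap b) b"
    define sm where "sm = slope q l Bm (Am b) b"
    have c: "c > 0" "c < X * b" using cmid_pos[OF q B(1) A(1) l b] cX by (auto simp: c_def)
    have "Ap b < Bp * c\<^sup>2" using s(2) unfolding c_def .
    then have "h * b\<^sup>2 < Bp * c\<^sup>2" unfolding h(2) .
    then have "h * (b / c)\<^sup>2 < Bp" using c by (simp add: power_divide field_simps)
    moreover have "1 / X \<le> b / c" using c X0' by (simp add: field_simps)
    ultimately have "(1 - 1 / (1 / X)) * (Bp - h * (1 / X)) \<le> (1 - 1 / (b / c)) * (Bp - h * (b / c))"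
      using X0' h by (intro flux_min_mono) auto
    moreover have spq: "b * ((1 - 1 / (b / c)) * (Bp - h * (b / c))) = (q * sp)\<^sup>2"
    proof -
      have "Ap b / (b * c) = h * (b / c)" using b c by (simp add: h(2) power2_eq_square)
      moreover have "b * (1 - 1 / (b / c)) = b - c" using b c by (simp add: right_diff_distrib)
      moreover have "(q * sp)\<^sup>2 = (b - c) * (Bp - Ap b / (b * c))" using s(4) unfolding sp_def c_def .
      ultimately show ?thesis by (simp only: mult.assoc[symmetric])
    qed
    moreover have "(max 0 (sqrt (Am b / b\<^sup>2) - sqrt Bm))\<^sup>2 < (1 - X) * (Bp - h / X)" using elim by (simp add: h_def)
    ultimately have "(max 0 (sqrt (Am b / b\<^sup>2) - sqrt Bm))\<^sup>2 < (1 - 1 / (b / c)) * (Bp - h * (b / c))" by simp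
    then have "b * (max 0 (sqrt (Am b / b\<^sup>2) - sqrt Bm))\<^sup>2 < b * ((1 - 1 / (b / c)) * (Bp - h * (b / c)))"
      using b by (intro mult_strict_left_mono)
    then have big: "b * (max 0 (sqrt (Am b / b\<^sup>2) - sqrt Bm))\<^sup>2 < (q * sp)\<^sup>2" unfolding spq .
    have sp: "sp < 0" using s(3) by (simp add: sp_def)
    have "sm < - sp"
    proof (cases "Bm * b\<^sup>2 < Am b")
      case False
      then have "sm \<le> 0" unfolding sm_def by (intro slope_nonpos q B A l b) simp
      then show ?thesis using sp by simp
    next
      case True
      have sm: "sm > 0" using slope_max(3)[OF q B(2) A(2) l b True] by (simp add: sm_def)
      have r: "sqrt (Am b / b\<^sup>2) = sqrt (Am b) / b" using b by (simp add: real_sqrt_divide)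
      have "Bm \<le> Am b / b\<^sup>2" using True b by (simp add: field_simps)
      then have "sqrt Bm \<le> sqrt (Am b) / b" unfolding r[symmetric] by simp
      then have "(q * sm)\<^sup>2 \<le> b * (max 0 (sqrt (Am b / b\<^sup>2) - sqrt Bm))\<^sup>2"
        using slope_sq_le[OF q B(2) A(2) l b True] unfolding r by (simp add: sm_def mult.commute)
      then have "(q * sm)\<^sup>2 < (q * - sp)\<^sup>2" using big by simp
      then have "q * sm < q * - sp" by (rule power2_less_imp_less) (use q sp in \<open>auto simp: mult_le_0_iff\<close>)
      then show ?thesis using q by (simp only: mult_less_cancel_left_pos)
    qed
    then show ?case using elim by (simp add: F_def sp_def sm_def)
  qed
  then obtain b1 where b1: "b1 > b0" "F b1 < 0" by (auto simp: eventually_at_top_linorder)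
  have "\<exists>b. b0 \<le> b \<and> b \<le> b1 \<and> F b = 0"
    using F0 b1 b0 cF by (intro IVT2) auto
  then obtain b where "b0 \<le> b" "F b = 0" by blast
  then show ?thesis using b0 unfolding F_def Ap_def Am_def Bp_def Bm_def by (intro exI[of _ b]) auto
qed

section \<open>The lemma of du Bois-Reymond on the circle\<close>

text \<open>Trigonometric polynomials: closed under differentiation, hence smooth, and dense by
  Stone-Weierstrass.\<close>

inductive trig :: "(real \<Rightarrow> real) \<Rightarrow> bool" where
  const: "trig (\<lambda>x. c)"
| sin: "trig sin"
| cos: "trig cos"
| add: "trig f \<Longrightarrow> trig g \<Longrightarrow> trig (\<lambda>x. f x + g x)"
| mult: "trig f \<Longrightarrow> trig g \<Longrightarrow> trig (\<lambda>x. f x * g x)"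

lemma trig_deriv: "trig f \<Longrightarrow> \<exists>f'. trig f' \<and> (\<forall>x. (f has_real_derivative f' x) (at x))"
proof (induction rule: trig.induct)
  case (const c)
  then show ?case by (intro exI[of _ "\<lambda>_. 0"]) (auto intro: trig.intros)
next
  case sin
  then show ?case by (intro exI[of _ cos]) (auto intro: trig.intros DERIV_sin)
next
  case cos
  have "trig (\<lambda>x. (- 1) * sin x)" by (intro trig.intros)
  then show ?case by (intro exI[of _ "\<lambda>x. (- 1) * sin x"]) (auto intro!: derivative_eq_intros)
next
  case (add f g)
  then obtain f' g' where d: "trig f'" "\<And>x. (f has_real_derivative f' x) (at x)"
      "trig g'" "\<And>x. (g has_real_derivative g' x) (at x)" by blast
  then show ?case by (intro exI[of _ "\<lambda>x. f' x + g' x"]) (auto intro: trig.intros derivative_intros)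
next
  case (mult f g)
  then obtain f' g' where d: "trig f'" "\<And>x. (f has_real_derivative f' x) (at x)"
      "trig g'" "\<And>x. (g has_real_derivative g' x) (at x)" by blast
  have "trig (\<lambda>x. f' x * g x + g' x * f x)" using d mult by (intro trig.intros)
  then show ?case using d
    by (intro exI[of _ "\<lambda>x. f' x * g x + g' x * f x"]) (auto intro!: derivative_eq_intros)
qed

lemma trig_deriv': assumes "trig f" shows "trig (deriv f)" "\<And>x. f differentiable (at x)"
proof -
  obtain f' where f': "trig f'" "\<And>x. (f has_real_derivative f' x) (at x)" using trig_deriv[OF assms] by blast
  have "deriv f = f'" using f'(2) by (auto intro: DERIV_imp_deriv)
  then show "trig (deriv f)" using f' by simp
  show "f differentiable (at x)" for x using f'(2) real_differentiable_def by blast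
qed

lemma trig_higher_deriv: "trig f \<Longrightarrow> trig ((deriv ^^ k) f)"
  by (induction k arbitrary: f) (auto simp: funpow_Suc_right trig_deriv'(1) simp del: funpow.simps)

lemma trig_cont: "trig f \<Longrightarrow> continuous_on S f"
  by (meson trig_deriv DERIV_isCont continuous_at_imp_continuous_on)

lemma trig_periodic: "trig f \<Longrightarrow> f (x + 2 * pi) = f x"
  by (induction rule: trig.induct) auto

lemma trig_compose_cis:
  assumes "real_polynomial_function (P :: complex \<Rightarrow> real)"
  shows "trig (\<lambda>x. P (cis x))"
  using assms
proof (induction rule: real_polynomial_function.induct)
  case (linear f)
  have "f (cis x) = f 1 * cos x + f \<i> * sin x" for x
  proof -
    have "cis x = cos x *\<^sub>R 1 + sin x *\<^sub>R \<i>" by (simp add: complex_eq_iff)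
    then show ?thesis
      using linear by (simp add: bounded_linear.linear linear_add linear_scale mult.commute)
  qed
  moreover have "trig (\<lambda>x. f 1 * cos x + f \<i> * sin x)" by (intro trig.intros)
  ultimately show ?case by simp
qed (auto intro: trig.intros)

text \<open>Vanishing near the end points makes g(Arg z) continuous on the whole unit circle, also
  across the branch cut of \<open>Arg\<close>. Real polynomials on the circle pull back to
  trigonometric polynomials.\<close>

lemma trig_approx:
  fixes g :: "real \<Rightarrow> real"
  assumes g: "continuous_on {-pi..pi} g" and d: "d > 0" "d < pi" and z: "\<And>x. \<bar>x\<bar> \<ge> d \<Longrightarrow> g x = 0" and e: "e > 0"
  obtains f where "trig f" "\<And>x. x \<in> {-pi..pi} \<Longrightarrow> \<bar>g x - f x\<bar> < e"
proof -
  define G where "G z = g (Arg z)" for z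
  have Gcis: "G (cis x) = g x" if "x \<in> {-pi..pi}" for x
  proof (cases "x = -pi")
    case True
    have "cis (- pi) = cis pi" by (simp add: complex_eq_iff)
    moreover have "Arg (cis pi) = pi" by (rule Arg_cis) simp
    ultimately have "G (cis x) = g pi" using True by (simp only: G_def)
    then show ?thesis using z[of pi] z[of "- pi"] d True by simp
  next
    case False
    then have "Arg (cis x) = x" using that by (intro Arg_cis) auto
    then show ?thesis by (simp add: G_def)
  qed
  have cg: "continuous (at t within {-pi..pi}) g" if "t \<in> {-pi..pi}" for t
    using g that by (simp add: continuous_on_eq_continuous_within)
  have "continuous_on (sphere 0 1) G"
    unfolding continuous_on_eq_continuous_within
  proof
    fix w :: complex assume w: "w \<in> sphere 0 1"
    have Re_w: "Re v = cos (Arg v)" if "v \<in> sphere 0 1" for v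
      using that cos_Arg[of v] by (cases "v = 0") auto
    have Arg_in: "Arg v \<in> {-pi..pi}" for v using Arg_bounded[of v] by auto
    show "continuous (at w within sphere 0 1) G"
    proof (cases "w \<in> \<real>\<^sub>\<le>\<^sub>0")
      case False
      have "(Arg \<longlongrightarrow> Arg w) (at w within sphere 0 1)"
        using continuous_within_Arg[OF False] by (simp add: continuous_within)
      then have "((\<lambda>v. g (Arg v)) \<longlongrightarrow> g (Arg w)) (at w within sphere 0 1)"
        by (rule continuous_on_tendsto_compose[OF g]) (use Arg_in in auto)
      then show ?thesis unfolding continuous_within G_def .
    next
      case True
      then have "w = -1" using w by (auto simp: complex_nonpos_Reals_iff complex_eq_iff norm_complex_def)
      have "\<forall>\<^sub>F v in at w within sphere 0 1. G v = 0"
      proof -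
        have "(Re \<longlongrightarrow> Re w) (at w within sphere 0 1)" by (rule tendsto_Re[OF tendsto_ident_at])
        moreover have "Re w < cos d" using cos_monotone_0_pi[of d pi] d by (simp add: \<open>w = -1\<close>)
        ultimately have "\<forall>\<^sub>F v in at w within sphere 0 1. Re v < cos d" by (rule order_tendstoD)
        moreover have "\<forall>\<^sub>F v in at w within sphere 0 1. v \<in> sphere 0 1"
          by (simp add: eventually_at_filter)
        ultimately show ?thesis
        proof eventually_elim
          case (elim v)
          have "\<bar>Arg v\<bar> \<ge> d"
          proof (rule ccontr)
            assume "\<not> \<bar>Arg v\<bar> \<ge> d"
            then have "cos d < cos \<bar>Arg v\<bar>" using d by (intro cos_monotone_0_pi) auto
            then show False using elim Re_w by simp
          qed
          then show ?case by (simp add: G_def z)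
        qed
      qed
      moreover have "Arg w = pi" using Arg_cis[of pi] \<open>w = -1\<close> by simp
      then have "G w = 0" using z[of pi] d by (simp add: G_def)
      ultimately show ?thesis unfolding continuous_within by (simp add: tendsto_eventually)
    qed
  qed
  then obtain P where P: "real_polynomial_function P" "\<And>v. v \<in> sphere 0 1 \<Longrightarrow> \<bar>G v - P v\<bar> < e"
    using Stone_Weierstrass_real_polynomial_function[of "sphere 0 1 :: complex set" G e] e by auto
  show thesis
  proof (rule that[of "\<lambda>x. P (cis x)"])
    show "trig (\<lambda>x. P (cis x))" using P(1) by (rule trig_compose_cis)
    show "\<bar>g x - P (cis x)\<bar> < e" if "x \<in> {-pi..pi}" for x using P(2)[of "cis x"] Gcis[OF that] by simp
  qed
qed


text \<open>The zero mean is what makes the primitive periodic.\<close>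

lemma trig_smooth_primitive:
  assumes f: "trig f" and m: "integral {-pi..pi} f = 0"
  obtains \<psi> where "smooth_fun \<psi>" "periodic2pi \<psi>" "deriv \<psi> = f"
proof -
  have "\<exists>F. \<forall>x :: real. (-\<infinity>::ereal) < x \<longrightarrow> x < (\<infinity>::ereal) \<longrightarrow> (F has_vector_derivative f x) (at x)"
    by (rule einterval_antiderivative) (use trig_cont[OF f, of UNIV] in \<open>auto simp: continuous_on_eq_continuous_at\<close>)
  then obtain F where F: "\<And>x. (F has_real_derivative f x) (at x)"
    by (auto simp: has_real_derivative_iff_has_vector_derivative)
  have d: "deriv F = f" using F by (auto intro: DERIV_imp_deriv)
  have "smooth_fun F"
    unfolding smooth_fun_def
  proof (intro allI)
    fix k x
    show "((deriv ^^ k) F) differentiable (at x)"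
    proof (cases k)
      case 0
      then show ?thesis using F real_differentiable_def by auto
    next
      case (Suc j)
      then show ?thesis using trig_deriv'(2)[OF trig_higher_deriv[OF f, of j]]
        by (simp add: funpow_Suc_right d del: funpow.simps)
    qed
  qed
  moreover have "periodic2pi F"
    unfolding periodic2pi_def
  proof
    fix x
    have "((\<lambda>x. F (x + 2 * pi) - F x) has_real_derivative f (y + 2 * pi) * 1 - f y) (at y)" for y
      by (intro derivative_intros F DERIV_chain2[of F]) (auto intro!: derivative_eq_intros)
    then have "\<And>y. ((\<lambda>x. F (x + 2 * pi) - F x) has_real_derivative 0) (at y)" by (simp add: trig_periodic[OF f])
    then have "F (x + 2 * pi) - F x = F (- pi + 2 * pi) - F (- pi)" by (intro DERIV_isconst_all) auto
    moreover have "(f has_integral F pi - F (- pi)) {-pi..pi}"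
      by (intro fundamental_theorem_of_calculus)
        (auto simp: has_real_derivative_iff_has_vector_derivative[symmetric] intro: F has_field_derivative_at_within)
    then have "F pi - F (- pi) = 0" using m by (simp add: integral_unique)
    ultimately show "F (x + 2 * pi) = F x" by simp
  qed
  ultimately show thesis using that d by blast
qed

lemma abs_integrable_mult_continuous:
  fixes g \<sigma> :: "real \<Rightarrow> real"
  assumes "\<sigma> absolutely_integrable_on {a..b}" "continuous_on {a..b} g"
  shows "(\<lambda>x. \<sigma> x * g x) absolutely_integrable_on {a..b}"
proof -
  have "(\<lambda>x. g x * \<sigma> x) absolutely_integrable_on {a..b}"
    using assms
    by (intro absolutely_integrable_bounded_measurable_product_real continuous_imp_measurable_on_sets_lebesgue
        compact_imp_bounded compact_continuous_image) auto
  then show ?thesis by (simp add: mult.commute)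
qed

lemma annihilates_continuous:
  assumes \<rho>: "\<rho> absolutely_integrable_on {-pi..pi}"
    and tr: "\<And>f. trig f \<Longrightarrow> integral {-pi..pi} (\<lambda>x. \<rho> x * f x) = 0"
    and g: "continuous_on {-pi..pi} g" and d: "d > 0" "d < pi" and z: "\<And>x. \<bar>x\<bar> \<ge> d \<Longrightarrow> g x = 0"
  shows "integral {-pi..pi} (\<lambda>x. \<rho> x * g x) = 0"
proof -
  define I where "I = integral {-pi..pi} (\<lambda>x. \<bar>\<rho> x\<bar>)"
  have ab: "(\<lambda>x. \<bar>\<rho> x\<bar>) integrable_on {-pi..pi}"
    using \<rho> by (simp add: absolutely_integrable_on_def)
  have I: "I \<ge> 0" unfolding I_def by (intro integral_nonneg ab) auto
  have "\<bar>integral {-pi..pi} (\<lambda>x. \<rho> x * g x)\<bar> \<le> 0 + e" if e: "e > 0" for e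
  proof -
    have e': "e / (I + 1) > 0" using e I by simp
    obtain f where f: "trig f" "\<And>x. x \<in> {-pi..pi} \<Longrightarrow> \<bar>g x - f x\<bar> < e / (I + 1)"
      using trig_approx[OF g d z e'] by blast
    have ig: "(\<lambda>x. \<rho> x * g x) integrable_on {-pi..pi}"
      using abs_integrable_mult_continuous[OF \<rho> g] by (simp add: absolutely_integrable_on_def)
    have "(\<lambda>x. \<rho> x * f x) integrable_on {-pi..pi}"
      using abs_integrable_mult_continuous[OF \<rho> trig_cont[OF f(1)]] by (simp add: absolutely_integrable_on_def)
    note fint = this
    have "integral {-pi..pi} (\<lambda>x. \<rho> x * g x - \<rho> x * f x) = integral {-pi..pi} (\<lambda>x. \<rho> x * g x)"
      using tr[OF f(1)] by (simp add: integral_diff[OF ig fint])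
    moreover have "norm (integral {-pi..pi} (\<lambda>x. \<rho> x * g x - \<rho> x * f x)) \<le> integral {-pi..pi} (\<lambda>x. e / (I + 1) * \<bar>\<rho> x\<bar>)"
    proof (rule integral_norm_bound_integral)
      show "(\<lambda>x. \<rho> x * g x - \<rho> x * f x) integrable_on {-pi..pi}" by (intro integrable_diff ig fint)
      show "(\<lambda>x. e / (I + 1) * \<bar>\<rho> x\<bar>) integrable_on {-pi..pi}" by (intro integrable_on_mult_right ab)
      fix x assume x: "x \<in> {-pi..pi}"
      have "\<bar>\<rho> x\<bar> * \<bar>g x - f x\<bar> \<le> \<bar>\<rho> x\<bar> * (e / (I + 1))" using f(2)[OF x] by (intro mult_left_mono) auto
      then show "norm (\<rho> x * g x - \<rho> x * f x) \<le> e / (I + 1) * \<bar>\<rho> x\<bar>"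
        by (simp only: right_diff_distrib[symmetric] real_norm_def abs_mult mult.commute)
    qed
    moreover have "integral {-pi..pi} (\<lambda>x. e / (I + 1) * \<bar>\<rho> x\<bar>) = e / (I + 1) * I"
      unfolding I_def by (rule integral_mult_right)
    moreover have "e / (I + 1) * I \<le> e" using e I by (simp add: field_simps)
    ultimately show ?thesis unfolding real_norm_def by linarith
  qed
  then have "\<bar>integral {-pi..pi} (\<lambda>x. \<rho> x * g x)\<bar> \<le> 0" by (rule field_le_epsilon)
  then show ?thesis by simp
qed

text \<open>The sign of \<rho> is almost everywhere a limit of continuous functions. Clamped to
  [-1, 1] and cut off near the end points they become admissible for
  \<open>annihilates_continuous\<close>, and dominated convergence shows that the integral of
  \<bar>\<rho>\<bar> vanishes.\<close>

lemma annihilates_imp_zero: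
  assumes \<rho>: "\<rho> absolutely_integrable_on {-pi..pi}"
    and tr: "\<And>f. trig f \<Longrightarrow> integral {-pi..pi} (\<lambda>x. \<rho> x * f x) = 0"
  shows "AE x in lborel. x \<in> {-pi..pi} \<longrightarrow> \<rho> x = 0"
proof -
  define S where "S = {-pi..pi}"
  define M where "M = lebesgue_on S"
  have S: "S \<in> sets lebesgue" by (simp add: S_def)
  have int: "integrable M \<rho>"
    unfolding M_def using \<rho> S by (simp add: absolutely_integrable_imp_integrable S_def)
  then have meas [measurable]: "\<rho> \<in> borel_measurable M" by simp
  have "(\<lambda>x. if \<rho> x = 0 then 0 else if 0 < \<rho> x then 1 else - 1 :: real) \<in> borel_measurable M" by measurable
  then have "(\<lambda>x. sgn (\<rho> x)) measurable_on S"
    unfolding M_def measurable_on_iff_borel_measurable[OF S] by (simp add: sgn_if)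
  then obtain Z g where Z: "negligible Z" and g: "\<And>k. continuous_on UNIV (g k)"
    and lim: "\<And>x. x \<notin> Z \<Longrightarrow> (\<lambda>k. g k x) \<longlonglongrightarrow> (if x \<in> S then sgn (\<rho> x) else 0)"
    unfolding measurable_on_def by blast
  define cut where "cut k x = max 0 (min 1 (real (k + 1) * (pi - \<bar>x\<bar>) - 1))" for k :: nat and x :: real
  define h where "h k x = cut k x * max (-1) (min 1 (g k x))" for k x
  have hb: "\<bar>h k x\<bar> \<le> 1" for k x
  proof -
    have "\<bar>cut k x\<bar> \<le> 1" "\<bar>max (-1) (min 1 (g k x))\<bar> \<le> 1" by (auto simp: cut_def)
    then show ?thesis unfolding h_def abs_mult by (intro mult_le_one) auto
  qed
  have hc: "continuous_on A (h k)" for k A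
    unfolding h_def cut_def by (intro continuous_intros continuous_on_subset[OF g]) auto
  have h0: "integral\<^sup>L M (\<lambda>x. \<rho> x * h k x) = 0" for k
  proof -
    define d where "d = max (pi / 2) (pi - 1 / real (k + 1))"
    have d: "d > 0" "d < pi" by (auto simp: d_def less_max_iff_disj)
    have "h k x = 0" if "\<bar>x\<bar> \<ge> d" for x
    proof -
      have "pi - \<bar>x\<bar> \<le> 1 / real (k + 1)" using that by (simp add: d_def)
      then have "real (k + 1) * (pi - \<bar>x\<bar>) \<le> real (k + 1) * (1 / real (k + 1))" by (intro mult_left_mono) auto
      then have "real (k + 1) * (pi - \<bar>x\<bar>) \<le> 1" by simp
      then have "cut k x = 0" by (simp add: cut_def)
      then show ?thesis by (simp add: h_def)
    qed
    then have "integral S (\<lambda>x. \<rho> x * h k x) = 0"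
      using annihilates_continuous[OF \<rho> tr hc d] by (simp add: S_def)
    moreover have "(\<lambda>x. \<rho> x * h k x) absolutely_integrable_on S"
      unfolding S_def by (rule abs_integrable_mult_continuous[OF \<rho> hc])
    then have "integrable M (\<lambda>x. \<rho> x * h k x)"
      unfolding M_def using S by (intro absolutely_integrable_imp_integrable)
    ultimately show ?thesis unfolding M_def by (simp add: lebesgue_integral_eq_integral S)
  qed
  have AEZ: "AE x in M. x \<in> S \<and> x \<notin> Z \<and> x \<noteq> pi \<and> x \<noteq> - pi"
  proof -
    have "negligible (Z \<union> {pi, - pi})" using Z by (intro negligible_Un) auto
    then have "Z \<union> {pi, - pi} \<in> null_sets lebesgue" by (simp only: negligible_iff_null_sets)
    then have "AE x in lebesgue. x \<notin> Z \<union> {pi, - pi}" by (rule AE_not_in)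
    then have "AE x in lebesgue. x \<in> S \<longrightarrow> x \<in> S \<and> x \<notin> Z \<and> x \<noteq> pi \<and> x \<noteq> - pi" by eventually_elim auto
    then show ?thesis unfolding M_def by (subst AE_restrict_space_iff) (use S in auto)
  qed
  have "(\<lambda>k. integral\<^sup>L M (\<lambda>x. \<rho> x * h k x)) \<longlonglongrightarrow> integral\<^sup>L M (\<lambda>x. \<bar>\<rho> x\<bar>)"
  proof (rule integral_dominated_convergence)
    show "(\<lambda>x. \<bar>\<rho> x\<bar>) \<in> borel_measurable M" by measurable
    show "integrable M (\<lambda>x. \<bar>\<rho> x\<bar>)" using int by (rule integrable_abs)
    have "h k \<in> borel_measurable M" for k
      unfolding M_def using S by (intro continuous_imp_measurable_on_sets_lebesgue hc)
    then show "(\<lambda>x. \<rho> x * h k x) \<in> borel_measurable M" for k by measurable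
    show "AE x in M. norm (\<rho> x * h k x) \<le> \<bar>\<rho> x\<bar>" for k
      using hb[of k] by (auto simp: abs_mult mult_left_le)
    show "AE x in M. (\<lambda>k. \<rho> x * h k x) \<longlonglongrightarrow> \<bar>\<rho> x\<bar>"
      using AEZ
    proof eventually_elim
      case (elim x)
      then have x: "pi - \<bar>x\<bar> > 0" by (auto simp: S_def)
      have "(\<lambda>k. cut k x) \<longlonglongrightarrow> 1"
      proof (rule tendsto_eventually)
        obtain K where K: "2 / (pi - \<bar>x\<bar>) < real K" using reals_Archimedean2 by blast
        show "\<forall>\<^sub>F k in sequentially. cut k x = 1"
          using eventually_ge_at_top[of K]
        proof eventually_elim
          case (elim k)
          have "2 / (pi - \<bar>x\<bar>) \<le> real (k + 1)" using K elim by simp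
          then have "2 \<le> real (k + 1) * (pi - \<bar>x\<bar>)" using x by (simp add: pos_divide_le_eq)
          then show ?case by (simp add: cut_def)
        qed
      qed
      moreover have "(\<lambda>k. max (-1) (min 1 (g k x))) \<longlonglongrightarrow> max (-1) (min 1 (sgn (\<rho> x)))"
        using lim[of x] elim by (intro tendsto_intros) auto
      then have "(\<lambda>k. max (-1) (min 1 (g k x))) \<longlonglongrightarrow> sgn (\<rho> x)" by (simp add: sgn_if split: if_splits)
      ultimately have "(\<lambda>k. \<rho> x * h k x) \<longlonglongrightarrow> \<rho> x * (1 * sgn (\<rho> x))"
        unfolding h_def by (intro tendsto_intros)
      then show ?case by (simp add: abs_sgn)
    qed
  qed
  then have "integral\<^sup>L M (\<lambda>x. \<bar>\<rho> x\<bar>) = 0" by (simp add: h0 LIMSEQ_const_iff)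
  then have "AE x in M. \<bar>\<rho> x\<bar> = 0" using int by (subst (asm) integral_nonneg_eq_0_iff_AE) auto
  then have "AE x in lebesgue. x \<in> S \<longrightarrow> \<bar>\<rho> x\<bar> = 0"
    unfolding M_def by (subst (asm) AE_restrict_space_iff) (use S in auto)
  then show ?thesis by (simp add: AE_completion_iff S_def)
qed

text \<open>A trigonometric polynomial minus its mean is the derivative of a test function. Hence
  \<sigma> minus its own mean annihilates all trigonometric polynomials.\<close>

theorem du_Bois_Reymond_circle:
  assumes \<sigma>: "\<sigma> absolutely_integrable_on {-pi..pi}"
    and tr: "\<And>\<psi>. smooth_fun \<psi> \<Longrightarrow> periodic2pi \<psi> \<Longrightarrow> integral {-pi..pi} (\<lambda>x. \<sigma> x * deriv \<psi> x) = 0"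
  shows "\<exists>c. AE x in lborel. x \<in> {-pi..pi} \<longrightarrow> \<sigma> x = c"
proof -
  have i\<sigma>: "\<sigma> integrable_on {-pi..pi}" using \<sigma> by (simp add: absolutely_integrable_on_def)
  define c where "c = integral {-pi..pi} \<sigma> / (2 * pi)"
  have c: "integral {-pi..pi} \<sigma> = 2 * pi * c" by (simp add: c_def)
  have "AE x in lborel. x \<in> {-pi..pi} \<longrightarrow> \<sigma> x - c = 0"
  proof (rule annihilates_imp_zero)
    show "(\<lambda>x. \<sigma> x - c) absolutely_integrable_on {-pi..pi}"
      by (intro set_integral_diff \<sigma> absolutely_integrable_continuous_real continuous_intros)
    fix f assume f: "trig f"
    define m where "m = integral {-pi..pi} f / (2 * pi)"
    have m: "integral {-pi..pi} f = 2 * pi * m" by (simp add: m_def)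
    have fi: "f integrable_on {-pi..pi}" by (intro integrable_continuous_real trig_cont f)
    have "trig (\<lambda>x. f x + - m)" by (intro trig.intros f)
    then have t: "trig (\<lambda>x. f x - m)" by simp
    have "integral {-pi..pi} (\<lambda>x. f x - m) = 0"
      using m by (simp add: integral_diff[OF fi integrable_const_ivl[of m]])
    then obtain \<psi> where \<psi>: "smooth_fun \<psi>" "periodic2pi \<psi>" "deriv \<psi> = (\<lambda>x. f x - m)"
      using trig_smooth_primitive[OF t] by blast
    have "(\<lambda>x. \<sigma> x * f x) integrable_on {-pi..pi}"
      using abs_integrable_mult_continuous[OF \<sigma> trig_cont[OF f]] by (simp add: absolutely_integrable_on_def)
    then have h1: "((\<lambda>x. \<sigma> x * f x) has_integral integral {-pi..pi} (\<lambda>x. \<sigma> x * f x)) {-pi..pi}" by (rule integrable_integral)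
    have h2: "((\<lambda>x. \<sigma> x * m) has_integral 2 * pi * c * m) {-pi..pi}"
      using has_integral_mult_left[OF integrable_integral[OF i\<sigma>], of m] c by simp
    have h3: "((\<lambda>x. c * f x) has_integral c * (2 * pi * m)) {-pi..pi}"
      using has_integral_mult_right[OF integrable_integral[OF fi], of c] m by simp
    have "((\<lambda>x. \<sigma> x * f x - \<sigma> x * m) has_integral integral {-pi..pi} (\<lambda>x. \<sigma> x * f x) - 2 * pi * c * m) {-pi..pi}"
      by (rule has_integral_diff[OF h1 h2])
    then have "integral {-pi..pi} (\<lambda>x. \<sigma> x * f x) = 2 * pi * c * m"
      using tr[OF \<psi>(1,2)] by (simp add: \<psi>(3) right_diff_distrib integral_unique)
    moreover have "((\<lambda>x. \<sigma> x * f x - c * f x) has_integral integral {-pi..pi} (\<lambda>x. \<sigma> x * f x) - c * (2 * pi * m)) {-pi..pi}"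
      by (rule has_integral_diff[OF h1 h3])
    ultimately show "integral {-pi..pi} (\<lambda>x. (\<sigma> x - c) * f x) = 0"
      by (simp add: left_diff_distrib integral_unique)
  qed
  then show ?thesis by (intro exI[of _ c]) (auto elim: eventually_mono)
qed

section \<open>From a solution on the circle to two quarter-circle problems\<close>

lemma halves_integral:
  fixes g g1 g2 :: "real \<Rightarrow> real"
  assumes c: "continuous_on {-pi..0} g1" "continuous_on {0..pi} g2"
    and e: "\<And>x. - pi < x \<Longrightarrow> x < 0 \<Longrightarrow> g x = g1 x" "\<And>x. 0 < x \<Longrightarrow> x < pi \<Longrightarrow> g x = g2 x"
  shows "g absolutely_integrable_on {-pi..pi}"
    and "integral {-pi..pi} g = integral {-pi..0} g1 + integral {0..pi} g2"
proof -
  have "g absolutely_integrable_on {-pi..0}"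
    by (rule absolutely_integrable_spike[OF absolutely_integrable_continuous_real[OF c(1)], of "{-pi, 0}"]) (use e in auto)
  moreover have "g absolutely_integrable_on {0..pi}"
    by (rule absolutely_integrable_spike[OF absolutely_integrable_continuous_real[OF c(2)], of "{0, pi}"]) (use e in auto)
  ultimately show "g absolutely_integrable_on {-pi..pi}" by (rule absolutely_integrable_on_combine) auto
  then have "g integrable_on {-pi..pi}" by (simp add: absolutely_integrable_on_def)
  then have "integral {-pi..pi} g = integral {-pi..0} g + integral {0..pi} g"
    by (intro Henstock_Kurzweil_Integration.integral_combine[symmetric]) auto
  moreover have "integral {-pi..0} g = integral {-pi..0} g1"
    by (rule integral_spike[of "{-pi, 0}"]) (use e in auto)
  moreover have "integral {0..pi} g = integral {0..pi} g2"
    by (rule integral_spike[of "{0, pi}"]) (use e in auto)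
  ultimately show "integral {-pi..pi} g = integral {-pi..0} g1 + integral {0..pi} g2" by simp
qed

lemma lam_eq: "- pi < x \<Longrightarrow> x < 0 \<Longrightarrow> lam x = -1" "0 < x \<Longrightarrow> x < pi \<Longrightarrow> lam x = 1"
proof -
  show "lam x = 1" if "0 < x" "x < pi" using sin_gt_zero[OF that] by (simp add: lam_def)
  show "lam x = -1" if "- pi < x" "x < 0" using sin_gt_zero[of "- x"] that by (simp add: lam_def)
qed

lemma lam_abs_integrable: "lam absolutely_integrable_on {-pi..pi}"
  by (rule halves_integral(1)[of "\<lambda>_. -1" "\<lambda>_. 1"]) (auto simp: lam_eq)

lemma lam_integral:
  assumes "continuous_on {-pi..pi} g"
  shows "integral {-pi..pi} (\<lambda>x. lam x * g x) = integral {0..pi} g - integral {-pi..0} g"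
proof -
  have c: "continuous_on {-pi..0} (\<lambda>x. - g x)" "continuous_on {0..pi} g"
    by (auto intro!: continuous_intros intro: continuous_on_subset[OF assms])
  show ?thesis
    by (subst halves_integral(2)[OF c]) (auto simp: lam_eq)
qed

lemma integral_halves:
  assumes "continuous_on {-pi..pi} (g :: real \<Rightarrow> real)"
  shows "integral {-pi..pi} g = integral {-pi..0} g + integral {0..pi} g"
  by (rule halves_integral(2)) (auto intro: continuous_on_subset[OF assms])

lemma gammaN_bounds:
  assumes c: "continuous_on {-pi..pi} N" and pos: "\<And>x. N x > 0"
  shows "-1 < gammaN N" "gammaN N < 1" "integral {-pi..pi} N > 0"
    "integral {-pi..pi} (\<lambda>x. lam x * N x) = - gammaN N * integral {-pi..pi} N"
proof -
  have "integral {0..pi} (\<lambda>_. 0) < integral {0..pi} N"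
    by (intro integral_less_real continuous_intros continuous_on_subset[OF c]) (use pos pi_not_less_zero in \<open>auto simp: not_le\<close>)
  moreover have "integral {-pi..0} (\<lambda>_. 0) < integral {-pi..0} N"
    by (intro integral_less_real continuous_intros continuous_on_subset[OF c]) (use pos pi_not_less_zero in \<open>auto simp: not_le\<close>)
  ultimately have p: "integral {0..pi} N > 0" "integral {-pi..0} N > 0" by auto
  show 1: "integral {-pi..pi} N > 0" using p integral_halves[OF c] by simp
  show "-1 < gammaN N" "gammaN N < 1"
    using p unfolding gammaN_def lam_integral[OF c] integral_halves[OF c] by (auto simp: field_simps)
  show "integral {-pi..pi} (\<lambda>x. lam x * N x) = - gammaN N * integral {-pi..pi} N"
    using 1 by (simp add: gammaN_def)
qed

lemma smooth_fun_deriv: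
  assumes "smooth_fun \<psi>"
  shows "(\<psi> has_real_derivative deriv \<psi> x) (at x)" "continuous_on S (deriv \<psi>)" "continuous_on S \<psi>"
proof -
  have "((deriv ^^ 0) \<psi>) differentiable (at x)" "((deriv ^^ 1) \<psi>) differentiable (at x)" for x
    using assms unfolding smooth_fun_def by blast+
  then have d: "\<psi> differentiable (at x)" "deriv \<psi> differentiable (at x)" for x by auto
  show "(\<psi> has_real_derivative deriv \<psi> x) (at x)"
    using d(1) by (simp add: DERIV_deriv_iff_real_differentiable)
  show "continuous_on S (deriv \<psi>)" "continuous_on S \<psi>"
    using d by (auto intro!: continuous_at_imp_continuous_on differentiable_imp_continuous_within)
qed

lemma smooth_fun_integral:
  assumes "smooth_fun \<psi>" "a \<le> b"
  shows "integral {a..b} (deriv \<psi>) = \<psi> b - \<psi> a"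
proof (rule integral_unique, rule fundamental_theorem_of_calculus)
  show "(\<psi> has_vector_derivative deriv \<psi> x) (at x within {a..b})" for x
    using smooth_fun_deriv(1)[OF assms(1), of x]
    by (simp add: has_real_derivative_iff_has_vector_derivative has_vector_derivative_at_within)
qed (rule assms)

lemma smooth_fun_lam_integral:
  assumes \<psi>: "smooth_fun \<psi>" "periodic2pi \<psi>"
  shows "integral {-pi..pi} (\<lambda>x. lam x * deriv \<psi> x) = 2 * (\<psi> pi - \<psi> 0)"
proof -
  have "\<psi> (- pi + 2 * pi) = \<psi> (- pi)" using \<psi>(2) unfolding periodic2pi_def by blast
  then show ?thesis
    by (simp add: lam_integral[OF smooth_fun_deriv(2)[OF \<psi>(1)]] smooth_fun_integral[OF \<psi>(1)])
qed

text \<open>An integral does not see a change on a null set, so a weak derivative that agrees almost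
  everywhere with a continuous function is classical. Restricting to \<open>{a..b}\<close> allows
  one-sided derivatives at the junctions, where the coefficients jump.\<close>

lemma weak_imp_classical:
  fixes f g h :: "real \<Rightarrow> real"
  assumes w: "weak_deriv_circ f g" and ae: "AE x in lborel. x \<in> {a..b} \<longrightarrow> g x = h x"
    and h: "continuous_on {a..b} h" and ab: "- pi \<le> a" "b \<le> pi" and x: "x \<in> {a..b}"
  shows "(f has_real_derivative h x) (at x within {a..b})"
proof -
  have gi: "g integrable_on {-pi..pi}" using w by (simp add: weak_deriv_circ_def absolutely_integrable_on_def)
  have fw: "f y = f (- pi) + integral {-pi..y} g" if "y \<in> {-pi..pi}" for y
    using w that unfolding weak_deriv_circ_def by blast
  have fe: "f y = f a + integral {a..y} h" if y: "y \<in> {a..b}" for y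
  proof -
    have "integral {-pi..a} g + integral {a..y} g = integral {-pi..y} g"
      using y ab gi by (intro Henstock_Kurzweil_Integration.integral_combine integrable_on_subinterval[OF gi]) auto
    moreover have "f y = f (- pi) + integral {-pi..y} g" "f a = f (- pi) + integral {-pi..a} g"
      using fw[of y] fw[of a] y ab by auto
    ultimately have "f y = f a + integral {a..y} g" by linarith
    moreover have "(g has_integral integral {a..y} g) {a..y}"
      using y ab by (intro integrable_integral integrable_on_subinterval[OF gi]) auto
    then have "(h has_integral integral {a..y} g) {a..y}"
      by (subst (asm) has_integral_AE[where g=h]) (use ae y in \<open>auto elim: eventually_mono\<close>)
    ultimately show ?thesis by (simp add: integral_unique)
  qed
  have "((\<lambda>y. f a + integral {a..y} h) has_real_derivative 0 + h x) (at x within {a..b})"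
    by (intro derivative_intros integral_has_real_derivative h x)
  then have "((\<lambda>y. f a + integral {a..y} h) has_real_derivative h x) (at x within {a..b})" by simp
  then show ?thesis by (rule has_field_derivative_transform_within[OF _ zero_less_one x]) (rule fe[symmetric])
qed

text \<open>The function and its reflection solve the same equation with the same end values.
  Monotonicity of \<open>nl\<close> and the maximum principle identify them, and the derivative at
  the midpoint then equals its own negative.\<close>

lemma symmetric_of_ends:
  assumes q: "q > 1" "B \<ge> 0" "A \<ge> 0" and l: "l > 0"
    and pos: "\<And>x. x \<in> {0..2 * l} \<Longrightarrow> f x > 0"
    and d1: "\<And>x. x \<in> {0..2 * l} \<Longrightarrow> (f has_real_derivative f1 x) (at x within {0..2 * l})"
    and d2: "\<And>x. x \<in> {0..2 * l} \<Longrightarrow> (f1 has_real_derivative nl q B A (f x)) (at x within {0..2 * l})"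
    and ends: "f 0 = f (2 * l)"
  shows "\<And>x. x \<in> {0..2 * l} \<Longrightarrow> f (2 * l - x) = f x" and "DN q l B A f f1"
proof -
  have r1: "((\<lambda>x. f (2 * l - x)) has_real_derivative - f1 (2 * l - x)) (at x within {0..2 * l})" if "x \<in> {0..2 * l}" for x
  proof -
    have "((\<lambda>x. f (2 * l - x)) has_real_derivative f1 (2 * l - x) * - 1) (at x within {0..2 * l})"
      by (rule DERIV_image_chain[where f=f and g="\<lambda>x. 2 * l - x", unfolded o_def, OF has_field_derivative_subset[OF d1]])
        (use that in \<open>auto intro!: derivative_eq_intros\<close>)
    then show ?thesis by simp
  qed
  have r2: "((\<lambda>x. - f1 (2 * l - x)) has_real_derivative nl q B A (f (2 * l - x))) (at x within {0..2 * l})" if "x \<in> {0..2 * l}" for x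
  proof -
    have "((\<lambda>x. f1 (2 * l - x)) has_real_derivative nl q B A (f (2 * l - x)) * - 1) (at x within {0..2 * l})"
      by (rule DERIV_image_chain[where f=f1 and g="\<lambda>x. 2 * l - x", unfolded o_def, OF has_field_derivative_subset[OF d2]])
        (use that in \<open>auto intro!: derivative_eq_intros\<close>)
    from DERIV_minus[OF this] show ?thesis by simp
  qed
  have le: "f x - f (2 * l - x) \<le> 0" if x: "x \<in> {0..2 * l}" for x
  proof (rule max_principle[where z="\<lambda>x. f x - f (2 * l - x)" and l="2 * l"])
    fix y assume y: "y \<in> {0..2 * l}"
    show "((\<lambda>x. f x - f (2 * l - x)) has_real_derivative f1 y - - f1 (2 * l - y)) (at y within {0..2 * l})"
      by (intro DERIV_diff d1 r1 y)
    show "((\<lambda>x. f1 x - - f1 (2 * l - x)) has_real_derivative nl q B A (f y) - nl q B A (f (2 * l - y))) (at y within {0..2 * l})"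
      by (intro DERIV_diff d2 r2 y)
    assume "f y - f (2 * l - y) > 0"
    then have "nl q B A (f (2 * l - y)) \<le> nl q B A (f y)"
      using y by (intro nl_mono q pos) auto
    then show "nl q B A (f y) - nl q B A (f (2 * l - y)) \<ge> 0" by simp
  qed (use ends x in auto)
  show sym: "f (2 * l - x) = f x" if x: "x \<in> {0..2 * l}" for x
    using le[OF x] le[of "2 * l - x"] x by auto
  have "f1 l = 0"
  proof -
    have "((\<lambda>x. f (2 * l - x)) has_real_derivative - f1 (2 * l - l)) (at l within {0..2 * l})" using l by (intro r1) auto
    then have "((\<lambda>x. f (2 * l - x)) has_real_derivative - f1 l) (at l within {0..2 * l})" by simp
    then have "(f has_real_derivative - f1 l) (at l within {0..2 * l})"
      by (rule has_field_derivative_transform_within[OF _ zero_less_one]) (use l sym in auto)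
    moreover have "(f has_real_derivative f1 l) (at l within {0..2 * l})" using l by (intro d1) auto
    moreover have "at l within {0..2 * l} = at l" using l by (intro at_within_interior) (simp add: interior_atLeastAtMost_real)
    ultimately have "- f1 l = f1 l" by (metis DERIV_unique)
    then show ?thesis by simp
  qed
  then show "DN q l B A f f1"
    unfolding DN_def using l pos by (auto intro: has_field_derivative_subset[OF d1] has_field_derivative_subset[OF d2])
qed

lemma ode_normal_form:
  fixes k q y P Q r s a :: real
  assumes "k > 0" "q > 0"
  shows "- 2 * k * q * y - 2 * a * P - k * s * P + k * r * Q = 0 \<longleftrightarrow> y = (r * Q - (2 * a / k + s) * P) / (2 * q)"
proof -
  have "- 2 * k * q * y - 2 * a * P - k * s * P + k * r * Q = k * ((r * Q - (2 * a / k + s) * P) - 2 * q * y)"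
    using assms by (simp add: field_simps)
  then show ?thesis using assms by (auto simp: field_simps)
qed

lemma trig_smooth: "trig f \<Longrightarrow> smooth_fun f"
  using trig_higher_deriv trig_deriv'(2) unfolding smooth_fun_def by blast

lemma exponent_facts:
  assumes "n \<ge> 3"
  shows "q_exp n > 2" "kappa n > 0" "1 / q_exp n = 1 / 2 - 1 / real n"
  using assms by (auto simp: q_exp_def kappa_def field_simps)

lemma AE_halves:
  assumes "AE x in lborel. x \<in> {-pi..pi} \<longrightarrow> P x"
  shows "AE x in lborel. x \<in> {0..pi} \<longrightarrow> P x \<and> lam x = 1"
    and "AE x in lborel. x \<in> {-pi..0} \<longrightarrow> P x \<and> lam x = - 1"
proof -
  have e: "AE x in lborel. (x \<in> {-pi..pi} \<longrightarrow> P x) \<and> x \<noteq> 0 \<and> x \<noteq> pi \<and> x \<noteq> - pi"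
    using assms AE_lborel_singleton[of 0] AE_lborel_singleton[of pi] AE_lborel_singleton[of "- pi"] by eventually_elim auto
  show "AE x in lborel. x \<in> {0..pi} \<longrightarrow> P x \<and> lam x = 1"
    using e by eventually_elim (auto simp: lam_eq)
  show "AE x in lborel. x \<in> {-pi..0} \<longrightarrow> P x \<and> lam x = - 1"
    using e by eventually_elim (auto simp: lam_eq)
qed

text \<open>Normalised so that the second equation disappears: its general solution is
  \<open>w' / (2 N) = b (\<lambda> + \<gamma>\<^sub>N)\<close> with \<open>b = \<phi>(0)\<^sup>q = \<phi>(\<pi>)\<^sup>q\<close>, because \<open>w\<close> is periodic.\<close>
lemma solution_flux:
  fixes w1 N \<phi> :: "real \<Rightarrow> real"
  assumes cN: "continuous_on {-pi..pi} N" and Np: "\<And>x. N x > 0" and pos: "\<And>x. \<phi> x > 0" and q: "q > 2"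
    and w: "weak_deriv_circ w w1" "periodic2pi w"
    and dist: "\<And>\<psi>. smooth_fun \<psi> \<Longrightarrow> periodic2pi \<psi> \<Longrightarrow>
          - integral {-pi..pi} (\<lambda>x. w1 x / (2 * N x) * deriv \<psi> x) = 2 * \<phi> 0 powr q * \<psi> 0 - 2 * \<phi> pi powr q * \<psi> pi"
  shows "\<phi> pi = \<phi> 0"
    and "AE x in lborel. x \<in> {-pi..pi} \<longrightarrow> w1 x / (2 * N x) = \<phi> 0 powr q * (lam x + gammaN N)"
proof -
  define b where "b = \<phi> 0 powr q"
  \<comment> \<open>The constant test function equates the weights of the two Dirac masses, hence
    the values of \<phi> at 0 and pi.\<close>
  have one: "smooth_fun (\<lambda>_. 1)" "periodic2pi (\<lambda>_. 1)" by (auto intro: trig_smooth trig.const simp: periodic2pi_def)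
  have e: "\<phi> pi powr q = \<phi> 0 powr q" using dist[OF one] by simp
  show "\<phi> pi = \<phi> 0"
  proof -
    have "(\<phi> pi powr q) powr (1 / q) = (\<phi> 0 powr q) powr (1 / q)" by (simp only: e)
    then show ?thesis using q pos[of 0] pos[of pi] by (simp add: powr_powr)
  qed
  have iw: "w1 absolutely_integrable_on {-pi..pi}" using w by (simp add: weak_deriv_circ_def)
  have cW: "continuous_on {-pi..pi} (\<lambda>x. 1 / (2 * N x))" using Np by (intro continuous_intros cN) (auto simp: less_imp_neq[symmetric])
  have iW: "(\<lambda>x. w1 x / (2 * N x)) absolutely_integrable_on {-pi..pi}"
    using abs_integrable_mult_continuous[OF iw cW] by simp
  have ib: "(\<lambda>x. b * lam x) absolutely_integrable_on {-pi..pi}"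
    using lam_abs_integrable by (intro set_integrable_mult_right)
  have "\<exists>c. AE x in lborel. x \<in> {-pi..pi} \<longrightarrow> w1 x / (2 * N x) - b * lam x = c"
  proof (rule du_Bois_Reymond_circle)
    show "(\<lambda>x. w1 x / (2 * N x) - b * lam x) absolutely_integrable_on {-pi..pi}"
      using iW ib by (intro set_integral_diff)
    fix \<psi> assume \<psi>: "smooth_fun \<psi>" "periodic2pi \<psi>"
    note c = smooth_fun_deriv(2)[OF \<psi>(1), of "{-pi..pi}"]
    have i1: "(\<lambda>x. w1 x / (2 * N x) * deriv \<psi> x) integrable_on {-pi..pi}"
      using abs_integrable_mult_continuous[OF iW c] by (simp add: absolutely_integrable_on_def)
    have i2: "(\<lambda>x. lam x * deriv \<psi> x) integrable_on {-pi..pi}"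
      using abs_integrable_mult_continuous[OF lam_abs_integrable c] by (simp add: absolutely_integrable_on_def)
    have h1: "((\<lambda>x. w1 x / (2 * N x) * deriv \<psi> x) has_integral 2 * b * (\<psi> pi - \<psi> 0)) {-pi..pi}"
    proof -
      have "integral {-pi..pi} (\<lambda>x. w1 x / (2 * N x) * deriv \<psi> x) = 2 * b * (\<psi> pi - \<psi> 0)"
        using dist[OF \<psi>] unfolding e b_def[symmetric] by (simp add: algebra_simps)
      then show ?thesis using integrable_integral[OF i1] by simp
    qed
    have h2: "((\<lambda>x. b * (lam x * deriv \<psi> x)) has_integral b * (2 * (\<psi> pi - \<psi> 0))) {-pi..pi}"
      using has_integral_mult_right[OF integrable_integral[OF i2], of b] smooth_fun_lam_integral[OF \<psi>] by simp
    show "integral {-pi..pi} (\<lambda>x. (w1 x / (2 * N x) - b * lam x) * deriv \<psi> x) = 0"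
      using has_integral_diff[OF h1 h2] by (simp add: left_diff_distrib mult.assoc integral_unique)
  qed
  then obtain c where c: "AE x in lborel. x \<in> {-pi..pi} \<longrightarrow> w1 x / (2 * N x) - b * lam x = c" by blast
  have w1: "AE x in lborel. x \<in> {-pi..pi} \<longrightarrow> w1 x = 2 * b * (lam x * N x) + 2 * c * N x"
    using c
  proof eventually_elim
    case (elim x)
    have Nx: "N x \<noteq> 0" using Np[of x] by simp
    show ?case
    proof
      assume "x \<in> {-pi..pi}"
      then have "w1 x / (2 * N x) = b * lam x + c" using elim by simp
      then have "w1 x = (b * lam x + c) * (2 * N x)" using Nx by (simp add: nonzero_divide_eq_eq)
      then show "w1 x = 2 * b * (lam x * N x) + 2 * c * N x" by (simp add: distrib_right)
    qed
  qed
  \<comment> \<open>Going once round the circle returns \<open>w\<close> to its value; this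
    determines the constant of integration \<open>c\<close>.\<close>
  have "integral {-pi..pi} w1 = 0"
  proof -
    have "w (- pi + 2 * pi) = w (- pi)" using w(2) unfolding periodic2pi_def by blast
    moreover have "\<forall>x\<in>{-pi..pi}. w x = w (- pi) + integral {-pi..x} w1" using w(1) unfolding weak_deriv_circ_def by blast
    then have "w pi = w (- pi) + integral {-pi..pi} w1" by (rule bspec) simp
    ultimately show ?thesis by simp
  qed
  then have "(w1 has_integral 0) {-pi..pi}" using iw by (metis absolutely_integrable_on_def integrable_integral)
  then have h0: "((\<lambda>x. 2 * b * (lam x * N x) + 2 * c * N x) has_integral 0) {-pi..pi}"
    by (subst (asm) has_integral_AE[OF w1])
  note G = gammaN_bounds[OF cN Np]
  define J where "J = integral {-pi..pi} N"
  have J: "J > 0" using G(3) by (simp add: J_def)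
  have Ni: "N integrable_on {-pi..pi}" by (rule integrable_continuous_real[OF cN])
  have lN: "(\<lambda>x. lam x * N x) integrable_on {-pi..pi}"
    using abs_integrable_mult_continuous[OF lam_abs_integrable cN] by (simp add: absolutely_integrable_on_def)
  have "((\<lambda>x. 2 * b * (lam x * N x) + 2 * c * N x) has_integral 2 * b * (- gammaN N * J) + 2 * c * J) {-pi..pi}"
    using integrable_integral[OF lN] integrable_integral[OF Ni] unfolding G(4) J_def[symmetric]
    by (intro has_integral_add has_integral_mult_right)
  then have "2 * b * (- gammaN N * J) + 2 * c * J = 0" using h0 by (rule has_integral_unique)
  then have "2 * J * (c - b * gammaN N) = 0" by (simp add: algebra_simps)
  then have "c = b * gammaN N" using J by simp
  then show "AE x in lborel. x \<in> {-pi..pi} \<longrightarrow> w1 x / (2 * N x) = \<phi> 0 powr q * (lam x + gammaN N)"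
    using c unfolding b_def[symmetric] by (auto elim!: eventually_mono simp: algebra_simps)
qed

text \<open>The left half is traversed backwards from 0, so its initial derivative is the negative
  of \<phi>' at 0. Since \<phi>' is continuous, the two initial slopes add up to zero.\<close>

lemma solution_data:
  assumes n: "n \<ge> 3" and cN: "continuous_on {-pi..pi} N" and Np: "\<And>x. N x > 0"
    and sol: "is_solution n N t \<eta> \<mu> \<phi> w"
  obtains b v1 w1 where "b > 0" "\<phi> 0 powr q_exp n = b" "periodic2pi \<phi>" "periodic2pi w" "weak_deriv_circ w w1"
    "DN (q_exp n) (pi / 2) ((t + 1)\<^sup>2) (2 * \<eta>\<^sup>2 / kappa n + (\<mu> + b * (1 + gammaN N))\<^sup>2) \<phi> v1"
    "DN (q_exp n) (pi / 2) ((t - 1)\<^sup>2) (2 * \<eta>\<^sup>2 / kappa n + (\<mu> - b * (1 - gammaN N))\<^sup>2) (\<lambda>x. \<phi> (- x)) (\<lambda>x. - v1 (- x))"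
    "\<And>x. x \<in> {0..pi} \<Longrightarrow> \<phi> (pi - x) = \<phi> x" "\<And>x. x \<in> {0..pi} \<Longrightarrow> \<phi> (- (pi - x)) = \<phi> (- x)"
    "AE x in lborel. x \<in> {-pi..pi} \<longrightarrow> w1 x = 2 * N x * (b * (lam x + gammaN N))"
proof -
  define q where "q = q_exp n"
  define \<gamma> where "\<gamma> = gammaN N"
  define k where "k = kappa n"
  have q: "q > 2" and k: "k > 0" using exponent_facts[OF n] by (auto simp: q_def k_def)
  obtain p \<phi>1 \<phi>2 w1 where pos: "\<And>x. \<phi> x > 0" and W2: "W2p_circ p \<phi> \<phi>1 \<phi>2" and W1: "W1p_circ p w w1"
    and ode: "AE x in lborel. x \<in> {-pi..pi} \<longrightarrow>
          - 2 * k * q * \<phi>2 x - 2 * \<eta>\<^sup>2 * \<phi> x powr (- q - 1)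
          - k * (\<mu> + w1 x / (2 * N x))\<^sup>2 * \<phi> x powr (- q - 1) + k * (tau t x)\<^sup>2 * \<phi> x powr (q - 1) = 0"
    and dist: "\<And>\<psi>. smooth_fun \<psi> \<Longrightarrow> periodic2pi \<psi> \<Longrightarrow>
          - integral {-pi..pi} (\<lambda>x. w1 x / (2 * N x) * deriv \<psi> x) = 2 * \<phi> 0 powr q * \<psi> 0 - 2 * \<phi> pi powr q * \<psi> pi"
    using sol unfolding is_solution_def q_def k_def by blast
  have \<phi>w: "weak_deriv_circ \<phi> \<phi>1" "weak_deriv_circ \<phi>1 \<phi>2" "periodic2pi \<phi>" "periodic2pi w" "weak_deriv_circ w w1"
    using W1 W2 by (auto simp: W1p_circ_def W2p_circ_def)
  define b where "b = \<phi> 0 powr q"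
  have b: "b > 0" using pos[of 0] by (simp add: b_def)
  have flux: "\<phi> pi = \<phi> 0" "AE x in lborel. x \<in> {-pi..pi} \<longrightarrow> w1 x / (2 * N x) = \<phi> 0 powr q * (lam x + gammaN N)"
    by (rule solution_flux[OF cN Np pos q \<phi>w(5,4)]; rule dist; assumption)+
  define Bp where "Bp = (t + 1)\<^sup>2"
  define Bm where "Bm = (t - 1)\<^sup>2"
  define Ap where "Ap = 2 * \<eta>\<^sup>2 / k + (\<mu> + b * (1 + \<gamma>))\<^sup>2"
  define Am where "Am = 2 * \<eta>\<^sup>2 / k + (\<mu> - b * (1 - \<gamma>))\<^sup>2"
  have nonneg: "Ap \<ge> 0" "Am \<ge> 0" "Bp \<ge> 0" "Bm \<ge> 0" using k by (auto simp: Ap_def Am_def Bp_def Bm_def)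
  have ode': "AE x in lborel. x \<in> {-pi..pi} \<longrightarrow> \<phi>2 x = nl q ((t + lam x)\<^sup>2) (2 * \<eta>\<^sup>2 / k + (\<mu> + b * (lam x + \<gamma>))\<^sup>2) (\<phi> x)"
    using ode flux(2)
  proof eventually_elim
    case (elim x)
    show ?case
    proof
      assume x: "x \<in> {-pi..pi}"
      have w: "w1 x / (2 * N x) = b * (lam x + \<gamma>)" using elim(2) x by (simp add: b_def \<gamma>_def)
      have "- 2 * k * q * \<phi>2 x - 2 * \<eta>\<^sup>2 * \<phi> x powr (- q - 1)
          - k * (\<mu> + b * (lam x + \<gamma>))\<^sup>2 * \<phi> x powr (- q - 1) + k * (t + lam x)\<^sup>2 * \<phi> x powr (q - 1) = 0"
        using elim(1) x unfolding w tau_def by blast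
      then have "\<phi>2 x = ((t + lam x)\<^sup>2 * \<phi> x powr (q - 1) - (2 * \<eta>\<^sup>2 / k + (\<mu> + b * (lam x + \<gamma>))\<^sup>2) * \<phi> x powr (- q - 1)) / (2 * q)"
        using ode_normal_form[of k q] k q by simp
      then show "\<phi>2 x = nl q ((t + lam x)\<^sup>2) (2 * \<eta>\<^sup>2 / k + (\<mu> + b * (lam x + \<gamma>))\<^sup>2) (\<phi> x)" by (simp only: nl_def)
    qed
  qed
  have odep: "AE x in lborel. x \<in> {0..pi} \<longrightarrow> \<phi>2 x = nl q Bp Ap (\<phi> x)"
    using AE_halves(1)[OF ode'] by eventually_elim (simp add: Bp_def Ap_def)
  have odem: "AE x in lborel. x \<in> {-pi..0} \<longrightarrow> \<phi>2 x = nl q Bm Am (\<phi> x)"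
    using AE_halves(2)[OF ode'] by eventually_elim (simp add: Bm_def Am_def algebra_simps)
  have c1: "continuous_on {-pi..pi} \<phi>1"
  proof -
    have "continuous_on {-pi..pi} (\<lambda>x. \<phi>1 (- pi) + integral {-pi..x} \<phi>2)"
      using \<phi>w(2) by (intro continuous_intros indefinite_integral_continuous_1)
        (simp add: weak_deriv_circ_def absolutely_integrable_on_def)
    moreover have "\<phi>1 x = \<phi>1 (- pi) + integral {-pi..x} \<phi>2" if "x \<in> {-pi..pi}" for x
      using \<phi>w(2) that unfolding weak_deriv_circ_def by blast
    ultimately show ?thesis by (simp only: continuous_on_cong[OF refl, of "{-pi..pi}" \<phi>1 "\<lambda>x. \<phi>1 (- pi) + integral {-pi..x} \<phi>2"])
  qed
  have d1: "(\<phi> has_real_derivative \<phi>1 x) (at x within {-pi..pi})" if "x \<in> {-pi..pi}" for x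
    by (rule weak_imp_classical[OF \<phi>w(1) _ c1 _ _ that]) auto
  have c0: "continuous_on {-pi..pi} \<phi>"
    using d1 by (meson DERIV_continuous continuous_on_eq_continuous_within)
  have cnl: "continuous_on S (\<lambda>x. nl q B A (\<phi> x))" if "S \<subseteq> {-pi..pi}" for S B A
    unfolding nl_def using pos q by (intro continuous_intros continuous_on_subset[OF c0 that]) (auto simp: less_imp_neq[symmetric])
  have dp: "(\<phi>1 has_real_derivative nl q Bp Ap (\<phi> x)) (at x within {0..pi})" if "x \<in> {0..pi}" for x
    by (rule weak_imp_classical[OF \<phi>w(2) odep cnl _ _ that]) auto
  have dm: "(\<phi>1 has_real_derivative nl q Bm Am (\<phi> x)) (at x within {-pi..0})" if "x \<in> {-pi..0}" for x
    by (rule weak_imp_classical[OF \<phi>w(2) odem cnl _ _ that]) auto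
  have um: "(uminus has_real_derivative - 1) (at x within {0..pi})" for x
    by (auto intro!: derivative_eq_intros)
  have im: "uminus ` {0..pi} = {- pi..0::real}" by simp
  have dm0: "((\<lambda>x. \<phi> (- x)) has_real_derivative - \<phi>1 (- x)) (at x within {0..pi})" if x: "x \<in> {0..pi}" for x
  proof -
    have "(\<phi> has_real_derivative \<phi>1 (- x)) (at (- x) within uminus ` {0..pi})"
      unfolding im using x by (intro has_field_derivative_subset[OF d1]) auto
    from DERIV_image_chain[OF this um] show ?thesis by (simp add: o_def)
  qed
  have dm1: "((\<lambda>x. - \<phi>1 (- x)) has_real_derivative nl q Bm Am (\<phi> (- x))) (at x within {0..pi})" if x: "x \<in> {0..pi}" for x
  proof -
    have "(\<phi>1 has_real_derivative nl q Bm Am (\<phi> (- x))) (at (- x) within uminus ` {0..pi})"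
      unfolding im using x by (intro dm) auto
    from DERIV_image_chain[OF this um]
    have "((\<lambda>x. \<phi>1 (- x)) has_real_derivative - nl q Bm Am (\<phi> (- x))) (at x within {0..pi})" by (simp add: o_def)
    from DERIV_minus[OF this] show ?thesis by simp
  qed
  have q1: "q > 1" and l: "pi / 2 > 0" and l2: "2 * (pi / 2) = pi" using q by auto
  have endm: "\<phi> (- pi) = \<phi> 0"
  proof -
    have "\<phi> (- pi + 2 * pi) = \<phi> (- pi)" using \<phi>w(3) unfolding periodic2pi_def by blast
    then show ?thesis using flux(1) by simp
  qed
  have S1: "\<And>x. x \<in> {0..pi} \<Longrightarrow> \<phi> (pi - x) = \<phi> x" "DN q (pi / 2) Bp Ap \<phi> \<phi>1"
    using symmetric_of_ends[OF q1 nonneg(3,1) l, of \<phi> \<phi>1, unfolded l2, OF pos has_field_derivative_subset[OF d1] dp] flux(1) by auto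
  have S2: "\<And>x. x \<in> {0..pi} \<Longrightarrow> \<phi> (- (pi - x)) = \<phi> (- x)" "DN q (pi / 2) Bm Am (\<lambda>x. \<phi> (- x)) (\<lambda>x. - \<phi>1 (- x))"
    using symmetric_of_ends[OF q1 nonneg(4,2) l, of "\<lambda>x. \<phi> (- x)" "\<lambda>x. - \<phi>1 (- x)", unfolded l2, OF pos dm0 dm1] endm by auto
  have "AE x in lborel. x \<in> {-pi..pi} \<longrightarrow> w1 x = 2 * N x * (b * (lam x + \<gamma>))"
    using flux(2)
  proof eventually_elim
    case (elim x)
    have Nx: "N x \<noteq> 0" using Np[of x] by simp
    show ?case
    proof
      assume "x \<in> {-pi..pi}"
      then have "w1 x / (2 * N x) = b * (lam x + \<gamma>)" using elim by (simp add: b_def \<gamma>_def)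
      then show "w1 x = 2 * N x * (b * (lam x + \<gamma>))" using Nx by (simp add: nonzero_divide_eq_eq)
    qed
  qed
  note AE = this
  show thesis
    by (rule that[of b w1 \<phi>1, folded q_def \<gamma>_def k_def, folded Ap_def Am_def Bp_def Bm_def];
        fact b b_def[symmetric] \<phi>w S1 S2 AE)
qed

section \<open>From two quarter-circle solutions back to the circle\<close>

lemma periodic2pi_int:
  assumes "periodic2pi f"
  shows "f (x + 2 * pi * of_int k) = f x"
proof (induction k rule: int_induct[where k=0])
  case (step1 i)
  have "f (x + 2 * pi * of_int i + 2 * pi) = f (x + 2 * pi * of_int i)" using assms unfolding periodic2pi_def by blast
  then show ?case using step1 by (simp add: algebra_simps)
next
  case (step2 i)
  have "f (x + 2 * pi * of_int (i - 1) + 2 * pi) = f (x + 2 * pi * of_int (i - 1))" using assms unfolding periodic2pi_def by blast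
  then show ?case using step2 by (simp add: algebra_simps)
qed simp

lemma circle_representative: obtains k :: int where "x + 2 * pi * of_int k \<in> {-pi..<pi}"
proof
  have "of_int \<lfloor>(x + pi) / (2 * pi)\<rfloor> \<le> (x + pi) / (2 * pi)" "(x + pi) / (2 * pi) < of_int \<lfloor>(x + pi) / (2 * pi)\<rfloor> + 1"
    by linarith+
  then have "of_int \<lfloor>(x + pi) / (2 * pi)\<rfloor> * (2 * pi) \<le> x + pi" "x + pi < (of_int \<lfloor>(x + pi) / (2 * pi)\<rfloor> + 1) * (2 * pi)"
    by (simp_all only: pos_le_divide_eq[OF mult_pos_pos[OF zero_less_numeral pi_gt_zero]]
        pos_divide_less_eq[OF mult_pos_pos[OF zero_less_numeral pi_gt_zero]])
  then show "x + 2 * pi * of_int (- \<lfloor>(x + pi) / (2 * pi)\<rfloor>) \<in> {-pi..<pi}" by (simp add: algebra_simps)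
qed

lemma periodic2pi_eqI:
  assumes "periodic2pi f" "periodic2pi g" "\<And>x. x \<in> {-pi..pi} \<Longrightarrow> f x = g x"
  shows "f = g"
proof
  fix x
  obtain k :: int where k: "x + 2 * pi * of_int k \<in> {-pi..<pi}" by (rule circle_representative)
  have "f (x + 2 * pi * of_int k) = g (x + 2 * pi * of_int k)" using k by (intro assms) auto
  then show "f x = g x" by (simp only: periodic2pi_int[OF assms(1)] periodic2pi_int[OF assms(2)])
qed

lemma periodic_extension:
  assumes "f0 (- pi) = f0 pi"
  obtains f where "periodic2pi f" "\<And>x. x \<in> {-pi..pi} \<Longrightarrow> f x = f0 x" "\<And>x. \<exists>y\<in>{-pi..pi}. f x = f0 y"
proof -
  define r where "r x = x - 2 * pi * of_int \<lfloor>(x + pi) / (2 * pi)\<rfloor>" for x :: real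
  have per: "r (x + 2 * pi) = r x" for x
  proof -
    have "(x + 2 * pi + pi) / (2 * pi) = (x + pi) / (2 * pi) + 1" by (simp add: field_simps)
    then have "\<lfloor>(x + 2 * pi + pi) / (2 * pi)\<rfloor> = \<lfloor>(x + pi) / (2 * pi)\<rfloor> + 1" by simp
    then show ?thesis unfolding r_def by (simp add: algebra_simps)
  qed
  have id: "r x = x" if "x \<in> {-pi..<pi}" for x
  proof -
    have "\<lfloor>(x + pi) / (2 * pi)\<rfloor> = 0" using that by (intro floor_unique) (auto simp: field_simps)
    then show ?thesis by (simp add: r_def)
  qed
  have rpi: "r pi = - pi" using per[of "- pi"] id[of "- pi"] by simp
  show thesis
  proof (rule that[of "\<lambda>x. f0 (r x)"])
    show "periodic2pi (\<lambda>x. f0 (r x))" by (simp add: periodic2pi_def per)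
    show "f0 (r x) = f0 x" if "x \<in> {-pi..pi}" for x
      using id[of x] rpi assms that by (cases "x = pi") auto
    show "\<exists>y\<in>{-pi..pi}. f0 (r x) = f0 y" for x
    proof -
      obtain k :: int where k: "x + 2 * pi * of_int k \<in> {-pi..<pi}" by (rule circle_representative)
      have "f0 (r x) = f0 (r (x + 2 * pi * of_int k))"
        by (rule periodic2pi_int[of "\<lambda>x. f0 (r x)", symmetric]) (simp add: periodic2pi_def per)
      then show ?thesis using id[OF k] k by (intro bexI[of _ "x + 2 * pi * of_int k"]) auto
    qed
  qed
qed

text \<open>The left half is parametrised by the distance from 0, which causes the sign in its
  derivative. At the seams only continuity is claimed, which is all that \<open>W1p_circI\<close>
  asks of finitely many points.\<close>

lemma circle_glue:
  fixes Fp Fm :: "real \<Rightarrow> real"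
  assumes c: "continuous_on {0..pi} Fp" "continuous_on {0..pi} Fm" and ends: "Fm 0 = Fp 0" "Fm pi = Fp pi"
  obtains f where "periodic2pi f" "continuous_on {-pi..pi} f"
    "\<And>x. x \<in> {0..pi} \<Longrightarrow> f x = Fp x" "\<And>x. x \<in> {0..pi} \<Longrightarrow> f (- x) = Fm x"
    "\<And>x. \<exists>y\<in>{0..pi}. f x = Fp y \<or> f x = Fm y"
    "\<And>x D. 0 < x \<Longrightarrow> x < pi \<Longrightarrow> (Fp has_real_derivative D) (at x) \<Longrightarrow> (f has_real_derivative D) (at x)"
    "\<And>x D. 0 < x \<Longrightarrow> x < pi \<Longrightarrow> (Fm has_real_derivative D) (at x) \<Longrightarrow> (f has_real_derivative - D) (at (- x))"
proof -
  define f0 where "f0 x = (if x \<le> 0 then Fm (- x) else Fp x)" for x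
  have "f0 (- pi) = f0 pi" using ends by (simp add: f0_def not_le[THEN iffD2, OF pi_gt_zero])
  then obtain f where f: "periodic2pi f" "\<And>x. x \<in> {-pi..pi} \<Longrightarrow> f x = f0 x" "\<And>x. \<exists>y\<in>{-pi..pi}. f x = f0 y"
    using periodic_extension by blast
  have fp: "f x = Fp x" if "x \<in> {0..pi}" for x using that f(2)[of x] ends by (auto simp: f0_def)
  have fm: "f (- x) = Fm x" if "x \<in> {0..pi}" for x using that f(2)[of "- x"] ends by (auto simp: f0_def)
  have "continuous_on {-pi..pi} f0"
    unfolding f0_def
  proof (rule continuous_on_cases_le)
    show "continuous_on {x \<in> {-pi..pi}. x \<le> 0} (\<lambda>x. Fm (- x))"
      by (rule continuous_on_compose2[OF c(2)]) (auto intro: continuous_intros)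
    show "continuous_on {x \<in> {-pi..pi}. 0 \<le> x} Fp" by (rule continuous_on_subset[OF c(1)]) auto
  qed (use ends in \<open>auto intro: continuous_intros\<close>)
  then have "continuous_on {-pi..pi} f" by (rule continuous_on_eq) (rule f(2)[symmetric])
  moreover have "\<exists>y\<in>{0..pi}. f x = Fp y \<or> f x = Fm y" for x
  proof -
    obtain y where y: "y \<in> {-pi..pi}" "f x = f0 y" using f(3) by blast
    show ?thesis
    proof (cases "y \<le> 0")
      case True
      then show ?thesis using y by (intro bexI[of _ "- y"]) (auto simp: f0_def)
    next
      case False
      then show ?thesis using y by (intro bexI[of _ y]) (auto simp: f0_def)
    qed
  qed
  moreover have "(f has_real_derivative D) (at x)" if "0 < x" "x < pi" "(Fp has_real_derivative D) (at x)" for x D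
    by (rule has_field_derivative_transform_within_open[OF that(3), of "{0<..<pi}"]) (use that fp in auto)
  moreover have "(f has_real_derivative - D) (at (- x))" if x: "0 < x" "x < pi" and D: "(Fm has_real_derivative D) (at x)" for x D
  proof -
    have "((\<lambda>y. Fm (- y)) has_real_derivative D * - 1) (at (- x))"
      by (rule DERIV_chain2[of Fm]) (use D in \<open>auto intro!: derivative_eq_intros\<close>)
    then have D': "((\<lambda>y. Fm (- y)) has_real_derivative - D) (at (- x))" by simp
    show ?thesis
    proof (rule has_field_derivative_transform_within_open[OF D', of "{-pi<..<0}"])
      fix y :: real assume "y \<in> {-pi<..<0}"
      then show "Fm (- y) = f y" using fm[of "- y"] by simp
    qed (use x in auto)
  qed
  ultimately show thesis using that[OF f(1) _ fp fm] by blast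
qed

lemma DN_reflect:
  assumes u: "DN q l B A u v" and l: "l > 0"
  obtains U V where "continuous_on {0..2 * l} U" "continuous_on {0..2 * l} V" "\<And>x. x \<in> {0..2 * l} \<Longrightarrow> U x > 0"
    "U 0 = u 0" "U (2 * l) = u 0" "V 0 = v 0" "V (2 * l) = - v 0"
    "\<And>x. 0 < x \<Longrightarrow> x < 2 * l \<Longrightarrow> x \<noteq> l \<Longrightarrow> (U has_real_derivative V x) (at x)"
    "\<And>x. 0 < x \<Longrightarrow> x < 2 * l \<Longrightarrow> x \<noteq> l \<Longrightarrow> (V has_real_derivative nl q B A (U x)) (at x)"
proof -
  define U where "U x = (if x \<le> l then u x else u (2 * l - x))" for x
  define V where "V x = (if x \<le> l then v x else - v (2 * l - x))" for x
  have vl: "v l = 0" by (rule DN_end[OF u])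
  have cU: "continuous_on {0..2 * l} U"
    unfolding U_def
  proof (rule continuous_on_cases_le)
    show "continuous_on {x \<in> {0..2 * l}. x \<le> l} u" by (rule continuous_on_subset[OF DN_cont[OF u]]) auto
    show "continuous_on {x \<in> {0..2 * l}. l \<le> x} (\<lambda>x. u (2 * l - x))"
      by (rule continuous_on_compose2[OF DN_cont[OF u]]) (auto intro!: continuous_intros)
  qed (auto intro: continuous_intros)
  have cV: "continuous_on {0..2 * l} V"
    unfolding V_def
  proof (rule continuous_on_cases_le)
    show "continuous_on {x \<in> {0..2 * l}. x \<le> l} v" by (rule continuous_on_subset[OF DN_cont1[OF u]]) auto
    have "continuous_on {x \<in> {0..2 * l}. l \<le> x} (\<lambda>x. v (2 * l - x))"
      by (rule continuous_on_compose2[OF DN_cont1[OF u]]) (auto intro!: continuous_intros)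
    then show "continuous_on {x \<in> {0..2 * l}. l \<le> x} (\<lambda>x. - v (2 * l - x))" by (rule continuous_on_minus)
  qed (use vl in \<open>auto intro: continuous_intros\<close>)
  have pos: "U x > 0" if "x \<in> {0..2 * l}" for x
    using that DN_pos[OF u, of x] DN_pos[OF u, of "2 * l - x"] by (auto simp: U_def)
  have dd: "(U has_real_derivative V x) (at x) \<and> (V has_real_derivative nl q B A (U x)) (at x)"
    if x: "0 < x" "x < 2 * l" "x \<noteq> l" for x
  proof (cases "x < l")
    case True
    note d = DN_at[OF u x(1) True]
    have "(U has_real_derivative v x) (at x)"
      by (rule has_field_derivative_transform_within_open[OF d(1), of "{..<l}"]) (use True in \<open>auto simp: U_def\<close>)
    moreover have "(V has_real_derivative nl q B A (u x)) (at x)"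
      by (rule has_field_derivative_transform_within_open[OF d(2), of "{..<l}"]) (use True in \<open>auto simp: V_def\<close>)
    ultimately show ?thesis using True by (simp add: U_def V_def)
  next
    case False
    then have xl: "l < x" "0 < 2 * l - x" "2 * l - x < l" using x by auto
    note d = DN_at[OF u xl(2,3)]
    have m: "((\<lambda>x. 2 * l - x) has_real_derivative - 1) (at x)" by (auto intro!: derivative_eq_intros)
    have d1: "((\<lambda>x. u (2 * l - x)) has_real_derivative - v (2 * l - x)) (at x)"
      using DERIV_chain2[OF d(1) m] by simp
    have d2: "((\<lambda>x. - v (2 * l - x)) has_real_derivative nl q B A (u (2 * l - x))) (at x)"
      using DERIV_minus[OF DERIV_chain2[OF d(2) m]] by simp
    have "(U has_real_derivative - v (2 * l - x)) (at x)"
      by (rule has_field_derivative_transform_within_open[OF d1, of "{l<..}"]) (use xl in \<open>auto simp: U_def\<close>)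
    moreover have "(V has_real_derivative nl q B A (u (2 * l - x))) (at x)"
      by (rule has_field_derivative_transform_within_open[OF d2, of "{l<..}"]) (use xl in \<open>auto simp: V_def\<close>)
    ultimately show ?thesis using xl by (simp add: U_def V_def)
  qed
  show thesis
  proof (rule that[OF cU cV pos])
    show "U 0 = u 0" "U (2 * l) = u 0" "V 0 = v 0" "V (2 * l) = - v 0" using l by (auto simp: U_def V_def)
  qed (use dd in blast)+
qed

lemma Lp_circ_halves:
  assumes p: "p > 0" and c: "continuous_on {-pi..0} g1" "continuous_on {0..pi} g2"
    and e: "\<And>x. - pi < x \<Longrightarrow> x < 0 \<Longrightarrow> g x = g1 x" "\<And>x. 0 < x \<Longrightarrow> x < pi \<Longrightarrow> g x = g2 x"
  shows "Lp_circ p g"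
proof -
  have "g absolutely_integrable_on {-pi..pi}" by (rule halves_integral(1)[OF c e])
  moreover have "(\<lambda>x. \<bar>g x\<bar> powr p) absolutely_integrable_on {-pi..pi}"
  proof (rule halves_integral(1))
    show "continuous_on {-pi..0} (\<lambda>x. \<bar>g1 x\<bar> powr p)" "continuous_on {0..pi} (\<lambda>x. \<bar>g2 x\<bar> powr p)"
      by (rule continuous_on_powr'[OF continuous_on_rabs[OF c(1)] continuous_on_const]
          continuous_on_powr'[OF continuous_on_rabs[OF c(2)] continuous_on_const], use p in auto)+
  qed (auto simp: e)
  ultimately show ?thesis by (simp add: Lp_circ_def absolutely_integrable_on_def)
qed

lemma Lp_circ_continuous:
  assumes "p > 0" "continuous_on {-pi..pi} f"
  shows "Lp_circ p f"
  by (rule Lp_circ_halves[OF assms(1)]) (auto intro: continuous_on_subset[OF assms(2)])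

lemma W1p_circI:
  assumes p: "p > 0" and f: "periodic2pi f" "continuous_on {-pi..pi} f" and g: "Lp_circ p g"
    and S: "finite S" and d: "\<And>x. x \<in> {-pi<..<pi} - S \<Longrightarrow> (f has_real_derivative g x) (at x)"
  shows "W1p_circ p f g"
  unfolding W1p_circ_def weak_deriv_circ_def
proof (intro conjI ballI)
  show "Lp_circ p f" by (rule Lp_circ_continuous[OF p f(2)])
  show "g absolutely_integrable_on {-pi..pi}" using g by (simp add: Lp_circ_def)
  fix x assume x: "x \<in> {-pi..pi}"
  have "(g has_integral f x - f (- pi)) {-pi..x}"
    by (rule fundamental_theorem_of_calculus_interior_strong[OF S])
      (use x d in \<open>auto simp: has_real_derivative_iff_has_vector_derivative[symmetric] intro: continuous_on_subset[OF f(2)]\<close>)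
  then show "f x = f (- pi) + integral {-pi..x} g" by (simp add: integral_unique)
qed (use f g in auto)

text \<open>The definition of \<open>gammaN\<close> is exactly the condition that this w' has
  integral zero, so that its primitive is periodic. The jumps of b \<lambda> at 0 and pi produce the
  two Dirac masses.\<close>

lemma flux_realised:
  assumes cN: "continuous_on {-pi..pi} N" and Np: "\<And>x. N x > 0"
  obtains w w1 where "W1p_circ 2 w w1" "\<And>x. - pi < x \<Longrightarrow> x < pi \<Longrightarrow> x \<noteq> 0 \<Longrightarrow> w1 x / (2 * N x) = b * (lam x + gammaN N)"
    "\<And>\<psi>. smooth_fun \<psi> \<Longrightarrow> periodic2pi \<psi> \<Longrightarrow>
          - integral {-pi..pi} (\<lambda>x. w1 x / (2 * N x) * deriv \<psi> x) = 2 * b * \<psi> 0 - 2 * b * \<psi> pi"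
proof -
  define \<gamma> where "\<gamma> = gammaN N"
  define w1 where "w1 x = 2 * N x * (b * (lam x + \<gamma>))" for x
  note sub = continuous_on_subset[OF cN]
  have c: "continuous_on {-pi..0} (\<lambda>x. 2 * N x * (b * (- 1 + \<gamma>)))" "continuous_on {0..pi} (\<lambda>x. 2 * N x * (b * (1 + \<gamma>)))"
    by (intro continuous_intros sub; simp)+
  have Lp: "Lp_circ 2 w1"
    by (rule Lp_circ_halves[OF _ c]) (auto simp: w1_def lam_eq)
  have iw: "w1 absolutely_integrable_on {-pi..pi}"
    by (rule halves_integral(1)[OF c]) (auto simp: w1_def lam_eq)
  then have iw': "w1 integrable_on {-pi..pi}" by (simp add: absolutely_integrable_on_def)
  note G = gammaN_bounds[OF cN Np, folded \<gamma>_def]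
  have I0: "integral {-pi..pi} w1 = 0"
  proof -
    have Ni: "N integrable_on {-pi..pi}" by (rule integrable_continuous_real[OF cN])
    have lN: "(\<lambda>x. lam x * N x) integrable_on {-pi..pi}"
      using abs_integrable_mult_continuous[OF lam_abs_integrable cN] by (simp add: absolutely_integrable_on_def)
    have "((\<lambda>x. 2 * b * (lam x * N x) + 2 * b * \<gamma> * N x) has_integral
        2 * b * (- \<gamma> * integral {-pi..pi} N) + 2 * b * \<gamma> * integral {-pi..pi} N) {-pi..pi}"
      using integrable_integral[OF lN] integrable_integral[OF Ni] unfolding G(4)
      by (intro has_integral_add has_integral_mult_right)
    moreover have "(\<lambda>x. 2 * b * (lam x * N x) + 2 * b * \<gamma> * N x) = w1" by (auto simp: w1_def algebra_simps)
    ultimately show ?thesis by (simp add: integral_unique)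
  qed
  define w0 where "w0 x = integral {-pi..x} w1" for x
  have "w0 (- pi) = w0 pi" by (simp add: w0_def I0)
  then obtain w where w: "periodic2pi w" "\<And>x. x \<in> {-pi..pi} \<Longrightarrow> w x = w0 x" using periodic_extension by blast
  have "continuous_on {-pi..pi} w0" unfolding w0_def by (rule indefinite_integral_continuous_1[OF iw'])
  then have "continuous_on {-pi..pi} w" by (rule continuous_on_eq) (rule w(2)[symmetric])
  then have "Lp_circ 2 w" by (intro Lp_circ_continuous) auto
  moreover have "weak_deriv_circ w w1"
    unfolding weak_deriv_circ_def
  proof (intro conjI ballI iw)
    fix x assume x: "x \<in> {-pi..pi}"
    have "w (- pi) = 0" using w(2)[of "- pi"] by (simp add: w0_def)
    then show "w x = w (- pi) + integral {-pi..x} w1" using w(2)[OF x] by (simp add: w0_def)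
  qed
  ultimately have W: "W1p_circ 2 w w1" using w Lp by (simp add: W1p_circ_def)
  have N0: "N x \<noteq> 0" for x using Np[of x] by simp
  have w1N: "w1 x / (2 * N x) = b * (lam x + \<gamma>)" for x using N0[of x] by (simp add: w1_def)
  show thesis
  proof (rule that[OF W])
    show "w1 x / (2 * N x) = b * (lam x + gammaN N)" for x using w1N by (simp add: \<gamma>_def)
    fix \<psi> assume \<psi>: "smooth_fun \<psi>" "periodic2pi \<psi>"
    note cd = smooth_fun_deriv(2)[OF \<psi>(1), of "{-pi..pi}"]
    have i1: "deriv \<psi> integrable_on {-pi..pi}" by (rule integrable_continuous_real[OF cd])
    have i2: "(\<lambda>x. lam x * deriv \<psi> x) integrable_on {-pi..pi}"
      using abs_integrable_mult_continuous[OF lam_abs_integrable cd] by (simp add: absolutely_integrable_on_def)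
    have "\<psi> (- pi + 2 * pi) = \<psi> (- pi)" using \<psi>(2) unfolding periodic2pi_def by blast
    then have z: "integral {-pi..pi} (deriv \<psi>) = 0" using smooth_fun_integral[OF \<psi>(1), of "- pi" pi] by simp
    have "((\<lambda>x. b * (lam x * deriv \<psi> x) + b * \<gamma> * deriv \<psi> x) has_integral b * (2 * (\<psi> pi - \<psi> 0)) + b * \<gamma> * 0) {-pi..pi}"
      using integrable_integral[OF i1] integrable_integral[OF i2] unfolding z smooth_fun_lam_integral[OF \<psi>]
      by (intro has_integral_add has_integral_mult_right)
    moreover have "(\<lambda>x. b * (lam x * deriv \<psi> x) + b * \<gamma> * deriv \<psi> x) = (\<lambda>x. w1 x / (2 * N x) * deriv \<psi> x)"
      unfolding w1N by (auto simp: algebra_simps)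
    ultimately have "integral {-pi..pi} (\<lambda>x. w1 x / (2 * N x) * deriv \<psi> x) = b * (2 * (\<psi> pi - \<psi> 0)) + b * \<gamma> * 0"
      by (simp only: integral_unique)
    then show "- integral {-pi..pi} (\<lambda>x. w1 x / (2 * N x) * deriv \<psi> x) = 2 * b * \<psi> 0 - 2 * b * \<psi> pi"
      by (simp add: algebra_simps)
  qed
qed

text \<open>Each quarter-circle solution is reflected about its midpoint, and the two halves are
  glued. The values agree at 0 and pi because both start from b^(1/q). The derivatives agree at 0
  because the slopes add up to zero, and at pi because reflection reverses both of them.\<close>

lemma solution_of_data:
  assumes n: "n \<ge> 3" and cN: "continuous_on {-pi..pi} N" and Np: "\<And>x. N x > 0" and b: "b > 0"
    and z: "slope (q_exp n) (pi / 2) ((t + 1)\<^sup>2) (2 * \<eta>\<^sup>2 / kappa n + (\<mu> + b * (1 + gammaN N))\<^sup>2) b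
      + slope (q_exp n) (pi / 2) ((t - 1)\<^sup>2) (2 * \<eta>\<^sup>2 / kappa n + (\<mu> - b * (1 - gammaN N))\<^sup>2) b = 0"
    and t: "t \<noteq> 1" "t \<noteq> - 1"
  shows "\<exists>\<phi> w. is_solution n N t \<eta> \<mu> \<phi> w"
proof -
  define q where "q = q_exp n"
  define \<gamma> where "\<gamma> = gammaN N"
  define k where "k = kappa n"
  have q: "q > 2" and k: "k > 0" using exponent_facts[OF n] by (auto simp: q_def k_def)
  define l where "l = pi / 2"
  have l: "l > 0" and l2: "2 * l = pi" by (auto simp: l_def)
  define Bp where "Bp = (t + 1)\<^sup>2"
  define Bm where "Bm = (t - 1)\<^sup>2"
  define Ap where "Ap = 2 * \<eta>\<^sup>2 / k + (\<mu> + b * (1 + \<gamma>))\<^sup>2"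
  define Am where "Am = 2 * \<eta>\<^sup>2 / k + (\<mu> - b * (1 - \<gamma>))\<^sup>2"
  have A: "Ap \<ge> 0" "Am \<ge> 0" using k by (auto simp: Ap_def Am_def)
  have B: "Bp > 0" "Bm > 0" using t by (auto simp: Bp_def Bm_def)
  obtain up vp where up: "DN q l Bp Ap up vp" "up 0 = b powr (1 / q)" "slope q l Bp Ap b = vp 0"
    using cmid_ex[OF q B(1) A(1) l b] by metis
  obtain um vm where um: "DN q l Bm Am um vm" "um 0 = b powr (1 / q)" "slope q l Bm Am b = vm 0"
    using cmid_ex[OF q B(2) A(2) l b] by metis
  have zz: "vp 0 + vm 0 = 0"
    using z unfolding q_def[symmetric] k_def[symmetric] \<gamma>_def[symmetric] l_def[symmetric]
    unfolding Ap_def[symmetric] Am_def[symmetric] Bp_def[symmetric] Bm_def[symmetric] up(3) um(3) .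
  obtain Up Vp where P: "continuous_on {0..pi} Up" "continuous_on {0..pi} Vp" "\<And>x. x \<in> {0..pi} \<Longrightarrow> Up x > 0"
    "Up 0 = up 0" "Up pi = up 0" "Vp 0 = vp 0" "Vp pi = - vp 0"
    "\<And>x. 0 < x \<Longrightarrow> x < pi \<Longrightarrow> x \<noteq> l \<Longrightarrow> (Up has_real_derivative Vp x) (at x)"
    "\<And>x. 0 < x \<Longrightarrow> x < pi \<Longrightarrow> x \<noteq> l \<Longrightarrow> (Vp has_real_derivative nl q Bp Ap (Up x)) (at x)"
  proof (rule DN_reflect[OF up(1) l, unfolded l2], goal_cases)
    case (1 U V)
    from 1(2-) show thesis by (rule 1(1))
  qed
  obtain Um Vm where M: "continuous_on {0..pi} Um" "continuous_on {0..pi} Vm" "\<And>x. x \<in> {0..pi} \<Longrightarrow> Um x > 0"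
    "Um 0 = um 0" "Um pi = um 0" "Vm 0 = vm 0" "Vm pi = - vm 0"
    "\<And>x. 0 < x \<Longrightarrow> x < pi \<Longrightarrow> x \<noteq> l \<Longrightarrow> (Um has_real_derivative Vm x) (at x)"
    "\<And>x. 0 < x \<Longrightarrow> x < pi \<Longrightarrow> x \<noteq> l \<Longrightarrow> (Vm has_real_derivative nl q Bm Am (Um x)) (at x)"
  proof (rule DN_reflect[OF um(1) l, unfolded l2], goal_cases)
    case (1 U V)
    from 1(2-) show thesis by (rule 1(1))
  qed
  have e0: "Um 0 = Up 0" "Um pi = Up pi" using P M up um by auto
  obtain \<phi> where \<phi>: "periodic2pi \<phi>" "continuous_on {-pi..pi} \<phi>"
    "\<And>x. x \<in> {0..pi} \<Longrightarrow> \<phi> x = Up x" "\<And>x. x \<in> {0..pi} \<Longrightarrow> \<phi> (- x) = Um x"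
    "\<And>x. \<exists>y\<in>{0..pi}. \<phi> x = Up y \<or> \<phi> x = Um y"
    "\<And>x D. 0 < x \<Longrightarrow> x < pi \<Longrightarrow> (Up has_real_derivative D) (at x) \<Longrightarrow> (\<phi> has_real_derivative D) (at x)"
    "\<And>x D. 0 < x \<Longrightarrow> x < pi \<Longrightarrow> (Um has_real_derivative D) (at x) \<Longrightarrow> (\<phi> has_real_derivative - D) (at (- x))"
  proof (rule circle_glue[OF P(1) M(1) e0], goal_cases)
    case (1 f)
    from 1(2-) show thesis by (rule 1(1))
  qed
  have cV: "continuous_on {0..pi} (\<lambda>x. - Vm x)" by (intro continuous_intros M)
  have e1: "- Vm 0 = Vp 0" "- Vm pi = Vp pi" using P M zz by auto
  obtain \<phi>1 where \<phi>1: "periodic2pi \<phi>1" "continuous_on {-pi..pi} \<phi>1"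
    "\<And>x. x \<in> {0..pi} \<Longrightarrow> \<phi>1 x = Vp x" "\<And>x. x \<in> {0..pi} \<Longrightarrow> \<phi>1 (- x) = - Vm x"
    "\<And>x. \<exists>y\<in>{0..pi}. \<phi>1 x = Vp y \<or> \<phi>1 x = - Vm y"
    "\<And>x D. 0 < x \<Longrightarrow> x < pi \<Longrightarrow> (Vp has_real_derivative D) (at x) \<Longrightarrow> (\<phi>1 has_real_derivative D) (at x)"
    "\<And>x D. 0 < x \<Longrightarrow> x < pi \<Longrightarrow> ((\<lambda>x. - Vm x) has_real_derivative D) (at x) \<Longrightarrow> (\<phi>1 has_real_derivative - D) (at (- x))"
  proof (rule circle_glue[OF P(2) cV e1], goal_cases)
    case (1 f)
    from 1(2-) show thesis by (rule 1(1))
  qed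
  have pos: "\<phi> x > 0" for x using \<phi>(5)[of x] P(3) M(3) by metis
  define \<phi>2 where "\<phi>2 x = (if x < 0 then nl q Bm Am (\<phi> x) else nl q Bp Ap (\<phi> x))" for x
  have cnl: "continuous_on S (\<lambda>x. nl q B A (\<phi> x))" if "S \<subseteq> {-pi..pi}" for S B A
    unfolding nl_def using pos q by (intro continuous_intros continuous_on_subset[OF \<phi>(2) that]) (auto simp: less_imp_neq[symmetric])
  \<comment> \<open>The second derivative is bounded, being continuous on each closed half apart
    from the end points; the exponent 2 is an arbitrary choice above 1.\<close>
  have Lp2: "Lp_circ 2 \<phi>2"
    by (rule Lp_circ_halves[of 2 "\<lambda>x. nl q Bm Am (\<phi> x)" "\<lambda>x. nl q Bp Ap (\<phi> x)"]) (auto intro: cnl simp: \<phi>2_def)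
  have dd: "(\<phi> has_real_derivative \<phi>1 x) (at x) \<and> (\<phi>1 has_real_derivative \<phi>2 x) (at x)"
    if x: "x \<in> {-pi<..<pi} - {- l, 0, l}" for x
  proof (cases "0 < x")
    case True
    then have x': "0 < x" "x < pi" "x \<noteq> l" using x by auto
    show ?thesis
      using \<phi>(6)[OF x'(1,2) P(8)[OF x']] \<phi>1(6)[OF x'(1,2) P(9)[OF x']] \<phi>(3)[of x] \<phi>1(3)[of x] x'
      by (simp add: \<phi>2_def)
  next
    case False
    then have x': "0 < - x" "- x < pi" "- x \<noteq> l" using x by auto
    have "(\<phi> has_real_derivative - Vm (- x)) (at x)"
      using \<phi>(7)[OF x'(1,2) M(8)[OF x']] by simp
    moreover have "(\<phi>1 has_real_derivative nl q Bm Am (Um (- x))) (at x)"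
      using \<phi>1(7)[OF x'(1,2) DERIV_minus[OF M(9)[OF x']]] by simp
    ultimately show ?thesis using \<phi>(4)[of "- x"] \<phi>1(4)[of "- x"] x' by (simp add: \<phi>2_def)
  qed
  have W2: "W2p_circ 2 \<phi> \<phi>1 \<phi>2"
    unfolding W2p_circ_def
  proof
    show "W1p_circ 2 \<phi> \<phi>1"
      by (rule W1p_circI[where S="{- l, 0, l}", OF _ \<phi>(1,2) Lp_circ_continuous[OF _ \<phi>1(2)]]) (use dd in auto)
    show "W1p_circ 2 \<phi>1 \<phi>2"
      by (rule W1p_circI[where S="{- l, 0, l}", OF _ \<phi>1(1,2) Lp2]) (use dd in auto)
  qed
  obtain w w1 where w: "W1p_circ 2 w w1" "\<And>x. - pi < x \<Longrightarrow> x < pi \<Longrightarrow> x \<noteq> 0 \<Longrightarrow> w1 x / (2 * N x) = b * (lam x + \<gamma>)"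
    "\<And>\<psi>. smooth_fun \<psi> \<Longrightarrow> periodic2pi \<psi> \<Longrightarrow>
          - integral {-pi..pi} (\<lambda>x. w1 x / (2 * N x) * deriv \<psi> x) = 2 * b * \<psi> 0 - 2 * b * \<psi> pi"
    unfolding \<gamma>_def
  proof (rule flux_realised[where b=b, OF cN Np], goal_cases)
    case (1 v v1)
    from 1(2-) show thesis by (rule 1(1))
  qed
  have ode: "- 2 * k * q * \<phi>2 x - 2 * \<eta>\<^sup>2 * \<phi> x powr (- q - 1) - k * (\<mu> + w1 x / (2 * N x))\<^sup>2 * \<phi> x powr (- q - 1)
      + k * (tau t x)\<^sup>2 * \<phi> x powr (q - 1) = 0" if x: "- pi < x" "x < pi" "x \<noteq> 0" for x
  proof -
    have "\<phi>2 x = nl q ((t + lam x)\<^sup>2) (2 * \<eta>\<^sup>2 / k + (\<mu> + b * (lam x + \<gamma>))\<^sup>2) (\<phi> x)"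
    proof (cases "x < 0")
      case True
      then show ?thesis using x by (simp add: \<phi>2_def lam_eq Bm_def Am_def algebra_simps)
    next
      case False
      then show ?thesis using x by (simp add: \<phi>2_def lam_eq Bp_def Ap_def)
    qed
    then have "\<phi>2 x = ((tau t x)\<^sup>2 * \<phi> x powr (q - 1) - (2 * \<eta>\<^sup>2 / k + (\<mu> + w1 x / (2 * N x))\<^sup>2) * \<phi> x powr (- q - 1)) / (2 * q)"
      unfolding nl_def tau_def w(2)[OF x] .
    then show ?thesis using k q by (intro iffD2[OF ode_normal_form]) auto
  qed
  have odeAE: "AE x in lborel. x \<in> {-pi..pi} \<longrightarrow> - 2 * k * q * \<phi>2 x - 2 * \<eta>\<^sup>2 * \<phi> x powr (- q - 1)
      - k * (\<mu> + w1 x / (2 * N x))\<^sup>2 * \<phi> x powr (- q - 1) + k * (tau t x)\<^sup>2 * \<phi> x powr (q - 1) = 0"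
    using AE_lborel_singleton[of 0] AE_lborel_singleton[of pi] AE_lborel_singleton[of "- pi"]
  proof eventually_elim
    case (elim x)
    show ?case
    proof
      assume "x \<in> {-pi..pi}"
      then have "- pi < x" "x < pi" "x \<noteq> 0" using elim by auto
      then show "- 2 * k * q * \<phi>2 x - 2 * \<eta>\<^sup>2 * \<phi> x powr (- q - 1) - k * (\<mu> + w1 x / (2 * N x))\<^sup>2 * \<phi> x powr (- q - 1)
          + k * (tau t x)\<^sup>2 * \<phi> x powr (q - 1) = 0" by (rule ode)
    qed
  qed
  have be: "\<phi> 0 powr q = b" "\<phi> pi powr q = b"
    using \<phi>(3)[of 0] \<phi>(3)[of pi] P(4,5) up(2) b q by (auto simp: powr_powr)
  show ?thesis
    unfolding is_solution_def q_def[symmetric] k_def[symmetric]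
    by (rule exI[of _ \<phi>], rule exI[of _ w], rule exI[of _ 2], rule conjI, simp,
        rule exI[of _ \<phi>1], rule exI[of _ \<phi>2], rule exI[of _ w1])
      (intro conjI allI impI pos W2 w(1) odeAE, simp only: w(3) be)
qed

section \<open>The matching condition for either sign of t - \<gamma>, and the theorem\<close>

text \<open>The jump at 0 of the derivative of the function glued from the two quarter-circle
  solutions with end value b^(1/q).\<close>

definition (in -) net_slope :: "real \<Rightarrow> real \<Rightarrow> real \<Rightarrow> real \<Rightarrow> real \<Rightarrow> real \<Rightarrow> real \<Rightarrow> real" where
  "net_slope q l t \<gamma> e \<mu> b = slope q l ((t + 1)\<^sup>2) (e + (\<mu> + b * (1 + \<gamma>))\<^sup>2) b
     + slope q l ((t - 1)\<^sup>2) (e + (\<mu> - b * (1 - \<gamma>))\<^sup>2) b"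

text \<open>The reflection \<open>x \<mapsto> -x\<close> of the circle.\<close>
lemma net_slope_swap: "net_slope q l (- t) (- \<gamma>) e (- \<mu>) b = net_slope q l t \<gamma> e \<mu> b"
proof -
  have "(- t + 1)\<^sup>2 = (t - 1)\<^sup>2" "(- t - 1)\<^sup>2 = (t + 1)\<^sup>2"
    "(- \<mu> + b * (1 + - \<gamma>))\<^sup>2 = (\<mu> - b * (1 - \<gamma>))\<^sup>2" "(- \<mu> - b * (1 - - \<gamma>))\<^sup>2 = (\<mu> + b * (1 + \<gamma>))\<^sup>2"
    by (simp_all add: power2_eq_square algebra_simps)
  then show ?thesis by (simp add: net_slope_def)
qed

text \<open>Both signs of t - \<gamma> are allowed here. Each fact is taken from the case t > 2 +
  \<gamma>, and for t < \<gamma> - 2 it is transported by \<open>net_slope_swap\<close>.\<close>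

context
  fixes q l \<nu> t \<gamma> e :: real
  assumes q: "q > 2" and l: "l > 0" and \<nu>: "1 / q = 1 / 2 - \<nu>" "0 < \<nu>" "\<nu> \<le> 1 / 3"
    and t: "\<bar>t - \<gamma>\<bar> > 2" and \<gamma>: "-1 < \<gamma>" "\<gamma> < 1" and e: "e \<ge> 0"
begin

lemma net_slope_zero_exists:
  assumes "e + \<mu>\<^sup>2 > 0"
  shows "\<exists>b>0. net_slope q l t \<gamma> e \<mu> b = 0"
proof (cases "t > 2 + \<gamma>")
  case True
  then show ?thesis using zero_exists[OF q l True \<gamma> e assms] by (simp add: net_slope_def)
next
  case False
  have "\<exists>b>0. net_slope q l (- t) (- \<gamma>) e (- \<mu>) b = 0"
    using zero_exists[OF q l _ _ _ e, of "- \<gamma>" "- t" "- \<mu>"] False t \<gamma> assms by (simp add: net_slope_def)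
  then show ?thesis by (simp only: net_slope_swap)
qed

lemma net_slope_nonzero:
  assumes "e = 0" "b > 0"
  shows "net_slope q l t \<gamma> e 0 b \<noteq> 0"
proof (cases "t > 2 + \<gamma>")
  case True
  interpret circle_flux q l \<nu> t \<gamma> e using q l \<nu> True \<gamma> e by unfold_locales
  show ?thesis
    using net_nonzero[OF assms(2,1)]
    by (simp add: net_slope_def net_def sp_def sm_def Bp_def Bm_def Gp_def Gm_def power_mult_distrib)
next
  case False
  interpret circle_flux q l \<nu> "- t" "- \<gamma>" e using q l \<nu> False t \<gamma> e by unfold_locales auto
  have "net_slope q l (- t) (- \<gamma>) e (- 0) b \<noteq> 0"
    using net_nonzero[OF assms(2,1)]
    by (simp add: net_slope_def net_def sp_def sm_def Bp_def Bm_def Gp_def Gm_def power_mult_distrib)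
  then show ?thesis unfolding net_slope_swap .
qed

lemma net_slope_zero_unique:
  assumes "e > 0" "b > 0" "net_slope q l t \<gamma> e 0 b = 0" "b' > 0" "net_slope q l t \<gamma> e 0 b' = 0"
  shows "b = b'"
proof (cases "t > 2 + \<gamma>")
  case True
  interpret circle_flux q l \<nu> t \<gamma> e using q l \<nu> True \<gamma> e by unfold_locales
  have "net c = net_slope q l t \<gamma> e 0 c" for c
    by (simp add: net_slope_def net_def sp_def sm_def Bp_def Bm_def Gp_def Gm_def power_mult_distrib)
  then show ?thesis using assms by (auto intro: zero_unique[OF assms(1,2) _ assms(4)])
next
  case False
  interpret circle_flux q l \<nu> "- t" "- \<gamma>" e using q l \<nu> False t \<gamma> e by unfold_locales auto
  have "net c = net_slope q l (- t) (- \<gamma>) e (- 0) c" for c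
    by (simp add: net_slope_def net_def sp_def sm_def Bp_def Bm_def Gp_def Gm_def power_mult_distrib)
  then have "net c = net_slope q l t \<gamma> e 0 c" for c by (simp only: net_slope_swap)
  then show ?thesis using assms by (auto intro: zero_unique[OF assms(1,2) _ assms(4)])
qed

end

lemma solution_net_slope:
  assumes n: "n \<ge> 3" and cN: "continuous_on {-pi..pi} N" and Np: "\<And>x. N x > 0" and t: "t \<noteq> 1" "t \<noteq> - 1"
    and sol: "is_solution n N t \<eta> \<mu> \<phi> w"
  shows "\<phi> 0 > 0" "net_slope (q_exp n) (pi / 2) t (gammaN N) (2 * \<eta>\<^sup>2 / kappa n) \<mu> (\<phi> 0 powr q_exp n) = 0"
proof -
  have q: "q_exp n > 2" and k: "kappa n > 0" using exponent_facts[OF n] by auto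
  have B: "(t + 1)\<^sup>2 > 0" "(t - 1)\<^sup>2 > 0" using t by auto
  have l: "pi / 2 > 0" by simp
  from sol show "\<phi> 0 > 0" unfolding is_solution_def by blast
  obtain b v1 where b: "\<phi> 0 powr q_exp n = b"
    and D: "DN (q_exp n) (pi / 2) ((t + 1)\<^sup>2) (2 * \<eta>\<^sup>2 / kappa n + (\<mu> + b * (1 + gammaN N))\<^sup>2) \<phi> v1"
    "DN (q_exp n) (pi / 2) ((t - 1)\<^sup>2) (2 * \<eta>\<^sup>2 / kappa n + (\<mu> - b * (1 - gammaN N))\<^sup>2) (\<lambda>x. \<phi> (- x)) (\<lambda>x. - v1 (- x))"
  proof (rule solution_data[OF n cN Np sol], goal_cases)
    case (1 b v1 w1)
    from 1(3,7,8) show thesis by (rule 1(1))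
  qed
  have "slope (q_exp n) (pi / 2) ((t + 1)\<^sup>2) (2 * \<eta>\<^sup>2 / kappa n + (\<mu> + b * (1 + gammaN N))\<^sup>2) b = v1 0"
    using slope_eq[OF q B(1) _ l D(1)] k by (simp add: b)
  moreover have "slope (q_exp n) (pi / 2) ((t - 1)\<^sup>2) (2 * \<eta>\<^sup>2 / kappa n + (\<mu> - b * (1 - gammaN N))\<^sup>2) b = - v1 0"
    using slope_eq[OF q B(2) _ l D(2)] k by (simp add: b)
  ultimately show "net_slope (q_exp n) (pi / 2) t (gammaN N) (2 * \<eta>\<^sup>2 / kappa n) \<mu> (\<phi> 0 powr q_exp n) = 0"
    by (simp add: net_slope_def b)
qed

text \<open>The value at 0 fixes \<open>b\<close>, hence the coefficients of both quarter-circle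
  problems and, by uniqueness and symmetry, all of \<phi>. The derivative of \<open>w\<close>
  depends only on \<open>b\<close> and \<open>N\<close>, so a constant is the only freedom
  left.\<close>

lemma solution_unique_of_value:
  assumes n: "n \<ge> 3" and cN: "continuous_on {-pi..pi} N" and Np: "\<And>x. N x > 0"
    and sol: "is_solution n N t \<eta> \<mu> \<phi> w" and sol': "is_solution n N t \<eta> \<mu> \<phi>' w'"
    and eq: "\<phi> 0 = \<phi>' 0"
  shows "\<phi>' = \<phi>" "\<exists>c. \<forall>x. w' x = w x + c"
proof -
  have q: "q_exp n > 1" and k: "kappa n > 0" using exponent_facts[OF n] by auto
  define b where "b = \<phi> 0 powr q_exp n"
  define Ap where "Ap = 2 * \<eta>\<^sup>2 / kappa n + (\<mu> + b * (1 + gammaN N))\<^sup>2"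
  define Am where "Am = 2 * \<eta>\<^sup>2 / kappa n + (\<mu> - b * (1 - gammaN N))\<^sup>2"
  have A: "Ap \<ge> 0" "Am \<ge> 0" using k by (auto simp: Ap_def Am_def)
  have B: "(t + 1)\<^sup>2 \<ge> 0" "(t - 1)\<^sup>2 \<ge> 0" by auto
  obtain v1 w1 where
    d: "periodic2pi \<phi>" "periodic2pi w" "weak_deriv_circ w w1"
    "DN (q_exp n) (pi / 2) ((t + 1)\<^sup>2) Ap \<phi> v1"
    "DN (q_exp n) (pi / 2) ((t - 1)\<^sup>2) Am (\<lambda>x. \<phi> (- x)) (\<lambda>x. - v1 (- x))"
    "\<And>x. x \<in> {0..pi} \<Longrightarrow> \<phi> (pi - x) = \<phi> x" "\<And>x. x \<in> {0..pi} \<Longrightarrow> \<phi> (- (pi - x)) = \<phi> (- x)"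
    "AE x in lborel. x \<in> {-pi..pi} \<longrightarrow> w1 x = 2 * N x * (b * (lam x + gammaN N))"
  proof (rule solution_data[OF n cN Np sol], goal_cases)
    case (1 b' v1 w1)
    have "b' = b" using 1(3) by (simp add: b_def)
    note F = 1[unfolded this, folded Ap_def Am_def]
    from F(4-11) show thesis by (rule F(1))
  qed
  obtain v1' w1' where
    d': "periodic2pi \<phi>'" "periodic2pi w'" "weak_deriv_circ w' w1'"
    "DN (q_exp n) (pi / 2) ((t + 1)\<^sup>2) Ap \<phi>' v1'"
    "DN (q_exp n) (pi / 2) ((t - 1)\<^sup>2) Am (\<lambda>x. \<phi>' (- x)) (\<lambda>x. - v1' (- x))"
    "\<And>x. x \<in> {0..pi} \<Longrightarrow> \<phi>' (pi - x) = \<phi>' x" "\<And>x. x \<in> {0..pi} \<Longrightarrow> \<phi>' (- (pi - x)) = \<phi>' (- x)"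
    "AE x in lborel. x \<in> {-pi..pi} \<longrightarrow> w1' x = 2 * N x * (b * (lam x + gammaN N))"
  proof (rule solution_data[OF n cN Np sol'], goal_cases)
    case (1 b' v1 w1)
    have "b' = b" using 1(3) by (simp add: b_def eq)
    note F = 1[unfolded this, folded Ap_def Am_def]
    from F(4-11) show thesis by (rule F(1))
  qed
  have p1: "\<phi>' x = \<phi> x" if "x \<in> {0..pi / 2}" for x
    by (rule DN_unique[OF q B(1) A(1) d'(4) d(4) _ that]) (simp add: eq)
  have m1: "\<phi>' (- x) = \<phi> (- x)" if "x \<in> {0..pi / 2}" for x
    by (rule DN_unique[OF q B(2) A(2) d'(5) d(5) _ that]) (simp add: eq)
  have p: "\<phi>' x = \<phi> x" if "x \<in> {0..pi}" for x
  proof (cases "x \<le> pi / 2")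
    case False
    then show ?thesis using d(6)[of x] d'(6)[of x] p1[of "pi - x"] that by auto
  qed (use p1 that in auto)
  have m: "\<phi>' (- x) = \<phi> (- x)" if "x \<in> {0..pi}" for x
  proof (cases "x \<le> pi / 2")
    case False
    then show ?thesis using d(7)[of x] d'(7)[of x] m1[of "pi - x"] that by auto
  qed (use m1 that in auto)
  show "\<phi>' = \<phi>"
  proof (rule periodic2pi_eqI[OF d'(1) d(1)])
    fix x assume "x \<in> {-pi..pi}"
    then show "\<phi>' x = \<phi> x" using p[of x] m[of "- x"] by (cases "x \<ge> 0") auto
  qed
  define c where "c = w' (- pi) - w (- pi)"
  have "w' = (\<lambda>x. w x + c)"
  proof (rule periodic2pi_eqI[OF d'(2)])
    show "periodic2pi (\<lambda>x. w x + c)" using d(2) by (simp add: periodic2pi_def)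
    fix x assume x: "x \<in> {-pi..pi}"
    have "w1 integrable_on {-pi..x}"
      by (rule integrable_on_subinterval[of _ "{-pi..pi}"])
        (use d(3) x in \<open>auto simp: weak_deriv_circ_def absolutely_integrable_on_def\<close>)
    then have "(w1 has_integral integral {-pi..x} w1) {-pi..x}" by (rule integrable_integral)
    moreover have "AE y in lborel. y \<in> {-pi..x} \<longrightarrow> w1 y = w1' y"
      using d(8) d'(8) by eventually_elim (use x in auto)
    ultimately have "(w1' has_integral integral {-pi..x} w1) {-pi..x}" by (subst (asm) has_integral_AE)
    then have i: "integral {-pi..x} w1' = integral {-pi..x} w1" by (rule integral_unique)
    have "w x = w (- pi) + integral {-pi..x} w1" "w' x = w' (- pi) + integral {-pi..x} w1'"
      using d(3) d'(3) x unfolding weak_deriv_circ_def by blast+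
    then show "w' x = w x + c" unfolding i c_def by linarith
  qed
  then show "\<exists>c. \<forall>x. w' x = w x + c" by auto
qed

theorem theorem3p1:
  fixes n :: nat and N :: "real \<Rightarrow> real" and t \<eta> \<mu> :: real
  assumes "n \<ge> 3"
    and "smooth_fun N" and "periodic2pi N" and "\<forall>x. N x > 0"
    and "\<bar>t - gammaN N\<bar> > 2"
  shows "((\<exists>\<phi> w. is_solution n N t \<eta> \<mu> \<phi> w) \<longleftrightarrow> (\<eta> \<noteq> 0 \<or> \<mu> \<noteq> 0))
    \<and> (\<mu> = 0 \<longrightarrow> (\<forall>\<phi> w \<phi>' w'. is_solution n N t \<eta> \<mu> \<phi> w \<and> is_solution n N t \<eta> \<mu> \<phi>' w'
          \<longrightarrow> \<phi>' = \<phi> \<and> (\<exists>c. \<forall>x. w' x = w x + c)))"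
proof -
  define q where "q = q_exp n"
  define e where "e = 2 * \<eta>\<^sup>2 / kappa n"
  define \<gamma> where "\<gamma> = gammaN N"
  have n: "n \<ge> 3" by fact
  have Np: "\<And>x. N x > 0" using assms(4) by blast
  have cN: "continuous_on {-pi..pi} N" by (rule smooth_fun_deriv(3)[OF assms(2)])
  have q: "q > 2" "1 / q = 1 / 2 - 1 / real n" and k: "kappa n > 0"
    using exponent_facts[OF n] by (auto simp: q_def)
  have \<nu>: "0 < 1 / real n" "1 / real n \<le> 1 / 3" using n by (auto simp: field_simps)
  have \<gamma>: "-1 < \<gamma>" "\<gamma> < 1" using gammaN_bounds[OF cN Np] by (auto simp: \<gamma>_def)
  have t: "\<bar>t - \<gamma>\<bar> > 2" using assms(5) by (simp add: \<gamma>_def)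
  have t1: "t \<noteq> 1" "t \<noteq> - 1" using t \<gamma> by auto
  have e: "e \<ge> 0" using k by (simp add: e_def)
  have l: "pi / 2 > 0" by simp
  note ctxt = q(1) l q(2) \<nu> t \<gamma> e
  have zero: "\<phi> 0 powr q > 0" "net_slope q (pi / 2) t \<gamma> e \<mu> (\<phi> 0 powr q) = 0" if "is_solution n N t \<eta> \<mu> \<phi> w" for \<phi> w
    using solution_net_slope[OF n cN Np t1 that] unfolding q_def e_def \<gamma>_def by auto
  have nontrivial: "\<eta> \<noteq> 0 \<or> \<mu> \<noteq> 0" if s: "is_solution n N t \<eta> \<mu> \<phi> w" for \<phi> w
  proof (rule ccontr)
    assume "\<not> (\<eta> \<noteq> 0 \<or> \<mu> \<noteq> 0)"
    then have "e = 0" "\<mu> = 0" by (auto simp: e_def)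
    then show False using net_slope_nonzero[OF ctxt \<open>e = 0\<close> zero(1)[OF s]] zero(2)[OF s] by simp
  qed
  have ex: "\<exists>\<phi> w. is_solution n N t \<eta> \<mu> \<phi> w" if "\<eta> \<noteq> 0 \<or> \<mu> \<noteq> 0"
  proof -
    have "e + \<mu>\<^sup>2 > 0"
    proof (cases "\<mu> = 0")
      case True
      then show ?thesis using that k by (simp add: e_def)
    next
      case False
      then show ?thesis using e by (simp add: add_nonneg_pos)
    qed
    then obtain b where b: "b > 0" "net_slope q (pi / 2) t \<gamma> e \<mu> b = 0"
      using net_slope_zero_exists[OF ctxt] by blast
    show ?thesis
      by (rule solution_of_data[OF n cN Np b(1) b(2)[unfolded net_slope_def q_def e_def \<gamma>_def] t1])
  qed
  have uniq: "\<phi>' = \<phi> \<and> (\<exists>c. \<forall>x. w' x = w x + c)"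
    if \<mu>: "\<mu> = 0" and s: "is_solution n N t \<eta> \<mu> \<phi> w" and s': "is_solution n N t \<eta> \<mu> \<phi>' w'" for \<phi> w \<phi>' w'
  proof -
    have "\<eta> \<noteq> 0" using nontrivial[OF s] \<mu> by simp
    then have "e > 0" using k by (simp add: e_def)
    then have "\<phi> 0 powr q = \<phi>' 0 powr q"
      using net_slope_zero_unique[OF ctxt] zero[OF s] zero[OF s'] \<mu> by blast
    then have "(\<phi> 0 powr q) powr (1 / q) = (\<phi>' 0 powr q) powr (1 / q)" by (simp only:)
    then have "\<phi> 0 = \<phi>' 0"
      using q(1) solution_net_slope(1)[OF n cN Np t1 s] solution_net_slope(1)[OF n cN Np t1 s'] by (simp add: powr_powr)
    then show ?thesis using solution_unique_of_value[OF n cN Np s s'] by blast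
  qed
  show ?thesis using nontrivial ex uniq by blast
qed

end
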